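(* Let $N\ge 1$ and $s\in(0,1)$. Assume that $g\in C(\mathbf{S}^{N-1})$, $g>0$, $g$ even; that $W\in C^{1,1}(\mathbb{R})$ and $W(v+1)=W(v)$ for all $v\in\mathbb{R}$; and that $\sigma\in C^{0,1}(\mathbb{R}^+\times\mathbb{R}^N)$ satisfies $\sigma(t+1,x)=\sigma(t,x)$ and $\sigma(t,x+k)=\sigma(t,x)$ for all $k\in\mathbb{Z}^N$ and $(t,x)\in\mathbb{R}^+\times\mathbb{R}^N$. Then for every $L\in\mathbb{R}$ and $p\in\mathbb{R}^N$ there exists a unique viscosity solution $w\in C_b(\mathbb{R}^+\times\mathbb{R}^N)$ of $$\begin{cases}\partial_\tau w=\mathcal{I}_s[w(\tau,\cdot)]+L-W'(w+p\cdot y)+\sigma(\tau,y)&\text{in }\mathbb{R}^+\times\mathbb{R}^N,\\ w(0,y)=0&\text{on }\mathbb{R}^N,\end{cases}$$ and there exists a unique $\lambda\in\mathbb{R}$ such that $\frac{w(\tau,y)}{\tau}$ converges to $\lambda$ as $\tau\to+\infty$, locally uniformly in $y$. Moreover, denoting this number $\lambda$ by $\overline{H}(p,L)$, the function $\overline{H}$ is continuous on $\mathbb{R}^N\times\mathbb{R}$ and non-decreasing in $L$.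
   Context: The anisotropic Lévy operator is $$\mathcal{I}_s[\varphi](x)=PV\int_{\mathbb{R}^N}\frac{\varphi(x+y)-\varphi(x)}{|y|^{N+2s}}\,g\Big(\frac{y}{|y|}\Big)dy,$$ for $\varphi\in C^2(\mathbb{R}^N)\cap L^\infty(\mathbb{R}^N)$, where $PV$ denotes principal value. Put $\mu(dz)=\frac{1}{|z|^{N+2s}}g(z/|z|)dz$ and, for $r>0$, $$\mathcal{I}_s^{1,r}[\varphi,x]=\int_{|z|\le r}(\varphi(x+z)-\varphi(x)-\nabla\varphi(x)\cdot z)\mu(dz),\qquad \mathcal{I}_s^{2,r}[\varphi,x]=\int_{|z|>r}(\varphi(x+z)-\varphi(x))\mu(dz).$$ $USC_b(\mathbb{R}^+\times\mathbb{R}^N)$ (resp. $LSC_b$) is the set of upper (resp. lower) semicontinuous functions on $\mathbb{R}^+\times\mathbb{R}^N$ that are bounded on $(0,T)\times\mathbb{R}^N$ for every $T>0$, and $C_b=USC_b\cap LSC_b$. Viscosity solutions: consider $u_t=F(t,x,u,Du,\mathcal{I}_s[u])$ in $\mathbb{R}^+\times\mathbb{R}^N$, $u(0,x)=u_0(x)$, with $F(t,x,u,p,L)$ continuous and non-decreasing in $L$. A function $u\in USC_b$ (resp. $LSC_b$) is a viscosity subsolution (resp. supersolution) if $u(0,x)\le (u_0)^*(x)$ (resp. $u(0,x)\ge (u_0)_*(x)$), where ${}^*,{}_*$ denote the semicontinuous envelopes, and for any $(t_0,x_0)\in\mathbb{R}^+\times\mathbb{R}^N$, any $\tau\in(0,t_0)$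 and any $\varphi\in C^2(\mathbb{R}^+\times\mathbb{R}^N)$ such that $u-\varphi$ attains a maximum (resp. minimum) over $(t_0-\tau,t_0+\tau)\times B_r(x_0)$ at $(t_0,x_0)$, one has $$\partial_t\varphi(t_0,x_0)-F\big(t_0,x_0,u(t_0,x_0),\nabla_x\varphi(t_0,x_0),\mathcal{I}_s^{1,r}[\varphi(t_0,\cdot),x_0]+\mathcal{I}_s^{2,r}[u(t_0,\cdot),x_0]\big)\le 0\quad(\text{resp. }\ge 0),$$ for a positive number $r$ (the notion does not depend on $r$). A function $u\in C_b$ is a viscosity solution if it is both a sub- and a supersolution. *)

theory Defs
  imports "HOL-Analysis.Analysis"
begin

text \<open>
  Functions on \<open>\<real>\<^sup>+ \<times> \<real>\<^sup>N\<close> are functions of pairs \<open>(t, x)\<close>, of which only the restriction to the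
  following set matters. The slice \<open>t = 0\<close> is included because semicontinuity up to \<open>t = 0\<close> is what
  ties the solution to its initial value.
\<close>

definition spacetime :: "(real \<times> (real ^ 'n)) set" where
  "spacetime = {0..} \<times> UNIV"

section \<open>Function classes\<close>

definition usc_on :: "'a::topological_space set \<Rightarrow> ('a \<Rightarrow> real) \<Rightarrow> bool" where
  "usc_on S f \<longleftrightarrow> (\<forall>x\<in>S. \<forall>a>f x. \<forall>\<^sub>F y in at x within S. f y < a)"

definition lsc_on :: "'a::topological_space set \<Rightarrow> ('a \<Rightarrow> real) \<Rightarrow> bool" where
  "lsc_on S f \<longleftrightarrow> (\<forall>x\<in>S. \<forall>a<f x. \<forall>\<^sub>F y in at x within S. a < f y)"

definition bounded_in_finite_time :: "(real \<times> (real ^ 'n) \<Rightarrow> real) \<Rightarrow> bool" where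
  "bounded_in_finite_time u \<longleftrightarrow> (\<forall>T>0. bounded (u ` ({0<..<T} \<times> UNIV)))"

definition USC_b :: "(real \<times> (real ^ 'n) \<Rightarrow> real) set" where
  "USC_b = {u. usc_on spacetime u \<and> bounded_in_finite_time u}"

definition LSC_b :: "(real \<times> (real ^ 'n) \<Rightarrow> real) set" where
  "LSC_b = {u. lsc_on spacetime u \<and> bounded_in_finite_time u}"

definition C_b :: "(real \<times> (real ^ 'n) \<Rightarrow> real) set" where
  "C_b = USC_b \<inter> LSC_b"

text \<open>
  The filter \<open>nhds x\<close> contains the point \<open>x\<close> itself, so these are the envelopes and not the
  punctured limits; they are extended reals because \<open>f\<close> need not be locally bounded.
\<close>

definition upper_envelope :: "('a::topological_space \<Rightarrow> real) \<Rightarrow> 'a \<Rightarrow> ereal" where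
  "upper_envelope f x = Limsup (nhds x) (\<lambda>y. ereal (f y))"

definition lower_envelope :: "('a::topological_space \<Rightarrow> real) \<Rightarrow> 'a \<Rightarrow> ereal" where
  "lower_envelope f x = Liminf (nhds x) (\<lambda>y. ereal (f y))"

text \<open>
  Derivatives are taken within \<open>S\<close>; for \<open>S = spacetime\<close> this is one-sided in time at \<open>t = 0\<close>.
\<close>

definition C2_on :: "'a::real_normed_vector set \<Rightarrow> ('a \<Rightarrow> real) \<Rightarrow> bool" where
  "C2_on S f \<longleftrightarrow>
     (\<exists>(f' :: 'a \<Rightarrow> 'a \<Rightarrow>\<^sub>L real) (f'' :: 'a \<Rightarrow> 'a \<Rightarrow>\<^sub>L 'a \<Rightarrow>\<^sub>L real).
        (\<forall>x\<in>S. (f has_derivative blinfun_apply (f' x)) (at x within S)) \<and>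
        (\<forall>x\<in>S. (f' has_derivative blinfun_apply (f'' x)) (at x within S)) \<and>
        continuous_on S f'')"

definition gradient :: "('a::real_inner \<Rightarrow> real) \<Rightarrow> 'a \<Rightarrow> 'a" where
  "gradient f x = (THE D. GDERIV f x :> D)"

section \<open>The anisotropic Levy operator\<close>

text \<open>
  The principal value operator \<open>I\<^sub>s\<close> occurs in the equation only in the viscosity sense, through
  its splitting at radius \<open>r\<close> into \<open>levy_inner\<close>, applied to the test function, and \<open>levy_outer\<close>,
  applied to the solution. As \<open>g\<close> is even, the gradient term in \<open>levy_inner\<close> does not alter the
  principal value.
\<close>

definition levy_measure :: "(real ^ 'n \<Rightarrow> real) \<Rightarrow> real \<Rightarrow> (real ^ 'n) measure" where
  "levy_measure g s =
     density lborel
       (\<lambda>z. ennreal (g (z /\<^sub>R norm z) / norm z powr (real CARD('n) + 2 * s)))"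

definition levy_inner ::
    "(real ^ 'n \<Rightarrow> real) \<Rightarrow> real \<Rightarrow> real \<Rightarrow> (real ^ 'n \<Rightarrow> real) \<Rightarrow> real ^ 'n \<Rightarrow> real" where
  "levy_inner g s r \<phi> x =
     (LINT z:{z. norm z \<le> r}|levy_measure g s. \<phi> (x + z) - \<phi> x - gradient \<phi> x \<bullet> z)"

definition levy_outer ::
    "(real ^ 'n \<Rightarrow> real) \<Rightarrow> real \<Rightarrow> real \<Rightarrow> (real ^ 'n \<Rightarrow> real) \<Rightarrow> real ^ 'n \<Rightarrow> real" where
  "levy_outer g s r u x =
     (LINT z:{z. norm z > r}|levy_measure g s. u (x + z) - u x)"

section \<open>Viscosity solutions\<close>

text \<open>
  Sub- and supersolutions of the problem \<open>u\<^sub>t = F(t, x, u, Du, I\<^sub>s[u])\<close>, \<open>u(0, \<cdot>) = u\<^sub>0\<close>.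
  The notion does not depend on \<open>r\<close>, hence the existential quantifier. The condition
  \<open>\<tau> \<in> {0<..<t0}\<close> excludes \<open>t0 = 0\<close>.
\<close>

definition viscosity_subsolution ::
    "(real ^ 'n \<Rightarrow> real) \<Rightarrow> real \<Rightarrow>
     (real \<Rightarrow> real ^ 'n \<Rightarrow> real \<Rightarrow> real ^ 'n \<Rightarrow> real \<Rightarrow> real) \<Rightarrow>
     (real ^ 'n \<Rightarrow> real) \<Rightarrow> (real \<times> (real ^ 'n) \<Rightarrow> real) \<Rightarrow> bool" where
  "viscosity_subsolution g s F u0 u \<longleftrightarrow>
     u \<in> USC_b \<and>
     (\<forall>x. ereal (u (0, x)) \<le> upper_envelope u0 x) \<and>
     (\<exists>r>0. \<forall>t0 x0 \<tau> \<phi>.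
        (t0, x0) \<in> spacetime \<and> \<tau> \<in> {0<..<t0} \<and> C2_on spacetime \<phi> \<and>
        (\<forall>z \<in> {t0 - \<tau><..<t0 + \<tau>} \<times> ball x0 r. u z - \<phi> z \<le> u (t0, x0) - \<phi> (t0, x0)) \<longrightarrow>
        deriv (\<lambda>t. \<phi> (t, x0)) t0
          - F t0 x0 (u (t0, x0)) (gradient (\<lambda>x. \<phi> (t0, x)) x0)
              (levy_inner g s r (\<lambda>x. \<phi> (t0, x)) x0 + levy_outer g s r (\<lambda>x. u (t0, x)) x0) \<le> 0)"

definition viscosity_supersolution ::
    "(real ^ 'n \<Rightarrow> real) \<Rightarrow> real \<Rightarrow>
     (real \<Rightarrow> real ^ 'n \<Rightarrow> real \<Rightarrow> real ^ 'n \<Rightarrow> real \<Rightarrow> real) \<Rightarrow>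
     (real ^ 'n \<Rightarrow> real) \<Rightarrow> (real \<times> (real ^ 'n) \<Rightarrow> real) \<Rightarrow> bool" where
  "viscosity_supersolution g s F u0 u \<longleftrightarrow>
     u \<in> LSC_b \<and>
     (\<forall>x. ereal (u (0, x)) \<ge> lower_envelope u0 x) \<and>
     (\<exists>r>0. \<forall>t0 x0 \<tau> \<phi>.
        (t0, x0) \<in> spacetime \<and> \<tau> \<in> {0<..<t0} \<and> C2_on spacetime \<phi> \<and>
        (\<forall>z \<in> {t0 - \<tau><..<t0 + \<tau>} \<times> ball x0 r. u z - \<phi> z \<ge> u (t0, x0) - \<phi> (t0, x0)) \<longrightarrow>
        deriv (\<lambda>t. \<phi> (t, x0)) t0
          - F t0 x0 (u (t0, x0)) (gradient (\<lambda>x. \<phi> (t0, x)) x0)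
              (levy_inner g s r (\<lambda>x. \<phi> (t0, x)) x0 + levy_outer g s r (\<lambda>x. u (t0, x)) x0) \<ge> 0)"

definition viscosity_solution ::
    "(real ^ 'n \<Rightarrow> real) \<Rightarrow> real \<Rightarrow>
     (real \<Rightarrow> real ^ 'n \<Rightarrow> real \<Rightarrow> real ^ 'n \<Rightarrow> real \<Rightarrow> real) \<Rightarrow>
     (real ^ 'n \<Rightarrow> real) \<Rightarrow> (real \<times> (real ^ 'n) \<Rightarrow> real) \<Rightarrow> bool" where
  "viscosity_solution g s F u0 u \<longleftrightarrow>
     u \<in> C_b \<and> viscosity_subsolution g s F u0 u \<and> viscosity_supersolution g s F u0 u"

section \<open>The cell problem and the effective Hamiltonian\<close>

definition cell_solution ::
    "(real ^ 'n \<Rightarrow> real) \<Rightarrow> real \<Rightarrow> (real \<Rightarrow> real) \<Rightarrow> (real \<times> (real ^ 'n) \<Rightarrow> real) \<Rightarrow>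
     real ^ 'n \<Rightarrow> real \<Rightarrow> (real \<times> (real ^ 'n) \<Rightarrow> real) \<Rightarrow> bool" where
  "cell_solution g s W \<sigma> p L w \<longleftrightarrow>
     viscosity_solution g s
       (\<lambda>\<tau> y v q l. l + L - deriv W (v + p \<bullet> y) + \<sigma> (\<tau>, y)) (\<lambda>y. 0) w"

definition has_growth_rate :: "(real \<times> (real ^ 'n) \<Rightarrow> real) \<Rightarrow> real \<Rightarrow> bool" where
  "has_growth_rate w c \<longleftrightarrow>
     (\<forall>K. compact K \<longrightarrow> uniform_limit K (\<lambda>\<tau> y. w (\<tau>, y) / \<tau>) (\<lambda>y. c) at_top)"

definition effective_hamiltonian ::
    "(real ^ 'n \<Rightarrow> real) \<Rightarrow> real \<Rightarrow> (real \<Rightarrow> real) \<Rightarrow> (real \<times> (real ^ 'n) \<Rightarrow> real) \<Rightarrow>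
     real ^ 'n \<Rightarrow> real \<Rightarrow> real" where
  "effective_hamiltonian g s W \<sigma> p L =
     (THE c. \<exists>w. cell_solution g s W \<sigma> p L w \<and> has_growth_rate w c)"

end

theory Submission
  imports Defs
begin

text \<open>
  The equation is \<open>\<partial>\<^sub>t w = I\<^sub>s[w] + f (t, y, w)\<close>, where \<open>f (t, y, w) = L - W' (w + p \<bullet> y) + \<sigma> (t, y)\<close> is bounded
  and Lipschitz. As the nonlocal term is linear and invariant under translations, the theorem can be
  read off an explicit finite difference scheme: the Levy measure is truncated near the origin, which
  makes it finite, and time is discretised so finely that a step is monotone (\<open>step_mono\<close>). Monotonicity
  gives bounds on the schemes, and Lipschitz bounds in space and time, that are uniform in the mesh
  (\<open>scheme_bound\<close>, \<open>scheme_lipschitz\<close>, \<open>scheme_time_increment\<close>).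

  Existence and uniqueness rest on smooth approximate solutions. Averaging a fine scheme over a small
  region of space-time commutes with the linear terms and perturbs the nonlinearity by a small amount, so
  the average is a smooth function that solves the equation up to \<open>\<eta>\<close> (\<open>approx_solution_exists\<close>). Such
  functions control everything else. Fine schemes stay close to them, so the schemes converge, to \<open>sol\<close>
  (\<open>scheme_near_approx_solution\<close>, \<open>sol_LIMSEQ\<close>). Being smooth, they can be used as test functions, so
  every viscosity subsolution lies below them up to an error of order \<open>\<eta>\<close>
  (\<open>subsolution_le_approx_solution\<close>). Finally, locally at a maximum of \<open>sol - \<phi>\<close>, they transfer the equation to
  the limit (\<open>limit_subsolution\<close>). Negation covers supersolutions, and \<open>sol\<close> is the unique viscosity
  solution (\<open>sol_viscosity_solution\<close>, \<open>viscosity_solution_unique\<close>).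

  For the long-time behaviour, the oscillation of the solution in space is bounded for all times,
  uniformly in \<open>p\<close> and \<open>L\<close> (\<open>oscillation_bound\<close>): periodicity reduces the claim to points at bounded distance,
  and for these the long jumps from both points reach a common region, which contracts the
  oscillation at a fixed rate. Restarting at integer times, where the equation repeats itself, and comparing
  with the solution shifted by an integer shows that the solution is almost additive in time
  (\<open>almost_additive\<close>), so it grows linearly, at a rate \<open>\<lambda>\<close>, up to an error that is bounded in time. On
  integer times that error is at most \<open>E\<close>, uniformly in \<open>p\<close> and \<open>L\<close>. Therefore \<open>\<lambda>\<close> is a uniform limit of \<open>w (m, 0) / m\<close>
  and inherits continuity and monotonicity from the solution at a fixed time (\<open>growth_rate_function\<close>).
\<close>

section \<open>Twice continuously differentiable functions\<close>

lemma C2_onI: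
  fixes f :: "'a::real_normed_vector \<Rightarrow> real"
  assumes "\<And>x. x \<in> S \<Longrightarrow> (f has_derivative blinfun_apply (f' x)) (at x within S)"
    and "\<And>x. x \<in> S \<Longrightarrow> (f' has_derivative blinfun_apply (f'' x)) (at x within S)"
    and "continuous_on S f''"
  shows "C2_on S f"
  using assms unfolding C2_on_def by blast

lemma C2_onE:
  fixes f :: "'a::real_normed_vector \<Rightarrow> real"
  assumes "C2_on S f"
  obtains f' f'' where "\<And>x. x \<in> S \<Longrightarrow> (f has_derivative blinfun_apply (f' x)) (at x within S)"
    and "\<And>x. x \<in> S \<Longrightarrow> (f' has_derivative blinfun_apply (f'' x)) (at x within S)"
    and "continuous_on S f''" "continuous_on S f" "continuous_on S f'"
proof -
  from assms obtain f' f'' where f: "\<forall>x\<in>S. (f has_derivative blinfun_apply (f' x)) (at x within S)"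
    "\<forall>x\<in>S. (f' has_derivative blinfun_apply (f'' x)) (at x within S)"
    "continuous_on S f''"
    unfolding C2_on_def by blast
  show thesis
    by (rule that[of f' f'']) (use f in \<open>auto intro: has_derivative_continuous_on\<close>)
qed

lemma C2_on_subset: "C2_on S f \<Longrightarrow> T \<subseteq> S \<Longrightarrow> C2_on T f"
  unfolding C2_on_def by (meson continuous_on_subset has_derivative_subset subset_iff)

lemma C2_on_const: "C2_on S (\<lambda>_::'a::real_normed_vector. c)"
  by (rule C2_onI[where f' = "\<lambda>_. 0" and f'' = "\<lambda>_. 0"])
     (auto simp: zero_blinfun.rep_eq)

lemma C2_on_linear:
  fixes f :: "'a::real_normed_vector \<Rightarrow> real"
  assumes "bounded_linear f"
  shows "C2_on S f"
proof (rule C2_onI[where f' = "\<lambda>_. Blinfun f" and f'' = "\<lambda>_. 0"])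
  fix x show "(f has_derivative blinfun_apply (Blinfun f)) (at x within S)"
    using bounded_linear_imp_has_derivative[OF assms] by (simp add: bounded_linear_Blinfun_apply assms)
qed (auto simp: zero_blinfun.rep_eq)

lemma C2_on_add:
  fixes f g :: "'a::real_normed_vector \<Rightarrow> real"
  assumes "C2_on S f" "C2_on S g"
  shows "C2_on S (\<lambda>x. f x + g x)"
proof -
  obtain f' f'' where f:
      "\<And>x. x \<in> S \<Longrightarrow> (f has_derivative blinfun_apply (f' x)) (at x within S)"
    "\<And>x. x \<in> S \<Longrightarrow> (f' has_derivative blinfun_apply (f'' x)) (at x within S)"
    "continuous_on S f''" by (rule C2_onE[OF assms(1)]) blast
  obtain g' g'' where g:
      "\<And>x. x \<in> S \<Longrightarrow> (g has_derivative blinfun_apply (g' x)) (at x within S)"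
    "\<And>x. x \<in> S \<Longrightarrow> (g' has_derivative blinfun_apply (g'' x)) (at x within S)"
    "continuous_on S g''" by (rule C2_onE[OF assms(2)]) blast
  show ?thesis
    by (rule C2_onI[where f' = "\<lambda>x. f' x + g' x" and f'' = "\<lambda>x. f'' x + g'' x"])
       (auto simp: plus_blinfun.rep_eq intro!: has_derivative_add f g continuous_intros)
qed

lemma C2_on_mult:
  fixes f g :: "'a::real_normed_vector \<Rightarrow> real"
  assumes "C2_on S f" "C2_on S g"
  shows "C2_on S (\<lambda>x. f x * g x)"
proof -
  obtain f' f'' where f:
      "\<And>x. x \<in> S \<Longrightarrow> (f has_derivative blinfun_apply (f' x)) (at x within S)"
    "\<And>x. x \<in> S \<Longrightarrow> (f' has_derivative blinfun_apply (f'' x)) (at x within S)"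
    "continuous_on S f''" "continuous_on S f" "continuous_on S f'" by (rule C2_onE[OF assms(1)]) blast
  obtain g' g'' where g:
      "\<And>x. x \<in> S \<Longrightarrow> (g has_derivative blinfun_apply (g' x)) (at x within S)"
    "\<And>x. x \<in> S \<Longrightarrow> (g' has_derivative blinfun_apply (g'' x)) (at x within S)"
    "continuous_on S g''" "continuous_on S g" "continuous_on S g'" by (rule C2_onE[OF assms(2)]) blast
  show ?thesis
  proof (rule C2_onI[where f' = "\<lambda>x. f x *\<^sub>R g' x + g x *\<^sub>R f' x" and
        f'' = "\<lambda>x. f x *\<^sub>R g'' x + (blinfun_scaleR_left (g' x) o\<^sub>L f' x)
                 + (g x *\<^sub>R f'' x + (blinfun_scaleR_left (f' x) o\<^sub>L g' x))"])
    fix x assume x: "x \<in> S"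
    show "((\<lambda>x. f x * g x) has_derivative blinfun_apply (f x *\<^sub>R g' x + g x *\<^sub>R f' x)) (at x within S)"
      by (rule has_derivative_eq_rhs[OF has_derivative_mult[OF f(1)[OF x] g(1)[OF x]]])
         (auto simp: plus_blinfun.rep_eq scaleR_blinfun.rep_eq)
    show "((\<lambda>x. f x *\<^sub>R g' x + g x *\<^sub>R f' x) has_derivative
           blinfun_apply (f x *\<^sub>R g'' x + (blinfun_scaleR_left (g' x) o\<^sub>L f' x)
                 + (g x *\<^sub>R f'' x + (blinfun_scaleR_left (f' x) o\<^sub>L g' x)))) (at x within S)"
      by (rule has_derivative_eq_rhs[OF has_derivative_add[OF has_derivative_scaleR[OF f(1)[OF x] g(2)[OF x]]
              has_derivative_scaleR[OF g(1)[OF x] f(2)[OF x]]]])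
         (auto simp: plus_blinfun.rep_eq scaleR_blinfun.rep_eq)
  qed (intro continuous_intros f g bounded_linear.continuous_on[OF bounded_linear_blinfun_scaleR_left])
qed

lemma C2_on_cmult:
  fixes f :: "'a::real_normed_vector \<Rightarrow> real"
  shows "C2_on S f \<Longrightarrow> C2_on S (\<lambda>x. c * f x)"
  by (intro C2_on_mult C2_on_const)

lemma C2_on_uminus:
  fixes f :: "'a::real_normed_vector \<Rightarrow> real"
  shows "C2_on S f \<Longrightarrow> C2_on S (\<lambda>x. - f x)"
  using C2_on_cmult[of S f "-1"] by simp

lemma C2_on_sum:
  fixes f :: "'i \<Rightarrow> 'a::real_normed_vector \<Rightarrow> real"
  assumes "\<And>i. i \<in> I \<Longrightarrow> C2_on S (f i)"
  shows "C2_on S (\<lambda>x. \<Sum>i\<in>I. f i x)"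
  using assms by (induction I rule: infinite_finite_induct) (auto intro: C2_on_const C2_on_add)

lemma C2_on_norm_square:
  fixes P :: "'a::real_normed_vector \<Rightarrow> 'b::euclidean_space"
  assumes P: "bounded_linear P"
  shows "C2_on S (\<lambda>x. (norm (P x - c))\<^sup>2)"
proof -
  have "C2_on S (\<lambda>x. \<Sum>b\<in>Basis. (P x \<bullet> b + - (c \<bullet> b)) * (P x \<bullet> b + - (c \<bullet> b)))"
    by (intro C2_on_sum C2_on_mult C2_on_add C2_on_const C2_on_linear
        bounded_linear_compose[OF bounded_linear_inner_left P])
  moreover have "(norm (P x - c))\<^sup>2 = (\<Sum>b\<in>Basis. (P x \<bullet> b + - (c \<bullet> b)) * (P x \<bullet> b + - (c \<bullet> b)))" for x
    by (subst norm_eq_sqrt_inner, subst real_sqrt_pow2, simp)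
       (subst euclidean_inner, simp add: inner_diff_left)
  ultimately show ?thesis by simp
qed

lemma C2_on_compose_real:
  fixes f :: "'a::real_normed_vector \<Rightarrow> real"
  assumes "C2_on S f"
    and k: "\<And>r. (k has_real_derivative k' r) (at r)" "\<And>r. (k' has_real_derivative k'' r) (at r)"
      "continuous_on UNIV k''"
  shows "C2_on S (\<lambda>x. k (f x))"
proof -
  obtain f' f'' where f:
      "\<And>x. x \<in> S \<Longrightarrow> (f has_derivative blinfun_apply (f' x)) (at x within S)"
    "\<And>x. x \<in> S \<Longrightarrow> (f' has_derivative blinfun_apply (f'' x)) (at x within S)"
    "continuous_on S f''" "continuous_on S f" "continuous_on S f'" by (rule C2_onE[OF assms(1)]) blast
  have ck': "continuous_on UNIV k'"
    using k(2) by (meson DERIV_continuous continuous_at_imp_continuous_on)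
  have comp: "((\<lambda>x. h (f x)) has_derivative (\<lambda>v. h' (f x) * f' x v)) (at x within S)"
    if "x \<in> S" "\<And>r. (h has_real_derivative h' r) (at r)" for x h h'
    using has_derivative_compose[OF f(1)[OF that(1)] that(2)[unfolded has_field_derivative_def]]
    by simp
  show ?thesis
  proof (rule C2_onI[where f' = "\<lambda>x. k' (f x) *\<^sub>R f' x" and
        f'' = "\<lambda>x. k' (f x) *\<^sub>R f'' x + (blinfun_scaleR_left (f' x) o\<^sub>L (k'' (f x) *\<^sub>R f' x))"])
    fix x assume x: "x \<in> S"
    show "((\<lambda>x. k (f x)) has_derivative blinfun_apply (k' (f x) *\<^sub>R f' x)) (at x within S)"
      using comp[OF x k(1)] by (simp add: scaleR_blinfun.rep_eq)
    show "((\<lambda>x. k' (f x) *\<^sub>R f' x) has_derivative blinfun_apply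
        (k' (f x) *\<^sub>R f'' x + (blinfun_scaleR_left (f' x) o\<^sub>L (k'' (f x) *\<^sub>R f' x)))) (at x within S)"
      by (rule has_derivative_eq_rhs[OF has_derivative_scaleR[OF comp[OF x k(2)] f(2)[OF x]]])
         (auto simp: plus_blinfun.rep_eq scaleR_blinfun.rep_eq)
  next
    show "continuous_on S (\<lambda>x. k' (f x) *\<^sub>R f'' x + (blinfun_scaleR_left (f' x) o\<^sub>L (k'' (f x) *\<^sub>R f' x)))"
      by (intro continuous_intros f bounded_linear.continuous_on[OF bounded_linear_blinfun_scaleR_left]
          continuous_on_compose2[OF ck' f(4)] continuous_on_compose2[OF k(3) f(4)]) auto
  qed
qed

text \<open>
  The derivatives of a convolution are integrals; expressed through partial derivatives, these are
  integrals of real functions rather than of linear maps.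
\<close>
lemma C2_onI_partials:
  fixes f :: "'a::euclidean_space \<Rightarrow> real"
  assumes f: "\<And>x. (f has_derivative (\<lambda>v. \<Sum>b\<in>Basis. (v \<bullet> b) * f1 b x)) (at x)"
    and f1: "\<And>b x. b \<in> Basis \<Longrightarrow> (f1 b has_derivative (\<lambda>v. \<Sum>c\<in>Basis. (v \<bullet> c) * f2 b c x)) (at x)"
    and f2: "\<And>b c. b \<in> Basis \<Longrightarrow> c \<in> Basis \<Longrightarrow> continuous_on UNIV (f2 b c)"
  shows "C2_on UNIV f"
proof (rule C2_onI[where f' = "\<lambda>x. \<Sum>b\<in>Basis. f1 b x *\<^sub>R blinfun_inner_left b" and
     f'' = "\<lambda>x. \<Sum>b\<in>Basis. \<Sum>c\<in>Basis. f2 b c x *\<^sub>R (blinfun_scaleR_left (blinfun_inner_left b) o\<^sub>L blinfun_inner_left c)"])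
  fix x :: 'a
  show "(f has_derivative blinfun_apply (\<Sum>b\<in>Basis. f1 b x *\<^sub>R blinfun_inner_left b)) (at x)"
    by (rule has_derivative_eq_rhs[OF f]) (auto simp: blinfun.sum_left scaleR_blinfun.rep_eq mult.commute)
  have "((\<lambda>x. \<Sum>b\<in>Basis. f1 b x *\<^sub>R blinfun_inner_left b) has_derivative
     (\<lambda>v. \<Sum>b\<in>Basis. (\<Sum>c\<in>Basis. (v \<bullet> c) * f2 b c x) *\<^sub>R blinfun_inner_left b)) (at x)"
    by (intro has_derivative_sum bounded_linear.has_derivative[OF bounded_linear_scaleR_left] f1)
  then show "((\<lambda>x. \<Sum>b\<in>Basis. f1 b x *\<^sub>R blinfun_inner_left b) has_derivative blinfun_apply
     (\<Sum>b\<in>Basis. \<Sum>c\<in>Basis. f2 b c x *\<^sub>R (blinfun_scaleR_left (blinfun_inner_left b) o\<^sub>L blinfun_inner_left c))) (at x)"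
    by (rule has_derivative_eq_rhs)
       (auto simp: blinfun.sum_left scaleR_blinfun.rep_eq scaleR_sum_left mult.commute intro!: ext)
qed (intro continuous_intros f2)

lemma taylor_bound:
  fixes f :: "'a::real_normed_vector \<Rightarrow> real" and f' :: "'a \<Rightarrow> 'a \<Rightarrow>\<^sub>L real"
  assumes "convex S"
    and f: "\<And>x. x \<in> S \<Longrightarrow> (f has_derivative blinfun_apply (f' x)) (at x within S)"
    and f': "\<And>x. x \<in> S \<Longrightarrow> (f' has_derivative blinfun_apply (f'' x)) (at x within S)"
    and B: "\<And>x. x \<in> S \<Longrightarrow> norm (f'' x) \<le> B" and xv: "x \<in> S" "x + v \<in> S"
  shows "\<bar>f (x + v) - f x - f' x v\<bar> \<le> B * (norm v)\<^sup>2"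
proof -
  define T where "T = closed_segment x (x + v)"
  have TS: "T \<subseteq> S" "convex T" and xT: "x \<in> T" "x + v \<in> T"
    using assms(1) xv closed_segment_subset unfolding T_def by auto
  have B0: "0 \<le> B" using B[OF xv(1)] norm_ge_zero order_trans by blast
  have lip: "norm (f' y - f' x) \<le> B * norm v" if "y \<in> T" for y
  proof -
    have "norm (f' y - f' x) \<le> B * norm (y - x)"
      using TS that xT B
      by (intro differentiable_bound[of T f' "\<lambda>y. blinfun_apply (f'' y)"])
         (auto intro!: has_derivative_subset[OF f'] simp: norm_blinfun.rep_eq[symmetric])
    also have "norm (y - x) \<le> norm v"
      using that segment_bound1[of y x "x+v"] unfolding T_def by simp
    finally show ?thesis using B0 by (simp add: mult_left_mono)
  qed
  have "norm ((f (x + v) - f' x (x + v)) - (f x - f' x x)) \<le> (B * norm v) * norm (x + v - x)"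
  proof (rule differentiable_bound[of T _ "\<lambda>y. blinfun_apply (f' y - f' x)"])
    fix y assume y: "y \<in> T"
    show "((\<lambda>y. f y - f' x y) has_derivative blinfun_apply (f' y - f' x)) (at y within T)"
      by (rule has_derivative_eq_rhs[OF has_derivative_diff[OF has_derivative_subset[OF f]
            bounded_linear_imp_has_derivative[OF blinfun.bounded_linear_right]]])
         (use y TS in \<open>auto simp: minus_blinfun.rep_eq\<close>)
    show "onorm (blinfun_apply (f' y - f' x)) \<le> B * norm v"
      using lip[OF y] by (simp add: norm_blinfun.rep_eq)
  qed (use TS xT in auto)
  then show ?thesis by (simp add: blinfun.bilinear_simps power2_eq_square algebra_simps)
qed

lemma DERIV_pos_part_power:
  fixes r :: real
  assumes "n \<ge> 1"
  shows "((\<lambda>r. (max 0 r) ^ Suc n) has_real_derivative real (Suc n) * (max 0 r) ^ n) (at r)"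
proof (cases r "0::real" rule: linorder_cases)
  case less
  have "((\<lambda>r. 0) has_real_derivative 0) (at r)" by simp
  then have "((\<lambda>r. (max 0 r) ^ Suc n) has_real_derivative 0) (at r)"
    by (rule has_field_derivative_transform_within_open[where S = "{..<0}"]) (use less in \<open>auto simp: max_def\<close>)
  then show ?thesis using less assms by (simp add: max_def power_0_left)
next
  case equal
  have "((\<lambda>h. (max 0 h) ^ Suc n / h) \<longlongrightarrow> 0) (at (0::real))"
  proof (rule Lim_null_comparison)
    show "\<forall>\<^sub>F h in at 0. norm ((max 0 h) ^ Suc n / h) \<le> \<bar>h\<bar> ^ n"
      by (intro always_eventually allI) (auto simp: max_def abs_mult power_abs)
    have "((\<lambda>h::real. \<bar>h\<bar> ^ n) \<longlongrightarrow> \<bar>0\<bar> ^ n) (at 0)" by (intro tendsto_intros)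
    then show "((\<lambda>h::real. \<bar>h\<bar> ^ n) \<longlongrightarrow> 0) (at 0)" using assms by (simp add: power_0_left)
  qed
  then show ?thesis using equal assms by (simp add: DERIV_def power_0_left)
next
  case greater
  have "((\<lambda>r. r ^ Suc n) has_real_derivative real (Suc n) * r ^ n) (at r)"
    using DERIV_pow[of "Suc n" r] by simp
  then have "((\<lambda>r. (max 0 r) ^ Suc n) has_real_derivative real (Suc n) * r ^ n) (at r)"
    by (rule has_field_derivative_transform_within_open[where S = "{0<..}"]) (use greater in \<open>auto simp: max_def\<close>)
  then show ?thesis using greater by (simp add: max_def)
qed

lemma C2_on_pos_part_cube:
  fixes f :: "'a::real_normed_vector \<Rightarrow> real"
  assumes "C2_on S f"
  shows "C2_on S (\<lambda>x. (max 0 (f x)) ^ 3)"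
proof (rule C2_on_compose_real[OF assms, where k' = "\<lambda>r. 3 * (max 0 r)^2" and k'' = "\<lambda>r. 6 * max 0 r"])
  fix r :: real
  show "((\<lambda>r. max 0 r ^ 3) has_real_derivative 3 * (max 0 r)\<^sup>2) (at r)"
    using DERIV_pos_part_power[of 2 r] by (simp add: eval_nat_numeral)
  show "((\<lambda>r. 3 * (max 0 r)\<^sup>2) has_real_derivative 6 * max 0 r) (at r)"
    using DERIV_cmult[OF DERIV_pos_part_power[of 1 r], of 3] by (simp add: eval_nat_numeral)
qed (intro continuous_intros)

section \<open>Mollification\<close>

lemma uniformly_continuous_compact_support:
  fixes K :: "'a::euclidean_space \<Rightarrow> real"
  assumes cont: "continuous_on UNIV K" and supp: "\<And>x. \<delta> < norm x \<Longrightarrow> K x = 0" and e: "0 < e"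
  obtains d where "0 < d" "d \<le> 1" "\<And>x y. dist x y < d \<Longrightarrow> \<bar>K x - K y\<bar> < e"
proof -
  have "uniformly_continuous_on (cball 0 (\<delta> + 1)) K"
    by (rule compact_uniformly_continuous) (auto intro: continuous_on_subset[OF cont])
  then obtain d where d: "d > 0" "\<And>x y. x \<in> cball 0 (\<delta>+1) \<Longrightarrow> y \<in> cball 0 (\<delta>+1) \<Longrightarrow> dist x y < d \<Longrightarrow> dist (K x) (K y) < e"
    using e unfolding uniformly_continuous_on_def by (metis dist_commute)
  have "\<bar>K x - K y\<bar> < e" if "dist x y < min d 1" for x y
  proof (cases "norm x \<le> \<delta> \<or> norm y \<le> \<delta>")
    case True
    moreover have "norm x \<le> norm y + dist x y" "norm y \<le> norm x + dist x y"
      using norm_triangle_sub[of x y] norm_triangle_sub[of y x] by (auto simp: dist_norm norm_minus_commute)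
    ultimately have "x \<in> cball 0 (\<delta>+1)" "y \<in> cball 0 (\<delta>+1)" using that by auto
    then show ?thesis using d(2)[of x y] that by (simp add: dist_real_def)
  next
    case False then show ?thesis using supp e by simp
  qed
  then show ?thesis using that[of "min d 1"] d(1) by simp
qed

lemma integrable_bounded_support:
  fixes f :: "'a::euclidean_space \<Rightarrow> real"
  assumes "f \<in> borel_measurable borel" "\<And>y. \<bar>f y\<bar> \<le> c * indicator (cball x r) y"
  shows "integrable lborel f" "\<bar>integral\<^sup>L lborel f\<bar> \<le> c * measure lborel (cball x r)"
proof -
  have i: "integrable lborel (\<lambda>y. c * indicator (cball x r) y)"
    using emeasure_lborel_cball_finite[of x r] by (intro integrable_mult_right integrable_real_indicator) auto
  show int: "integrable lborel f"
    by (rule Bochner_Integration.integrable_bound[OF i]) (use assms in \<open>auto intro: order_trans[OF _ abs_ge_self]\<close>)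
  have "\<bar>integral\<^sup>L lborel f\<bar> \<le> integral\<^sup>L lborel (\<lambda>y. \<bar>f y\<bar>)"
    using integral_norm_bound[of lborel f] by simp
  also have "\<dots> \<le> integral\<^sup>L lborel (\<lambda>y. c * indicator (cball x r) y)"
    using assms int i by (intro integral_mono) auto
  finally show "\<bar>integral\<^sup>L lborel f\<bar> \<le> c * measure lborel (cball x r)" by simp
qed

lemma continuous_on_vimage_diff:
  fixes K :: "'a::real_normed_vector \<Rightarrow> real"
  assumes "continuous_on UNIV K"
  shows "(\<lambda>y. K (x - y)) \<in> borel_measurable borel"
  by (rule borel_measurable_continuous_onI, rule continuous_on_compose2[OF assms])
     (auto intro: continuous_intros)

lemma content_cball_indep:
  fixes x :: "'a::euclidean_space"
  shows "r \<ge> 0 \<Longrightarrow> measure lborel (cball x r) = measure lborel (cball (0::'a) r)"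
  by (simp add: content_cball)

lemma convolution_integrand:
  fixes u K :: "'a::euclidean_space \<Rightarrow> real"
  assumes u: "u \<in> borel_measurable borel" "\<And>y. \<bar>u y\<bar> \<le> U"
    and K: "continuous_on UNIV K" and supp: "\<And>x. \<delta> < norm x \<Longrightarrow> K x = 0"
  shows "integrable lborel (\<lambda>y. u y * K (x - y))"
proof -
  have [measurable]: "(\<lambda>y. K (x - y)) \<in> borel_measurable borel" by (rule continuous_on_vimage_diff[OF K])
  note u(1)[measurable]
  have "compact (K ` cball 0 \<delta>)" by (intro compact_continuous_image continuous_on_subset[OF K]) auto
  then obtain k where k0: "k > 0" "\<forall>x\<in>K ` cball 0 \<delta>. norm x \<le> k"
    using compact_imp_bounded bounded_pos by metis
  have k: "\<bar>K x\<bar> \<le> k" if "norm x \<le> \<delta>" for x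
    using k0(2) that by simp
  have U0: "U \<ge> 0" using u(2)[of 0] by (meson abs_ge_zero order_trans)
  have "\<bar>u y * K (x - y)\<bar> \<le> U * k * indicator (cball x \<delta>) y" for y
    using mult_mono[OF u(2) k, of "x - y" y] U0 k0(1) supp[of "x - y"]
    by (cases "norm (x - y) \<le> \<delta>") (auto simp: abs_mult dist_norm indicator_def)
  then show ?thesis by (intro integrable_bounded_support(1)[where c = "U * k" and x = x and r = \<delta>]) auto
qed

lemma continuous_convolution:
  fixes u K :: "'a::euclidean_space \<Rightarrow> real"
  assumes u: "u \<in> borel_measurable borel" "\<And>y. \<bar>u y\<bar> \<le> U"
    and K: "continuous_on UNIV K" and supp: "\<And>x. \<delta> < norm x \<Longrightarrow> K x = 0" and \<delta>: "0 < \<delta>"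
  shows "continuous_on UNIV (\<lambda>x. \<integral>y. u y * K (x - y) \<partial>lborel)"
  unfolding continuous_on_iff
proof (intro ballI allI impI)
  fix x :: 'a and e :: real assume e: "0 < e"
  have U0: "U \<ge> 0" using u(2)[of 0] by (meson abs_ge_zero order_trans)
  define V where "V = measure lborel (cball (0::'a) (\<delta> + 1))"
  have V: "V \<ge> 0" by (simp add: V_def)
  define e' where "e' = e / (U * V + 1)"
  have UV: "U * V + 1 > 0" by (intro add_nonneg_pos mult_nonneg_nonneg U0 V) auto
  have e': "e' > 0" using e UV by (simp add: e'_def)
  obtain d where d: "0 < d" "d \<le> 1" "\<And>x y. dist x y < d \<Longrightarrow> \<bar>K x - K y\<bar> < e'"
    using uniformly_continuous_compact_support[OF K supp e'] by metis
  have [measurable]: "(\<lambda>y. K (x - y)) \<in> borel_measurable borel" for x by (rule continuous_on_vimage_diff[OF K])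
  note u(1)[measurable]
  show "\<exists>d>0. \<forall>x'\<in>UNIV. dist x' x < d \<longrightarrow> dist (\<integral>y. u y * K (x' - y) \<partial>lborel) (\<integral>y. u y * K (x - y) \<partial>lborel) < e"
  proof (intro exI[of _ d] conjI ballI impI d(1))
    fix x' assume x': "dist x' x < d"
    have bd: "\<bar>u y * K (x' - y) - u y * K (x - y)\<bar> \<le> (U * e') * indicator (cball x (\<delta> + 1)) y" for y
    proof (cases "norm (x - y) \<le> \<delta> + 1")
      case True
      have "\<bar>u y * K (x' - y) - u y * K (x - y)\<bar> = \<bar>u y\<bar> * \<bar>K (x' - y) - K (x - y)\<bar>"
        by (simp add: right_diff_distrib[symmetric] abs_mult)
      also have "\<dots> \<le> U * e'"
        using x' U0 by (intro mult_mono u(2) less_imp_le[OF d(3)]) (auto simp: dist_norm)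
      finally show ?thesis using True by (simp add: dist_norm)
    next
      case False
      have "norm (x - y) \<le> norm (x' - y) + dist x' x"
        using norm_triangle_ineq[of "x' - y" "x - x'"] by (simp add: dist_norm norm_minus_commute)
      then have "K (x' - y) = 0" "K (x - y) = 0" using False x' d(2) supp by auto
      then show ?thesis using False by (simp add: dist_norm)
    qed
    have "\<bar>\<integral>y. u y * K (x' - y) - u y * K (x - y) \<partial>lborel\<bar> \<le> (U * e') * measure lborel (cball x (\<delta> + 1))"
      by (rule integrable_bounded_support(2)[OF _ bd]) measurable
    also have "\<dots> = U * e' * V" using content_cball_indep[of "\<delta>+1" x] \<delta> by (simp add: V_def)
    also have "\<dots> = e * ((U * V) / (U * V + 1))" by (simp add: e'_def)
    also have "\<dots> < e * 1" using UV e by (intro mult_strict_left_mono) (auto simp: divide_simps)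
    finally show "dist (\<integral>y. u y * K (x' - y) \<partial>lborel) (\<integral>y. u y * K (x - y) \<partial>lborel) < e"
      using Bochner_Integration.integral_diff[OF convolution_integrand[OF u K supp, of _ x'] convolution_integrand[OF u K supp, of _ x]]
      by (simp add: dist_real_def)
  qed
qed

text \<open>
  The derivative falls on the kernel, whose first-order remainder is uniformly small because the
  kernel has compact support.
\<close>
lemma convolution_has_derivative:
  fixes u K :: "'a::euclidean_space \<Rightarrow> real"
  assumes u: "u \<in> borel_measurable borel" "\<And>y. \<bar>u y\<bar> \<le> U"
    and K: "\<And>x. (K has_derivative (\<lambda>v. \<Sum>b\<in>Basis. (v \<bullet> b) * K1 b x)) (at x)"
    and K1: "\<And>b. b \<in> Basis \<Longrightarrow> continuous_on UNIV (K1 b)"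
    and supp: "\<And>x. \<delta> < norm x \<Longrightarrow> K x = 0" "\<And>b x. b \<in> Basis \<Longrightarrow> \<delta> < norm x \<Longrightarrow> K1 b x = 0" and \<delta>: "0 < \<delta>"
  shows "((\<lambda>x. \<integral>y. u y * K (x - y) \<partial>lborel) has_derivative
           (\<lambda>v. \<Sum>b\<in>Basis. (v \<bullet> b) * (\<integral>y. u y * K1 b (x - y) \<partial>lborel))) (at x)"
  unfolding has_derivative_at_alt
proof (intro conjI allI impI)
  show "bounded_linear (\<lambda>v. \<Sum>b\<in>Basis. (v \<bullet> b) * (\<integral>y. u y * K1 b (x - y) \<partial>lborel))"
    by (intro bounded_linear_sum bounded_linear_mult_const bounded_linear_inner_left)
next
  fix e :: real assume e: "0 < e"
  have cK: "continuous_on UNIV K"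
    by (rule has_derivative_continuous_on[OF K])
  have U0: "U \<ge> 0" using u(2)[of 0] by (meson abs_ge_zero order_trans)
  define V where "V = measure lborel (cball (0::'a) (\<delta> + 1))"
  have V: "V \<ge> 0" by (simp add: V_def)
  define e' where "e' = e / (U * V + 1)"
  have UV: "U * V + 1 > 0" by (intro add_nonneg_pos mult_nonneg_nonneg U0 V) auto
  have e': "e' > 0" using e UV by (simp add: e'_def)
  define e1 where "e1 = e' / real DIM('a)"
  have e1: "e1 > 0" using e' by (simp add: e1_def)
  have "\<exists>d. 0 < d \<and> d \<le> 1 \<and> (\<forall>x y. dist x y < d \<longrightarrow> \<bar>K1 b x - K1 b y\<bar> < e1)" if b: "b \<in> Basis" for b :: 'a
    using uniformly_continuous_compact_support[OF K1[OF b] supp(2)[OF b] e1] by metis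
  then obtain d where d: "\<And>b. b \<in> Basis \<Longrightarrow> 0 < d b \<and> d b \<le> 1 \<and> (\<forall>x y. dist x y < d b \<longrightarrow> \<bar>K1 b x - K1 b y\<bar> < e1)"
    by metis
  define D where "D = Min (d ` Basis)"
  have D: "0 < D" "D \<le> 1" "\<And>b. b \<in> Basis \<Longrightarrow> D \<le> d b"
  proof -
    show "D \<le> d b" if "b \<in> Basis" for b using that by (simp add: D_def)
    have "D \<in> d ` Basis" unfolding D_def by (rule Min_in) auto
    then show "0 < D" "D \<le> 1" using d by auto
  qed
  \<comment> \<open>The remainder of the kernel is small uniformly in the base point.\<close>
  have rem: "\<bar>K (z + v) - K z - (\<Sum>b\<in>Basis. (v \<bullet> b) * K1 b z)\<bar> \<le> e' * norm v" if v: "norm v < D" for z v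
  proof -
    have "norm ((K (z + v) - (\<Sum>b\<in>Basis. ((z+v) \<bullet> b) * K1 b z)) - (K z - (\<Sum>b\<in>Basis. (z \<bullet> b) * K1 b z)))
       \<le> e' * norm (z + v - z)"
    proof (rule differentiable_bound[of "ball z D" _ "\<lambda>y v. (\<Sum>b\<in>Basis. (v \<bullet> b) * K1 b y) - (\<Sum>b\<in>Basis. (v \<bullet> b) * K1 b z)"])
      fix y assume y: "y \<in> ball z D"
      have bl: "bounded_linear (\<lambda>w::'a. (\<Sum>b\<in>Basis. (w \<bullet> b) * K1 b z))"
        by (intro bounded_linear_sum bounded_linear_mult_const bounded_linear_inner_left)
      show "((\<lambda>y. K y - (\<Sum>b\<in>Basis. (y \<bullet> b) * K1 b z)) has_derivative
           (\<lambda>v. (\<Sum>b\<in>Basis. (v \<bullet> b) * K1 b y) - (\<Sum>b\<in>Basis. (v \<bullet> b) * K1 b z))) (at y within ball z D)"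
        by (intro has_derivative_diff has_derivative_at_withinI[OF K] bounded_linear_imp_has_derivative bl)
      show "onorm (\<lambda>v. (\<Sum>b\<in>Basis. (v \<bullet> b) * K1 b y) - (\<Sum>b\<in>Basis. (v \<bullet> b) * K1 b z)) \<le> e'"
      proof (rule onorm_bound)
        fix w :: 'a
        have "norm ((\<Sum>b\<in>Basis. (w \<bullet> b) * K1 b y) - (\<Sum>b\<in>Basis. (w \<bullet> b) * K1 b z))
           = \<bar>\<Sum>b\<in>Basis. (w \<bullet> b) * (K1 b y - K1 b z)\<bar>"
          by (simp add: sum_subtractf right_diff_distrib)
        also have "\<dots> \<le> (\<Sum>b\<in>Basis. \<bar>(w \<bullet> b) * (K1 b y - K1 b z)\<bar>)" by (rule sum_abs)
        also have "\<dots> \<le> (\<Sum>b\<in>(Basis::'a set). norm w * e1)"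
        proof (rule sum_mono)
          fix b :: 'a assume b: "b \<in> Basis"
          have "\<bar>K1 b y - K1 b z\<bar> \<le> e1" using d[OF b] D(3)[OF b] y by (simp add: dist_commute less_imp_le)
          then show "\<bar>(w \<bullet> b) * (K1 b y - K1 b z)\<bar> \<le> norm w * e1"
            using Basis_le_norm[OF b, of w] e1 by (auto simp: abs_mult intro!: mult_mono)
        qed
        also have "\<dots> = e' * norm w" by (simp add: e1_def)
        finally show "norm ((\<Sum>b\<in>Basis. (w \<bullet> b) * K1 b y) - (\<Sum>b\<in>Basis. (w \<bullet> b) * K1 b z)) \<le> e' * norm w" .
      qed (use e' in simp)
    qed (use v D(1) in \<open>auto simp: dist_norm\<close>)
    then show ?thesis by (simp add: inner_add_left sum.distrib algebra_simps)
  qed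
  show "\<exists>d>0. \<forall>y. norm (y - x) < d \<longrightarrow> norm ((\<integral>z. u z * K (y - z) \<partial>lborel) - (\<integral>z. u z * K (x - z) \<partial>lborel)
          - (\<Sum>b\<in>Basis. ((y - x) \<bullet> b) * (\<integral>z. u z * K1 b (x - z) \<partial>lborel))) \<le> e * norm (y - x)"
  proof (intro exI[of _ D] conjI allI impI D(1))
    fix y assume y: "norm (y - x) < D"
    define v where "v = y - x"
    have yv: "y = x + v" "norm v < D" using y by (auto simp: v_def)
    have [measurable]: "(\<lambda>y. K (x - y)) \<in> borel_measurable borel" for x by (rule continuous_on_vimage_diff[OF cK])
    have [measurable]: "b \<in> Basis \<Longrightarrow> (\<lambda>y. K1 b (x - y)) \<in> borel_measurable borel" for x b by (rule continuous_on_vimage_diff[OF K1])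
    note u(1)[measurable]
    define R where "R z = u z * K (x + v - z) - u z * K (x - z) - (\<Sum>b\<in>Basis. (v \<bullet> b) * (u z * K1 b (x - z)))" for z
    have [measurable]: "R \<in> borel_measurable borel" unfolding R_def by measurable
    have Req: "R z = u z * (K ((x - z) + v) - K (x - z) - (\<Sum>b\<in>Basis. (v \<bullet> b) * K1 b (x - z)))" for z
      by (simp add: R_def algebra_simps sum_distrib_left)
    have bd: "\<bar>R z\<bar> \<le> (U * (e' * norm v)) * indicator (cball x (\<delta> + 1)) z" for z
    proof (cases "norm (x - z) \<le> \<delta> + 1")
      case True
      have "\<bar>R z\<bar> \<le> U * (e' * norm v)"
        unfolding Req abs_mult using U0 rem[OF yv(2)] by (intro mult_mono u(2)) auto
      then show ?thesis using True by (simp add: dist_norm)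
    next
      case False
      have "norm (x - z) \<le> norm (x - z + v) + norm v"
        using norm_triangle_ineq4[of "x - z + v" v] by simp
      then have "K (x - z + v) = 0" "K (x - z) = 0" "\<And>b. b \<in> Basis \<Longrightarrow> K1 b (x - z) = 0"
        using False yv(2) D(2) supp by auto
      then show ?thesis using False by (simp add: Req dist_norm)
    qed
    have "\<bar>integral\<^sup>L lborel R\<bar> \<le> (U * (e' * norm v)) * measure lborel (cball x (\<delta> + 1))"
      by (rule integrable_bounded_support(2)[OF _ bd]) measurable
    also have "\<dots> = U * (e' * norm v) * V" using content_cball_indep[of "\<delta>+1" x] \<delta> by (simp add: V_def)
    also have "\<dots> = e * norm v * ((U * V) / (U * V + 1))" by (simp add: e'_def)
    also have "\<dots> \<le> e * norm v * 1" using UV e by (intro mult_left_mono) (auto simp: divide_simps)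
    finally have "\<bar>integral\<^sup>L lborel R\<bar> \<le> e * norm v" by simp
    moreover have "integral\<^sup>L lborel R = (\<integral>z. u z * K (y - z) \<partial>lborel) - (\<integral>z. u z * K (x - z) \<partial>lborel)
          - (\<Sum>b\<in>Basis. (v \<bullet> b) * (\<integral>z. u z * K1 b (x - z) \<partial>lborel))"
      unfolding R_def using convolution_integrand[OF u cK supp(1)] convolution_integrand[OF u K1 supp(2)]
      by (simp add: yv(1) Bochner_Integration.integral_sum)
    ultimately show "norm ((\<integral>z. u z * K (y - z) \<partial>lborel) - (\<integral>z. u z * K (x - z) \<partial>lborel)
          - (\<Sum>b\<in>Basis. ((y - x) \<bullet> b) * (\<integral>z. u z * K1 b (x - z) \<partial>lborel))) \<le> e * norm (y - x)"
      by (simp add: v_def)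
  qed
qed

lemma C2_on_UNIV_supported_partials:
  fixes K :: "'a::euclidean_space \<Rightarrow> real"
  assumes "C2_on UNIV K" and supp: "\<And>x. \<delta> < norm x \<Longrightarrow> K x = 0"
  obtains K1 K2 B where
    "\<And>x. (K has_derivative (\<lambda>v. \<Sum>b\<in>Basis. (v \<bullet> b) * K1 b x)) (at x)"
    "\<And>b x. b \<in> Basis \<Longrightarrow> (K1 b has_derivative (\<lambda>v. \<Sum>c\<in>Basis. (v \<bullet> c) * K2 b c x)) (at x)"
    "\<And>b. b \<in> Basis \<Longrightarrow> continuous_on UNIV (K1 b)"
    "\<And>b c. b \<in> Basis \<Longrightarrow> c \<in> Basis \<Longrightarrow> continuous_on UNIV (K2 b c)"
    "\<And>b x. \<delta> < norm x \<Longrightarrow> K1 b x = 0" "\<And>b c x. \<delta> < norm x \<Longrightarrow> K2 b c x = 0"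
    "0 \<le> B" "\<And>x v. \<bar>K (x + v) - K x - (\<Sum>b\<in>Basis. (v \<bullet> b) * K1 b x)\<bar> \<le> B * (norm v)\<^sup>2"
proof -
  obtain f' f'' where f:
      "\<And>x. x \<in> UNIV \<Longrightarrow> (K has_derivative blinfun_apply (f' x)) (at x)"
    "\<And>x. x \<in> UNIV \<Longrightarrow> (f' has_derivative blinfun_apply (f'' x)) (at x)"
    "continuous_on UNIV f''" "continuous_on UNIV K" "continuous_on UNIV f'"
    by (rule C2_onE[OF assms(1)]) blast
  define Out where "Out = {x::'a. \<delta> < norm x}"
  have op: "open Out" unfolding Out_def by (intro open_Collect_less continuous_intros)
  have zero: "g' = 0" if "x \<in> Out" "(g has_derivative blinfun_apply g') (at x)" "\<And>x. x \<in> Out \<Longrightarrow> g x = 0"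
    for x and g :: "'a \<Rightarrow> 'b::real_normed_vector" and g'
  proof -
    have "(g has_derivative (\<lambda>_. 0)) (at x)"
      by (rule has_derivative_transform_within_open[OF has_derivative_const[of 0] op that(1)]) (simp add: that(3))
    then have "blinfun_apply g' = (\<lambda>_. 0)" using that(2) has_derivative_unique by blast
    then show ?thesis by (auto intro!: blinfun_eqI)
  qed
  have f'0: "f' x = 0" if "x \<in> Out" for x
    using zero[OF that f(1)[OF UNIV_I]] supp by (auto simp: Out_def)
  have f''0: "f'' x = 0" if "x \<in> Out" for x
    using zero[OF that f(2)[OF UNIV_I] f'0] by auto
  have "compact (f'' ` cball 0 \<delta>)" by (intro compact_continuous_image continuous_on_subset[OF f(3)]) auto
  then obtain B where B0: "B > 0" "\<forall>x\<in>f'' ` cball 0 \<delta>. norm x \<le> B"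
    using compact_imp_bounded bounded_pos by metis
  have B: "norm (f'' x) \<le> B" for x
    using f''0[of x] B0 by (cases "norm x \<le> \<delta>") (auto simp: Out_def)
  define K1 where "K1 b x = f' x b" for b x
  define K2 where "K2 b c x = f'' x c b" for b c x
  have exp1: "blinfun_apply (f' x) v = (\<Sum>b\<in>Basis. (v \<bullet> b) * K1 b x)" for x v
  proof -
    have "blinfun_apply (f' x) v = blinfun_apply (f' x) (\<Sum>b\<in>Basis. (v \<bullet> b) *\<^sub>R b)"
      by (simp add: euclidean_representation)
    then show ?thesis by (simp add: blinfun.sum_right blinfun.scaleR_right K1_def)
  qed
  have exp2: "blinfun_apply (blinfun_apply (f'' x) v) b = (\<Sum>c\<in>Basis. (v \<bullet> c) * K2 b c x)" for x v b
  proof -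
    have "blinfun_apply (f'' x) v = blinfun_apply (f'' x) (\<Sum>c\<in>Basis. (v \<bullet> c) *\<^sub>R c)"
      by (simp add: euclidean_representation)
    then show ?thesis by (simp add: blinfun.sum_right blinfun.scaleR_right blinfun.sum_left blinfun.scaleR_left K2_def)
  qed
  show ?thesis
  proof (rule that[of K1 K2 B])
    show "(K has_derivative (\<lambda>v. \<Sum>b\<in>Basis. (v \<bullet> b) * K1 b x)) (at x)" for x
      using f(1)[OF UNIV_I, of x] by (simp add: exp1[abs_def])
    show "(K1 b has_derivative (\<lambda>v. \<Sum>c\<in>Basis. (v \<bullet> c) * K2 b c x)) (at x)" for b x
      unfolding exp2[symmetric] K1_def
      by (rule bounded_linear.has_derivative[OF blinfun.bounded_linear_left f(2)[OF UNIV_I]])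
    show "continuous_on UNIV (K1 b)" for b unfolding K1_def by (intro continuous_intros f)
    show "continuous_on UNIV (K2 b c)" for b c unfolding K2_def by (intro continuous_intros f)
    show "\<delta> < norm x \<Longrightarrow> K1 b x = 0" for b x using f'0 by (simp add: K1_def Out_def)
    show "\<delta> < norm x \<Longrightarrow> K2 b c x = 0" for b c x using f''0 by (simp add: K2_def Out_def)
    show "\<bar>K (x + v) - K x - (\<Sum>b\<in>Basis. (v \<bullet> b) * K1 b x)\<bar> \<le> B * (norm v)\<^sup>2" for x v
      unfolding exp1[symmetric] by (rule taylor_bound[of UNIV K f' f'']) (use f B in auto)
  qed (use B0 in simp)
qed

text \<open>
  The cube of a positive part is twice continuously differentiable, so the cube of the positive part
  of \<open>\<delta>\<^sup>2 - |x|\<^sup>2\<close>, normalised, serves as mollifier.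
\<close>
lemma mollifier_exists:
  assumes \<delta>: "0 < \<delta>"
  obtains \<rho> :: "'a::euclidean_space \<Rightarrow> real" where "C2_on UNIV \<rho>" "\<And>x. 0 \<le> \<rho> x"
    "\<And>x. \<delta> < norm x \<Longrightarrow> \<rho> x = 0" "integrable lborel \<rho>" "integral\<^sup>L lborel \<rho> = 1"
proof -
  define k where "k x = (max 0 (\<delta>\<^sup>2 + - ((norm (x - 0))\<^sup>2))) ^ 3" for x :: 'a
  have k2: "C2_on UNIV k" unfolding k_def
    by (intro C2_on_pos_part_cube C2_on_add C2_on_const C2_on_uminus C2_on_norm_square bounded_linear_ident)
  have k0: "0 \<le> k x" for x by (simp add: k_def)
  have ks: "k x = 0" if "\<delta> < norm x" for x
    using power_strict_mono[OF that, of 2] \<delta> by (simp add: k_def)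
  have ck: "continuous_on UNIV k" by (rule C2_onE[OF k2])
  have [measurable]: "k \<in> borel_measurable borel" by (rule borel_measurable_continuous_onI[OF ck])
  define D where "D = (\<delta>\<^sup>2)^3"
  have "k x \<le> D" for x unfolding k_def D_def by (intro power_mono) auto
  then have kb: "\<bar>k x\<bar> \<le> D * indicator (cball 0 \<delta>) x" for x
    using ks[of x] k0[of x] by (auto simp: indicator_def)
  have int: "integrable lborel k" by (rule integrable_bounded_support(1)[OF _ kb]) measurable
  define c where "c = (\<delta>\<^sup>2 / 2) ^ 3"
  have c: "c > 0" using \<delta> by (simp add: c_def)
  have "c * indicator (cball 0 (\<delta>/2)) x \<le> k x" for x
  proof (cases "norm x \<le> \<delta> / 2")
    case True
    have "(norm x)\<^sup>2 \<le> (\<delta>/2)\<^sup>2" using True by (intro power_mono) auto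
    moreover have "(\<delta>/2)\<^sup>2 = \<delta>\<^sup>2 / 4" by (simp add: power_divide)
    moreover have "0 \<le> \<delta>\<^sup>2" by simp
    ultimately have "\<delta>\<^sup>2 / 2 \<le> \<delta>\<^sup>2 - (norm x)\<^sup>2" by linarith
    then have "\<delta>\<^sup>2 / 2 \<le> max 0 (\<delta>\<^sup>2 + - ((norm (x - 0))\<^sup>2))" by (intro max.coboundedI2) simp
    then have "c \<le> k x" unfolding c_def k_def by (intro power_mono) auto
    then show ?thesis using True by simp
  qed (auto simp: k0)
  then have "(\<integral>x. c * indicator (cball (0::'a) (\<delta>/2)) x \<partial>lborel) \<le> integral\<^sup>L lborel k"
    using emeasure_lborel_cball_finite[of "0::'a" "\<delta>/2"]
    by (intro integral_mono int integrable_mult_right integrable_real_indicator) auto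
  then have "c * measure lborel (cball (0::'a) (\<delta>/2)) \<le> integral\<^sup>L lborel k" by simp
  moreover have "c * measure lborel (cball (0::'a) (\<delta>/2)) > 0" using c \<delta> by (simp add: content_cball_pos)
  ultimately have I: "integral\<^sup>L lborel k > 0" by linarith
  show ?thesis
  proof (rule that[of "\<lambda>x. inverse (integral\<^sup>L lborel k) * k x"])
    show "C2_on UNIV (\<lambda>x. inverse (integral\<^sup>L lborel k) * k x)" by (rule C2_on_cmult[OF k2])
  qed (use I k0 ks int in auto)
qed

text \<open>
  The constant \<open>B\<close> depends on the mollifier alone, so the Taylor estimate is uniform over all
  functions with the same bound. This lets the mesh of the scheme be chosen after the mollifier.
\<close>
lemma smooth_convolution:
  fixes \<rho> :: "'a::euclidean_space \<Rightarrow> real"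
  assumes "C2_on UNIV \<rho>" "\<And>x. \<delta> < norm x \<Longrightarrow> \<rho> x = 0" "0 < \<delta>"
  obtains B where "0 \<le> B" "\<And>u U. u \<in> borel_measurable borel \<Longrightarrow> (\<And>y. \<bar>u y\<bar> \<le> U) \<Longrightarrow>
       C2_on UNIV (\<lambda>x. \<integral>y. u y * \<rho> (x - y) \<partial>lborel) \<and>
       (\<exists>F' :: 'a \<Rightarrow> 'a \<Rightarrow>\<^sub>L real. (\<forall>x. ((\<lambda>x. \<integral>y. u y * \<rho> (x - y) \<partial>lborel) has_derivative blinfun_apply (F' x)) (at x)) \<and>
            (\<forall>x v. \<bar>(\<integral>y. u y * \<rho> (x + v - y) \<partial>lborel) - (\<integral>y. u y * \<rho> (x - y) \<partial>lborel) - F' x v\<bar> \<le> U * B * (norm v)\<^sup>2))"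
proof -
  obtain K1 K2 B where K:
    "\<And>x. (\<rho> has_derivative (\<lambda>v. \<Sum>b\<in>Basis. (v \<bullet> b) * K1 b x)) (at x)"
    "\<And>b x. b \<in> Basis \<Longrightarrow> (K1 b has_derivative (\<lambda>v. \<Sum>c\<in>Basis. (v \<bullet> c) * K2 b c x)) (at x)"
    "\<And>b. b \<in> Basis \<Longrightarrow> continuous_on UNIV (K1 b)"
    "\<And>b c. b \<in> Basis \<Longrightarrow> c \<in> Basis \<Longrightarrow> continuous_on UNIV (K2 b c)"
    "\<And>b x. \<delta> < norm x \<Longrightarrow> K1 b x = 0" "\<And>b c x. \<delta> < norm x \<Longrightarrow> K2 b c x = 0"
    "0 \<le> B" "\<And>x v. \<bar>\<rho> (x + v) - \<rho> x - (\<Sum>b\<in>Basis. (v \<bullet> b) * K1 b x)\<bar> \<le> B * (norm v)\<^sup>2"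
    by (rule C2_on_UNIV_supported_partials[OF assms(1,2)]) blast+
  have c\<rho>: "continuous_on UNIV \<rho>" by (rule C2_onE[OF assms(1)])
  define V where "V = measure lborel (cball (0::'a) \<delta>)"
  show ?thesis
  proof (rule that[of "B * (2 * V)"])
    show "0 \<le> B * (2 * V)" using K(7) by (simp add: V_def)
    fix u :: "'a \<Rightarrow> real" and U assume u: "u \<in> borel_measurable borel" "\<And>y. \<bar>u y\<bar> \<le> U"
    define F where "F x = (\<integral>y. u y * \<rho> (x - y) \<partial>lborel)" for x
    define F1 where "F1 b x = (\<integral>y. u y * K1 b (x - y) \<partial>lborel)" for b x
    define F2 where "F2 b c x = (\<integral>y. u y * K2 b c (x - y) \<partial>lborel)" for b c x
    have U0: "U \<ge> 0" using u(2)[of 0] by (meson abs_ge_zero order_trans)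
    have d1: "(F has_derivative (\<lambda>v. \<Sum>b\<in>Basis. (v \<bullet> b) * F1 b x)) (at x)" for x
      unfolding F_def F1_def by (rule convolution_has_derivative[OF u K(1,3) assms(2) K(5) assms(3)])
    have d2: "(F1 b has_derivative (\<lambda>v. \<Sum>c\<in>Basis. (v \<bullet> c) * F2 b c x)) (at x)" if "b \<in> Basis" for b x
      unfolding F2_def F1_def by (rule convolution_has_derivative[OF u K(2)[OF that] K(4)[OF that] K(5,6) assms(3)])
    have d3: "continuous_on UNIV (F2 b c)" if "b \<in> Basis" "c \<in> Basis" for b c
      unfolding F2_def by (rule continuous_convolution[OF u K(4)[OF that] K(6) assms(3)])
    have C2: "C2_on UNIV F" by (rule C2_onI_partials[OF d1 d2 d3])
    define F' where "F' x = (\<Sum>b\<in>Basis. F1 b x *\<^sub>R blinfun_inner_left b)" for x :: 'a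
    have F': "blinfun_apply (F' x) v = (\<Sum>b\<in>Basis. (v \<bullet> b) * F1 b x)" for x v
      by (simp add: F'_def blinfun.sum_left scaleR_blinfun.rep_eq mult.commute)
    have tay: "\<bar>F (x + v) - F x - F' x v\<bar> \<le> U * (B * (2 * V)) * (norm v)\<^sup>2" for x v
    proof -
      have [measurable]: "(\<lambda>y. \<rho> (x - y)) \<in> borel_measurable borel" for x by (rule continuous_on_vimage_diff[OF c\<rho>])
      have [measurable]: "b \<in> Basis \<Longrightarrow> (\<lambda>y. K1 b (x - y)) \<in> borel_measurable borel" for x b by (rule continuous_on_vimage_diff[OF K(3)])
      note u(1)[measurable]
      define R where "R z = u z * \<rho> (x + v - z) - u z * \<rho> (x - z) - (\<Sum>b\<in>Basis. (v \<bullet> b) * (u z * K1 b (x - z)))" for z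
      have Req: "R z = u z * (\<rho> ((x - z) + v) - \<rho> (x - z) - (\<Sum>b\<in>Basis. (v \<bullet> b) * K1 b (x - z)))" for z
        by (simp add: R_def algebra_simps sum_distrib_left)
      define c where "c = U * (B * (norm v)\<^sup>2)"
      have c0: "c \<ge> 0" using U0 K(7) by (simp add: c_def)
      have bd: "\<bar>R z\<bar> \<le> c * indicator (cball x \<delta>) z + c * indicator (cball (x + v) \<delta>) z" for z
      proof (cases "norm (x - z) \<le> \<delta> \<or> norm (x - z + v) \<le> \<delta>")
        case True
        have "\<bar>R z\<bar> \<le> c"
          unfolding Req abs_mult c_def using U0 K(8) by (intro mult_mono u(2)) auto
        then show ?thesis using True c0 by (auto simp: dist_norm indicator_def algebra_simps)
      next
        case False
        then have "\<rho> (x - z + v) = 0" "\<rho> (x - z) = 0" "\<And>b. K1 b (x - z) = 0"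
          using assms(2) K(5) by auto
        then show ?thesis using c0 by (simp add: Req)
      qed
      have i: "integrable lborel (\<lambda>z. c * indicator (cball x \<delta>) z + c * indicator (cball (x + v) \<delta>) z)"
        using emeasure_lborel_cball_finite[of x \<delta>] emeasure_lborel_cball_finite[of "x + v" \<delta>]
        by (intro Bochner_Integration.integrable_add integrable_mult_right integrable_real_indicator) auto
      have iR: "integrable lborel R"
        unfolding R_def using convolution_integrand[OF u c\<rho> assms(2)] convolution_integrand[OF u K(3,5)]
        by (intro Bochner_Integration.integrable_diff Bochner_Integration.integrable_sum integrable_mult_right) auto
      have "\<bar>integral\<^sup>L lborel R\<bar> \<le> integral\<^sup>L lborel (\<lambda>y. \<bar>R y\<bar>)"
        using integral_norm_bound[of lborel R] by simp
      also have "\<dots> \<le> integral\<^sup>L lborel (\<lambda>z. c * indicator (cball x \<delta>) z + c * indicator (cball (x + v) \<delta>) z)"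
        using bd iR i by (intro integral_mono) auto
      also have "\<dots> = c * measure lborel (cball x \<delta>) + c * measure lborel (cball (x + v) \<delta>)"
        using emeasure_lborel_cball_finite[of x \<delta>] emeasure_lborel_cball_finite[of "x + v" \<delta>]
        by (subst Bochner_Integration.integral_add)
           (auto intro!: integrable_mult_right integrable_real_indicator simp del: integrable_mult_right_iff)
      also have "\<dots> = U * (B * (2 * V)) * (norm v)\<^sup>2"
        using content_cball_indep[of \<delta> x] content_cball_indep[of \<delta> "x + v"] assms(3) by (simp add: V_def c_def)
      also have "integral\<^sup>L lborel R = F (x + v) - F x - F' x v"
        unfolding R_def F_def F' F1_def
        using convolution_integrand[OF u c\<rho> assms(2)] convolution_integrand[OF u K(3,5)]
        by (simp add: Bochner_Integration.integral_sum)
      finally show ?thesis .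
    qed
    show "C2_on UNIV (\<lambda>x. \<integral>y. u y * \<rho> (x - y) \<partial>lborel) \<and>
       (\<exists>F' :: 'a \<Rightarrow> 'a \<Rightarrow>\<^sub>L real. (\<forall>x. ((\<lambda>x. \<integral>y. u y * \<rho> (x - y) \<partial>lborel) has_derivative blinfun_apply (F' x)) (at x)) \<and>
            (\<forall>x v. \<bar>(\<integral>y. u y * \<rho> (x + v - y) \<partial>lborel) - (\<integral>y. u y * \<rho> (x - y) \<partial>lborel) - F' x v\<bar> \<le> U * (B * (2 * V)) * (norm v)\<^sup>2))"
      using C2 d1 tay unfolding F'[symmetric] F_def by blast
  qed
qed

lemma lborel_integral_translate:
  fixes f :: "'a::euclidean_space \<Rightarrow> real"
  shows "(\<integral>y. f (y + a) \<partial>lborel) = (\<integral>y. f y \<partial>lborel)"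
proof (cases "f \<in> borel_measurable borel")
  case True
  then show ?thesis
    by (subst (2) lborel_distr_plus[symmetric, of a], subst integral_distr) (auto simp: add.commute)
next
  case False
  have "(\<lambda>y. f (y + a)) \<notin> borel_measurable borel"
  proof
    assume "(\<lambda>y. f (y + a)) \<in> borel_measurable borel"
    from measurable_compose[OF _ this, of "\<lambda>y. y - a" borel] False show False by simp
  qed
  then show ?thesis using False borel_measurable_integrable
    by (metis measurable_lborel2 not_integrable_integral_eq)
qed

section \<open>The Levy measure\<close>

lemma borel_measurable_continuous_off_zero:
  fixes f :: "'a::euclidean_space \<Rightarrow> real"
  assumes "continuous_on (- {0}) f" "f 0 = 0"
  shows "f \<in> borel_measurable borel"
proof -
  have "(\<lambda>x. indicator (- {0}) x *\<^sub>R f x) \<in> borel_measurable borel"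
    using assms by (intro borel_measurable_continuous_on_indicator) auto
  also have "(\<lambda>x. indicator (- {0}) x *\<^sub>R f x) = f" using assms(2) by (auto simp: indicator_def)
  finally show ?thesis .
qed

text \<open>
  A geometric series of shells, on each of which the density is controlled by its value at one
  radius, takes the place of polar coordinates.
\<close>
lemma emeasure_density_shells_finite:
  fixes h :: "'a::euclidean_space \<Rightarrow> real"
  assumes h: "h \<in> borel_measurable borel" "\<And>z. 0 \<le> h z"
    and A: "\<And>k. A k \<in> sets borel" "\<And>k. A k \<subseteq> cball 0 (\<rho> k)" "\<And>k::nat. 0 \<le> \<rho> k"
    and c: "\<And>k z. z \<in> A k \<Longrightarrow> h z \<le> c k" "\<And>k. 0 \<le> c k" "\<And>k. c k * \<rho> k ^ DIM('a) \<le> C * q ^ k"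
    and q: "0 \<le> q" "q < 1" and C: "0 \<le> C" and S: "S \<subseteq> {0} \<union> (\<Union>k. A k)"
  shows "emeasure (density lborel (\<lambda>z. ennreal (h z))) S < \<infinity>"
proof -
  let ?M = "density lborel (\<lambda>z. ennreal (h z))"
  note h(1)[measurable]
  note A(1)[measurable]
  define V where "V = unit_ball_vol (real DIM('a))"
  have V: "V \<ge> 0" by (simp add: V_def)
  have "emeasure ?M (A k) \<le> ennreal (V * C * q ^ k)" for k
  proof -
    have "emeasure ?M (A k) = (\<integral>\<^sup>+z. ennreal (h z) * indicator (A k) z \<partial>lborel)"
      by (rule emeasure_density) auto
    also have "\<dots> \<le> (\<integral>\<^sup>+z. ennreal (c k) * indicator (cball (0::'a) (\<rho> k)) z \<partial>lborel)"
    proof (rule nn_integral_mono)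
      fix z :: 'a show "ennreal (h z) * indicator (A k) z \<le> ennreal (c k) * indicator (cball 0 (\<rho> k)) z"
      proof (cases "z \<in> A k")
        case True
        then have "z \<in> cball 0 (\<rho> k)" using A(2)[of k] by blast
        then show ?thesis using c(1)[OF True] True by (simp add: ennreal_leI)
      qed simp
    qed
    also have "\<dots> = ennreal (c k) * ennreal (V * \<rho> k ^ DIM('a))"
      using A(3)[of k] by (simp add: nn_integral_cmult_indicator emeasure_cball V_def)
    also have "\<dots> = ennreal (V * (c k * \<rho> k ^ DIM('a)))"
      using c(2)[of k] V A(3)[of k] by (simp add: ennreal_mult[symmetric] mult_ac)
    also have "\<dots> \<le> ennreal (V * (C * q ^ k))"
      using c(3)[of k] V by (intro ennreal_leI mult_left_mono)
    finally show ?thesis by (simp add: mult_ac)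
  qed
  then have "(\<Sum>k. emeasure ?M (A k)) \<le> (\<Sum>k. ennreal (V * C * q ^ k))"
    by (intro suminf_le) auto
  also have "\<dots> < \<infinity>"
    using q C V by (subst suminf_ennreal2) (auto intro!: summable_mult summable_geometric)
  finally have fin: "(\<Sum>k. emeasure ?M (A k)) < \<infinity>" .
  have "emeasure ?M S \<le> emeasure ?M ({0} \<union> (\<Union>k. A k))" by (rule emeasure_mono[OF S]) auto
  also have "\<dots> \<le> emeasure ?M {0} + emeasure ?M (\<Union>k. A k)" by (rule emeasure_subadditive) auto
  also have "emeasure ?M {0} = 0"
  proof -
    have "{0::'a} \<in> null_sets lborel" by (simp add: null_sets_def)
    then show ?thesis by (subst emeasure_density) (auto intro: nn_integral_null_set)
  qed
  also have "emeasure ?M (\<Union>k. A k) \<le> (\<Sum>k. emeasure ?M (A k))"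
    by (rule emeasure_subadditive_countably) auto
  finally show ?thesis using fin by (simp add: order_le_less_trans)
qed

lemma cball_borel [measurable]: "cball (x::'a::euclidean_space) r \<in> sets borel"
  by simp

locale levy_kernel =
  fixes g :: "real ^ 'n \<Rightarrow> real" and s :: real
  assumes s0: "0 < s" and s1: "s < 1"
    and g_cont: "continuous_on (sphere 0 1) g"
    and g_pos: "\<And>z. z \<in> sphere 0 1 \<Longrightarrow> g z > 0"
    and g_even: "\<And>z. z \<in> sphere 0 1 \<Longrightarrow> g (- z) = g z"
begin

abbreviation "\<mu> \<equiv> levy_measure g s"

definition dens :: "real ^ 'n \<Rightarrow> real" where
  "dens z = g (z /\<^sub>R norm z) / norm z powr (real CARD('n) + 2 * s)"

lemma dens_0 [simp]: "dens 0 = 0"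
  by (simp add: dens_def)

lemma normalized_in_sphere: "z \<noteq> 0 \<Longrightarrow> z /\<^sub>R norm z \<in> sphere 0 1"
  by simp

lemma dens_nonneg: "0 \<le> dens z"
  using g_pos[OF normalized_in_sphere, of z] by (cases "z = 0") (auto simp: dens_def less_imp_le)

lemma dens_even: "dens (- z) = dens z"
  using g_even[OF normalized_in_sphere, of z] by (cases "z = 0") (auto simp: dens_def)

lemma dens_measurable [measurable]: "dens \<in> borel_measurable borel"
proof (rule borel_measurable_continuous_off_zero)
  have "(\<lambda>z. z /\<^sub>R norm z) ` (- {0}) \<subseteq> sphere (0::real^'n) 1"
    by (intro image_subsetI normalized_in_sphere) auto
  then have "continuous_on (- {0}) (\<lambda>z. g (z /\<^sub>R norm z))"
    by (intro continuous_on_compose2[OF g_cont] continuous_intros) auto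
  then show "continuous_on (- {0}) dens"
    unfolding dens_def by (intro continuous_intros) auto
qed simp

lemma levy_measure_dens: "\<mu> = density lborel (\<lambda>z. ennreal (dens z))"
  by (simp add: levy_measure_def dens_def)

lemma sets_levy [measurable_cong, simp]: "sets \<mu> = sets borel"
  by (simp add: levy_measure_dens)

lemma measurable_levy: "f \<in> borel_measurable \<mu> \<longleftrightarrow> f \<in> borel_measurable borel"
  by (rule eqset_imp_iff[OF measurable_cong_sets[OF sets_levy refl]])

lemma space_levy [simp]: "space \<mu> = UNIV"
  by (simp add: levy_measure_dens)

lemma sphere_bounds: obtains G G' where "0 < G'" "\<And>z. z \<in> sphere 0 1 \<Longrightarrow> g z \<le> G" "0 \<le> G" "\<And>z. z \<in> sphere 0 1 \<Longrightarrow> G' \<le> g z"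
proof -
  have "axis undefined 1 \<in> sphere (0 :: real^'n) 1" by (simp add: norm_axis_1)
  then have ne: "sphere (0::real^'n) 1 \<noteq> {}" by blast
  obtain x where x: "x \<in> sphere 0 1" "\<And>y. y \<in> sphere 0 1 \<Longrightarrow> g y \<le> g x"
    using continuous_attains_sup[OF compact_sphere ne g_cont] by blast
  obtain y where y: "y \<in> sphere 0 1" "\<And>z. z \<in> sphere 0 1 \<Longrightarrow> g y \<le> g z"
    using continuous_attains_inf[OF compact_sphere ne g_cont] by blast
  show ?thesis by (rule that[of "g y" "g x"]) (use x y g_pos[OF x(1)] g_pos[OF y(1)] in auto)
qed

lemma dens_upper: obtains G where "0 \<le> G" "\<And>z r. 0 < r \<Longrightarrow> r \<le> norm z \<Longrightarrow> dens z \<le> G / r powr (real CARD('n) + 2 * s)"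
proof -
  obtain G' G where G: "0 < G'" "\<And>z. z \<in> sphere 0 1 \<Longrightarrow> g z \<le> G" "0 \<le> G" "\<And>z. z \<in> sphere 0 1 \<Longrightarrow> G' \<le> g z"
    by (rule sphere_bounds) (rule that)
  show ?thesis
  proof (rule that[OF G(3)])
    fix z :: "real ^ 'n" and r :: real assume r: "0 < r" "r \<le> norm z"
    then have z: "z \<noteq> 0" by auto
    show "dens z \<le> G / r powr (real CARD('n) + 2 * s)"
      unfolding dens_def using r s0 G(2)[OF normalized_in_sphere[OF z]] G(3)
      by (intro frac_le powr_mono2) auto
  qed
qed

text \<open>
  Dyadic shells going outwards: the mass of the \<open>k\<close>-th one is of order \<open>2 powr (- 2 * s * k)\<close>, which is
  summable because \<open>s > 0\<close>.
\<close>
lemma emeasure_levy_tail: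
  assumes r: "0 < r"
  shows "emeasure \<mu> {z. r < norm z} < \<infinity>"
proof -
  define a where "a = real CARD('n) + 2 * s"
  obtain G where G: "0 \<le> G" "\<And>z r. 0 < r \<Longrightarrow> r \<le> norm z \<Longrightarrow> dens z \<le> G / r powr a"
    unfolding a_def by (rule dens_upper) blast
  define A where "A k = {z :: real ^ 'n. 2 ^ k * r < norm z \<and> norm z \<le> 2 ^ Suc k * r}" for k
  show ?thesis unfolding levy_measure_dens
  proof (rule emeasure_density_shells_finite[where A = A and \<rho> = "\<lambda>k. 2 ^ Suc k * r" and c = "\<lambda>k. G / (2 ^ k * r) powr a"
       and C = "G * 2 ^ CARD('n) / r powr (2 * s)" and q = "2 powr (- 2 * s)"])
    show "A k \<in> sets borel" for k unfolding A_def by measurable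
    show "dens z \<le> G / (2 ^ k * r) powr a" if "z \<in> A k" for k z
      using that r by (intro G(2)) (auto simp: A_def)
    show "G / (2 ^ k * r) powr a * (2 ^ Suc k * r) ^ DIM(real ^ 'n) \<le> G * 2 ^ CARD('n) / r powr (2 * s) * (2 powr (- 2 * s)) ^ k" for k
    proof -
      define R where "R = 2 ^ k * r"
      have R: "R > 0" using r by (simp add: R_def)
      have pa: "R powr a = R ^ CARD('n) * R powr (2 * s)" using R by (simp add: a_def powr_add powr_realpow)
      have "R powr (2 * s) * (2 powr (- 2 * s)) ^ k = r powr (2 * s)"
      proof -
        have "R powr (2 * s) = (2 powr real k) powr (2 * s) * r powr (2 * s)"
          using r by (simp add: R_def powr_mult powr_realpow)
        also have "(2 powr real k) powr (2 * s) = 2 powr (2 * s * real k)" by (simp add: powr_powr mult_ac)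
        finally have "R powr (2 * s) = 2 powr (2 * s * real k) * r powr (2 * s)" .
        moreover have "(2 powr (- 2 * s)) ^ k = 2 powr (- (2 * s * real k))"
          by (subst powr_realpow[symmetric]) (simp_all add: powr_powr)
        ultimately show ?thesis by (simp add: powr_minus)
      qed
      then have eq: "1 / R powr (2 * s) = (2 powr (- 2 * s)) ^ k / r powr (2 * s)"
        using R r by (simp add: field_simps)
      have "G / R powr a * (2 * R) ^ CARD('n) = G * 2 ^ CARD('n) * (1 / R powr (2 * s))"
        unfolding pa using R by (simp add: power_mult_distrib)
      also have "\<dots> = G * 2 ^ CARD('n) / r powr (2 * s) * (2 powr (- 2 * s)) ^ k" unfolding eq by simp
      finally show ?thesis by (simp add: R_def mult.assoc)
    qed
    show "{z. r < norm z} \<subseteq> {0} \<union> (\<Union>k. A k)"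
    proof
      fix z :: "real ^ 'n" assume z: "z \<in> {z. r < norm z}"
      obtain n where n: "norm z / r < 2 ^ n" using real_arch_pow[of 2 "norm z / r"] by auto
      define m where "m = (LEAST n. norm z \<le> 2 ^ n * r)"
      have ex: "norm z \<le> 2 ^ n * r" using n r by (simp add: field_simps)
      have m: "norm z \<le> 2 ^ m * r" unfolding m_def by (rule LeastI[of "\<lambda>n. norm z \<le> 2 ^ n * r", OF ex])
      obtain k where k: "m = Suc k" using m z by (cases m) auto
      have "\<not> norm z \<le> 2 ^ k * r" using not_less_Least[of k "\<lambda>n. norm z \<le> 2 ^ n * r"] k unfolding m_def by simp
      then have "z \<in> A k" using m k by (simp add: A_def)
      then show "z \<in> {0} \<union> (\<Union>k. A k)" by blast
    qed
    show "2 powr (- 2 * s) < (1::real)" using s0 by (simp add: powr_less_one)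
  qed (use r G dens_nonneg s0 in \<open>auto simp: A_def\<close>)
qed

text \<open>
  Dyadic shells going inwards: the contribution of the \<open>k\<close>-th one is of order
  \<open>2 powr (- (2 - 2 * s) * k)\<close>, which is summable because \<open>s < 1\<close>.
\<close>
lemma second_moment_finite:
  assumes r: "0 < r"
  shows "integrable \<mu> (\<lambda>z. indicator (cball 0 r) z * (norm z)\<^sup>2)"
proof -
  define a where "a = real CARD('n) + 2 * s"
  obtain G where G: "0 \<le> G" "\<And>z r. 0 < r \<Longrightarrow> r \<le> norm z \<Longrightarrow> dens z \<le> G / r powr a"
    unfolding a_def by (rule dens_upper) blast
  define A where "A k = {z :: real ^ 'n. r / 2 ^ Suc k < norm z \<and> norm z \<le> r / 2 ^ k}" for k
  have "emeasure (density lborel (\<lambda>z. ennreal (dens z * (norm z)\<^sup>2))) (cball 0 r) < \<infinity>"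
  proof (rule emeasure_density_shells_finite[where A = A and \<rho> = "\<lambda>k. r / 2 ^ k" and c = "\<lambda>k. G / (r / 2 ^ Suc k) powr a * (r / 2 ^ k)\<^sup>2"
       and C = "G * 2 powr a * r powr (2 - 2 * s)" and q = "2 powr (- (2 - 2 * s))"])
    show "A k \<in> sets borel" for k unfolding A_def by measurable
    show "dens z * (norm z)\<^sup>2 \<le> G / (r / 2 ^ Suc k) powr a * (r / 2 ^ k)\<^sup>2" if "z \<in> A k" for k z
      using that r G(1) by (intro mult_mono G(2) power_mono) (auto simp: A_def less_imp_le)
    show "G / (r / 2 ^ Suc k) powr a * (r / 2 ^ k)\<^sup>2 * (r / 2 ^ k) ^ DIM(real ^ 'n) \<le>
       G * 2 powr a * r powr (2 - 2 * s) * (2 powr (- (2 - 2 * s))) ^ k" for k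
    proof -
      define R where "R = r / 2 ^ k"
      have R: "R > 0" using r by (simp add: R_def)
      have "R\<^sup>2 * R ^ CARD('n) = R powr (2 - 2 * s) * R powr a"
      proof -
        have "R powr (2 - 2 * s) * R powr a = R powr real (2 + CARD('n))"
          by (simp only: powr_add[symmetric] a_def) (simp add: algebra_simps)
        also have "\<dots> = R ^ (2 + CARD('n))" by (rule powr_realpow[OF R])
        finally show ?thesis by (simp add: power_add power2_eq_square)
      qed
      then have eq: "G / (R / 2) powr a * R\<^sup>2 * R ^ CARD('n) = G * 2 powr a * R powr (2 - 2 * s)"
        using R by (simp add: powr_divide mult.assoc)
      have "R powr (2 - 2 * s) = r powr (2 - 2 * s) * (2 powr (- (2 - 2 * s))) ^ k"
      proof -
        have "R = r * 2 powr (- real k)" by (simp add: R_def powr_minus powr_realpow field_simps)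
        then have "R powr (2 - 2 * s) = r powr (2 - 2 * s) * (2 powr (- real k)) powr (2 - 2 * s)"
          using r by (simp add: powr_mult)
        also have "(2 powr (- real k)) powr (2 - 2 * s) = (2 powr (- (2 - 2 * s))) powr real k"
          by (simp add: powr_powr algebra_simps)
        also have "\<dots> = (2 powr (- (2 - 2 * s))) ^ k" by (rule powr_realpow) simp
        finally show ?thesis .
      qed
      then have "G / (R / 2) powr a * R\<^sup>2 * R ^ CARD('n) = G * 2 powr a * r powr (2 - 2 * s) * (2 powr (- (2 - 2 * s))) ^ k"
        unfolding eq by (simp only: mult.assoc)
      moreover have "r / 2 ^ Suc k = R / 2" by (simp add: R_def)
      ultimately show ?thesis by (simp add: R_def mult.commute[of 2])
    qed
    show "cball 0 r \<subseteq> {0} \<union> (\<Union>k. A k)"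
    proof
      fix z :: "real ^ 'n" assume z: "z \<in> cball 0 r"
      show "z \<in> {0} \<union> (\<Union>k. A k)"
      proof (cases "z = 0")
        case False
        obtain n where n: "r / norm z < 2 ^ n" using real_arch_pow[of 2 "r / norm z"] by auto
        define m where "m = (LEAST n. r / 2 ^ n < norm z)"
        have ex: "r / 2 ^ n < norm z" using n False by (simp add: field_simps)
        have m: "r / 2 ^ m < norm z" unfolding m_def by (rule LeastI[of "\<lambda>n. r / 2 ^ n < norm z", OF ex])
        obtain k where k: "m = Suc k" using m z by (cases m) auto
        have "\<not> r / 2 ^ k < norm z" using not_less_Least[of k "\<lambda>n. r / 2 ^ n < norm z"] k unfolding m_def by simp
        then have "z \<in> A k" using m k by (simp add: A_def)
        then show ?thesis by blast
      qed simp
    qed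
    show "2 powr (- (2 - 2 * s)) < (1::real)" using s1 by (simp add: powr_less_one)
  qed (use r G dens_nonneg s0 s1 in \<open>auto simp: A_def\<close>)
  also have "emeasure (density lborel (\<lambda>z. ennreal (dens z * (norm z)\<^sup>2))) (cball 0 r)
     = (\<integral>\<^sup>+z. ennreal (dens z * (norm z)\<^sup>2) * indicator (cball 0 r) z \<partial>lborel)"
    by (rule emeasure_density) auto
  also have "\<dots> = (\<integral>\<^sup>+z. ennreal (norm (indicator (cball 0 r) z * (norm z)\<^sup>2)) \<partial>\<mu>)"
    unfolding levy_measure_dens
    by (subst nn_integral_density) (auto intro!: nn_integral_cong simp: indicator_def ennreal_mult dens_nonneg)
  finally have fin: "(\<integral>\<^sup>+z. ennreal (norm (indicator (cball 0 r) z * (norm z)\<^sup>2)) \<partial>\<mu>) < \<infinity>" .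
  have "(\<lambda>z. indicator (cball 0 r) z * (norm z)\<^sup>2) \<in> borel_measurable \<mu>"
    unfolding measurable_levy by measurable
  then show ?thesis using fin by (rule integrableI_bounded)
qed

lemma lborel_reflect: "distr lborel borel uminus = (lborel :: 'a::euclidean_space measure)"
  using lborel_affine[of "-1" "0::'a"] by (simp add: density_1)

lemma levy_integral_reflect:
  fixes f :: "real ^ 'n \<Rightarrow> real"
  assumes [measurable]: "f \<in> borel_measurable borel"
  shows "(\<integral>z. f (- z) \<partial>\<mu>) = (\<integral>z. f z \<partial>\<mu>)"
proof -
  have "(\<integral>z. f z \<partial>\<mu>) = (\<integral>z. dens z * f z \<partial>lborel)"
    unfolding levy_measure_dens by (subst integral_real_density) (auto simp: dens_nonneg)
  also have "\<dots> = (\<integral>z. dens z * f z \<partial>distr lborel borel uminus)" by (simp only: lborel_reflect)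
  also have "\<dots> = (\<integral>z. dens (- z) * f (- z) \<partial>lborel)" by (subst integral_distr) auto
  also have "\<dots> = (\<integral>z. f (- z) \<partial>\<mu>)"
    unfolding levy_measure_dens by (subst integral_real_density) (auto simp: dens_nonneg dens_even)
  finally show ?thesis by simp
qed

lemma levy_integrable_reflect:
  fixes f :: "real ^ 'n \<Rightarrow> real"
  assumes "integrable \<mu> f"
  shows "integrable \<mu> (\<lambda>z. f (- z))"
proof -
  have [measurable]: "f \<in> borel_measurable borel" using borel_measurable_integrable[OF assms] by simp
  have "integrable lborel (\<lambda>z. dens z * f z)"
    using assms unfolding levy_measure_dens by (subst (asm) integrable_real_density) (auto simp: dens_nonneg)
  then have "integrable (distr lborel borel uminus) (\<lambda>z. dens z * f z)" by (simp only: lborel_reflect)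
  then have "integrable lborel (\<lambda>z. dens (- z) * f (- z))" by (subst (asm) integrable_distr_eq) auto
  then show ?thesis
    unfolding levy_measure_dens by (subst integrable_real_density) (auto simp: dens_nonneg dens_even)
qed

end

context levy_kernel
begin

definition tail :: "real \<Rightarrow> (real ^ 'n) measure" where
  "tail r = density \<mu> (indicator {z. r < norm z})"

definition tail_mass :: "real \<Rightarrow> real" where
  "tail_mass r = measure (tail r) UNIV"

definition small_moment :: "real \<Rightarrow> real" where
  "small_moment r = (\<integral>z. indicator (cball 0 r) z * (norm z)\<^sup>2 \<partial>\<mu>)"

lemma sets_tail [measurable_cong, simp]: "sets (tail r) = sets borel"
  by (simp add: tail_def)

lemma space_tail [simp]: "space (tail r) = UNIV"
  by (simp add: tail_def)

lemma jumps_measurable [measurable]: "{z :: real ^ 'n. r < norm z} \<in> sets borel"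
  by measurable

lemma finite_tail: "0 < r \<Longrightarrow> finite_measure (tail r)"
  using emeasure_levy_tail[of r]
  by (intro finite_measureI) (simp add: tail_def emeasure_density nn_integral_indicator)

lemma tail_mass_nonneg: "0 \<le> tail_mass r"
  by (simp add: tail_mass_def)

lemma small_moment_nonneg: "0 \<le> small_moment r"
  unfolding small_moment_def by (rule Bochner_Integration.integral_nonneg) (simp add: indicator_def)

lemma integrable_tail_bounded:
  fixes f :: "real ^ 'n \<Rightarrow> real"
  assumes "0 < r" "f \<in> borel_measurable borel" "\<And>z. \<bar>f z\<bar> \<le> B"
  shows "integrable (tail r) f"
proof -
  interpret finite_measure "tail r" using assms(1) by (rule finite_tail)
  show ?thesis by (rule integrable_const_bound[of _ B]) (use assms in auto)
qed

lemma tail_integral_eq: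
  fixes f :: "real ^ 'n \<Rightarrow> real"
  assumes [measurable]: "f \<in> borel_measurable borel"
  shows "(\<integral>z. f z \<partial>tail r) = (\<integral>z. indicator {z. r < norm z} z * f z \<partial>\<mu>)"
    "integrable (tail r) f \<longleftrightarrow> integrable \<mu> (\<lambda>z. indicator {z. r < norm z} z * f z)"
proof -
  have e: "tail r = density \<mu> (\<lambda>z. ennreal (indicator {z. r < norm z} z))"
    unfolding tail_def by (intro arg_cong2[where f = density] ext) (auto simp: indicator_def)
  show "(\<integral>z. f z \<partial>tail r) = (\<integral>z. indicator {z. r < norm z} z * f z \<partial>\<mu>)"
    unfolding e by (subst integral_real_density) auto
  show "integrable (tail r) f \<longleftrightarrow> integrable \<mu> (\<lambda>z. indicator {z. r < norm z} z * f z)"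
    unfolding e by (subst integrable_real_density) auto
qed

lemma levy_outer_tail:
  assumes "u \<in> borel_measurable borel"
  shows "levy_outer g s r u x = (\<integral>z. u (x + z) - u x \<partial>tail r)"
proof -
  note assms[measurable]
  show ?thesis
    unfolding levy_outer_def set_lebesgue_integral_def by (subst tail_integral_eq(1)) auto
qed

lemma tail_integral_mono:
  fixes f h :: "real ^ 'n \<Rightarrow> real"
  assumes "0 < r" "f \<in> borel_measurable borel" "h \<in> borel_measurable borel" "\<And>z. \<bar>f z\<bar> \<le> B" "\<And>z. \<bar>h z\<bar> \<le> B'" "\<And>z. f z \<le> h z"
  shows "(\<integral>z. f z \<partial>tail r) \<le> (\<integral>z. h z \<partial>tail r)"
  using assms by (intro integral_mono integrable_tail_bounded) auto

lemma tail_integral_abs_bound: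
  fixes f :: "real ^ 'n \<Rightarrow> real"
  assumes r: "0 < r" and f: "f \<in> borel_measurable borel" and b: "\<And>z. \<bar>f z\<bar> \<le> B"
  shows "\<bar>\<integral>z. f z \<partial>tail r\<bar> \<le> tail_mass r * B"
proof -
  have B: "0 \<le> B" using b[of 0] by linarith
  have "(\<integral>z. f z \<partial>tail r) \<le> (\<integral>z. B \<partial>tail r)"
    by (rule tail_integral_mono[OF r f _ b]) (use b B in \<open>auto intro: abs_le_D1\<close>)
  moreover have "(\<integral>z. - B \<partial>tail r) \<le> (\<integral>z. f z \<partial>tail r)"
    by (rule tail_integral_mono[OF r _ f _ b]) (use b B in \<open>auto simp: abs_le_iff minus_le_iff\<close>)
  ultimately show ?thesis by (simp add: tail_mass_def abs_le_iff)
qed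

lemma levy_dominated_small:
  fixes f :: "real ^ 'n \<Rightarrow> real"
  assumes r: "0 < r" and f: "f \<in> borel_measurable borel" and b: "\<And>z. norm z \<le> r \<Longrightarrow> \<bar>f z\<bar> \<le> B * (norm z)\<^sup>2"
  shows "integrable \<mu> (\<lambda>z. indicator (cball 0 r) z * f z)"
    "\<bar>\<integral>z. indicator (cball 0 r) z * f z \<partial>\<mu>\<bar> \<le> B * small_moment r"
proof -
  note f[measurable]
  have i: "integrable \<mu> (\<lambda>z. B * (indicator (cball 0 r) z * (norm z)\<^sup>2))"
    by (intro integrable_mult_right second_moment_finite r)
  have le: "\<bar>indicator (cball 0 r) z * f z\<bar> \<le> B * (indicator (cball 0 r) z * (norm z)\<^sup>2)" for z
    using b[of z] by (simp add: indicator_def)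
  show int: "integrable \<mu> (\<lambda>z. indicator (cball 0 r) z * f z)"
    by (rule Bochner_Integration.integrable_bound[OF i]) (use le in \<open>auto intro!: AE_I2 order_trans[OF _ abs_ge_self]\<close>)
  have "\<bar>\<integral>z. indicator (cball 0 r) z * f z \<partial>\<mu>\<bar> \<le> (\<integral>z. \<bar>indicator (cball 0 r) z * f z\<bar> \<partial>\<mu>)"
    using integral_norm_bound[of \<mu> "\<lambda>z. indicator (cball 0 r) z * f z"] by simp
  also have "\<dots> \<le> (\<integral>z. B * (indicator (cball 0 r) z * (norm z)\<^sup>2) \<partial>\<mu>)"
    by (intro integral_mono i integrable_abs int le)
  finally show "\<bar>\<integral>z. indicator (cball 0 r) z * f z \<partial>\<mu>\<bar> \<le> B * small_moment r"
    by (simp add: small_moment_def)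
qed

lemma small_moment_tendsto_0: "(\<lambda>n. small_moment (1 / real (Suc n))) \<longlonglongrightarrow> 0"
proof -
  have "(\<lambda>n. \<integral>z. indicator (cball 0 (1 / real (Suc n))) z * (norm z)\<^sup>2 \<partial>\<mu>) \<longlonglongrightarrow> (\<integral>z. 0 \<partial>\<mu>)"
  proof (rule integral_dominated_convergence[where w = "\<lambda>z. indicator (cball 0 1) z * (norm z)\<^sup>2"])
    show "AE z in \<mu>. (\<lambda>n. indicator (cball 0 (1 / real (Suc n))) z * (norm z)\<^sup>2) \<longlonglongrightarrow> (0::real)"
    proof (rule AE_I2)
      fix z :: "real ^ 'n"
      have le: "norm (indicator (cball 0 (1 / real (Suc n))) z * (norm z)\<^sup>2) \<le> (1 / real (Suc n))\<^sup>2" for n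
      proof (cases "norm z \<le> 1 / real (Suc n)")
        case True
        then have "(norm z)\<^sup>2 \<le> (1 / real (Suc n))\<^sup>2" by (intro power_mono) auto
        then show ?thesis using True by (simp del: of_nat_Suc)
      qed (simp del: of_nat_Suc)
      have "(\<lambda>n. (1 / real (Suc n))\<^sup>2) \<longlonglongrightarrow> 0\<^sup>2"
        by (intro tendsto_power LIMSEQ_Suc[OF lim_1_over_n])
      then have lim: "(\<lambda>n. (1 / real (Suc n))\<^sup>2) \<longlonglongrightarrow> 0" by (simp only: power_zero_numeral)
      show "(\<lambda>n. indicator (cball 0 (1 / real (Suc n))) z * (norm z)\<^sup>2) \<longlonglongrightarrow> (0::real)"
        by (rule Lim_null_comparison[OF always_eventually[OF allI[OF le]] lim])
    qed
    show "AE z in \<mu>. norm (indicator (cball 0 (1 / real (Suc n))) z * (norm z)\<^sup>2) \<le> indicator (cball 0 1) z * (norm z)\<^sup>2" for n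
    proof (rule AE_I2)
      fix z :: "real ^ 'n"
      have "1 / real (Suc n) \<le> 1" by simp
      then show "norm (indicator (cball 0 (1 / real (Suc n))) z * (norm z)\<^sup>2) \<le> indicator (cball 0 1) z * (norm z)\<^sup>2"
        using order_trans[of "norm z" "1 / real (Suc n)" 1]
        by (cases "norm z \<le> 1 / real (Suc n)") (simp_all del: of_nat_Suc add: indicator_def)
    qed
  qed (auto intro: second_moment_finite)
  then show ?thesis by (simp add: small_moment_def)
qed

text \<open>
  Some fixed ball, far from the origin and from \<open>d\<close>, is reached from both points by jumps longer
  than 1 with a density that is bounded below, and on that ball \<open>1 - u\<close> and \<open>u\<close> add up to 1. This is
  how long jumps keep the oscillation of solutions bounded.
\<close>
lemma tail_overlap:
  assumes R: "0 \<le> R"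
  obtains c where "0 < c" "\<And>d (u :: real ^ 'n \<Rightarrow> real). norm d \<le> R \<Longrightarrow> u \<in> borel_measurable borel \<Longrightarrow> (\<And>x. 0 \<le> u x) \<Longrightarrow> (\<And>x. u x \<le> 1) \<Longrightarrow>
     c \<le> (\<integral>z. 1 - u z \<partial>tail 1) + (\<integral>z. u (d + z) \<partial>tail 1)"
proof -
  obtain G' G where G: "0 < G'" "\<And>z. z \<in> sphere 0 1 \<Longrightarrow> g z \<le> G" "0 \<le> G" "\<And>z. z \<in> sphere 0 1 \<Longrightarrow> G' \<le> g z"
    by (rule sphere_bounds) (rule that)
  define a where "a = real CARD('n) + 2 * s"
  define k where "k = G' / (2 * R + 4) powr a"
  define y :: "real ^ 'n" where "y = (R + 3) *\<^sub>R axis undefined 1"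
  have ny: "norm y = R + 3" using R by (simp add: y_def norm_axis_1)
  have k: "k > 0" using G(1) R by (simp add: k_def)
  \<comment> \<open>A jump that ends in the ball has length between \<open>2\<close> and \<open>2 * R + 4\<close>, where the density is at least \<open>k\<close>.\<close>
  have low: "k * indicator (cball y 1) (z + d) \<le> indicator {z. 1 < norm z} z * dens z" if "norm d \<le> R" for d z
  proof (cases "z + d \<in> cball y 1")
    case True
    then have t: "norm (z + d - y) \<le> 1" by (simp add: dist_norm norm_minus_commute)
    have "norm y \<le> norm (z + d - y) + norm z + norm d"
      using norm_triangle_ineq4[of "z + d" "z + d - y"] norm_triangle_ineq[of z d] by simp
    then have z1: "2 \<le> norm z" using t that ny by simp
    have "norm z \<le> norm (z + d - y) + norm y + norm d"
      using norm_triangle_ineq[of "z + d - y" "y - d"] norm_triangle_ineq4[of y d] by simp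
    then have z2: "norm z \<le> 2 * R + 4" using t that ny by simp
    have z0: "z \<noteq> 0" using z1 by auto
    have "k \<le> dens z" unfolding k_def dens_def a_def using z0 z1 z2 s0 R G(1) G(4)[OF normalized_in_sphere[OF z0]]
      by (intro frac_le powr_mono2) auto
    then show ?thesis using True z1 by simp
  qed (use dens_nonneg[of z] in \<open>simp add: indicator_def\<close>)
  define c where "c = k * measure lborel (cball y 1)"
  show ?thesis
  proof (rule that[of c])
    show "c > 0" using k by (simp add: c_def content_cball_pos)
    fix d :: "real ^ 'n" and u :: "real ^ 'n \<Rightarrow> real" assume d: "norm d \<le> R" and u: "u \<in> borel_measurable borel" "\<And>x. 0 \<le> u x" "\<And>x. u x \<le> 1"
    note u(1)[measurable]
    have tail_lb: "(\<integral>z. k * (indicator (cball y 1) z * v z) \<partial>lborel) \<le> (\<integral>z. v (e + z) \<partial>tail 1)"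
      if v[measurable]: "v \<in> borel_measurable borel" and v01: "\<And>z. 0 \<le> v z" "\<And>z. v z \<le> 1" and e: "norm e \<le> R" for v :: "real ^ 'n \<Rightarrow> real" and e
    proof -
      have "integrable (tail 1) (\<lambda>z. v (e + z))"
        by (rule integrable_tail_bounded[where B = 1]) (use v01 in \<open>auto simp: abs_le_iff intro: order_trans[of _ 0]\<close>)
      then have "integrable \<mu> (\<lambda>z. indicator {z. 1 < norm z} z * v (e + z))"
        by (subst (asm) tail_integral_eq(2)) auto
      then have i: "integrable lborel (\<lambda>z. dens z * (indicator {z. 1 < norm z} z * v (e + z)))"
        unfolding levy_measure_dens by (subst (asm) integrable_real_density) (auto simp: dens_nonneg)
      have i2: "integrable lborel (\<lambda>z. k * (indicator (cball y 1) (z + e) * v (z + e)))"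
      proof (rule Bochner_Integration.integrable_bound[OF i])
        show "AE z in lborel. norm (k * (indicator (cball y 1) (z + e) * v (z + e))) \<le> norm (dens z * (indicator {z. 1 < norm z} z * v (e + z)))"
        proof (rule AE_I2)
          fix z show "norm (k * (indicator (cball y 1) (z + e) * v (z + e))) \<le> norm (dens z * (indicator {z. 1 < norm z} z * v (e + z)))"
            using mult_right_mono[OF low[OF e, of z] v01(1)[of "z + e"]] k v01(1)[of "z + e"] dens_nonneg[of z]
            by (simp add: mult_ac add.commute abs_mult)
        qed
      qed measurable
      have "(\<integral>z. k * (indicator (cball y 1) z * v z) \<partial>lborel) = (\<integral>z. k * (indicator (cball y 1) (z + e) * v (z + e)) \<partial>lborel)"
        by (rule lborel_integral_translate[symmetric])
      also have "\<dots> \<le> (\<integral>z. dens z * (indicator {z. 1 < norm z} z * v (e + z)) \<partial>lborel)"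
      proof (rule integral_mono[OF i2 i])
        fix z show "k * (indicator (cball y 1) (z + e) * v (z + e)) \<le> dens z * (indicator {z. 1 < norm z} z * v (e + z))"
          using mult_right_mono[OF low[OF e, of z] v01(1)[of "z + e"]] by (simp add: mult_ac add.commute)
      qed
      also have "\<dots> = (\<integral>z. v (e + z) \<partial>tail 1)"
        unfolding levy_measure_dens by (subst tail_integral_eq(1), measurable)
           (unfold levy_measure_dens, subst integral_real_density, auto simp: dens_nonneg)
      finally show ?thesis .
    qed
    have int: "integrable lborel (\<lambda>z. k * (indicator (cball y 1) z * v z))"
      if [measurable]: "v \<in> borel_measurable borel" and v01: "\<And>z. 0 \<le> v z" "\<And>z. v z \<le> 1" for v :: "real ^ 'n \<Rightarrow> real"
      by (rule integrable_bounded_support(1)[of _ k y 1]) (use v01 k in \<open>auto simp: indicator_def abs_mult mult_left_le\<close>)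
    have "c = (\<integral>z. k * (indicator (cball y 1) z * (1 - u z)) + k * (indicator (cball y 1) z * u z) \<partial>lborel)"
      by (simp add: c_def algebra_simps)
    also have "\<dots> = (\<integral>z. k * (indicator (cball y 1) z * (1 - u z)) \<partial>lborel) + (\<integral>z. k * (indicator (cball y 1) z * u z) \<partial>lborel)"
      by (intro Bochner_Integration.integral_add int) (use u in auto)
    also have "\<dots> \<le> (\<integral>z. 1 - u (0 + z) \<partial>tail 1) + (\<integral>z. u (d + z) \<partial>tail 1)"
      by (intro add_mono tail_lb[of "\<lambda>z. 1 - u z"] tail_lb[of u] d) (use u R in auto)
    finally show "c \<le> (\<integral>z. 1 - u z \<partial>tail 1) + (\<integral>z. u (d + z) \<partial>tail 1)" by simp
  qed
qed

end

section \<open>The nonlocal operator on smooth functions\<close>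

definition space_gradient :: "((real \<times> (real ^ 'n)) \<Rightarrow>\<^sub>L real) \<Rightarrow> real ^ 'n" where
  "space_gradient A = (\<Sum>b\<in>Basis. A (0, b) *\<^sub>R b)"

lemma space_gradient_inner: "space_gradient A \<bullet> v = A (0, v)"
proof -
  have "A (0, v) = A (\<Sum>b\<in>Basis. (v \<bullet> b) *\<^sub>R (0, b))"
    by (rule arg_cong[where f = "blinfun_apply A"])
       (simp add: prod_eq_iff fst_sum snd_sum euclidean_representation)
  also have "\<dots> = (\<Sum>b\<in>Basis. (v \<bullet> b) * A (0, b))" by (simp only: blinfun.sum_right blinfun.scaleR_right real_scaleR_def)
  also have "\<dots> = (\<Sum>b\<in>Basis. A (0, b) * (b \<bullet> v))"
    by (rule sum.cong) (simp_all only: inner_commute mult.commute)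
  also have "\<dots> = space_gradient A \<bullet> v" by (simp add: space_gradient_def inner_sum_left)
  finally show ?thesis ..
qed

lemma GDERIV_unique:
  assumes "GDERIV f x :> D" "GDERIV f x :> E"
  shows "D = E"
proof -
  have "(\<lambda>h. h \<bullet> D) = (\<lambda>h. h \<bullet> E)"
    using assms has_derivative_unique unfolding gderiv_def by blast
  then have "(D - E) \<bullet> D = (D - E) \<bullet> E" by meson
  then have "(D - E) \<bullet> (D - E) = 0" by (simp only: inner_diff_right[of _ D E])
  then show ?thesis by simp
qed

lemma has_derivative_slices:
  fixes \<phi> :: "real \<times> (real ^ 'n) \<Rightarrow> real"
  assumes "(\<phi> has_derivative blinfun_apply A) (at (t, x))"
  shows "gradient (\<lambda>x. \<phi> (t, x)) x = space_gradient A" "deriv (\<lambda>t. \<phi> (t, x)) t = A (1, 0)"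
    "GDERIV (\<lambda>x. \<phi> (t, x)) x :> space_gradient A" "((\<lambda>t. \<phi> (t, x)) has_real_derivative A (1, 0)) (at t)"
proof -
  have "((\<lambda>x. \<phi> (t, x)) has_derivative (\<lambda>v. A (0, v))) (at x)"
    by (rule has_derivative_compose[of "\<lambda>x. (t, x)", OF _ assms, unfolded o_def])
       (intro has_derivative_Pair has_derivative_const has_derivative_ident)
  then show G: "GDERIV (\<lambda>x. \<phi> (t, x)) x :> space_gradient A"
    unfolding gderiv_def by (simp add: space_gradient_inner inner_commute[of _ "space_gradient A"])
  then show "gradient (\<lambda>x. \<phi> (t, x)) x = space_gradient A"
    unfolding gradient_def using GDERIV_unique by blast
  have d: "((\<lambda>t. \<phi> (t, x)) has_derivative (\<lambda>h. A (h, 0))) (at t)"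
    by (rule has_derivative_compose[of "\<lambda>t. (t, x)", OF _ assms, unfolded o_def])
       (intro has_derivative_Pair has_derivative_const has_derivative_ident)
  have eq: "(\<lambda>h. A (h, 0)) = (*) (A (1, 0))"
  proof
    fix h show "A (h, 0) = A (1, 0) * h"
      using blinfun.scaleR_right[of A h "(1, 0)"] by (simp add: mult.commute)
  qed
  show D: "((\<lambda>t. \<phi> (t, x)) has_real_derivative A (1, 0)) (at t)"
    unfolding has_field_derivative_def using d by (simp only: eq)
  then show "deriv (\<lambda>t. \<phi> (t, x)) t = A (1, 0)" by (rule DERIV_imp_deriv)
qed

context levy_kernel
begin

text \<open>
  Symmetrising removes the gradient, and with it the choice of a radius at which the integral is
  split; evenness of the kernel is what makes both descriptions agree.
\<close>
definition levy_op :: "(real ^ 'n \<Rightarrow> real) \<Rightarrow> real ^ 'n \<Rightarrow> real" where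
  "levy_op \<phi> y = (\<integral>z. \<phi> (y + z) + \<phi> (y - z) - 2 * \<phi> y \<partial>\<mu>) / 2"

text \<open>
  Evenness of the kernel cancels the gradient term, so the splitting has the same value at every
  radius; truncating at radius \<open>r\<close> then costs no more than the second moment of the jumps below \<open>r\<close>.
\<close>
lemma levy_op_split:
  fixes \<phi> :: "real ^ 'n \<Rightarrow> real"
  assumes r: "0 < r" and m: "\<phi> \<in> borel_measurable borel" and b: "\<And>x. \<bar>\<phi> x\<bar> \<le> A"
    and T: "\<And>z. norm z \<le> r \<Longrightarrow> \<bar>\<phi> (y + z) - \<phi> y - G \<bullet> z\<bar> \<le> B * (norm z)\<^sup>2"
  shows "(\<integral>z. indicator (cball 0 r) z * (\<phi> (y + z) - \<phi> y - G \<bullet> z) \<partial>\<mu>) + (\<integral>z. \<phi> (y + z) - \<phi> y \<partial>tail r) = levy_op \<phi> y"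
    "integrable \<mu> (\<lambda>z. indicator (cball 0 r) z * (\<phi> (y + z) - \<phi> y - G \<bullet> z))"
    "integrable (tail r) (\<lambda>z. \<phi> (y + z) - \<phi> y)"
    "\<bar>(\<integral>z. \<phi> (y + z) - \<phi> y \<partial>tail r) - levy_op \<phi> y\<bar> \<le> B * small_moment r"
proof -
  note m[measurable]
  have [measurable]: "(\<lambda>z. \<phi> (y + z) - \<phi> y - G \<bullet> z) \<in> borel_measurable borel" by measurable
  have i1: "integrable \<mu> (\<lambda>z. indicator (cball 0 r) z * (\<phi> (y + z) - \<phi> y - G \<bullet> z))"
    and bd: "\<bar>\<integral>z. indicator (cball 0 r) z * (\<phi> (y + z) - \<phi> y - G \<bullet> z) \<partial>\<mu>\<bar> \<le> B * small_moment r"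
    using levy_dominated_small[OF r _ T] by auto
  show "integrable \<mu> (\<lambda>z. indicator (cball 0 r) z * (\<phi> (y + z) - \<phi> y - G \<bullet> z))" by (rule i1)
  show i2: "integrable (tail r) (\<lambda>z. \<phi> (y + z) - \<phi> y)"
  proof (rule integrable_tail_bounded[OF r, where B = "2 * A"])
    show "\<bar>\<phi> (y + z) - \<phi> y\<bar> \<le> 2 * A" for z using b[of "y + z"] b[of y] by linarith
  qed measurable
  then have i3: "integrable \<mu> (\<lambda>z. indicator {z. r < norm z} z * (\<phi> (y + z) - \<phi> y))"
    by (subst (asm) tail_integral_eq(2)) auto
  define h where "h z = indicator (cball 0 r) z * (\<phi> (y + z) - \<phi> y - G \<bullet> z) + indicator {z. r < norm z} z * (\<phi> (y + z) - \<phi> y)" for z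
  have [measurable]: "h \<in> borel_measurable borel" unfolding h_def by measurable
  have ih: "integrable \<mu> h" unfolding h_def by (intro Bochner_Integration.integrable_add i1 i3)
  have hh: "h z + h (- z) = \<phi> (y + z) + \<phi> (y - z) - 2 * \<phi> y" for z
    by (cases "norm z \<le> r") (auto simp: h_def indicator_def)
  have "2 * levy_op \<phi> y = (\<integral>z. h z + h (- z) \<partial>\<mu>)" by (simp add: levy_op_def hh)
  also have "\<dots> = (\<integral>z. h z \<partial>\<mu>) + (\<integral>z. h (- z) \<partial>\<mu>)"
    by (rule Bochner_Integration.integral_add[OF ih levy_integrable_reflect[OF ih]])
  also have "\<dots> = 2 * (\<integral>z. h z \<partial>\<mu>)" by (subst levy_integral_reflect) auto
  also have "(\<integral>z. h z \<partial>\<mu>) = (\<integral>z. indicator (cball 0 r) z * (\<phi> (y + z) - \<phi> y - G \<bullet> z) \<partial>\<mu>) + (\<integral>z. \<phi> (y + z) - \<phi> y \<partial>tail r)"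
    unfolding h_def by (subst Bochner_Integration.integral_add[OF i1 i3], subst tail_integral_eq(1)) auto
  finally show eq: "(\<integral>z. indicator (cball 0 r) z * (\<phi> (y + z) - \<phi> y - G \<bullet> z) \<partial>\<mu>) + (\<integral>z. \<phi> (y + z) - \<phi> y \<partial>tail r) = levy_op \<phi> y"
    by simp
  show "\<bar>(\<integral>z. \<phi> (y + z) - \<phi> y \<partial>tail r) - levy_op \<phi> y\<bar> \<le> B * small_moment r"
    using bd eq by linarith
qed

lemma levy_inner_eq: "levy_inner g s r \<phi> x = (\<integral>z. indicator (cball 0 r) z * (\<phi> (x + z) - \<phi> x - gradient \<phi> x \<bullet> z) \<partial>\<mu>)"
  unfolding levy_inner_def set_lebesgue_integral_def
  by (rule arg_cong[where f = "integral\<^sup>L \<mu>"]) (auto simp: indicator_def)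

lemma levy_op_uminus: "levy_op (\<lambda>x. - \<phi> x) y = - levy_op \<phi> y"
proof -
  have "(\<integral>z. - \<phi> (y + z) + - \<phi> (y - z) - 2 * - \<phi> y \<partial>\<mu>) = - (\<integral>z. \<phi> (y + z) + \<phi> (y - z) - 2 * \<phi> y \<partial>\<mu>)"
    by (subst Bochner_Integration.integral_minus[symmetric]) (rule arg_cong[where f = "integral\<^sup>L \<mu>"], auto)
  then show ?thesis unfolding levy_op_def by (simp only:)
qed

text \<open>
  The contributions of \<open>z\<close> and \<open>- z\<close> cancel because the kernel is even.
\<close>
lemma annulus_linear_integral:
  assumes "0 < a"
  shows "integrable \<mu> (\<lambda>z. indicator {z. a < norm z \<and> norm z \<le> b} z * (G \<bullet> z))"
    "(\<integral>z. indicator {z. a < norm z \<and> norm z \<le> b} z * (G \<bullet> z) \<partial>\<mu>) = 0"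
proof -
  let ?f = "\<lambda>z. indicator {z. a < norm z \<and> norm z \<le> b} z * (G \<bullet> z)"
  have [measurable]: "?f \<in> borel_measurable borel" by measurable
  have "integrable (tail a) ?f"
  proof (rule integrable_tail_bounded[OF assms, where B = "norm G * \<bar>b\<bar>"])
    fix z
    have "\<bar>G \<bullet> z\<bar> \<le> norm G * norm z" by (rule Cauchy_Schwarz_ineq2)
    also have "\<dots> \<le> norm G * \<bar>b\<bar>" if "norm z \<le> b" using that by (intro mult_left_mono) auto
    finally show "\<bar>indicator {z. a < norm z \<and> norm z \<le> b} z * (G \<bullet> z)\<bar> \<le> norm G * \<bar>b\<bar>"
      by (auto simp: indicator_def)
  qed measurable
  then have "integrable \<mu> (\<lambda>z. indicator {z. a < norm z} z * ?f z)" by (subst (asm) tail_integral_eq(2)) auto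
  also have "(\<lambda>z. indicator {z. a < norm z} z * ?f z) = ?f" by (auto simp: indicator_def)
  finally show "integrable \<mu> ?f" .
  have "(\<integral>z. ?f z \<partial>\<mu>) = (\<integral>z. ?f (- z) \<partial>\<mu>)" by (rule levy_integral_reflect[symmetric]) measurable
  also have "\<dots> = (\<integral>z. - ?f z \<partial>\<mu>)" by (rule arg_cong[where f = "integral\<^sup>L \<mu>"]) (auto simp: indicator_def)
  finally show "(\<integral>z. ?f z \<partial>\<mu>) = 0" by simp
qed

text \<open>
  A barrier confines maxima to a bounded set at a cost that vanishes as \<open>R\<close> grows. The upper bounds
  on its increments follow from convexity of the exponential.
\<close>
definition barrier :: "real \<Rightarrow> real ^ 'n \<Rightarrow> real" where
  "barrier R y = 1 - exp (- ((norm y)\<^sup>2 / R\<^sup>2))"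

definition barrier_gradient :: "real \<Rightarrow> real ^ 'n \<Rightarrow> real ^ 'n" where
  "barrier_gradient R y = (2 * exp (- ((norm y)\<^sup>2 / R\<^sup>2)) / R\<^sup>2) *\<^sub>R y"

lemma barrier_bounds: "0 \<le> barrier R y" "barrier R y \<le> 1" "barrier R 0 = 0"
  by (auto simp: barrier_def)

lemma barrier_continuous: "continuous_on UNIV (barrier R)"
  unfolding barrier_def by (cases "R = 0") (auto intro!: continuous_intros)

lemma barrier_increment:
  assumes "R > 0"
  shows "barrier R (y + z) - barrier R y - barrier_gradient R y \<bullet> z \<le> (norm z)\<^sup>2 / R\<^sup>2"
proof -
  define a where "a = (norm y)\<^sup>2 / R\<^sup>2"
  define b where "b = (norm (y + z))\<^sup>2 / R\<^sup>2"
  have ba: "b - a = (2 * (y \<bullet> z) + (norm z)\<^sup>2) / R\<^sup>2"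
    by (simp add: a_def b_def power2_norm_eq_inner inner_add diff_divide_distrib[symmetric] inner_commute)
  have "exp (- a) * (1 + (a - b)) \<le> exp (- a) * exp (a - b)"
    by (intro mult_left_mono exp_ge_add_one_self) auto
  also have "\<dots> = exp (- b)" by (simp add: exp_add[symmetric])
  finally have "exp (- a) - exp (- b) \<le> exp (- a) * (b - a)" by (simp add: algebra_simps)
  also have "\<dots> = barrier_gradient R y \<bullet> z + exp (- a) * ((norm z)\<^sup>2 / R\<^sup>2)"
    by (simp add: ba barrier_gradient_def a_def[symmetric] field_simps add_divide_distrib)
  also have "exp (- a) * ((norm z)\<^sup>2 / R\<^sup>2) \<le> 1 * ((norm z)\<^sup>2 / R\<^sup>2)"
    by (intro mult_right_mono) (auto simp: a_def)
  finally show ?thesis by (simp add: barrier_def a_def b_def)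
qed

lemma barrier_gradient_bound:
  assumes "R > 0"
  shows "norm (barrier_gradient R y) \<le> 2 / R"
proof -
  define t where "t = norm y / R"
  have t: "t \<ge> 0" using assms by (simp add: t_def)
  have "t \<le> 1 + t\<^sup>2" using zero_le_power2[of "t - 1"] t by (simp add: power2_eq_square algebra_simps)
  also have "\<dots> \<le> exp (t\<^sup>2)" by (rule exp_ge_add_one_self)
  finally have "t * exp (- t\<^sup>2) \<le> 1" by (simp add: exp_minus field_simps)
  moreover have "norm (barrier_gradient R y) = (2 / R) * (t * exp (- t\<^sup>2))"
    using assms by (simp add: barrier_gradient_def t_def power_divide power2_eq_square[of R])
  ultimately show ?thesis using assms mult_left_mono[of "t * exp (- t\<^sup>2)" 1 "2/R"] by simp
qed

lemma barrier_GDERIV: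
  assumes "R > 0"
  shows "GDERIV (barrier R) y :> barrier_gradient R y"
proof -
  have d1: "((\<lambda>y. y \<bullet> y) has_derivative (\<lambda>v. 2 * (y \<bullet> v))) (at y)"
    by (rule has_derivative_eq_rhs[OF has_derivative_inner[OF has_derivative_ident has_derivative_ident]])
       (auto simp: inner_commute)
  have d2: "((\<lambda>u. 1 - exp (- (u / R\<^sup>2))) has_real_derivative exp (- (y \<bullet> y / R\<^sup>2)) / R\<^sup>2) (at (y \<bullet> y))"
    by (rule DERIV_cong[OF DERIV_diff[OF DERIV_const DERIV_fun_exp[OF DERIV_minus[OF DERIV_cdivide[OF DERIV_ident]]]]]) simp
  have "((\<lambda>y. 1 - exp (- (y \<bullet> y / R\<^sup>2))) has_derivative (\<lambda>v. v \<bullet> barrier_gradient R y)) (at y)"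
    by (rule has_derivative_eq_rhs[OF has_derivative_compose[OF d1 d2[unfolded has_field_derivative_def]]])
       (auto simp: barrier_gradient_def power2_norm_eq_inner inner_commute)
  then show ?thesis unfolding gderiv_def barrier_def[abs_def] by (simp add: power2_norm_eq_inner)
qed

lemma barrier_tail_tendsto_0:
  assumes r: "0 < r"
  shows "(\<lambda>n. \<integral>z. min 1 (2 / real (Suc n) * norm z + (norm z)\<^sup>2 / (real (Suc n))\<^sup>2) \<partial>tail r) \<longlonglongrightarrow> 0"
proof -
  interpret finite_measure "tail r" by (rule finite_tail[OF r])
  have "(\<lambda>n. \<integral>z. min 1 (2 / real (Suc n) * norm z + (norm z)\<^sup>2 / (real (Suc n))\<^sup>2) \<partial>tail r) \<longlonglongrightarrow> (\<integral>z. 0 \<partial>tail r)"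
  proof (rule integral_dominated_convergence[where w = "\<lambda>_. 1"])
    have "(\<lambda>n. min 1 (2 / real (Suc n) * norm z + (norm z)\<^sup>2 / (real (Suc n))\<^sup>2)) \<longlonglongrightarrow> min 1 (2 * 0 * norm z + (norm z)\<^sup>2 * 0\<^sup>2)" for z :: "real ^ 'n"
      unfolding divide_inverse power_inverse[symmetric]
      by (intro tendsto_intros LIMSEQ_inverse_real_of_nat)
    then show "AE z in tail r. (\<lambda>n. min 1 (2 / real (Suc n) * norm z + (norm z)\<^sup>2 / (real (Suc n))\<^sup>2)) \<longlonglongrightarrow> 0"
      by (intro AE_I2) simp
  qed (auto intro!: AE_I2 simp: add_nonneg_nonneg)
  then show ?thesis by simp
qed

lemma barrier_tail_le:
  assumes R: "0 < R" and r: "0 < r"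
  shows "(\<integral>z. barrier R (y + z) - barrier R y \<partial>tail r)
     \<le> (\<integral>z. min 1 (2 / R * norm z + (norm z)\<^sup>2 / R\<^sup>2) \<partial>tail r)"
proof (rule tail_integral_mono[OF r, where B = 1 and B' = 1])
  have [measurable]: "barrier R \<in> borel_measurable borel"
    by (rule borel_measurable_continuous_onI[OF barrier_continuous])
  show "(\<lambda>z. barrier R (y + z) - barrier R y) \<in> borel_measurable borel" by measurable
  fix z
  show "\<bar>barrier R (y + z) - barrier R y\<bar> \<le> 1"
    using barrier_bounds(1,2)[of R "y + z"] barrier_bounds(1,2)[of R y] by linarith
  have "barrier_gradient R y \<bullet> z \<le> norm (barrier_gradient R y) * norm z" by (rule norm_cauchy_schwarz)
  also have "\<dots> \<le> 2 / R * norm z" by (intro mult_right_mono barrier_gradient_bound R) auto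
  finally show "barrier R (y + z) - barrier R y \<le> min 1 (2 / R * norm z + (norm z)\<^sup>2 / R\<^sup>2)"
    using barrier_increment[OF R, of y z] barrier_bounds(2)[of R "y + z"] barrier_bounds(1)[of R y]
    by (simp add: min_def)
  show "\<bar>min 1 (2 / R * norm z + (norm z)\<^sup>2 / R\<^sup>2)\<bar> \<le> 1"
    using R by (simp add: abs_le_iff add_nonneg_nonneg)
qed measurable

text \<open>
  The bound does not depend on \<open>\<epsilon>\<close>: on the annulus the gradient term integrates to zero, which
  leaves a multiple of the second moment.
\<close>
lemma barrier_truncated_le:
  assumes R: "0 < R" and assms: "0 < \<epsilon>" "\<epsilon> \<le> 1"
  shows "(\<integral>z. barrier R (y + z) - barrier R y \<partial>tail \<epsilon>)
     \<le> small_moment 1 / R\<^sup>2 + (\<integral>z. min 1 (2 / R * norm z + (norm z)\<^sup>2 / R\<^sup>2) \<partial>tail 1)"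
proof -
  let ?f = "\<lambda>z. barrier R (y + z) - barrier R y"
  let ?G = "barrier_gradient R y"
  let ?A = "{z. \<epsilon> < norm z \<and> norm z \<le> 1}"
  have [measurable]: "barrier R \<in> borel_measurable borel"
    by (rule borel_measurable_continuous_onI[OF barrier_continuous])
  have b: "\<bar>?f z\<bar> \<le> 1" for z
    using barrier_bounds(1,2)[of R "y + z"] barrier_bounds(1,2)[of R y] by linarith
  have "integrable (tail \<epsilon>) ?f" "integrable (tail 1) ?f"
    using assms b by (intro integrable_tail_bounded[where B = 1]; simp)+
  then have i: "integrable \<mu> (\<lambda>z. indicator {z. \<epsilon> < norm z} z * ?f z)" "integrable \<mu> (\<lambda>z. indicator {z. 1 < norm z} z * ?f z)"
    by (subst (asm) (1 2) tail_integral_eq(2), auto)+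
  have "(\<lambda>z. indicator {z. \<epsilon> < norm z} z * ?f z - indicator {z. 1 < norm z} z * ?f z) = (\<lambda>z. indicator ?A z * ?f z)"
    using assms by (auto simp: indicator_def)
  then have iA: "integrable \<mu> (\<lambda>z. indicator ?A z * ?f z)"
    using Bochner_Integration.integrable_diff[OF i] by simp
  have iG: "integrable \<mu> (\<lambda>z. indicator ?A z * (?G \<bullet> z))" and zG: "(\<integral>z. indicator ?A z * (?G \<bullet> z) \<partial>\<mu>) = 0"
    using annulus_linear_integral[OF assms(2)] by auto
  have i2: "integrable \<mu> (\<lambda>z. indicator (cball 0 1) z * (norm z)\<^sup>2 / R\<^sup>2)"
    by (intro Bochner_Integration.integrable_divide_zero second_moment_finite) auto
  have "(\<integral>z. ?f z \<partial>tail \<epsilon>) = (\<integral>z. indicator {z. \<epsilon> < norm z} z * ?f z \<partial>\<mu>)"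
    by (subst tail_integral_eq(1)) auto
  also have "\<dots> = (\<integral>z. indicator {z. 1 < norm z} z * ?f z + indicator ?A z * ?f z \<partial>\<mu>)"
    using assms by (intro arg_cong[where f = "integral\<^sup>L \<mu>"]) (auto simp: indicator_def)
  also have "\<dots> = (\<integral>z. indicator {z. 1 < norm z} z * ?f z \<partial>\<mu>) + (\<integral>z. indicator ?A z * ?f z \<partial>\<mu>)"
    by (rule Bochner_Integration.integral_add[OF i(2) iA])
  also have "(\<integral>z. indicator {z. 1 < norm z} z * ?f z \<partial>\<mu>) = (\<integral>z. ?f z \<partial>tail 1)"
    by (subst tail_integral_eq(1)) auto
  also have "(\<integral>z. indicator ?A z * ?f z \<partial>\<mu>) = (\<integral>z. indicator ?A z * ?f z - indicator ?A z * (?G \<bullet> z) \<partial>\<mu>)"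
    using zG by (simp add: Bochner_Integration.integral_diff[OF iA iG])
  also have "\<dots> \<le> (\<integral>z. indicator (cball 0 1) z * (norm z)\<^sup>2 / R\<^sup>2 \<partial>\<mu>)"
  proof (rule integral_mono[OF Bochner_Integration.integrable_diff[OF iA iG] i2])
    fix z show "indicator ?A z * ?f z - indicator ?A z * (?G \<bullet> z) \<le> indicator (cball 0 1) z * (norm z)\<^sup>2 / R\<^sup>2"
      using barrier_increment[OF R, of y z] by (auto simp: indicator_def)
  qed
  also have "\<dots> = small_moment 1 / R\<^sup>2" by (simp add: small_moment_def)
  finally show ?thesis using barrier_tail_le[OF R, of 1 y] by simp
qed

end

section \<open>An explicit monotone scheme\<close>

text \<open>
  A closed form of the recursion \<open>a' \<le> (1 + h * K) * a + h * E\<close> that is stable under induction.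
\<close>
lemma discrete_gronwall_step:
  fixes h K a E :: real
  assumes "0 \<le> h" "0 \<le> K" "0 \<le> a" "0 \<le> E"
  shows "(1 + h * K) * (exp (K * (real k * h)) * (a + real k * h * E)) + h * E
     \<le> exp (K * (real (Suc k) * h)) * (a + real (Suc k) * h * E)"
proof -
  let ?e = "exp (K * (real k * h))" and ?e' = "exp (K * (real (Suc k) * h))"
  have "1 + h * K \<le> exp (h * K)" by (rule exp_ge_add_one_self)
  then have "(1 + h * K) * ?e \<le> exp (h * K) * ?e" by (intro mult_right_mono) auto
  also have "\<dots> = ?e'" by (simp add: exp_add[symmetric] algebra_simps)
  finally have e: "(1 + h * K) * ?e \<le> ?e'" .
  have "1 \<le> ?e'" using assms by simp
  then have "1 * (h * E) \<le> ?e' * (h * E)" using assms by (intro mult_right_mono) auto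
  moreover have "(1 + h * K) * ?e * (a + real k * h * E) \<le> ?e' * (a + real k * h * E)"
    using e assms by (intro mult_right_mono) auto
  ultimately show ?thesis by (simp add: algebra_simps)
qed

context levy_kernel
begin

definition step :: "real \<Rightarrow> real \<Rightarrow> (real ^ 'n \<Rightarrow> real \<Rightarrow> real) \<Rightarrow> (real ^ 'n \<Rightarrow> real) \<Rightarrow> real ^ 'n \<Rightarrow> real" where
  "step \<epsilon> h F u y = u y + h * ((\<integral>z. u (y + z) - u y \<partial>tail \<epsilon>) + F y (u y))"

lemma step_change: "step \<epsilon> h F u y = step \<epsilon> h F' u y + h * (F y (u y) - F' y (u y))"
  by (simp add: step_def algebra_simps)

lemma tail_integral_shift:
  assumes "0 < \<epsilon>" "u \<in> borel_measurable borel" "\<And>x. \<bar>u x\<bar> \<le> (A::real)"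
  shows "(\<integral>z. u (y + z) - u y \<partial>tail \<epsilon>) = (\<integral>z. u (y + z) \<partial>tail \<epsilon>) - tail_mass \<epsilon> * u y"
    "integrable (tail \<epsilon>) (\<lambda>z. u (y + z))"
proof -
  note assms(2)[measurable]
  show i: "integrable (tail \<epsilon>) (\<lambda>z. u (y + z))"
    by (rule integrable_tail_bounded[OF assms(1) _ assms(3)]) measurable
  interpret finite_measure "tail \<epsilon>" by (rule finite_tail[OF assms(1)])
  show "(\<integral>z. u (y + z) - u y \<partial>tail \<epsilon>) = (\<integral>z. u (y + z) \<partial>tail \<epsilon>) - tail_mass \<epsilon> * u y"
    using i by (subst Bochner_Integration.integral_diff) (auto simp: tail_mass_def)
qed

text \<open>
  Under the condition \<open>h * (tail_mass \<epsilon> + K) \<le> 1\<close> the step is monotone, so an ordering up to a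
  nonnegative function \<open>b\<close> is propagated up to the image of \<open>b\<close> under the linearised step.
\<close>
lemma step_mono:
  assumes \<epsilon>: "0 < \<epsilon>" and h: "0 \<le> h" and K: "0 \<le> K" and cfl: "h * (tail_mass \<epsilon> + K) \<le> 1"
    and m: "u \<in> borel_measurable borel" "v \<in> borel_measurable borel" "b \<in> borel_measurable borel"
    and bd: "\<And>x. \<bar>u x\<bar> \<le> A" "\<And>x. \<bar>v x\<bar> \<le> A'" "\<And>x. \<bar>b x\<bar> \<le> A''"
    and b0: "\<And>x. 0 \<le> b x" and uv: "\<And>x. u x \<le> v x + b x"
    and F: "\<And>a a'. \<bar>F2 y a - F2 y a'\<bar> \<le> K * \<bar>a - a'\<bar>" and FE: "F1 y (u y) \<le> F2 y (u y) + E"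
  shows "step \<epsilon> h F1 u y \<le> step \<epsilon> h F2 v y + b y + h * ((\<integral>z. b (y + z) - b y \<partial>tail \<epsilon>) + K * b y + E)"
proof -
  note m[measurable]
  let ?m = "tail_mass \<epsilon>"
  have Iu: "(\<integral>z. u (y + z) - u y \<partial>tail \<epsilon>) = (\<integral>z. u (y + z) \<partial>tail \<epsilon>) - ?m * u y"
    by (rule tail_integral_shift[OF \<epsilon> m(1) bd(1)])
  have Iv: "(\<integral>z. v (y + z) - v y \<partial>tail \<epsilon>) = (\<integral>z. v (y + z) \<partial>tail \<epsilon>) - ?m * v y"
    by (rule tail_integral_shift[OF \<epsilon> m(2) bd(2)])
  have Ib: "(\<integral>z. b (y + z) - b y \<partial>tail \<epsilon>) = (\<integral>z. b (y + z) \<partial>tail \<epsilon>) - ?m * b y"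
    by (rule tail_integral_shift[OF \<epsilon> m(3) bd(3)])
  have i: "integrable (tail \<epsilon>) (\<lambda>z. u (y + z))" "integrable (tail \<epsilon>) (\<lambda>z. v (y + z))" "integrable (tail \<epsilon>) (\<lambda>z. b (y + z))"
    using tail_integral_shift(2)[OF \<epsilon> m(1) bd(1)] tail_integral_shift(2)[OF \<epsilon> m(2) bd(2)] tail_integral_shift(2)[OF \<epsilon> m(3) bd(3)] by auto
  have "(\<integral>z. u (y + z) \<partial>tail \<epsilon>) \<le> (\<integral>z. v (y + z) + b (y + z) \<partial>tail \<epsilon>)"
    using i uv by (intro integral_mono) auto
  also have "\<dots> = (\<integral>z. v (y + z) \<partial>tail \<epsilon>) + (\<integral>z. b (y + z) \<partial>tail \<epsilon>)"
    by (rule Bochner_Integration.integral_add[OF i(2,3)])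
  finally have I: "h * (\<integral>z. u (y + z) \<partial>tail \<epsilon>) \<le> h * ((\<integral>z. v (y + z) \<partial>tail \<epsilon>) + (\<integral>z. b (y + z) \<partial>tail \<epsilon>))"
    using h by (rule mult_left_mono)
  have E: "h * F1 y (u y) \<le> h * (F2 y (u y) + E)" using FE h by (rule mult_left_mono)
  define d where "d = u y - v y"
  have d: "d \<le> b y" using uv[of y] by (simp add: d_def)
  have "(1 - h * ?m) * d + h * (F2 y (u y) - F2 y (v y)) \<le> (1 - h * ?m + h * K) * b y"
  proof (cases "d \<ge> 0")
    case True
    have "h * (F2 y (u y) - F2 y (v y)) \<le> h * (K * d)"
      using F[of "u y" "v y"] True h by (intro mult_left_mono) (auto simp: d_def)
    then have "(1 - h * ?m) * d + h * (F2 y (u y) - F2 y (v y)) \<le> (1 - h * ?m + h * K) * d"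
      by (simp add: algebra_simps)
    also have "\<dots> \<le> (1 - h * ?m + h * K) * b y"
    proof -
      have "0 \<le> h * K" using h K by simp
      then have "0 \<le> 1 - h * ?m + h * K" using cfl by (simp add: algebra_simps)
      then show ?thesis using d by (rule mult_left_mono[rotated])
    qed
    finally show ?thesis .
  next
    case False
    have "h * (F2 y (u y) - F2 y (v y)) \<le> h * (K * - d)"
      using F[of "u y" "v y"] False h by (intro mult_left_mono) (auto simp: d_def)
    then have "(1 - h * ?m) * d + h * (F2 y (u y) - F2 y (v y)) \<le> (1 - h * (?m + K)) * d"
      by (simp add: algebra_simps)
    also have "\<dots> \<le> 0" using False cfl by (intro mult_nonneg_nonpos) auto
    also have "0 \<le> (1 - h * ?m + h * K) * b y"
    proof (intro mult_nonneg_nonneg b0)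
      have "0 \<le> h * K" using h K by simp
      moreover have "h * ?m + h * K \<le> 1" using cfl by (simp add: distrib_left)
      ultimately show "0 \<le> 1 - h * ?m + h * K" by linarith
    qed
    finally show ?thesis .
  qed
  then show ?thesis using I E unfolding step_def Iu Iv Ib d_def by (simp add: algebra_simps)
qed

lemma step_mono_sequence:
  fixes u v :: "nat \<Rightarrow> real ^ 'n \<Rightarrow> real"
  assumes \<epsilon>: "0 < \<epsilon>" and h: "0 \<le> h" and K: "0 \<le> K" and cfl: "h * (tail_mass \<epsilon> + K) \<le> 1"
    and m: "\<And>k. u k \<in> borel_measurable borel" "\<And>k. v k \<in> borel_measurable borel"
    and bd: "\<And>k x. \<bar>u k x\<bar> \<le> A k" "\<And>k x. \<bar>v k x\<bar> \<le> A' k"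
    and F: "\<And>k y a a'. \<bar>F k y a - F k y a'\<bar> \<le> K * \<bar>a - a'\<bar>"
    and u: "\<And>k y. k < N \<Longrightarrow> u (Suc k) y \<le> step \<epsilon> h (F k) (u k) y + h * E"
    and v: "\<And>k y. k < N \<Longrightarrow> step \<epsilon> h (F k) (v k) y \<le> v (Suc k) y"
    and init: "\<And>y. u 0 y \<le> v 0 y + a" and a: "0 \<le> a" and E: "0 \<le> E" and k: "k \<le> N"
  shows "u k y \<le> v k y + exp (K * (real k * h)) * (a + real k * h * E)"
  using k
proof (induction k arbitrary: y)
  case 0 then show ?case using init by simp
next
  case (Suc k)
  define B where "B = exp (K * (real k * h)) * (a + real k * h * E)"
  have B: "0 \<le> B" using a E h by (simp add: B_def)
  have "u (Suc k) y \<le> step \<epsilon> h (F k) (u k) y + h * E" using u Suc by simp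
  also have "step \<epsilon> h (F k) (u k) y \<le> step \<epsilon> h (F k) (v k) y + B + h * ((\<integral>z. B - B \<partial>tail \<epsilon>) + K * B + 0)"
    by (rule step_mono[OF \<epsilon> h K cfl m(1) m(2) _ bd(1) bd(2), where b = "\<lambda>_. B" and A'' = "\<bar>B\<bar>"])
       (use B Suc F in \<open>auto simp: B_def\<close>)
  also have "step \<epsilon> h (F k) (v k) y \<le> v (Suc k) y" using v Suc by simp
  finally have "u (Suc k) y \<le> v (Suc k) y + ((1 + h * K) * B + h * E)" by (simp add: algebra_simps)
  also have "(1 + h * K) * B + h * E \<le> exp (K * (real (Suc k) * h)) * (a + real (Suc k) * h * E)"
    unfolding B_def by (rule discrete_gronwall_step[OF h K a E])
  finally show ?case by simp
qed

lemma step_measurable: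
  assumes \<epsilon>: "0 < \<epsilon>" and u: "u \<in> borel_measurable borel" and F: "continuous_on UNIV (\<lambda>(y, a). F y a)"
  shows "step \<epsilon> h F u \<in> borel_measurable borel"
proof -
  interpret finite_measure "tail \<epsilon>" by (rule finite_tail[OF \<epsilon>])
  note u[measurable]
  have [measurable]: "(\<lambda>y. \<integral>z. u (y + z) - u y \<partial>tail \<epsilon>) \<in> borel_measurable borel"
    by (rule borel_measurable_lebesgue_integral) measurable
  have "(\<lambda>(y, a). F y a) \<in> borel_measurable borel" by (rule borel_measurable_continuous_onI[OF F])
  then have "(\<lambda>y. (\<lambda>(y, a). F y a) (y, u y)) \<in> borel_measurable borel"
    by (rule measurable_compose[rotated]) (simp add: borel_prod[symmetric])
  then have [measurable]: "(\<lambda>y. F y (u y)) \<in> borel_measurable borel" by simp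
  show ?thesis unfolding step_def[abs_def] by measurable
qed

definition cutoff :: "nat \<Rightarrow> real" where
  "cutoff n = 1 / real (Suc n)"

text \<open>
  Two requirements fix the number of time steps per unit of time: it is an integer, so that the
  scheme respects the time period of the equation, and it is large enough for the scheme to be
  monotone.
\<close>
definition steps_per_unit :: "real \<Rightarrow> nat \<Rightarrow> nat" where
  "steps_per_unit K n = Suc n + nat \<lceil>tail_mass (cutoff n) + K\<rceil>"

definition mesh :: "real \<Rightarrow> nat \<Rightarrow> real" where
  "mesh K n = 1 / real (steps_per_unit K n)"

lemma cutoff_pos: "0 < cutoff n" "cutoff n \<le> 1"
  by (auto simp: cutoff_def)

lemma mesh_pos: "0 < mesh K n"
  by (simp add: mesh_def steps_per_unit_def)

lemma mesh_le: "mesh K n \<le> 1 / real (Suc n)"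
  unfolding mesh_def steps_per_unit_def by (intro divide_left_mono) auto

lemma mesh_le_1: "mesh K n \<le> 1"
  using mesh_le[of K n] by (rule order_trans) simp

lemma mesh_steps: "real (m * steps_per_unit K n) * mesh K n = real m"
proof -
  have "real (steps_per_unit K n) \<noteq> 0" by (simp add: steps_per_unit_def)
  then show ?thesis by (simp add: mesh_def)
qed

lemma mesh_cfl:
  assumes "0 \<le> K"
  shows "mesh K n * (tail_mass (cutoff n) + K) \<le> 1"
proof -
  have "tail_mass (cutoff n) + K \<le> real (steps_per_unit K n)"
    using assms tail_mass_nonneg[of "cutoff n"] unfolding steps_per_unit_def by linarith
  moreover have "0 < real (steps_per_unit K n)" by (simp add: steps_per_unit_def)
  ultimately show ?thesis by (simp add: mesh_def divide_simps)
qed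

fun scheme :: "real \<Rightarrow> (real \<Rightarrow> real ^ 'n \<Rightarrow> real \<Rightarrow> real) \<Rightarrow> nat \<Rightarrow> nat \<Rightarrow> real ^ 'n \<Rightarrow> real" where
  "scheme K f n 0 = (\<lambda>y. 0)"
| "scheme K f n (Suc k) = step (cutoff n) (mesh K n) (f (real k * mesh K n)) (scheme K f n k)"

end

locale levy_equation = levy_kernel g s for g :: "real ^ 'n \<Rightarrow> real" and s +
  fixes f :: "real \<Rightarrow> real ^ 'n \<Rightarrow> real \<Rightarrow> real" and K K' C :: real
  assumes f_lip: "\<And>t y a a'. 0 \<le> t \<Longrightarrow> \<bar>f t y a - f t y a'\<bar> \<le> K * \<bar>a - a'\<bar>"
    and f_lip': "\<And>t t' y y' a. 0 \<le> t \<Longrightarrow> 0 \<le> t' \<Longrightarrow> \<bar>f t y a - f t' y' a\<bar> \<le> K' * (\<bar>t - t'\<bar> + norm (y - y'))"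
    and f_bound: "\<And>t y a. 0 \<le> t \<Longrightarrow> \<bar>f t y a\<bar> \<le> C"
    and K_nonneg: "0 \<le> K" and K'_nonneg: "0 \<le> K'"
begin

lemma C_nonneg: "0 \<le> C"
  using f_bound[of 0 0 0] by linarith

lemma f_lip_both:
  assumes "0 \<le> t" "0 \<le> t'"
  shows "\<bar>f t y a - f t' y' a'\<bar> \<le> K' * (\<bar>t - t'\<bar> + norm (y - y')) + K * \<bar>a - a'\<bar>"
  using f_lip[OF assms(1), of y a a'] f_lip'[OF assms, of y a' y'] by linarith

lemma f_continuous:
  assumes "0 \<le> t"
  shows "continuous_on UNIV (\<lambda>(y, a). f t y a)"
  unfolding continuous_on_iff
proof (intro ballI allI impI)
  fix x :: "(real ^ 'n) \<times> real" and e :: real assume e: "0 < e"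
  show "\<exists>d>0. \<forall>x'\<in>UNIV. dist x' x < d \<longrightarrow> dist (case x' of (y, a) \<Rightarrow> f t y a) (case x of (y, a) \<Rightarrow> f t y a) < e"
  proof (intro exI[of _ "e / (K' + K + 1)"] conjI ballI impI)
    fix x' assume d: "dist x' x < e / (K' + K + 1)"
    obtain y a where x: "x = (y, a)" by (cases x)
    obtain y' a' where x': "x' = (y', a')" by (cases x')
    have y: "norm (y' - y) \<le> dist x' x" using dist_fst_le[of x' x] by (simp add: x x' dist_norm)
    have a: "\<bar>a' - a\<bar> \<le> dist x' x" using dist_snd_le[of x' x] by (simp add: x x' dist_norm)
    have "\<bar>f t y' a' - f t y a\<bar> \<le> K' * norm (y' - y) + K * \<bar>a' - a\<bar>"
      using f_lip_both[OF assms assms, of y' a' y a] by simp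
    also have "\<dots> \<le> K' * dist x' x + K * dist x' x"
      using y a K_nonneg K'_nonneg by (intro add_mono mult_left_mono)
    also have "\<dots> \<le> (K' + K + 1) * dist x' x" by (simp add: algebra_simps)
    also have "\<dots> < e" using d K_nonneg K'_nonneg by (simp add: field_simps)
    finally show "dist (case x' of (y, a) \<Rightarrow> f t y a) (case x of (y, a) \<Rightarrow> f t y a) < e"
      by (simp add: x x' dist_real_def)
  qed (use e K_nonneg K'_nonneg in \<open>simp add: add_nonneg_pos\<close>)
qed

abbreviation "w \<equiv> scheme K f"
abbreviation "hs \<equiv> mesh K"

lemma time_nonneg: "0 \<le> real k * hs n"
  using mesh_pos[of K n] by (simp add: less_imp_le)

lemma scheme_measurable [measurable]: "w n k \<in> borel_measurable borel"
  by (induction k) (auto intro!: step_measurable cutoff_pos f_continuous time_nonneg)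

lemma scheme_bound: "\<bar>w n k y\<bar> \<le> real k * hs n * C"
proof (induction k arbitrary: y)
  case 0 then show ?case by simp
next
  case (Suc k)
  let ?B = "real k * hs n * C"
  have B: "0 \<le> ?B" using time_nonneg[of k n] C_nonneg by simp
  have h: "0 \<le> hs n" using mesh_pos[of K n] by simp
  have cfl: "hs n * (tail_mass (cutoff n) + 0) \<le> 1"
  proof -
    have "hs n * (tail_mass (cutoff n) + 0) \<le> hs n * (tail_mass (cutoff n) + K)"
      using h K_nonneg by (intro mult_left_mono) auto
    then show ?thesis using mesh_cfl[OF K_nonneg, of n] by simp
  qed
  have "w n (Suc k) y \<le> step (cutoff n) (hs n) (\<lambda>_ _. 0) (\<lambda>_. 0) y + ?B + hs n * ((\<integral>z. ?B - ?B \<partial>tail (cutoff n)) + 0 * ?B + C)"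
    unfolding scheme.simps
    by (rule step_mono[OF cutoff_pos(1) h _ cfl scheme_measurable, where A = ?B and A' = 0 and A'' = ?B])
       (use B Suc f_bound[OF time_nonneg, of k n] in \<open>auto intro: abs_le_D1\<close>)
  moreover have "step (cutoff n) (hs n) (\<lambda>_ _. 0) (\<lambda>_. 0) y \<le> w n (Suc k) y + ?B + hs n * ((\<integral>z. ?B - ?B \<partial>tail (cutoff n)) + 0 * ?B + C)"
  proof -
    have "step (cutoff n) (hs n) (\<lambda>y a. - f (real k * hs n) y (- a)) (\<lambda>y. - w n k y) y \<le> step (cutoff n) (hs n) (\<lambda>_ _. 0) (\<lambda>_. 0) y + ?B + hs n * ((\<integral>z. ?B - ?B \<partial>tail (cutoff n)) + 0 * ?B + C)"
      by (rule step_mono[OF cutoff_pos(1) h _ cfl, where A = ?B and A' = 0 and A'' = ?B])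
         (use B Suc f_bound[OF time_nonneg, of k n] in \<open>auto simp: abs_le_iff\<close>)
    moreover have "step (cutoff n) (hs n) (\<lambda>y a. - f (real k * hs n) y (- a)) (\<lambda>y. - w n k y) y = - w n (Suc k) y"
    proof -
      have "(\<integral>z. - w n k (y + z) - - w n k y \<partial>tail (cutoff n)) = - (\<integral>z. w n k (y + z) - w n k y \<partial>tail (cutoff n))"
        by (subst Bochner_Integration.integral_minus[symmetric]) (rule arg_cong[where f = "integral\<^sup>L (tail (cutoff n))"], auto)
      then show ?thesis by (simp only: step_def scheme.simps) (simp add: algebra_simps)
    qed
    ultimately show ?thesis by (simp add: step_def)
  qed
  ultimately show ?case by (simp add: step_def abs_le_iff algebra_simps)
qed

lemma scheme_compare:
  assumes "\<And>k. v k \<in> borel_measurable borel" "\<And>k x. \<bar>v k x\<bar> \<le> A k"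
    and "0 \<le> a" "0 \<le> E" "k \<le> N"
  shows "(\<And>k y. k < N \<Longrightarrow> v (Suc k) y \<le> step (cutoff n) (hs n) (f (real k * hs n)) (v k) y + hs n * E) \<Longrightarrow>
      (\<And>y. v 0 y \<le> a) \<Longrightarrow> v k y \<le> w n k y + exp (K * (real k * hs n)) * (a + real k * hs n * E)"
    and "(\<And>k y. k < N \<Longrightarrow> step (cutoff n) (hs n) (f (real k * hs n)) (v k) y - hs n * E \<le> v (Suc k) y) \<Longrightarrow>
      (\<And>y. - a \<le> v 0 y) \<Longrightarrow> w n k y \<le> v k y + exp (K * (real k * hs n)) * (a + real k * hs n * E)"
proof -
  have h: "0 \<le> hs n" using mesh_pos[of K n] by simp
  have F: "\<bar>f (real k * hs n) y a - f (real k * hs n) y a'\<bar> \<le> K * \<bar>a - a'\<bar>" for k y a a'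
    by (rule f_lip[OF time_nonneg])
  show "v k y \<le> w n k y + exp (K * (real k * hs n)) * (a + real k * hs n * E)"
    if "\<And>k y. k < N \<Longrightarrow> v (Suc k) y \<le> step (cutoff n) (hs n) (f (real k * hs n)) (v k) y + hs n * E" "\<And>y. v 0 y \<le> a"
    by (rule step_mono_sequence[OF cutoff_pos(1) h K_nonneg mesh_cfl[OF K_nonneg] assms(1) scheme_measurable assms(2) scheme_bound F _ _ _ assms(3,4,5)])
       (use that in auto)
  have "- v k y \<le> - w n k y + exp (K * (real k * hs n)) * (a + real k * hs n * E)"
    if a: "\<And>k y. k < N \<Longrightarrow> step (cutoff n) (hs n) (f (real k * hs n)) (v k) y - hs n * E \<le> v (Suc k) y" "\<And>y. - a \<le> v 0 y"
  proof -
    have neg: "step (cutoff n) (hs n) (\<lambda>y a. - f (real k * hs n) y (- a)) (\<lambda>y. - u y) y = - step (cutoff n) (hs n) (f (real k * hs n)) u y" for k u y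
    proof -
      have "(\<integral>z. - u (y + z) - - u y \<partial>tail (cutoff n)) = - (\<integral>z. u (y + z) - u y \<partial>tail (cutoff n))"
        by (subst Bochner_Integration.integral_minus[symmetric]) (rule arg_cong[where f = "integral\<^sup>L (tail (cutoff n))"], auto)
      then show ?thesis by (simp only: step_def) (simp add: algebra_simps)
    qed
    show ?thesis
    proof (rule step_mono_sequence[OF cutoff_pos(1) h K_nonneg mesh_cfl[OF K_nonneg], where u = "\<lambda>k y. - v k y" and v = "\<lambda>k y. - w n k y"
          and F = "\<lambda>k y a. - f (real k * hs n) y (- a)" and A = A and A' = "\<lambda>k. real k * hs n * C", OF _ _ _ _ _ _ _ _ assms(3,4,5)])
      show "\<bar>- f (real k * hs n) y (- a) - - f (real k * hs n) y (- a')\<bar> \<le> K * \<bar>a - a'\<bar>" for k y a a'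
        using F[of k y "- a" "- a'"] by (simp add: abs_minus_commute)
    qed (use a assms(1,2) scheme_bound in \<open>auto simp: neg algebra_simps minus_le_iff\<close>)
  qed
  then show "w n k y \<le> v k y + exp (K * (real k * hs n)) * (a + real k * hs n * E)"
    if "\<And>k y. k < N \<Longrightarrow> step (cutoff n) (hs n) (f (real k * hs n)) (v k) y - hs n * E \<le> v (Suc k) y" "\<And>y. - a \<le> v 0 y"
    using that by fastforce
qed

lemma step_translate: "step \<epsilon> h F u (y + a) = step \<epsilon> h (\<lambda>y. F (y + a)) (\<lambda>y. u (y + a)) y"
  by (simp add: step_def add_ac)

text \<open>
  The nonlocal operator commutes with translations, so a translate by \<open>d\<close> solves the same scheme up to
  an error \<open>K' * norm d\<close> and is compared with the original.
\<close>
lemma scheme_lipschitz: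
  assumes "real k * hs n \<le> T"
  shows "\<bar>w n k y - w n k y'\<bar> \<le> exp (K * T) * T * K' * norm (y - y')"
proof -
  have h: "0 \<le> hs n" using mesh_pos[of K n] by simp
  have T: "0 \<le> T" using assms time_nonneg[of k n] by simp
  have one: "w n k (y + d) \<le> w n k y + exp (K * T) * T * K' * norm d" for y d
  proof -
    have "w n k (y + d) \<le> w n k y + exp (K * (real k * hs n)) * (0 + real k * hs n * (K' * norm d))"
    proof (rule scheme_compare(1)[where v = "\<lambda>k y. w n k (y + d)" and N = k and A = "\<lambda>k. real k * hs n * C"])
      show "w n (Suc k) (y + d) \<le> step (cutoff n) (hs n) (f (real k * hs n)) (\<lambda>y. w n k (y + d)) y + hs n * (K' * norm d)" for k y
      proof -
        have "f (real k * hs n) (y + d) a \<le> f (real k * hs n) y a + K' * norm d" for a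
          using f_lip'[OF time_nonneg[of k n] time_nonneg[of k n], of "y + d" a y] by simp
        then have "hs n * f (real k * hs n) (y + d) a \<le> hs n * (f (real k * hs n) y a + K' * norm d)" for a
          by (intro mult_left_mono h)
        then show ?thesis by (simp add: step_translate) (simp add: step_def algebra_simps)
      qed
    qed (use K'_nonneg scheme_bound in auto)
    also have "exp (K * (real k * hs n)) * (0 + real k * hs n * (K' * norm d)) \<le> exp (K * T) * (T * (K' * norm d))"
      using assms K_nonneg K'_nonneg T time_nonneg[of k n] by (intro mult_mono) (auto intro: mult_left_mono mult_right_mono)
    finally show ?thesis by (simp add: mult.assoc)
  qed
  show ?thesis using one[of y' "y - y'"] one[of y "y' - y"] by (simp add: abs_le_iff norm_minus_commute algebra_simps)
qed

text \<open>
  The scheme started one step later solves the same scheme up to an error \<open>K' * h\<close>, from an initial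
  value that is at most \<open>h * C\<close>. A bound through the difference equation itself would contain the
  mass of the truncated kernel, which is unbounded as the truncation is removed.
\<close>
lemma scheme_time_increment:
  assumes "real k * hs n \<le> T"
  shows "\<bar>w n (Suc k) y - w n k y\<bar> \<le> hs n * (exp (K * T) * (C + T * K'))"
proof -
  let ?v = "\<lambda>k. w n (Suc k)"
  have h: "0 \<le> hs n" using mesh_pos[of K n] by simp
  have T: "0 \<le> T" using assms time_nonneg[of k n] by simp
  have df: "\<bar>f (real (Suc k) * hs n) y a - f (real k * hs n) y a\<bar> \<le> K' * hs n" for k y a
    using f_lip'[OF time_nonneg[of "Suc k" n] time_nonneg[of k n], of y a y] h by (simp add: algebra_simps)
  have df': "hs n * (f (real (Suc k) * hs n) y a - f (real k * hs n) y a) \<le> hs n * (K' * hs n)"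
    "- (hs n * (K' * hs n)) \<le> hs n * (f (real (Suc k) * hs n) y a - f (real k * hs n) y a)" for k y a
    using df[of k y a] mult_left_mono[OF _ h, of "f (real (Suc k) * hs n) y a - f (real k * hs n) y a" "K' * hs n"]
      mult_left_mono[OF _ h, of "- (K' * hs n)" "f (real (Suc k) * hs n) y a - f (real k * hs n) y a"]
    by (simp_all only: abs_le_iff minus_le_iff mult_minus_right)
  have b1: "\<bar>w n (Suc 0) y\<bar> \<le> hs n * C" for y using scheme_bound[of n "Suc 0" y] by simp
  have "w n (Suc k) y \<le> w n k y + exp (K * (real k * hs n)) * (hs n * C + real k * hs n * (K' * hs n))"
  proof (rule scheme_compare(1)[where v = ?v and N = k and A = "\<lambda>k. real (Suc k) * hs n * C"])
    show "w n (Suc (Suc k)) y \<le> step (cutoff n) (hs n) (f (real k * hs n)) (w n (Suc k)) y + hs n * (K' * hs n)" for k y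
      using df'(1)[of k y "w n (Suc k) y"]
        step_change[of "cutoff n" "hs n" "f (real (Suc k) * hs n)" "w n (Suc k)" y "f (real k * hs n)"]
      unfolding scheme.simps(2)[of K f n "Suc k"] by linarith
    show "w n (Suc 0) y \<le> hs n * C" for y using b1[of y] by linarith
  qed (use h C_nonneg K'_nonneg scheme_bound in \<open>auto simp del: scheme.simps of_nat_Suc\<close>)
  moreover have "w n k y \<le> w n (Suc k) y + exp (K * (real k * hs n)) * (hs n * C + real k * hs n * (K' * hs n))"
  proof (rule scheme_compare(2)[where v = ?v and N = k and A = "\<lambda>k. real (Suc k) * hs n * C"])
    show "step (cutoff n) (hs n) (f (real k * hs n)) (w n (Suc k)) y - hs n * (K' * hs n) \<le> w n (Suc (Suc k)) y" for k y
      using df'(2)[of k y "w n (Suc k) y"]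
        step_change[of "cutoff n" "hs n" "f (real (Suc k) * hs n)" "w n (Suc k)" y "f (real k * hs n)"]
      unfolding scheme.simps(2)[of K f n "Suc k"] by linarith
    show "- (hs n * C) \<le> w n (Suc 0) y" for y using b1[of y] by linarith
  qed (use h C_nonneg K'_nonneg scheme_bound in \<open>auto simp del: scheme.simps of_nat_Suc\<close>)
  moreover have "exp (K * (real k * hs n)) * (hs n * C + real k * hs n * (K' * hs n)) \<le> exp (K * T) * (hs n * C + T * (K' * hs n))"
  proof (rule mult_mono)
    show "exp (K * (real k * hs n)) \<le> exp (K * T)" using assms K_nonneg by (simp add: mult_left_mono)
    have "real k * hs n * (K' * hs n) \<le> T * (K' * hs n)" using assms K'_nonneg h by (intro mult_right_mono) auto
    then show "hs n * C + real k * hs n * (K' * hs n) \<le> hs n * C + T * (K' * hs n)" by simp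
    show "0 \<le> hs n * C + real k * hs n * (K' * hs n)" using K'_nonneg h C_nonneg by simp
  qed simp
  ultimately show ?thesis by (simp add: abs_le_iff algebra_simps)
qed

end

section \<open>Approximate classical solutions\<close>

lemma mollifier_average:
  fixes \<rho> G :: "'a::euclidean_space \<Rightarrow> real"
  assumes \<rho>: "continuous_on UNIV \<rho>" "\<And>x. 0 \<le> \<rho> x" "\<And>x. \<delta> < norm x \<Longrightarrow> \<rho> x = 0" "integral\<^sup>L lborel \<rho> = 1"
    and G: "G \<in> borel_measurable borel" "\<And>y. \<bar>G y\<bar> \<le> A"
    and e: "\<And>y. norm (x - y) \<le> \<delta> \<Longrightarrow> \<bar>G y - a\<bar> \<le> e"
  shows "\<bar>(\<integral>y. G y * \<rho> (x - y) \<partial>lborel) - a\<bar> \<le> e"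
proof -
  have refl: "distr lborel borel uminus = (lborel :: 'a measure)"
    using lborel_affine[of "-1" "0::'a"] by (simp add: density_1)
  have [measurable]: "\<rho> \<in> borel_measurable borel" by (rule borel_measurable_continuous_onI[OF \<rho>(1)])
  have one: "(\<integral>y. \<rho> (x - y) \<partial>lborel) = 1"
  proof -
    have "(\<integral>y. \<rho> (x - y) \<partial>lborel) = (\<integral>y. \<rho> (x - y) \<partial>distr lborel borel uminus)" by (simp only: refl)
    also have "\<dots> = (\<integral>y. \<rho> (y + x) \<partial>lborel)" by (subst integral_distr) (auto simp: add.commute)
    also have "\<dots> = 1" using lborel_integral_translate[of \<rho> x] \<rho>(4) by simp
    finally show ?thesis .
  qed
  have i1: "integrable lborel (\<lambda>y. \<rho> (x - y))"
    using convolution_integrand[where u = "\<lambda>_. 1" and U = 1, OF _ _ \<rho>(1,3)] by simp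
  have i2: "integrable lborel (\<lambda>y. G y * \<rho> (x - y))"
    by (rule convolution_integrand[OF G \<rho>(1,3)])
  have up: "G y * \<rho> (x - y) \<le> (a + e) * \<rho> (x - y)" "(a - e) * \<rho> (x - y) \<le> G y * \<rho> (x - y)" for y
  proof -
    show "G y * \<rho> (x - y) \<le> (a + e) * \<rho> (x - y)"
    proof (cases "norm (x - y) \<le> \<delta>")
      case True then show ?thesis using e[OF True] \<rho>(2) by (intro mult_right_mono) (auto simp: abs_le_iff)
    qed (use \<rho>(3) in simp)
    show "(a - e) * \<rho> (x - y) \<le> G y * \<rho> (x - y)"
    proof (cases "norm (x - y) \<le> \<delta>")
      case True then show ?thesis using e[OF True] \<rho>(2) by (intro mult_right_mono) (auto simp: abs_le_iff)
    qed (use \<rho>(3) in simp)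
  qed
  have "(\<integral>y. G y * \<rho> (x - y) \<partial>lborel) \<le> (\<integral>y. (a + e) * \<rho> (x - y) \<partial>lborel)"
    by (intro integral_mono i2 integrable_mult_right i1 up)
  moreover have "(\<integral>y. (a - e) * \<rho> (x - y) \<partial>lborel) \<le> (\<integral>y. G y * \<rho> (x - y) \<partial>lborel)"
    by (intro integral_mono i2 integrable_mult_right i1 up)
  ultimately show ?thesis using one by (simp add: abs_le_iff)
qed

context levy_kernel
begin

text \<open>
  A classical solution up to an error \<open>\<eta>\<close> for times in \<open>{0..T}\<close>. Smoothness and the bounds hold for
  all times, so that difference quotients may leave the interval.
\<close>
definition approx_solution :: "(real \<Rightarrow> real ^ 'n \<Rightarrow> real \<Rightarrow> real) \<Rightarrow> real \<Rightarrow> real \<Rightarrow> (real \<times> (real ^ 'n) \<Rightarrow> real) \<Rightarrow> bool" where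
  "approx_solution f T \<eta> \<Phi> \<longleftrightarrow> C2_on UNIV \<Phi> \<and> (\<exists>(\<Phi>' :: real \<times> (real ^ 'n) \<Rightarrow> (real \<times> (real ^ 'n)) \<Rightarrow>\<^sub>L real) B.
     (\<forall>z. (\<Phi> has_derivative blinfun_apply (\<Phi>' z)) (at z)) \<and> (\<forall>z. \<bar>\<Phi> z\<bar> \<le> B) \<and>
     (\<forall>z v. \<bar>\<Phi> (z + v) - \<Phi> z - \<Phi>' z v\<bar> \<le> B * (norm v)\<^sup>2) \<and>
     (\<forall>t\<in>{0..T}. \<forall>y. \<bar>\<Phi>' (t, y) (1, 0) - levy_op (\<lambda>x. \<Phi> (t, x)) y - f t y (\<Phi> (t, y))\<bar> \<le> \<eta>) \<and>
     (\<forall>y. \<bar>\<Phi> (0, y)\<bar> \<le> \<eta>))"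

text \<open>
  Both operations are integrals over translates and the truncated kernel is finite, so this is the
  theorem of Fubini.
\<close>
lemma convolution_commutes_with_tail:
  fixes u \<rho> :: "real \<times> (real ^ 'n) \<Rightarrow> real"
  assumes \<epsilon>: "0 < \<epsilon>" and \<rho>: "continuous_on UNIV \<rho>" "\<And>x. \<delta> < norm x \<Longrightarrow> \<rho> x = 0"
    and u: "u \<in> borel_measurable borel" "\<And>y. \<bar>u y\<bar> \<le> U"
  defines "\<Phi> \<equiv> \<lambda>x. \<integral>y. u y * \<rho> (x - y) \<partial>lborel"
  shows "(\<integral>z. \<Phi> (x + (0, z)) - \<Phi> x \<partial>tail \<epsilon>) = (\<integral>y. (\<integral>z. u (y + (0, z)) - u y \<partial>tail \<epsilon>) * \<rho> (x - y) \<partial>lborel)"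
    "(\<lambda>y. \<integral>z. u (y + (0, z)) - u y \<partial>tail \<epsilon>) \<in> borel_measurable borel"
    "\<bar>\<integral>z. u (y + (0, z)) - u y \<partial>tail \<epsilon>\<bar> \<le> tail_mass \<epsilon> * (2 * U)"
proof -
  interpret finite_measure "tail \<epsilon>" by (rule finite_tail[OF \<epsilon>])
  have sf: "sigma_finite_measure (tail \<epsilon>)" ..
  interpret pair_sigma_finite "lborel :: (real \<times> (real ^ 'n)) measure" "tail \<epsilon>" ..
  note u(1)[measurable]
  have [measurable]: "(\<lambda>y. \<rho> (x - y)) \<in> borel_measurable borel" for x by (rule continuous_on_vimage_diff[OF \<rho>(1)])
  have shift: "\<Phi> (x + a) = (\<integral>y. u (y + a) * \<rho> (x - y) \<partial>lborel)" for x a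
    using lborel_integral_translate[of "\<lambda>y. u y * \<rho> (x + a - y)" a] by (simp add: \<Phi>_def algebra_simps)
  have [measurable]: "(\<lambda>(y, z). u (y + (0, z))) \<in> borel_measurable (borel \<Otimes>\<^sub>M borel)"
  proof -
    have "(\<lambda>p :: (real \<times> (real ^ 'n)) \<times> (real ^ 'n). fst p + (0, snd p)) \<in> borel_measurable borel"
      by (intro borel_measurable_continuous_onI continuous_intros)
    from measurable_compose[OF this u(1)] show ?thesis by (simp add: borel_prod case_prod_beta)
  qed
  have [measurable]: "(\<lambda>y. u (y + a)) \<in> borel_measurable borel" for a by measurable
  have bd: "\<bar>u a - u b\<bar> \<le> 2 * U" for a b using u(2)[of a] u(2)[of b] by linarith
  have mz: "(\<lambda>z. u (y + (0, z)) - u y) \<in> borel_measurable borel" for y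
  proof -
    have "(\<lambda>z :: real ^ 'n. y + (0, z)) \<in> borel_measurable borel"
      by (intro borel_measurable_continuous_onI continuous_intros)
    from measurable_compose[OF this u(1)] show ?thesis by measurable
  qed
  show "\<bar>\<integral>z. u (y + (0, z)) - u y \<partial>tail \<epsilon>\<bar> \<le> tail_mass \<epsilon> * (2 * U)" for y
    by (rule tail_integral_abs_bound[OF \<epsilon> mz bd])
  show "(\<lambda>y. \<integral>z. u (y + (0, z)) - u y \<partial>tail \<epsilon>) \<in> borel_measurable borel"
    by (rule sigma_finite_measure.borel_measurable_lebesgue_integral[OF sf]) measurable
  have i1: "integrable lborel (\<lambda>y. \<rho> (x - y))"
    using convolution_integrand[where u = "\<lambda>_. 1" and U = 1, OF _ _ \<rho>] by simp
  have U0: "0 \<le> U" using u(2)[of 0] by linarith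
  have I: "integrable (lborel \<Otimes>\<^sub>M tail \<epsilon>) (\<lambda>(y, z). (u (y + (0, z)) - u y) * \<rho> (x - y))"
  proof (rule Fubini_integrable)
    show "(\<lambda>(y, z). (u (y + (0, z)) - u y) * \<rho> (x - y)) \<in> borel_measurable (lborel \<Otimes>\<^sub>M tail \<epsilon>)" by measurable
    show "integrable lborel (\<lambda>y. \<integral>z. norm (case (y, z) of (y, z) \<Rightarrow> (u (y + (0, z)) - u y) * \<rho> (x - y)) \<partial>tail \<epsilon>)"
    proof (rule Bochner_Integration.integrable_bound[where f = "\<lambda>y. tail_mass \<epsilon> * (2 * U) * \<rho> (x - y)"])
      show "integrable lborel (\<lambda>y. tail_mass \<epsilon> * (2 * U) * \<rho> (x - y))" by (intro integrable_mult_right i1)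
      show "(\<lambda>y. \<integral>z. norm (case (y, z) of (y, z) \<Rightarrow> (u (y + (0, z)) - u y) * \<rho> (x - y)) \<partial>tail \<epsilon>) \<in> borel_measurable lborel"
        by measurable
      show "AE y in lborel. norm (\<integral>z. norm (case (y, z) of (y, z) \<Rightarrow> (u (y + (0, z)) - u y) * \<rho> (x - y)) \<partial>tail \<epsilon>) \<le> norm (tail_mass \<epsilon> * (2 * U) * \<rho> (x - y))"
      proof (rule AE_I2)
        fix y
        have "\<bar>\<integral>z. \<bar>(u (y + (0, z)) - u y) * \<rho> (x - y)\<bar> \<partial>tail \<epsilon>\<bar> \<le> tail_mass \<epsilon> * (2 * U * \<bar>\<rho> (x - y)\<bar>)"
        proof (rule tail_integral_abs_bound[OF \<epsilon>])
          show "(\<lambda>z. \<bar>(u (y + (0, z)) - u y) * \<rho> (x - y)\<bar>) \<in> borel_measurable borel" using mz[of y] by measurable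
          show "\<bar>\<bar>(u (y + (0, z)) - u y) * \<rho> (x - y)\<bar>\<bar> \<le> 2 * U * \<bar>\<rho> (x - y)\<bar>" for z
            using bd[of "y + (0, z)" y] by (simp add: abs_mult mult_right_mono)
        qed
        then show "norm (\<integral>z. norm (case (y, z) of (y, z) \<Rightarrow> (u (y + (0, z)) - u y) * \<rho> (x - y)) \<partial>tail \<epsilon>) \<le> norm (tail_mass \<epsilon> * (2 * U) * \<rho> (x - y))"
          using U0 tail_mass_nonneg[of \<epsilon>] by (simp add: abs_mult mult.assoc)
      qed
    qed
    show "AE y in lborel. integrable (tail \<epsilon>) (\<lambda>z. case (y, z) of (y, z) \<Rightarrow> (u (y + (0, z)) - u y) * \<rho> (x - y))"
    proof (rule AE_I2)
      fix y
      have "integrable (tail \<epsilon>) (\<lambda>z. u (y + (0, z)) - u y)" by (rule integrable_tail_bounded[OF \<epsilon> mz bd])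
      then show "integrable (tail \<epsilon>) (\<lambda>z. case (y, z) of (y, z) \<Rightarrow> (u (y + (0, z)) - u y) * \<rho> (x - y))" by simp
    qed
  qed
  have m': "(\<lambda>y. u (y + a)) \<in> borel_measurable borel" for a by measurable
  have "(\<integral>z. \<Phi> (x + (0, z)) - \<Phi> x \<partial>tail \<epsilon>) = (\<integral>z. (\<integral>y. (u (y + (0, z)) - u y) * \<rho> (x - y) \<partial>lborel) \<partial>tail \<epsilon>)"
  proof (rule Bochner_Integration.integral_cong[OF refl])
    fix z
    have "\<Phi> (x + (0, z)) - \<Phi> x = (\<integral>y. u (y + (0, z)) * \<rho> (x - y) \<partial>lborel) - (\<integral>y. u y * \<rho> (x - y) \<partial>lborel)"
      by (simp add: shift) (simp add: \<Phi>_def)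
    also have "\<dots> = (\<integral>y. u (y + (0, z)) * \<rho> (x - y) - u y * \<rho> (x - y) \<partial>lborel)"
      by (rule Bochner_Integration.integral_diff[symmetric])
         (use convolution_integrand[OF m' u(2) \<rho>] convolution_integrand[OF u \<rho>] in auto)
    finally show "\<Phi> (x + (0, z)) - \<Phi> x = (\<integral>y. (u (y + (0, z)) - u y) * \<rho> (x - y) \<partial>lborel)"
      by (simp add: left_diff_distrib)
  qed
  also have "\<dots> = (\<integral>y. (\<integral>z. (u (y + (0, z)) - u y) * \<rho> (x - y) \<partial>tail \<epsilon>) \<partial>lborel)"
    by (rule Fubini_integral[OF I])
  also have "\<dots> = (\<integral>y. (\<integral>z. u (y + (0, z)) - u y \<partial>tail \<epsilon>) * \<rho> (x - y) \<partial>lborel)" by simp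
  finally show "(\<integral>z. \<Phi> (x + (0, z)) - \<Phi> x \<partial>tail \<epsilon>) = (\<integral>y. (\<integral>z. u (y + (0, z)) - u y \<partial>tail \<epsilon>) * \<rho> (x - y) \<partial>lborel)" .
qed

end

context levy_equation
begin

definition step_index :: "nat \<Rightarrow> real \<Rightarrow> nat" where
  "step_index n t = nat \<lfloor>t / hs n\<rfloor>"

lemma step_index_bounds:
  assumes "0 \<le> t"
  shows "real (step_index n t) * hs n \<le> t" "t < real (step_index n t) * hs n + hs n"
proof -
  have h: "0 < hs n" by (rule mesh_pos)
  have i: "real (step_index n t) = real_of_int \<lfloor>t / hs n\<rfloor>"
    using assms h unfolding step_index_def by simp
  have "real_of_int \<lfloor>t / hs n\<rfloor> \<le> t / hs n" "t / hs n < real_of_int \<lfloor>t / hs n\<rfloor> + 1" by linarith+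
  then show "real (step_index n t) * hs n \<le> t" "t < real (step_index n t) * hs n + hs n"
    unfolding i using h by (simp_all only: pos_le_divide_eq[OF h] pos_divide_less_eq[OF h] distrib_right mult_1)
qed

lemma step_index_Suc: "0 \<le> t \<Longrightarrow> step_index n (t + hs n) = Suc (step_index n t)"
  using mesh_pos[of K n] unfolding step_index_def by (simp add: add_divide_distrib nat_add_distrib)

lemma step_index_add_period:
  assumes "0 \<le> t"
  shows "step_index n (real m + t) = m * steps_per_unit K n + step_index n t"
proof -
  have h: "0 < hs n" by (rule mesh_pos)
  have "(real m + t) / hs n = real (m * steps_per_unit K n) + t / hs n"
    using mesh_steps[of m K n] h by (simp add: field_simps)
  then have "\<lfloor>(real m + t) / hs n\<rfloor> = int (m * steps_per_unit K n) + \<lfloor>t / hs n\<rfloor>"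
    using floor_add_int[of "t / hs n" "int (m * steps_per_unit K n)"] by (simp add: add.commute)
  moreover have "0 \<le> \<lfloor>t / hs n\<rfloor>" using assms h by simp
  ultimately show ?thesis unfolding step_index_def by (simp add: nat_add_distrib del: of_nat_mult)
qed

lemma step_index_mono: "t' \<le> t \<Longrightarrow> step_index n t' \<le> step_index n t"
  using mesh_pos[of K n] unfolding step_index_def by (intro nat_mono floor_mono divide_right_mono) auto

lemma scheme_time_lipschitz:
  assumes "real (k + j) * hs n \<le> T"
  shows "\<bar>w n (k + j) y - w n k y\<bar> \<le> real j * hs n * (exp (K * T) * (C + T * K'))"
  using assms
proof (induction j)
  case (Suc j)
  have h: "0 < hs n" by (rule mesh_pos)
  have "real (k + j) * hs n \<le> real (k + Suc j) * hs n" using h by (intro mult_right_mono) auto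
  then have T: "real (k + j) * hs n \<le> T" using Suc.prems by linarith
  have "\<bar>w n (k + Suc j) y - w n k y\<bar> \<le> \<bar>w n (Suc (k + j)) y - w n (k + j) y\<bar> + \<bar>w n (k + j) y - w n k y\<bar>"
    by (simp del: scheme.simps)
  also have "\<dots> \<le> hs n * (exp (K * T) * (C + T * K')) + real j * hs n * (exp (K * T) * (C + T * K'))"
    by (intro add_mono scheme_time_increment Suc.IH T)
  finally show ?case by (simp add: algebra_simps)
qed simp

lemma scheme_at_times:
  assumes "0 \<le> t" "t \<le> T" "0 \<le> t'" "t' \<le> T"
  shows "\<bar>w n (step_index n t) y - w n (step_index n t') y'\<bar>
     \<le> exp (K * T) * T * K' * norm (y - y') + exp (K * T) * (C + T * K') * (\<bar>t - t'\<bar> + hs n)"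
proof -
  let ?M = "exp (K * T) * (C + T * K')"
  have h: "0 < hs n" by (rule mesh_pos)
  have M: "0 \<le> ?M" using assms C_nonneg K'_nonneg by simp
  have one: "\<bar>w n (step_index n t) y - w n (step_index n t') y\<bar> \<le> ?M * (\<bar>t - t'\<bar> + hs n)"
    if "0 \<le> t'" "t' \<le> t" "t \<le> T" for t t'
  proof -
    let ?k = "step_index n t'" and ?j = "step_index n t - step_index n t'"
    have le: "step_index n t' \<le> step_index n t" using that by (intro step_index_mono)
    have t0: "0 \<le> t" using that by linarith
    have "\<bar>w n (?k + ?j) y - w n ?k y\<bar> \<le> real ?j * hs n * ?M"
      by (rule scheme_time_lipschitz) (use le step_index_bounds(1)[OF t0, of n] that in simp)
    also have "\<dots> = (real (step_index n t) * hs n - real ?k * hs n) * ?M" using le by (simp add: of_nat_diff left_diff_distrib)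
    also have "\<dots> \<le> (\<bar>t - t'\<bar> + hs n) * ?M"
      using step_index_bounds(1)[OF t0, of n] step_index_bounds(2)[OF that(1), of n] M
      by (intro mult_right_mono) auto
    finally show ?thesis using le by (simp add: mult.commute)
  qed
  have "\<bar>w n (step_index n t) y - w n (step_index n t') y\<bar> \<le> ?M * (\<bar>t - t'\<bar> + hs n)"
    using one[of t' t] one[of t t'] assms by (cases "t' \<le> t") (auto simp: abs_minus_commute)
  moreover have "\<bar>w n (step_index n t') y - w n (step_index n t') y'\<bar> \<le> exp (K * T) * T * K' * norm (y - y')"
    by (rule scheme_lipschitz) (use step_index_bounds(1)[OF assms(3), of n] assms in linarith)
  ultimately show ?thesis by linarith
qed

text \<open>
  The equation is linear up to a term that is Lipschitz in its arguments. Averaging the scheme over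
  a small space-time region therefore yields a smooth function that solves the equation up to a
  small error; the mesh is chosen after the radius of the average.
\<close>
lemma approx_solution_exists:
  assumes T: "0 \<le> T" and \<eta>: "0 < \<eta>"
  shows "\<exists>\<Phi>. approx_solution f T \<eta> \<Phi>"
proof -
  \<comment> \<open>Besides \<open>T\<close> itself, room for the radius \<open>\<delta>\<close> of the average, for a shift by \<open>\<delta>\<close>, and for one time step.\<close>
  define T1 where "T1 = T + 2"
  define l where "l = exp (K * T1) * T1 * K'"
  define M where "M = exp (K * T1) * (C + T1 * K')"
  define U where "U = T1 * C"
  have T1: "0 \<le> T1" using T by (simp add: T1_def)
  have pos: "0 \<le> l" "0 \<le> M" "0 \<le> U" using T1 C_nonneg K'_nonneg by (auto simp: l_def M_def U_def)
  define Q where "Q = 3 * K' + K * (2 * l + 2 * M) + 2 * C + 1"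
  have Q: "Q > 0" "3 * K' + K * (2 * l + 2 * M) \<le> Q" "2 * C \<le> Q"
    using pos K_nonneg K'_nonneg C_nonneg by (auto simp: Q_def add_nonneg_pos)
  define \<delta> where "\<delta> = min (1/2) (\<eta> / (2 * Q))"
  have \<delta>: "0 < \<delta>" "\<delta> \<le> 1/2" "\<delta> * Q \<le> \<eta> / 2"
  proof -
    show "0 < \<delta>" "\<delta> \<le> 1/2" using \<eta> Q by (auto simp: \<delta>_def)
    have "\<delta> * Q \<le> \<eta> / (2 * Q) * Q" using Q by (intro mult_right_mono) (auto simp: \<delta>_def)
    then show "\<delta> * Q \<le> \<eta> / 2" using Q by simp
  qed
  have \<delta>1: "(3 * K' + K * (2 * l + 2 * M)) * \<delta> \<le> \<eta> / 2" "2 * C * \<delta> \<le> \<eta> / 2"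
  proof -
    have "(3 * K' + K * (2 * l + 2 * M)) * \<delta> \<le> Q * \<delta>" "2 * C * \<delta> \<le> Q * \<delta>"
      using \<delta>(1) by (intro mult_right_mono Q; simp)+
    moreover have "Q * \<delta> \<le> \<eta> / 2" using \<delta>(3) by (simp only: mult.commute)
    ultimately show "(3 * K' + K * (2 * l + 2 * M)) * \<delta> \<le> \<eta> / 2" "2 * C * \<delta> \<le> \<eta> / 2" by linarith+
  qed
  obtain \<rho> :: "real \<times> (real ^ 'n) \<Rightarrow> real" where \<rho>: "C2_on UNIV \<rho>" "\<And>x. 0 \<le> \<rho> x"
    "\<And>x. \<delta> < norm x \<Longrightarrow> \<rho> x = 0" "integrable lborel \<rho>" "integral\<^sup>L lborel \<rho> = 1"
    using mollifier_exists[OF \<delta>(1)] by metis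
  have c\<rho>: "continuous_on UNIV \<rho>" by (rule C2_onE[OF \<rho>(1)])
  obtain B0 where B0: "0 \<le> B0" "\<And>u U. u \<in> borel_measurable borel \<Longrightarrow> (\<And>y. \<bar>u y\<bar> \<le> U) \<Longrightarrow>
       C2_on UNIV (\<lambda>x. \<integral>y. u y * \<rho> (x - y) \<partial>lborel) \<and>
       (\<exists>F' :: real \<times> (real ^ 'n) \<Rightarrow> (real \<times> (real ^ 'n)) \<Rightarrow>\<^sub>L real. (\<forall>x. ((\<lambda>x. \<integral>y. u y * \<rho> (x - y) \<partial>lborel) has_derivative blinfun_apply (F' x)) (at x)) \<and>
            (\<forall>x v. \<bar>(\<integral>y. u y * \<rho> (x + v - y) \<partial>lborel) - (\<integral>y. u y * \<rho> (x - y) \<partial>lborel) - F' x v\<bar> \<le> U * B0 * (norm v)\<^sup>2))"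
    by (rule smooth_convolution[OF \<rho>(1,3) \<delta>(1)]) (assumption, rule that, assumption, blast)
  define B where "B = U * B0 + U"
  have B: "0 \<le> B" "U \<le> B" "U * B0 \<le> B" using pos B0(1) by (auto simp: B_def)
  have "(\<lambda>n. 1 / real (Suc n) * (K' + K * M + B) + B * small_moment (1 / real (Suc n))) \<longlonglongrightarrow> 0 * (K' + K * M + B) + B * 0"
    by (intro tendsto_intros LIMSEQ_Suc[OF lim_1_over_n] small_moment_tendsto_0)
  then have "\<forall>\<^sub>F n in sequentially. 1 / real (Suc n) * (K' + K * M + B) + B * small_moment (1 / real (Suc n)) < \<eta> / 2"
    using \<eta> by (intro order_tendstoD(2)[where y = "0 * (K' + K * M + B) + B * 0"]) auto
  then obtain n where n: "1 / real (Suc n) * (K' + K * M + B) + B * small_moment (1 / real (Suc n)) < \<eta> / 2"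
    by (meson eventually_sequentially order_refl)
  define h where "h = hs n"
  have h: "0 < h" "h \<le> 1" "h \<le> 1 / real (Suc n)" using mesh_pos[of K n] mesh_le_1[of K n] mesh_le[of K n] by (auto simp: h_def)
  have hn: "h * (K' + K * M + B) + B * small_moment (cutoff n) \<le> \<eta> / 2"
  proof -
    have "h * (K' + K * M + B) \<le> 1 / real (Suc n) * (K' + K * M + B)"
      using h(3) K_nonneg K'_nonneg pos B by (intro mult_right_mono) auto
    then show ?thesis using n unfolding cutoff_def by linarith
  qed
  define \<epsilon> where "\<epsilon> = cutoff n"
  have \<epsilon>: "0 < \<epsilon>" using cutoff_pos by (simp add: \<epsilon>_def)
  \<comment> \<open>The shift by \<open>\<delta>\<close> makes averages at times \<open>t \<ge> 0\<close> draw on nonnegative times only; the cap keeps \<open>u\<close> bounded.\<close>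
  define u where "u x = w n (step_index n (min (fst x + \<delta>) T1)) (snd x)" for x :: "real \<times> (real ^ 'n)"
  have um[measurable]: "u \<in> borel_measurable borel"
  proof -
    have "(\<lambda>x. (\<lambda>k x. w n k (snd x)) (step_index n (min (fst x + \<delta>) T1)) x) \<in> borel_measurable (borel \<Otimes>\<^sub>M borel :: (real \<times> (real ^ 'n)) measure)"
      by (rule measurable_compose_countable) (unfold step_index_def, measurable)
    then show ?thesis by (simp add: u_def[abs_def] borel_prod)
  qed
  have idx: "real (step_index n (min t T1)) * h \<le> T1" "real (step_index n (min t T1)) * h \<le> max 0 t" for t
  proof -
    have "step_index n (min t T1) \<le> step_index n (max 0 (min t T1))" by (rule step_index_mono) simp
    then have "real (step_index n (min t T1)) * h \<le> real (step_index n (max 0 (min t T1))) * h"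
      using h by (intro mult_right_mono) auto
    also have "\<dots> \<le> max 0 (min t T1)" unfolding h_def by (rule step_index_bounds) simp
    finally have *: "real (step_index n (min t T1)) * h \<le> max 0 (min t T1)" .
    then show "real (step_index n (min t T1)) * h \<le> T1" using T1 by auto
    show "real (step_index n (min t T1)) * h \<le> max 0 t" using * by auto
  qed
  have ub: "\<bar>u x\<bar> \<le> U" for x
  proof -
    have "\<bar>u x\<bar> \<le> real (step_index n (min (fst x + \<delta>) T1)) * hs n * C" unfolding u_def by (rule scheme_bound)
    also have "\<dots> \<le> U" unfolding U_def h_def[symmetric] by (intro mult_right_mono idx C_nonneg)
    finally show ?thesis .
  qed
  define \<Phi> where "\<Phi> x = (\<integral>y. u y * \<rho> (x - y) \<partial>lborel)" for x
  obtain \<Phi>' :: "real \<times> (real ^ 'n) \<Rightarrow> (real \<times> (real ^ 'n)) \<Rightarrow>\<^sub>L real" where \<Phi>':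
    "C2_on UNIV \<Phi>" "\<And>x. (\<Phi> has_derivative blinfun_apply (\<Phi>' x)) (at x)"
    "\<And>x v. \<bar>\<Phi> (x + v) - \<Phi> x - \<Phi>' x v\<bar> \<le> U * B0 * (norm v)\<^sup>2"
    using B0(2)[OF um ub] unfolding \<Phi>_def[abs_def] by blast
  have tay: "\<bar>\<Phi> (x + v) - \<Phi> x - \<Phi>' x v\<bar> \<le> B * (norm v)\<^sup>2" for x v
    using \<Phi>'(3)[of x v] mult_right_mono[OF B(3), of "(norm v)\<^sup>2"] by simp
  have \<Phi>b: "\<bar>\<Phi> x\<bar> \<le> U" for x
    using mollifier_average[OF c\<rho> \<rho>(2,3,5) um ub, where x = x and a = 0 and e = U] ub by (simp add: \<Phi>_def)
  have near: "0 \<le> fst x' + \<delta>" "fst x' + \<delta> \<le> T + 1" "\<bar>fst x' - t\<bar> \<le> \<delta>" "norm (snd x' - y) \<le> \<delta>"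
    if "0 \<le> t" "t \<le> T" "norm ((t, y) - x') \<le> \<delta>" for t y x'
  proof -
    have 1: "\<bar>t - fst x'\<bar> \<le> \<delta>" using norm_fst_le[of "t - fst x'" "y - snd x'"] that(3) by (cases x') auto
    have 2: "norm (y - snd x') \<le> \<delta>" using norm_snd_le[of "y - snd x'" "t - fst x'"] that(3) by (cases x') auto
    show "0 \<le> fst x' + \<delta>" "fst x' + \<delta> \<le> T + 1" "\<bar>fst x' - t\<bar> \<le> \<delta>" "norm (snd x' - y) \<le> \<delta>"
      using 1 2 that \<delta> by (auto simp: norm_minus_commute)
  qed
  have osc: "\<bar>u x' - u x''\<bar> \<le> l * (2 * \<delta>) + M * (2 * \<delta> + h)"
    if "0 \<le> t" "t \<le> T" "norm ((t, y) - x') \<le> \<delta>" "norm ((t, y) - x'') \<le> \<delta>" for t y x' x''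
  proof -
    note n1 = near[OF that(1,2,3)] and n2 = near[OF that(1,2,4)]
    have "\<bar>u x' - u x''\<bar> \<le> l * norm (snd x' - snd x'') + M * (\<bar>(fst x' + \<delta>) - (fst x'' + \<delta>)\<bar> + h)"
      using scheme_at_times[of "fst x' + \<delta>" T1 "fst x'' + \<delta>" n "snd x'" "snd x''"] n1 n2
      by (simp add: u_def l_def M_def h_def T1_def)
    also have "\<dots> \<le> l * (2 * \<delta>) + M * (2 * \<delta> + h)"
    proof (intro add_mono mult_left_mono pos)
      show "norm (snd x' - snd x'') \<le> 2 * \<delta>"
        using norm_triangle_ineq4[of "snd x' - y" "snd x'' - y"] n1(4) n2(4) by simp
      show "\<bar>(fst x' + \<delta>) - (fst x'' + \<delta>)\<bar> \<le> 2 * \<delta>" using n1(3) n2(3) by linarith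
    qed simp
    finally show ?thesis .
  qed
  define S where "S x = (\<integral>z. u (x + (0, z)) - u x \<partial>tail \<epsilon>)" for x
  define G where "G x = (u (x + (h, 0)) - u x) / h - S x" for x
  have S: "S \<in> borel_measurable borel" "\<And>x. \<bar>S x\<bar> \<le> tail_mass \<epsilon> * (2 * U)"
    "\<And>x. (\<integral>z. \<Phi> (x + (0, z)) - \<Phi> x \<partial>tail \<epsilon>) = (\<integral>y. S y * \<rho> (x - y) \<partial>lborel)"
    using convolution_commutes_with_tail[OF \<epsilon> c\<rho> \<rho>(3) um ub] by (auto simp: S_def[abs_def] \<Phi>_def)
  have um': "(\<lambda>x. u (x + (h, 0))) \<in> borel_measurable borel" by measurable
  have Gm: "G \<in> borel_measurable borel" unfolding G_def[abs_def] using S(1) um' by measurable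
  have Gb: "\<bar>G x\<bar> \<le> 2 * U / h + tail_mass \<epsilon> * (2 * U)" for x
  proof -
    have "\<bar>u (x + (h, 0)) - u x\<bar> \<le> 2 * U" using ub[of x] ub[of "x + (h, 0)"] by linarith
    then have "\<bar>(u (x + (h, 0)) - u x) / h\<bar> \<le> 2 * U / h" using h by (simp add: abs_divide divide_right_mono)
    then show ?thesis using S(2)[of x] unfolding G_def by linarith
  qed
  \<comment> \<open>The scheme, read as an equation for its interpolation \<open>u\<close> near the times of interest.\<close>
  have Geq: "G x' = f (real (step_index n (fst x' + \<delta>)) * h) (snd x') (u x')"
    if "0 \<le> t" "t \<le> T" "norm ((t, y) - x') \<le> \<delta>" for t y x'
  proof -
    note n1 = near[OF that]
    let ?k = "step_index n (fst x' + \<delta>)"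
    have u1: "u x' = w n ?k (snd x')" "u (x' + (0, z)) = w n ?k (snd x' + z)" for z
      using n1 by (simp_all add: u_def T1_def)
    have "step_index n (fst x' + h + \<delta>) = Suc ?k"
      using step_index_Suc[OF n1(1), of n] by (simp add: h_def add_ac)
    moreover have "min (fst x' + h + \<delta>) T1 = fst x' + h + \<delta>" using n1 h by (simp add: T1_def)
    ultimately have "u (x' + (h, 0)) = w n (Suc ?k) (snd x')" by (simp add: u_def del: scheme.simps)
    then have "u (x' + (h, 0)) - u x' = h * (S x' + f (real ?k * h) (snd x') (u x'))"
      by (simp add: step_def S_def u1 \<epsilon>_def h_def)
    then show ?thesis using h by (simp add: G_def)
  qed
  have eq: "(\<Phi> (x + (h, 0)) - \<Phi> x) / h = (\<integral>z. \<Phi> (x + (0, z)) - \<Phi> x \<partial>tail \<epsilon>) + (\<integral>y. G y * \<rho> (x - y) \<partial>lborel)" for x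
  proof -
    have iS: "integrable lborel (\<lambda>y. S y * \<rho> (x - y))" by (rule convolution_integrand[OF S(1,2) c\<rho> \<rho>(3)])
    have iG: "integrable lborel (\<lambda>y. G y * \<rho> (x - y))" by (rule convolution_integrand[OF Gm Gb c\<rho> \<rho>(3)])
    have iu: "integrable lborel (\<lambda>y. u y * \<rho> (x - y))" by (rule convolution_integrand[OF um ub c\<rho> \<rho>(3)])
    have iu': "integrable lborel (\<lambda>y. u (y + (h, 0)) * \<rho> (x - y))" by (rule convolution_integrand[OF um' ub c\<rho> \<rho>(3)])
    have "\<Phi> (x + (h, 0)) = (\<integral>y. u (y + (h, 0)) * \<rho> (x - y) \<partial>lborel)"
      using lborel_integral_translate[of "\<lambda>y. u y * \<rho> (x + (h, 0) - y)" "(h, 0)"] by (simp add: \<Phi>_def algebra_simps)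
    then have "\<Phi> (x + (h, 0)) - \<Phi> x = (\<integral>y. u (y + (h, 0)) * \<rho> (x - y) - u y * \<rho> (x - y) \<partial>lborel)"
      using Bochner_Integration.integral_diff[OF iu' iu] by (simp add: \<Phi>_def)
    also have "\<dots> = (\<integral>y. h * (S y * \<rho> (x - y) + G y * \<rho> (x - y)) \<partial>lborel)"
      using h by (intro Bochner_Integration.integral_cong) (auto simp: G_def field_simps)
    also have "\<dots> = h * ((\<integral>y. S y * \<rho> (x - y) \<partial>lborel) + (\<integral>y. G y * \<rho> (x - y) \<partial>lborel))"
      using Bochner_Integration.integral_add[OF iS iG] by simp
    finally show ?thesis using h S(3)[of x] by simp
  qed
  have "approx_solution f T \<eta> \<Phi>"
    unfolding approx_solution_def
  proof (intro conjI exI[of _ \<Phi>'] exI[of _ B] allI ballI)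
    show "C2_on UNIV \<Phi>" "(\<Phi> has_derivative blinfun_apply (\<Phi>' z)) (at z)" "\<bar>\<Phi> (z + v) - \<Phi> z - \<Phi>' z v\<bar> \<le> B * (norm v)\<^sup>2" for z v
      using \<Phi>'(1,2) tay by auto
    show "\<bar>\<Phi> z\<bar> \<le> B" for z using \<Phi>b[of z] B by linarith
    show "\<bar>\<Phi> (0, y)\<bar> \<le> \<eta>" for y
    proof -
      have "\<bar>\<Phi> (0, y) - 0\<bar> \<le> 2 * C * \<delta>"
        unfolding \<Phi>_def
      proof (rule mollifier_average[OF c\<rho> \<rho>(2,3,5) um ub])
        fix x' :: "real \<times> (real ^ 'n)" assume x': "norm ((0, y) - x') \<le> \<delta>"
        note n1 = near[OF order_refl T x']
        have "\<bar>u x'\<bar> \<le> real (step_index n (min (fst x' + \<delta>) T1)) * hs n * C" unfolding u_def by (rule scheme_bound)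
        also have "\<dots> \<le> (2 * \<delta>) * C"
          using n1 idx(2)[of "fst x' + \<delta>"] \<delta> unfolding h_def[symmetric] by (intro mult_right_mono C_nonneg) auto
        finally show "\<bar>u x' - 0\<bar> \<le> 2 * C * \<delta>" by (simp add: mult_ac)
      qed
      then show ?thesis using \<delta>1(2) \<eta> by simp
    qed
    fix t and y :: "real ^ 'n" assume "t \<in> {0..T}"
    then have t: "0 \<le> t" "t \<le> T" by auto
    let ?x = "(t, y)"
    define e where "e = l * (2 * \<delta>) + M * (2 * \<delta> + h)"
    \<comment> \<open>Three errors: \<open>e1\<close> from averaging the nonlinearity, \<open>e2\<close> from the time step, \<open>e3\<close> from the truncation.\<close>
    have e1: "\<bar>(\<integral>y. G y * \<rho> (?x - y) \<partial>lborel) - f t y (\<Phi> ?x)\<bar> \<le> K' * (3 * \<delta> + h) + K * e"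
    proof (rule mollifier_average[OF c\<rho> \<rho>(2,3,5) Gm Gb])
      fix x' assume x': "norm (?x - x') \<le> \<delta>"
      note n1 = near[OF t x']
      let ?k = "step_index n (fst x' + \<delta>)"
      have "\<bar>\<Phi> ?x - u x'\<bar> \<le> e"
        unfolding \<Phi>_def e_def
      proof (rule mollifier_average[OF c\<rho> \<rho>(2,3,5) um ub])
        fix x'' assume "norm (?x - x'') \<le> \<delta>"
        then show "\<bar>u x'' - u x'\<bar> \<le> l * (2 * \<delta>) + M * (2 * \<delta> + h)" by (rule osc[OF t _ x'])
      qed
      moreover have "\<bar>real ?k * h - t\<bar> + norm (snd x' - y) \<le> 3 * \<delta> + h"
        unfolding h_def using step_index_bounds[OF n1(1), of n] n1(3,4) \<delta>(1) mesh_pos[of K n] by linarith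
      ultimately have "K' * (\<bar>real ?k * h - t\<bar> + norm (snd x' - y)) + K * \<bar>u x' - \<Phi> ?x\<bar> \<le> K' * (3 * \<delta> + h) + K * e"
        by (intro add_mono[OF mult_left_mono[OF _ K'_nonneg] mult_left_mono[OF _ K_nonneg]]) (simp_all only: abs_minus_commute)
      moreover have "\<bar>f (real ?k * h) (snd x') (u x') - f t y (\<Phi> ?x)\<bar> \<le> K' * (\<bar>real ?k * h - t\<bar> + norm (snd x' - y)) + K * \<bar>u x' - \<Phi> ?x\<bar>"
        by (rule f_lip_both) (use h t in auto)
      ultimately show "\<bar>G x' - f t y (\<Phi> ?x)\<bar> \<le> K' * (3 * \<delta> + h) + K * e"
        using Geq[OF t x'] by linarith
    qed
    have e2: "\<bar>(\<Phi> (?x + (h, 0)) - \<Phi> ?x) / h - \<Phi>' ?x (1, 0)\<bar> \<le> B * h"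
    proof -
      have "\<Phi>' ?x (h, 0) = h * \<Phi>' ?x (1, 0)" using blinfun.scaleR_right[of "\<Phi>' ?x" h "(1, 0)"] by simp
      moreover have D: "h * ((\<Phi> (?x + (h, 0)) - \<Phi> ?x) / h - \<Phi>' ?x (1, 0)) = \<Phi> (?x + (h, 0)) - \<Phi> ?x - h * \<Phi>' ?x (1, 0)"
      proof -
        have "h * (a / h - b) = a - h * b" for a b using h by (simp add: right_diff_distrib)
        then show ?thesis .
      qed
      ultimately have "\<bar>h * ((\<Phi> (?x + (h, 0)) - \<Phi> ?x) / h - \<Phi>' ?x (1, 0))\<bar> \<le> B * h\<^sup>2"
        using tay[of ?x "(h, 0)"] h by (subst D) (simp add: norm_Pair)
      then have "h * \<bar>(\<Phi> (?x + (h, 0)) - \<Phi> ?x) / h - \<Phi>' ?x (1, 0)\<bar> \<le> h * (B * h)"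
        using h by (simp only: abs_mult power2_eq_square) (simp add: mult_ac)
      then show ?thesis using h by (simp only: mult_le_cancel_left_pos)
    qed
    have e3: "\<bar>(\<integral>z. \<Phi> (?x + (0, z)) - \<Phi> ?x \<partial>tail \<epsilon>) - levy_op (\<lambda>x. \<Phi> (t, x)) y\<bar> \<le> B * small_moment \<epsilon>"
    proof -
      have "continuous_on UNIV \<Phi>" by (rule C2_onE[OF \<Phi>'(1)])
      then have "continuous_on UNIV (\<lambda>x. \<Phi> (t, x))" by (rule continuous_on_compose2) (auto intro: continuous_intros)
      then have m: "(\<lambda>x. \<Phi> (t, x)) \<in> borel_measurable borel" by (rule borel_measurable_continuous_onI)
      have "\<bar>\<Phi> (t, y + z) - \<Phi> (t, y) - space_gradient (\<Phi>' ?x) \<bullet> z\<bar> \<le> B * (norm z)\<^sup>2" for z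
        using tay[of ?x "(0, z)"] by (simp add: space_gradient_inner norm_Pair)
      from levy_op_split(4)[OF \<epsilon> m \<Phi>b this] show ?thesis by simp
    qed
    have "K' * (3 * \<delta> + h) + K * e + B * h + B * small_moment \<epsilon> = (3 * K' + K * (2 * l + 2 * M)) * \<delta> + (h * (K' + K * M + B) + B * small_moment (cutoff n))"
      by (simp add: e_def \<epsilon>_def algebra_simps)
    also have "\<dots> \<le> \<eta>" using \<delta>1(1) hn by linarith
    finally show "\<bar>\<Phi>' (t, y) (1, 0) - levy_op (\<lambda>x. \<Phi> (t, x)) y - f t y (\<Phi> (t, y))\<bar> \<le> \<eta>"
      using e1 e2 e3 eq[of ?x] by linarith
  qed
  then show ?thesis by blast
qed

end

section \<open>Convergence of the scheme\<close>

lemma approx_solutionE: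
  fixes g :: "real ^ 'n \<Rightarrow> real"
  assumes "levy_kernel.approx_solution g s f T \<eta> \<Phi>" "levy_kernel g s"
  obtains \<Phi>' B where "C2_on UNIV \<Phi>" "\<And>z. (\<Phi> has_derivative blinfun_apply (\<Phi>' z)) (at z)" "\<And>z. \<bar>\<Phi> z\<bar> \<le> B"
    "\<And>z v. \<bar>\<Phi> (z + v) - \<Phi> z - \<Phi>' z v\<bar> \<le> B * (norm v)\<^sup>2" "0 \<le> B"
    "\<And>t y. 0 \<le> t \<Longrightarrow> t \<le> T \<Longrightarrow> \<bar>\<Phi>' (t, y) (1, 0) - levy_kernel.levy_op g s (\<lambda>x. \<Phi> (t, x)) y - f t y (\<Phi> (t, y))\<bar> \<le> \<eta>"
    "\<And>y. \<bar>\<Phi> (0, y)\<bar> \<le> \<eta>"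
proof -
  from assms(1) obtain \<Phi>' B where P: "C2_on UNIV \<Phi>" "\<forall>z. (\<Phi> has_derivative blinfun_apply (\<Phi>' z)) (at z)" "\<forall>z. \<bar>\<Phi> z\<bar> \<le> B"
    "\<forall>z v. \<bar>\<Phi> (z + v) - \<Phi> z - \<Phi>' z v\<bar> \<le> B * (norm v)\<^sup>2"
    "\<forall>t\<in>{0..T}. \<forall>y. \<bar>\<Phi>' (t, y) (1, 0) - levy_kernel.levy_op g s (\<lambda>x. \<Phi> (t, x)) y - f t y (\<Phi> (t, y))\<bar> \<le> \<eta>"
    "\<forall>y. \<bar>\<Phi> (0, y)\<bar> \<le> \<eta>"
    unfolding levy_kernel.approx_solution_def[OF assms(2)] by blast
  have "0 \<le> B" using P(3) by (meson abs_ge_zero order_trans)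
  then show thesis using that[of \<Phi>' B] P by (metis atLeastAtMost_iff)
qed

context levy_equation
begin

lemma approx_solution_split:
  fixes \<Phi>' :: "real \<times> (real ^ 'n) \<Rightarrow> (real \<times> (real ^ 'n)) \<Rightarrow>\<^sub>L real"
  assumes "\<And>z v. \<bar>\<Phi> (z + v) - \<Phi> z - \<Phi>' z v\<bar> \<le> B * (norm v)\<^sup>2" "\<And>z. \<bar>\<Phi> z\<bar> \<le> B" "continuous_on UNIV \<Phi>" "0 < r"
  shows "\<bar>(\<integral>z. \<Phi> (t, y + z) - \<Phi> (t, y) \<partial>tail r) - levy_op (\<lambda>x. \<Phi> (t, x)) y\<bar> \<le> B * small_moment r"
proof -
  have "continuous_on UNIV (\<lambda>x. \<Phi> (t, x))" by (rule continuous_on_compose2[OF assms(3)]) (auto intro: continuous_intros)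
  then have m: "(\<lambda>x. \<Phi> (t, x)) \<in> borel_measurable borel" by (rule borel_measurable_continuous_onI)
  have "\<bar>\<Phi> (t, y + z) - \<Phi> (t, y) - space_gradient (\<Phi>' (t, y)) \<bullet> z\<bar> \<le> B * (norm z)\<^sup>2" for z
    using assms(1)[of "(t, y)" "(0, z)"] by (simp add: space_gradient_inner norm_Pair)
  from levy_op_split(4)[OF assms(4) m assms(2) this] show ?thesis by simp
qed

definition stability_constant :: "real \<Rightarrow> real" where
  "stability_constant T = exp (K * T) * (1 + 2 * T) + 1"

lemma stability_constant_pos: "0 \<le> T \<Longrightarrow> 0 < stability_constant T"
  by (simp add: stability_constant_def add_nonneg_pos)

text \<open>
  A smooth approximate solution nearly satisfies every scheme that is fine enough compared with its
  second derivatives, hence stays close to the solution of that scheme.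
\<close>
lemma scheme_near_approx_solution:
  assumes \<Phi>: "approx_solution f T \<eta> \<Phi>" and \<eta>: "0 < \<eta>" and T: "0 \<le> T"
  shows "\<exists>n0. \<forall>n\<ge>n0. \<forall>t\<in>{0..T}. \<forall>y. \<bar>w n (step_index n t) y - \<Phi> (t, y)\<bar> \<le> stability_constant T * \<eta>"
proof -
  obtain \<Phi>' B where P: "C2_on UNIV \<Phi>" "\<And>z. (\<Phi> has_derivative blinfun_apply (\<Phi>' z)) (at z)" "\<And>z. \<bar>\<Phi> z\<bar> \<le> B"
    "\<And>z v. \<bar>\<Phi> (z + v) - \<Phi> z - \<Phi>' z v\<bar> \<le> B * (norm v)\<^sup>2" "0 \<le> B"
    "\<And>t y. 0 \<le> t \<Longrightarrow> t \<le> T \<Longrightarrow> \<bar>\<Phi>' (t, y) (1, 0) - levy_op (\<lambda>x. \<Phi> (t, x)) y - f t y (\<Phi> (t, y))\<bar> \<le> \<eta>"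
    "\<And>y. \<bar>\<Phi> (0, y)\<bar> \<le> \<eta>"
    by (rule approx_solutionE[OF \<Phi> levy_kernel_axioms]) blast
  have c\<Phi>: "continuous_on UNIV \<Phi>" by (rule C2_onE[OF P(1)])
  have "(\<lambda>n. 1 / real (Suc n) * (4 * B) + B * small_moment (1 / real (Suc n))) \<longlonglongrightarrow> 0 * (4 * B) + B * 0"
    by (intro tendsto_intros LIMSEQ_Suc[OF lim_1_over_n] small_moment_tendsto_0)
  then have "\<forall>\<^sub>F n in sequentially. 1 / real (Suc n) * (4 * B) + B * small_moment (1 / real (Suc n)) < \<eta>"
    using \<eta> by (intro order_tendstoD(2)[where y = "0 * (4 * B) + B * 0"]) auto
  then obtain n0 where n0: "\<And>n. n \<ge> n0 \<Longrightarrow> 1 / real (Suc n) * (4 * B) + B * small_moment (1 / real (Suc n)) < \<eta>"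
    unfolding eventually_sequentially by blast
  have "\<bar>w n (step_index n t) y - \<Phi> (t, y)\<bar> \<le> stability_constant T * \<eta>" if n: "n \<ge> n0" and t: "0 \<le> t" "t \<le> T" for n t y
  proof -
    define h where "h = hs n"
    have h: "0 < h" "h \<le> 1" "h \<le> 1 / real (Suc n)" using mesh_pos[of K n] mesh_le_1[of K n] mesh_le[of K n] by (auto simp: h_def)
    have small: "4 * (B * h) + B * small_moment (cutoff n) \<le> \<eta>"
    proof -
      have "h * (4 * B) \<le> 1 / real (Suc n) * (4 * B)" using h P(5) by (intro mult_right_mono) auto
      moreover have "h * (4 * B) = 4 * (B * h)" by simp
      ultimately show ?thesis using n0[OF n] unfolding cutoff_def by linarith
    qed
    have sm: "0 \<le> B * small_moment (cutoff n)" using P(5) small_moment_nonneg by simp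
    have Bh: "0 \<le> B * h" using P(5) h by simp
    define v where "v k y = \<Phi> (real k * h, y)" for k and y :: "real ^ 'n"
    have cons: "\<bar>v (Suc k) y - step (cutoff n) h (f (real k * h)) (v k) y\<bar> \<le> h * (2 * \<eta>)"
      if k: "real k * h \<le> T" for k y
    proof -
      let ?x = "(real k * h, y)"
      let ?I = "\<integral>z. \<Phi> (real k * h, y + z) - \<Phi> ?x \<partial>tail (cutoff n)"
      have kh: "0 \<le> real k * h" using h by simp
      have e1: "\<bar>?I - levy_op (\<lambda>x. \<Phi> (real k * h, x)) y\<bar> \<le> B * small_moment (cutoff n)"
        by (rule approx_solution_split[OF P(4) P(3) c\<Phi> cutoff_pos(1)])
      have "\<Phi>' ?x (h, 0) = h * \<Phi>' ?x (1, 0)" using blinfun.scaleR_right[of "\<Phi>' ?x" h "(1, 0)"] by simp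
      then have e2: "\<bar>v (Suc k) y - v k y - h * \<Phi>' ?x (1, 0)\<bar> \<le> h * (B * h)"
        using P(4)[of ?x "(h, 0)"] h by (simp add: v_def norm_Pair power2_eq_square algebra_simps)
      have "\<bar>\<Phi>' ?x (1, 0) - (?I + f (real k * h) y (\<Phi> ?x))\<bar> \<le> \<eta> + B * small_moment (cutoff n)"
        using e1 P(6)[OF kh k, of y] by linarith
      then have "\<bar>h * (\<Phi>' ?x (1, 0) - (?I + f (real k * h) y (\<Phi> ?x)))\<bar> \<le> h * (\<eta> + B * small_moment (cutoff n))"
        using h by (simp only: abs_mult) (simp add: mult_left_mono)
      moreover have "step (cutoff n) h (f (real k * h)) (v k) y = v k y + h * (?I + f (real k * h) y (\<Phi> ?x))"
        by (simp add: step_def v_def)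
      ultimately have "\<bar>v (Suc k) y - step (cutoff n) h (f (real k * h)) (v k) y\<bar> \<le> h * (B * h) + h * (\<eta> + B * small_moment (cutoff n))"
        using e2 unfolding right_diff_distrib by linarith
      also have "\<dots> = h * (B * h + B * small_moment (cutoff n) + \<eta>)" by (simp add: algebra_simps)
      also have "\<dots> \<le> h * (2 * \<eta>)" using small h Bh by (intro mult_left_mono) auto
      finally show ?thesis .
    qed
    let ?N = "step_index n t"
    have N: "real ?N * h \<le> t" "t < real ?N * h + h" using step_index_bounds[OF t(1), of n] by (auto simp: h_def)
    have kN: "real k * h \<le> T" if "k < ?N" for k
    proof -
      have "real k * h \<le> real ?N * h" using that h by (intro mult_right_mono) auto
      then show ?thesis using N t by linarith
    qed
    have vm: "v k \<in> borel_measurable borel" for k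
    proof -
      have "continuous_on UNIV (v k)" unfolding v_def by (rule continuous_on_compose2[OF c\<Phi>]) (auto intro: continuous_intros)
      then show ?thesis by (rule borel_measurable_continuous_onI)
    qed
    have vb: "\<bar>v k x\<bar> \<le> B" for k x using P(3) by (simp add: v_def)
    have init: "\<bar>v 0 y\<bar> \<le> \<eta>" for y using P(7) by (simp add: v_def)
    have "v ?N y \<le> w n ?N y + exp (K * (real ?N * hs n)) * (\<eta> + real ?N * hs n * (2 * \<eta>))"
    proof (rule scheme_compare(1)[OF vm vb _ _ order_refl])
      show "v (Suc k) y \<le> step (cutoff n) (hs n) (f (real k * hs n)) (v k) y + hs n * (2 * \<eta>)" if "k < ?N" for k y
        using cons[OF kN[OF that], of y] unfolding h_def by linarith
      show "v 0 y \<le> \<eta>" for y using init[of y] by linarith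
    qed (use \<eta> in auto)
    moreover have "w n ?N y \<le> v ?N y + exp (K * (real ?N * hs n)) * (\<eta> + real ?N * hs n * (2 * \<eta>))"
    proof (rule scheme_compare(2)[OF vm vb _ _ order_refl])
      show "step (cutoff n) (hs n) (f (real k * hs n)) (v k) y - hs n * (2 * \<eta>) \<le> v (Suc k) y" if "k < ?N" for k y
        using cons[OF kN[OF that], of y] unfolding h_def by linarith
      show "- \<eta> \<le> v 0 y" for y using init[of y] by linarith
    qed (use \<eta> in auto)
    moreover have "exp (K * (real ?N * hs n)) * (\<eta> + real ?N * hs n * (2 * \<eta>)) \<le> exp (K * T) * (\<eta> + T * (2 * \<eta>))"
    proof (rule mult_mono)
      have NT: "real ?N * hs n \<le> T" using N t by (simp add: h_def)
      show "exp (K * (real ?N * hs n)) \<le> exp (K * T)" using NT K_nonneg by (simp add: mult_left_mono)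
      have "real ?N * hs n * (2 * \<eta>) \<le> T * (2 * \<eta>)" using NT \<eta> by (intro mult_right_mono) auto
      then show "\<eta> + real ?N * hs n * (2 * \<eta>) \<le> \<eta> + T * (2 * \<eta>)" by simp
      show "0 \<le> \<eta> + real ?N * hs n * (2 * \<eta>)" using \<eta> time_nonneg[of ?N n] by simp
    qed simp
    moreover have "\<bar>\<Phi> (t, y) - v ?N y\<bar> \<le> \<eta>"
    proof -
      define r where "r = t - real ?N * h"
      have r: "0 \<le> r" "r \<le> h" using N by (auto simp: r_def)
      let ?x = "(real ?N * h, y)"
      have "\<bar>\<Phi>' ?x (1, 0)\<bar> \<le> 3 * B"
        using P(4)[of ?x "(1, 0)"] P(3)[of ?x] P(3)[of "?x + (1, 0)"] by (simp add: norm_Pair)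
      then have "r * \<bar>\<Phi>' ?x (1, 0)\<bar> \<le> h * (3 * B)" using r h by (intro mult_mono) auto
      moreover have "\<Phi>' ?x (r, 0) = r * \<Phi>' ?x (1, 0)" using blinfun.scaleR_right[of "\<Phi>' ?x" r "(1, 0)"] by simp
      ultimately have d: "\<bar>\<Phi>' ?x (r, 0)\<bar> \<le> 3 * (B * h)" using r by (simp add: abs_mult mult_ac)
      have "r * r \<le> h * 1" using r h by (intro mult_mono) auto
      then have "B * (r * r) \<le> B * h" using P(5) by (intro mult_left_mono) auto
      moreover have "\<bar>\<Phi> (t, y) - v ?N y - \<Phi>' ?x (r, 0)\<bar> \<le> B * (r * r)"
        using P(4)[of ?x "(r, 0)"] r by (simp add: v_def norm_Pair r_def power2_eq_square)
      ultimately have "\<bar>\<Phi> (t, y) - v ?N y\<bar> \<le> 4 * (B * h)" using d by linarith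
      then show ?thesis using small sm by linarith
    qed
    moreover have "exp (K * T) * (\<eta> + T * (2 * \<eta>)) + \<eta> = stability_constant T * \<eta>"
      by (simp add: stability_constant_def algebra_simps)
    ultimately show ?thesis by linarith
  qed
  then show ?thesis by (intro exI[of _ n0]) auto
qed

definition sol :: "real \<times> (real ^ 'n) \<Rightarrow> real" where
  "sol z = lim (\<lambda>n. w n (step_index n (fst z)) (snd z))"

text \<open>
  All sufficiently fine schemes are close to one and the same approximate solution, hence close to
  each other.
\<close>
lemma sol_LIMSEQ:
  assumes t: "0 \<le> t"
  shows "(\<lambda>n. w n (step_index n t) y) \<longlonglongrightarrow> sol (t, y)"
proof -
  have "Cauchy (\<lambda>n. w n (step_index n t) y)"
  proof (rule metric_CauchyI)
    fix e :: real assume e: "0 < e"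
    define \<eta> where "\<eta> = e / (3 * stability_constant t)"
    have \<eta>: "0 < \<eta>" "stability_constant t * \<eta> = e / 3" using e stability_constant_pos[OF t] by (auto simp: \<eta>_def)
    obtain \<Phi> where \<Phi>: "approx_solution f t \<eta> \<Phi>" using approx_solution_exists[OF t \<eta>(1)] by blast
    obtain n0 where n0: "\<And>n. n \<ge> n0 \<Longrightarrow> \<bar>w n (step_index n t) y - \<Phi> (t, y)\<bar> \<le> e / 3"
    proof -
      obtain n0 where "\<forall>n\<ge>n0. \<forall>ta\<in>{0..t}. \<forall>y. \<bar>w n (step_index n ta) y - \<Phi> (ta, y)\<bar> \<le> stability_constant t * \<eta>"
        using scheme_near_approx_solution[OF \<Phi> \<eta>(1) t] by blast
      then show thesis using that[of n0] t unfolding \<eta>(2) by simp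
    qed
    have "dist (w m (step_index m t) y) (w n (step_index n t) y) < e" if "m \<ge> n0" "n \<ge> n0" for m n
      using n0[OF that(1)] n0[OF that(2)] e unfolding dist_real_def by linarith
    then show "\<exists>M. \<forall>m\<ge>M. \<forall>n\<ge>M. dist (w m (step_index m t) y) (w n (step_index n t) y) < e" by blast
  qed
  then have "convergent (\<lambda>n. w n (step_index n t) y)" by (rule Cauchy_convergent)
  then show ?thesis by (simp add: sol_def convergent_LIMSEQ_iff)
qed

lemma sol_near_approx_solution:
  assumes "approx_solution f T \<eta> \<Phi>" "0 < \<eta>" "0 \<le> t" "t \<le> T"
  shows "\<bar>sol (t, y) - \<Phi> (t, y)\<bar> \<le> stability_constant T * \<eta>"
proof (rule LIMSEQ_le_const2)
  show "(\<lambda>n. \<bar>w n (step_index n t) y - \<Phi> (t, y)\<bar>) \<longlonglongrightarrow> \<bar>sol (t, y) - \<Phi> (t, y)\<bar>"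
    by (intro tendsto_intros sol_LIMSEQ assms)
  have T: "0 \<le> T" using assms by linarith
  show "\<exists>N. \<forall>n\<ge>N. \<bar>w n (step_index n t) y - \<Phi> (t, y)\<bar> \<le> stability_constant T * \<eta>"
  proof -
    obtain n0 where "\<forall>n\<ge>n0. \<forall>t\<in>{0..T}. \<forall>y. \<bar>w n (step_index n t) y - \<Phi> (t, y)\<bar> \<le> stability_constant T * \<eta>"
      using scheme_near_approx_solution[OF assms(1,2) T] by blast
    then show ?thesis using assms(3,4) by (intro exI[of _ n0]) simp
  qed
qed

lemma mesh_tendsto_0: "hs \<longlonglongrightarrow> 0"
proof (rule tendsto_sandwich[of "\<lambda>_. 0" _ _ "\<lambda>n. 1 / real (Suc n)"])
  show "(\<lambda>n. 1 / real (Suc n)) \<longlonglongrightarrow> 0" by (rule LIMSEQ_Suc[OF lim_1_over_n])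
  show "\<forall>\<^sub>F n in sequentially. 0 \<le> hs n" using mesh_pos[of K] by (intro always_eventually allI less_imp_le)
  show "\<forall>\<^sub>F n in sequentially. hs n \<le> 1 / real (Suc n)" using mesh_le[of K] by (intro always_eventually allI)
qed simp

lemma sol_lipschitz:
  assumes "0 \<le> t" "t \<le> T" "0 \<le> t'" "t' \<le> T"
  shows "\<bar>sol (t, y) - sol (t', y')\<bar> \<le> exp (K * T) * T * K' * norm (y - y') + exp (K * T) * (C + T * K') * \<bar>t - t'\<bar>"
proof (rule LIMSEQ_le)
  show "(\<lambda>n. \<bar>w n (step_index n t) y - w n (step_index n t') y'\<bar>) \<longlonglongrightarrow> \<bar>sol (t, y) - sol (t', y')\<bar>"
    by (intro tendsto_intros sol_LIMSEQ assms)
  have "(\<lambda>n. exp (K * T) * T * K' * norm (y - y') + exp (K * T) * (C + T * K') * (\<bar>t - t'\<bar> + hs n)) \<longlonglongrightarrow> exp (K * T) * T * K' * norm (y - y') + exp (K * T) * (C + T * K') * (\<bar>t - t'\<bar> + 0)"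
    by (intro tendsto_intros mesh_tendsto_0)
  then show "(\<lambda>n. exp (K * T) * T * K' * norm (y - y') + exp (K * T) * (C + T * K') * (\<bar>t - t'\<bar> + hs n)) \<longlonglongrightarrow> exp (K * T) * T * K' * norm (y - y') + exp (K * T) * (C + T * K') * \<bar>t - t'\<bar>"
    by simp
  show "\<exists>N. \<forall>n\<ge>N. \<bar>w n (step_index n t) y - w n (step_index n t') y'\<bar> \<le> exp (K * T) * T * K' * norm (y - y') + exp (K * T) * (C + T * K') * (\<bar>t - t'\<bar> + hs n)"
    using scheme_at_times[OF assms] by blast
qed

lemma sol_bound:
  assumes "0 \<le> t"
  shows "\<bar>sol (t, y)\<bar> \<le> t * C"
proof (rule LIMSEQ_le_const2)
  show "(\<lambda>n. \<bar>w n (step_index n t) y\<bar>) \<longlonglongrightarrow> \<bar>sol (t, y)\<bar>"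
    by (intro tendsto_intros sol_LIMSEQ assms)
  have "\<bar>w n (step_index n t) y\<bar> \<le> t * C" for n
    using scheme_bound[of n "step_index n t" y] mult_right_mono[OF step_index_bounds(1)[OF assms, of n] C_nonneg] by linarith
  then show "\<exists>N. \<forall>n\<ge>N. \<bar>w n (step_index n t) y\<bar> \<le> t * C" by blast
qed

lemma sol_continuous: "continuous_on spacetime sol"
  unfolding continuous_on_sequentially
proof (intro allI ballI impI, elim conjE)
  fix X :: "nat \<Rightarrow> real \<times> (real ^ 'n)" and a assume a: "a \<in> spacetime" and X: "\<forall>n. X n \<in> spacetime" and lim: "X \<longlonglongrightarrow> a"
  obtain t y where ty: "a = (t, y)" by (cases a)
  have t0: "0 \<le> t" using a by (simp add: ty spacetime_def)
  define T where "T = t + 1"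
  define l where "l = exp (K * T) * T * K'"
  define M where "M = exp (K * T) * (C + T * K')"
  have f1: "(\<lambda>n. fst (X n)) \<longlonglongrightarrow> t" and s1: "(\<lambda>n. snd (X n)) \<longlonglongrightarrow> y"
    using tendsto_fst[OF lim] tendsto_snd[OF lim] by (auto simp: ty)
  have ev: "\<forall>\<^sub>F n in sequentially. fst (X n) < T" using order_tendstoD(2)[OF f1, of T] by (simp add: T_def)
  have "(\<lambda>n. sol (X n) - sol a) \<longlonglongrightarrow> 0"
  proof (rule Lim_null_comparison)
    show "\<forall>\<^sub>F n in sequentially. norm (sol (X n) - sol a) \<le> l * norm (snd (X n) - y) + M * \<bar>fst (X n) - t\<bar>"
      using ev
    proof eventually_elim
      case (elim n)
      have "0 \<le> fst (X n)" using X by (metis spacetime_def mem_Times_iff atLeast_iff)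
      then show ?case using sol_lipschitz[of "fst (X n)" T t "snd (X n)" y] elim t0 by (simp add: ty l_def M_def T_def)
    qed
    have "(\<lambda>n. l * norm (snd (X n) - y) + M * \<bar>fst (X n) - t\<bar>) \<longlonglongrightarrow> l * norm (y - y) + M * \<bar>t - t\<bar>"
      by (intro tendsto_intros f1 s1)
    then show "(\<lambda>n. l * norm (snd (X n) - y) + M * \<bar>fst (X n) - t\<bar>) \<longlonglongrightarrow> 0" by simp
  qed
  then show "(sol \<circ> X) \<longlonglongrightarrow> sol a" by (simp add: o_def LIM_zero_iff)
qed

end

section \<open>Comparison with viscosity subsolutions\<close>

lemma C2_spacetimeE:
  fixes \<phi> :: "real \<times> (real ^ 'n) \<Rightarrow> real"
  assumes "C2_on spacetime \<phi>"
  obtains \<phi>' where "\<And>t x. 0 < t \<Longrightarrow> (\<phi> has_derivative blinfun_apply (\<phi>' (t, x))) (at (t, x))"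
    "continuous_on spacetime \<phi>" "continuous_on spacetime \<phi>'"
    "\<And>S. compact S \<Longrightarrow> convex S \<Longrightarrow> S \<subseteq> spacetime \<Longrightarrow> \<exists>B\<ge>0. \<forall>x v. x \<in> S \<longrightarrow> x + v \<in> S \<longrightarrow> \<bar>\<phi> (x + v) - \<phi> x - \<phi>' x v\<bar> \<le> B * (norm v)\<^sup>2"
proof -
  obtain \<phi>' \<phi>'' where f:
      "\<And>x. x \<in> spacetime \<Longrightarrow> (\<phi> has_derivative blinfun_apply (\<phi>' x)) (at x within spacetime)"
    "\<And>x. x \<in> spacetime \<Longrightarrow> (\<phi>' has_derivative blinfun_apply (\<phi>'' x)) (at x within spacetime)"
    "continuous_on spacetime \<phi>''" "continuous_on spacetime \<phi>" "continuous_on spacetime \<phi>'"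
    by (rule C2_onE[OF assms]) blast
  show thesis
  proof (rule that[OF _ f(4,5)])
    fix t :: real and x :: "real ^ 'n" assume t: "0 < t"
    have "open ({0::real<..} \<times> (UNIV :: (real ^ 'n) set))" by (intro open_Times) auto
    then have "(t, x) \<in> interior spacetime"
      by (rule interiorI) (use t in \<open>auto simp: spacetime_def\<close>)
    then have "at (t, x) within spacetime = at (t, x)" by (rule at_within_interior)
    then show "(\<phi> has_derivative blinfun_apply (\<phi>' (t, x))) (at (t, x))"
      using f(1)[of "(t, x)"] t by (simp add: spacetime_def)
  next
    fix S :: "(real \<times> (real ^ 'n)) set" assume S: "compact S" "convex S" "S \<subseteq> spacetime"
    have "compact (\<phi>'' ` S)" by (intro compact_continuous_image continuous_on_subset[OF f(3)] S)
    then obtain B where B: "B > 0" "\<forall>x\<in>\<phi>'' ` S. norm x \<le> B"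
      using compact_imp_bounded bounded_pos by metis
    have "\<bar>\<phi> (x + v) - \<phi> x - \<phi>' x v\<bar> \<le> B * (norm v)\<^sup>2" if "x \<in> S" "x + v \<in> S" for x v
    proof (rule taylor_bound[OF S(2) _ _ _ that])
      show "(\<phi> has_derivative blinfun_apply (\<phi>' x)) (at x within S)" if "x \<in> S" for x
        using has_derivative_subset[OF f(1) S(3)] S(3) that by blast
      show "(\<phi>' has_derivative blinfun_apply (\<phi>'' x)) (at x within S)" if "x \<in> S" for x
        using has_derivative_subset[OF f(2) S(3)] S(3) that by blast
    qed (use B in auto)
    then show "\<exists>B\<ge>0. \<forall>x v. x \<in> S \<longrightarrow> x + v \<in> S \<longrightarrow> \<bar>\<phi> (x + v) - \<phi> x - \<phi>' x v\<bar> \<le> B * (norm v)\<^sup>2"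
      using B(1) by (intro exI[of _ B]) auto
  qed
qed

lemma slice_taylor:
  fixes \<phi> :: "real \<times> (real ^ 'n) \<Rightarrow> real"
  assumes "C2_on spacetime \<phi>" "0 < t"
  shows "\<exists>B\<ge>0. \<forall>z. norm z \<le> r \<longrightarrow> \<bar>\<phi> (t, y + z) - \<phi> (t, y) - gradient (\<lambda>x. \<phi> (t, x)) y \<bullet> z\<bar> \<le> B * (norm z)\<^sup>2"
proof -
  obtain \<phi>' where \<phi>': "\<And>t x. 0 < t \<Longrightarrow> (\<phi> has_derivative blinfun_apply (\<phi>' (t, x))) (at (t, x))"
    "continuous_on spacetime \<phi>" "continuous_on spacetime \<phi>'"
    "\<And>S. compact S \<Longrightarrow> convex S \<Longrightarrow> S \<subseteq> spacetime \<Longrightarrow> \<exists>B\<ge>0. \<forall>x v. x \<in> S \<longrightarrow> x + v \<in> S \<longrightarrow> \<bar>\<phi> (x + v) - \<phi> x - \<phi>' x v\<bar> \<le> B * (norm v)\<^sup>2"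
    by (rule C2_spacetimeE[OF assms(1)]) blast
  have "{t} \<times> cball y r \<subseteq> spacetime" using assms(2) by (auto simp: spacetime_def)
  then obtain B where B: "B \<ge> 0" "\<And>x v. x \<in> {t} \<times> cball y r \<Longrightarrow> x + v \<in> {t} \<times> cball y r \<Longrightarrow> \<bar>\<phi> (x + v) - \<phi> x - \<phi>' x v\<bar> \<le> B * (norm v)\<^sup>2"
    using \<phi>'(4)[of "{t} \<times> cball y r"] by (auto simp: compact_Times convex_Times)
  have "\<bar>\<phi> (t, y + z) - \<phi> (t, y) - gradient (\<lambda>x. \<phi> (t, x)) y \<bullet> z\<bar> \<le> B * (norm z)\<^sup>2" if "norm z \<le> r" for z
  proof -
    have "0 \<le> r" using that norm_ge_zero order_trans by blast
    then show ?thesis using B(2)[of "(t, y)" "(0, z)"] that has_derivative_slices(1)[OF \<phi>'(1)[OF assms(2)], of y]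
      by (simp add: space_gradient_inner norm_Pair dist_norm)
  qed
  then show ?thesis using B(1) by blast
qed

lemma usc_lsc_imp_continuous_on:
  assumes "usc_on S f" "lsc_on S f"
  shows "continuous_on S f"
  unfolding continuous_on_def
proof (intro ballI)
  fix x assume x: "x \<in> S"
  show "(f \<longlongrightarrow> f x) (at x within S)"
    by (rule order_tendstoI) (use assms x in \<open>auto simp: usc_on_def lsc_on_def\<close>)
qed

lemma C_b_continuous: "v \<in> C_b \<Longrightarrow> continuous_on spacetime v"
  by (auto simp: C_b_def USC_b_def LSC_b_def intro: usc_lsc_imp_continuous_on)

lemma C_b_slice_measurable:
  fixes v :: "real \<times> (real ^ 'n) \<Rightarrow> real"
  assumes "v \<in> C_b" "0 \<le> t"
  shows "(\<lambda>x. v (t, x)) \<in> borel_measurable borel"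
proof (rule borel_measurable_continuous_onI)
  show "continuous_on UNIV (\<lambda>x. v (t, x))"
    by (rule continuous_on_compose2[OF C_b_continuous[OF assms(1)]])
       (use assms(2) in \<open>auto intro!: continuous_intros simp: spacetime_def\<close>)
qed

lemma C_b_bound:
  fixes v :: "real \<times> (real ^ 'n) \<Rightarrow> real"
  assumes "v \<in> C_b" "0 < T"
  obtains V where "0 \<le> V" "\<And>t x. 0 < t \<Longrightarrow> t < T \<Longrightarrow> \<bar>v (t, x)\<bar> \<le> V"
proof -
  have "bounded (v ` ({0<..<T} \<times> UNIV))"
    using assms by (auto simp: C_b_def USC_b_def bounded_in_finite_time_def)
  then obtain V where V: "0 < V" "\<forall>z\<in>v ` ({0<..<T} \<times> UNIV). norm z \<le> V" unfolding bounded_pos by blast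
  show thesis by (rule that[of V]) (use V in auto)
qed

lemma gradient_eqI: "GDERIV f x :> D \<Longrightarrow> gradient f x = D"
  unfolding gradient_def using GDERIV_unique by blast

lemma C2_on_barrier: "C2_on S (\<lambda>z :: real \<times> (real ^ 'n). 1 - exp (- ((norm (snd z))\<^sup>2 / R\<^sup>2)))"
proof -
  have "C2_on S (\<lambda>z :: real \<times> (real ^ 'n). (norm (snd z - 0))\<^sup>2)" by (rule C2_on_norm_square[OF bounded_linear_snd])
  then have "C2_on S (\<lambda>z :: real \<times> (real ^ 'n). exp (c * (norm (snd z - 0))\<^sup>2))" for c
    by (rule C2_on_compose_real[where k = "\<lambda>r. exp (c * r)" and k' = "\<lambda>r. c * exp (c * r)"
          and k'' = "\<lambda>r. c * (c * exp (c * r))"])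
       (auto intro!: derivative_eq_intros continuous_intros)
  from this[of "- 1 / R\<^sup>2"] have "C2_on S (\<lambda>z :: real \<times> (real ^ 'n). exp (- ((norm (snd z))\<^sup>2 / R\<^sup>2)))" by simp
  from C2_on_add[OF C2_on_const[of S 1] C2_on_uminus[OF this]] show ?thesis by simp
qed

lemma C2_on_exp_time: "C2_on S (\<lambda>z :: real \<times> (real ^ 'n). exp (c * fst z))"
  by (rule C2_on_compose_real[OF C2_on_linear[OF bounded_linear_fst], where k = "\<lambda>r. exp (c * r)" and k' = "\<lambda>r. c * exp (c * r)" and k'' = "\<lambda>r. c * (c * exp (c * r))"])
     (auto intro!: derivative_eq_intros continuous_intros)

context levy_kernel
begin

lemma barrier_total_tendsto_0:
  assumes "0 < r"
  shows "(\<lambda>n. small_moment r / (real (Suc n))\<^sup>2 + (\<integral>z. min 1 (2 / real (Suc n) * norm z + (norm z)\<^sup>2 / (real (Suc n))\<^sup>2) \<partial>tail r)) \<longlonglongrightarrow> 0"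
proof -
  have "(\<lambda>n. small_moment r * (inverse (real (Suc n)))\<^sup>2 + (\<integral>z. min 1 (2 / real (Suc n) * norm z + (norm z)\<^sup>2 / (real (Suc n))\<^sup>2) \<partial>tail r)) \<longlonglongrightarrow> small_moment r * 0\<^sup>2 + 0"
    by (intro tendsto_intros LIMSEQ_inverse_real_of_nat barrier_tail_tendsto_0 assms)
  then show ?thesis by (simp add: divide_inverse power_inverse)
qed

lemma barrier_tendsto_0: "(\<lambda>n. barrier (real (Suc n)) y) \<longlonglongrightarrow> 0"
proof -
  have "(\<lambda>n. 1 - exp (- ((norm y)\<^sup>2 * (inverse (real (Suc n)))\<^sup>2))) \<longlonglongrightarrow> 1 - exp (- ((norm y)\<^sup>2 * 0\<^sup>2))"
    by (intro tendsto_intros LIMSEQ_inverse_real_of_nat)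
  then show ?thesis by (simp add: barrier_def divide_inverse power_inverse)
qed

text \<open>
  An approximate solution is smooth, so after a perturbation it is itself a test function, and the
  maximum principle applies to \<open>v - \<Phi>\<close> directly, in place of a doubling of variables. In the
  perturbation the exponential factor absorbs the Lipschitz dependence on the unknown, the barrier
  makes the maximum exist, and the cubic term keeps it away from the final time.
\<close>
lemma subsolution_le_approx_solution:
  assumes v: "v \<in> C_b" and sub: "viscosity_subsolution g s (\<lambda>t y a q l. l + f t y a) (\<lambda>_. 0) v"
    and K: "0 \<le> K" and f: "\<And>t y a a'. 0 \<le> t \<Longrightarrow> \<bar>f t y a - f t y a'\<bar> \<le> K * \<bar>a - a'\<bar>"
    and \<Phi>: "approx_solution f (T + 1) \<eta> \<Phi>" and \<eta>: "0 \<le> \<eta>" and T: "0 \<le> t1" "t1 \<le> T"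
  shows "v (t1, y1) \<le> \<Phi> (t1, y1) + exp ((K + 1) * t1) * \<eta>"
proof -
  define \<gamma> where "\<gamma> = K + 1"
  obtain \<Phi>' B where P: "C2_on UNIV \<Phi>" "\<And>z. (\<Phi> has_derivative blinfun_apply (\<Phi>' z)) (at z)" "\<And>z. \<bar>\<Phi> z\<bar> \<le> B"
    "\<And>z v. \<bar>\<Phi> (z + v) - \<Phi> z - \<Phi>' z v\<bar> \<le> B * (norm v)\<^sup>2" "0 \<le> B"
    "\<And>t y. 0 \<le> t \<Longrightarrow> t \<le> T + 1 \<Longrightarrow> \<bar>\<Phi>' (t, y) (1, 0) - levy_op (\<lambda>x. \<Phi> (t, x)) y - f t y (\<Phi> (t, y))\<bar> \<le> \<eta>"
    "\<And>y. \<bar>\<Phi> (0, y)\<bar> \<le> \<eta>"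
    by (rule approx_solutionE[OF \<Phi> levy_kernel_axioms]) blast
  have c\<Phi>: "continuous_on UNIV \<Phi>" by (rule C2_onE[OF P(1)])
  have cv: "continuous_on spacetime v" by (rule C_b_continuous[OF v])
  have v0: "v (0, y) \<le> 0" for y
  proof -
    have "ereal (v (0, y)) \<le> upper_envelope (\<lambda>_. 0) y" using sub by (simp add: viscosity_subsolution_def)
    also have "\<dots> = 0" by (simp add: upper_envelope_def Limsup_const)
    finally show ?thesis by simp
  qed
  obtain r where r: "0 < r" and test: "\<And>t0 x0 \<tau> \<phi>. (t0, x0) \<in> spacetime \<Longrightarrow> \<tau> \<in> {0<..<t0} \<Longrightarrow> C2_on spacetime \<phi> \<Longrightarrow>
        (\<And>z. z \<in> {t0 - \<tau><..<t0 + \<tau>} \<times> ball x0 r \<Longrightarrow> v z - \<phi> z \<le> v (t0, x0) - \<phi> (t0, x0)) \<Longrightarrow>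
        deriv (\<lambda>t. \<phi> (t, x0)) t0 - ((levy_inner g s r (\<lambda>x. \<phi> (t0, x)) x0 + levy_outer g s r (\<lambda>x. v (t0, x)) x0) + f t0 x0 (v (t0, x0))) \<le> 0"
    using sub unfolding viscosity_subsolution_def by blast
  obtain V where V: "0 \<le> V" "\<And>t x. 0 < t \<Longrightarrow> t < T + 2 \<Longrightarrow> \<bar>v (t, x)\<bar> \<le> V"
    using C_b_bound[OF v, of "T + 2"] T by auto
  define M where "M = V + B + 1"
  have M: "1 \<le> M" using V P(5) by (simp add: M_def)
  define \<beta> where "\<beta> R = small_moment r / R\<^sup>2 + (\<integral>z. min 1 (2 / R * norm z + (norm z)\<^sup>2 / R\<^sup>2) \<partial>tail r)" for R
  have key: "exp (- \<gamma> * t1) * (v (t1, y1) - \<Phi> (t1, y1)) \<le> \<eta> + M * \<beta> R + M * barrier R y1" if R: "0 < R" for R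
  proof (rule ccontr)
    assume neg: "\<not> ?thesis"
    \<comment> \<open>The penalisation vanishes up to time \<open>T\<close> and equals 1 at time \<open>T + 1\<close>; a cube is twice continuously differentiable.\<close>
    define \<omega> where "\<omega> t = (max 0 (t - T)) ^ 3" for t
    define H where "H z = exp (- \<gamma> * fst z) * (v z - \<Phi> z) - M * barrier R (snd z) - M * \<omega> (fst z)" for z
    \<comment> \<open>Beyond radius \<open>R * M\<close> the barrier term is at least \<open>M - 1 = V + B\<close> and \<open>H\<close> is not positive.\<close>
    define \<rho> where "\<rho> = max (norm y1) (R * M)"
    define A where "A = {0..T + 1} \<times> cball (0 :: real ^ 'n) \<rho>"
    have \<omega>0: "0 \<le> \<omega> t" for t by (simp add: \<omega>_def)
    have \<beta>0: "0 \<le> \<beta> R"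
    proof -
      have "0 \<le> (\<integral>z. min 1 (2 / R * norm z + (norm z)\<^sup>2 / R\<^sup>2) \<partial>tail r)"
        using R by (intro Bochner_Integration.integral_nonneg) (simp add: add_nonneg_nonneg)
      then show ?thesis using small_moment_nonneg by (simp add: \<beta>_def)
    qed
    have H1: "\<eta> + M * \<beta> R < H (t1, y1)"
      using neg T by (simp add: H_def \<omega>_def)
    have cH: "continuous_on A H"
    proof -
      have "A \<subseteq> spacetime" by (auto simp: A_def spacetime_def)
      then have "continuous_on A v" by (rule continuous_on_subset[OF cv])
      moreover have "continuous_on A \<Phi>" by (rule continuous_on_subset[OF c\<Phi>]) simp
      moreover have "continuous_on A (\<lambda>z. barrier R (snd z))"
        by (rule continuous_on_compose2[OF barrier_continuous]) (auto intro: continuous_intros)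
      ultimately show ?thesis unfolding H_def \<omega>_def by (intro continuous_intros) auto
    qed
    have "compact A" unfolding A_def by (intro compact_Times) auto
    moreover have A1: "(t1, y1) \<in> A" using T by (simp add: A_def \<rho>_def)
    ultimately obtain z0 where z0: "z0 \<in> A" "\<And>z. z \<in> A \<Longrightarrow> H z \<le> H z0"
      using continuous_attains_sup[of A H] cH by blast
    obtain t0 y0 where ty: "z0 = (t0, y0)" by (cases z0)
    define m where "m = H (t0, y0)"
    have m: "\<eta> + M * \<beta> R < m" using z0(2)[OF A1] H1 by (simp add: m_def ty)
    have m0: "\<eta> < m" "0 < m" using m \<eta> mult_nonneg_nonneg[of M "\<beta> R"] \<beta>0 M by linarith+
    have t0: "0 \<le> t0" "t0 \<le> T + 1" using z0(1) by (auto simp: ty A_def)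
    have vb: "exp (- \<gamma> * t) * (v (t, y) - \<Phi> (t, y)) \<le> V + B" if "0 \<le> t" "t \<le> T + 1" for t y
    proof -
      have d: "v (t, y) - \<Phi> (t, y) \<le> V + B"
        using V(2)[of t y] v0[of y] P(3)[of "(t, y)"] V(1) that by (cases "t = 0") auto
      have "0 \<le> \<gamma> * t" using that K by (simp add: \<gamma>_def)
      then have e: "exp (- \<gamma> * t) \<le> 1" by simp
      have "exp (- \<gamma> * t) * (v (t, y) - \<Phi> (t, y)) \<le> exp (- \<gamma> * t) * (V + B)" by (intro mult_left_mono d) auto
      also have "\<dots> \<le> 1 * (V + B)" using e V P(5) by (intro mult_right_mono) auto
      finally show ?thesis by simp
    qed
    have max: "H (t, y) \<le> m" if t: "0 \<le> t" "t \<le> T + 1" for t y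
    proof (cases "norm y \<le> \<rho>")
      case True then show ?thesis using z0(2)[of "(t, y)"] t by (simp add: A_def m_def ty)
    next
      case False
      then have "R * M \<le> norm y" by (simp add: \<rho>_def)
      then have "M \<le> norm y / R" using R by (simp add: field_simps)
      then have "M\<^sup>2 \<le> (norm y / R)\<^sup>2" using M by (intro power_mono) auto
      then have "M \<le> (norm y)\<^sup>2 / R\<^sup>2" using M self_le_power[of M 2] by (simp add: power_divide)
      also have "\<dots> \<le> exp ((norm y)\<^sup>2 / R\<^sup>2)" using exp_ge_add_one_self[of "(norm y)\<^sup>2 / R\<^sup>2"] by linarith
      finally have "M * exp (- ((norm y)\<^sup>2 / R\<^sup>2)) \<le> 1" by (simp add: exp_minus field_simps)
      then have "M - 1 \<le> M * barrier R y" by (simp add: barrier_def right_diff_distrib)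
      moreover have "0 \<le> M * \<omega> t" using M \<omega>0 by simp
      ultimately have "H (t, y) \<le> V + B - (M - 1)" using vb[OF t, of y] by (simp add: H_def)
      then show ?thesis using m0 by (simp add: M_def)
    qed
    have t0pos: "0 < t0"
    proof (rule ccontr)
      assume "\<not> 0 < t0"
      then have t00: "t0 = 0" using t0 by simp
      have "0 \<le> M * barrier R y0" "0 \<le> M * \<omega> 0" using M \<omega>0 barrier_bounds by simp_all
      then have "m \<le> v (0, y0) - \<Phi> (0, y0)" unfolding m_def H_def t00 by simp
      also have "\<dots> \<le> \<eta>" using v0[of y0] P(7)[of y0] by linarith
      finally show False using m0 by simp
    qed
    have t0T: "t0 < T + 1"
    proof (rule ccontr)
      assume "\<not> t0 < T + 1"
      then have t01: "t0 = T + 1" using t0 by simp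
      have "0 \<le> M * barrier R y0" using M barrier_bounds by simp
      then have "m \<le> V + B - M" using vb[of t0 y0] t0 unfolding m_def H_def t01 by (simp add: \<omega>_def)
      then show False using m0 by (simp add: M_def)
    qed
    \<comment> \<open>The function that touches \<open>v\<close> from above exactly where \<open>H\<close> attains its maximum \<open>m\<close>.\<close>
    define \<phi> where "\<phi> z = \<Phi> z + exp (\<gamma> * fst z) * (m + M * (1 - exp (- ((norm (snd z))\<^sup>2 / R\<^sup>2))) + M * (max 0 (fst z + - T)) ^ 3)" for z :: "real \<times> (real ^ 'n)"
    have \<phi>_eq: "\<phi> (t, y) = \<Phi> (t, y) + exp (\<gamma> * t) * (m + M * barrier R y + M * \<omega> t)" for t y
      by (simp add: \<phi>_def barrier_def \<omega>_def)
    have v\<phi>: "v (t, y) - \<phi> (t, y) = exp (\<gamma> * t) * (H (t, y) - m)" for t y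
    proof -
      have "exp (\<gamma> * t) * (exp (- \<gamma> * t) * X) = X" for X
        by (simp add: mult.assoc[symmetric] exp_add[symmetric])
      moreover have "exp (\<gamma> * t) * (X - b - c - m) = exp (\<gamma> * t) * X - exp (\<gamma> * t) * (m + b + c)" for X b c
        by (simp add: algebra_simps)
      moreover have "exp (\<gamma> * t) * exp (- (\<gamma> * t)) = 1" by (simp add: exp_minus)
      ultimately show ?thesis unfolding \<phi>_eq H_def by simp
    qed
    have touch: "v (t0, y0) = \<phi> (t0, y0)" using v\<phi>[of t0 y0] by (simp add: m_def)
    have above: "v (t, y) \<le> \<phi> (t, y)" if "0 \<le> t" "t \<le> T + 1" for t y
    proof -
      have "exp (\<gamma> * t) * (H (t, y) - m) \<le> 0" using max[OF that, of y] by (intro mult_nonneg_nonpos) auto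
      then show ?thesis using v\<phi>[of t y] by linarith
    qed
    have C2: "C2_on spacetime \<phi>"
      unfolding \<phi>_def
      by (intro C2_on_add C2_on_mult C2_on_const C2_on_exp_time C2_on_barrier C2_on_pos_part_cube C2_on_linear bounded_linear_fst C2_on_subset[OF P(1)]) auto
    define \<tau> where "\<tau> = min t0 (T + 1 - t0) / 2"
    have \<tau>: "\<tau> \<in> {0<..<t0}" "\<tau> \<le> T + 1 - t0" using t0pos t0T by (auto simp: \<tau>_def)
    define E where "E = exp (\<gamma> * t0)"
    have E: "0 < E" by (simp add: E_def)
    define Q where "Q = m + M * barrier R y0 + M * \<omega> t0"
    have Q: "m \<le> Q" using M \<omega>0 barrier_bounds by (simp add: Q_def)
    have visc: "deriv (\<lambda>t. \<phi> (t, y0)) t0 - ((levy_inner g s r (\<lambda>x. \<phi> (t0, x)) y0 + levy_outer g s r (\<lambda>x. v (t0, x)) y0) + f t0 y0 (v (t0, y0))) \<le> 0"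
    proof (rule test[OF _ \<tau>(1) C2])
      show "(t0, y0) \<in> spacetime" using t0 by (simp add: spacetime_def)
      fix z assume z: "z \<in> {t0 - \<tau><..<t0 + \<tau>} \<times> ball y0 r"
      have "v (fst z, snd z) \<le> \<phi> (fst z, snd z)" by (rule above) (use z \<tau> in auto)
      then show "v z - \<phi> z \<le> v (t0, y0) - \<phi> (t0, y0)" using touch by simp
    qed
    have D\<phi>: "((\<lambda>t. \<phi> (t, y0)) has_real_derivative \<Phi>' (t0, y0) (1, 0) + (\<gamma> * E * Q + E * (M * (3 * (max 0 (t0 - T))\<^sup>2)))) (at t0)"
    proof -
      have d1: "((\<lambda>t. \<Phi> (t, y0)) has_real_derivative \<Phi>' (t0, y0) (1, 0)) (at t0)"
        by (rule has_derivative_slices(4)[OF P(2)])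
      have "((\<lambda>t. (max 0 (t - T)) ^ Suc 2) has_real_derivative (real (Suc 2) * (max 0 (t0 - T)) ^ 2) * 1) (at t0)"
        by (rule DERIV_chain2[where g = "\<lambda>t. t - T", OF DERIV_pos_part_power]) (auto intro!: derivative_eq_intros)
      then have d2: "(\<omega> has_real_derivative 3 * (max 0 (t0 - T))\<^sup>2) (at t0)"
        by (simp add: \<omega>_def[abs_def] eval_nat_numeral)
      have d3: "((\<lambda>t. exp (\<gamma> * t)) has_real_derivative E * \<gamma>) (at t0)"
        unfolding E_def by (auto intro!: derivative_eq_intros)
      have d4: "((\<lambda>t. m + M * barrier R y0 + M * \<omega> t) has_real_derivative M * (3 * (max 0 (t0 - T))\<^sup>2)) (at t0)"
        using DERIV_add[OF DERIV_const[of "m + M * barrier R y0"] DERIV_cmult[OF d2, of M]] by simp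
      have "((\<lambda>t. \<Phi> (t, y0) + exp (\<gamma> * t) * (m + M * barrier R y0 + M * \<omega> t)) has_real_derivative
         \<Phi>' (t0, y0) (1, 0) + (E * \<gamma> * Q + M * (3 * (max 0 (t0 - T))\<^sup>2) * E)) (at t0)"
        unfolding Q_def using DERIV_add[OF d1 DERIV_mult[OF d3 d4]] by (simp add: E_def)
      then show ?thesis unfolding \<phi>_eq by (simp add: mult_ac)
    qed
    have grad: "gradient (\<lambda>x. \<phi> (t0, x)) y0 = space_gradient (\<Phi>' (t0, y0)) + (E * M) *\<^sub>R barrier_gradient R y0"
    proof (rule gradient_eqI)
      have g1: "((\<lambda>x. \<Phi> (t0, x)) has_derivative (\<lambda>h. h \<bullet> space_gradient (\<Phi>' (t0, y0)))) (at y0)"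
        using has_derivative_slices(3)[OF P(2)] unfolding gderiv_def .
      have g2: "(barrier R has_derivative (\<lambda>h. h \<bullet> barrier_gradient R y0)) (at y0)"
        using barrier_GDERIV[OF R] unfolding gderiv_def .
      have "((\<lambda>x. \<Phi> (t0, x) + (E * (m + M * \<omega> t0) + (E * M) * barrier R x)) has_derivative
          (\<lambda>h. h \<bullet> space_gradient (\<Phi>' (t0, y0)) + (0 + (E * M) * (h \<bullet> barrier_gradient R y0)))) (at y0)"
        by (intro has_derivative_add g1 has_derivative_const has_derivative_mult_right g2)
      then show "GDERIV (\<lambda>x. \<phi> (t0, x)) y0 :> space_gradient (\<Phi>' (t0, y0)) + (E * M) *\<^sub>R barrier_gradient R y0"
        unfolding gderiv_def \<phi>_eq E_def[symmetric] by (simp add: inner_add_right algebra_simps)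
    qed
    have m\<Phi>: "(\<lambda>x. \<Phi> (t0, x)) \<in> borel_measurable borel"
    proof (rule borel_measurable_continuous_onI)
      show "continuous_on UNIV (\<lambda>x. \<Phi> (t0, x))"
        by (rule continuous_on_compose2[OF c\<Phi>]) (auto intro: continuous_intros)
    qed
    have mb: "barrier R \<in> borel_measurable borel" by (rule borel_measurable_continuous_onI[OF barrier_continuous])
    have m\<phi>: "(\<lambda>x. \<phi> (t0, x)) \<in> borel_measurable borel" unfolding \<phi>_eq using m\<Phi> mb by measurable
    have mv: "(\<lambda>x. v (t0, x)) \<in> borel_measurable borel" by (rule C_b_slice_measurable[OF v t0(1)])
    note m\<Phi>[measurable] mb[measurable] m\<phi>[measurable] mv[measurable]
    have T\<Phi>: "\<bar>\<Phi> (t0, y0 + z) - \<Phi> (t0, y0) - space_gradient (\<Phi>' (t0, y0)) \<bullet> z\<bar> \<le> B * (norm z)\<^sup>2" for z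
      using P(4)[of "(t0, y0)" "(0, z)"] by (simp add: space_gradient_inner norm_Pair)
    note split = levy_op_split[OF r m\<Phi> P(3) T\<Phi>]
    let ?a = "\<lambda>z. \<Phi> (t0, y0 + z) - \<Phi> (t0, y0) - space_gradient (\<Phi>' (t0, y0)) \<bullet> z"
    let ?b = "\<lambda>z. barrier R (y0 + z) - barrier R y0 - barrier_gradient R y0 \<bullet> z"
    have inner: "levy_inner g s r (\<lambda>x. \<phi> (t0, x)) y0 \<le> (\<integral>z. indicator (cball 0 r) z * ?a z \<partial>\<mu>) + E * M * (small_moment r / R\<^sup>2)"
    proof -
      obtain B' where B': "0 \<le> B'" "\<And>z. norm z \<le> r \<Longrightarrow> \<bar>\<phi> (t0, y0 + z) - \<phi> (t0, y0) - gradient (\<lambda>x. \<phi> (t0, x)) y0 \<bullet> z\<bar> \<le> B' * (norm z)\<^sup>2"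
        using slice_taylor[OF C2 t0pos] by blast
      have i\<phi>: "integrable \<mu> (\<lambda>z. indicator (cball 0 r) z * (\<phi> (t0, y0 + z) - \<phi> (t0, y0) - gradient (\<lambda>x. \<phi> (t0, x)) y0 \<bullet> z))"
        by (rule levy_dominated_small(1)[OF r _ B'(2)]) measurable
      have i2: "integrable \<mu> (\<lambda>z. E * M / R\<^sup>2 * (indicator (cball 0 r) z * (norm z)\<^sup>2))"
        by (intro integrable_mult_right second_moment_finite r)
      have "levy_inner g s r (\<lambda>x. \<phi> (t0, x)) y0 \<le> (\<integral>z. indicator (cball 0 r) z * ?a z + E * M / R\<^sup>2 * (indicator (cball 0 r) z * (norm z)\<^sup>2) \<partial>\<mu>)"
        unfolding levy_inner_eq
      proof (rule integral_mono[OF i\<phi> Bochner_Integration.integrable_add[OF split(2) i2]])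
        fix z
        have "\<phi> (t0, y0 + z) - \<phi> (t0, y0) - gradient (\<lambda>x. \<phi> (t0, x)) y0 \<bullet> z = ?a z + E * M * ?b z"
        proof -
          have "gradient (\<lambda>x. \<phi> (t0, x)) y0 \<bullet> z = space_gradient (\<Phi>' (t0, y0)) \<bullet> z + E * M * (barrier_gradient R y0 \<bullet> z)"
            unfolding grad by (simp add: inner_add_left)
          then show ?thesis by (simp only:) (simp add: \<phi>_eq E_def[symmetric] algebra_simps)
        qed
        also have "\<dots> \<le> ?a z + E * M * ((norm z)\<^sup>2 / R\<^sup>2)"
          using barrier_increment[OF R, of y0 z] E M by (intro add_left_mono mult_left_mono) auto
        finally show "indicator (cball 0 r) z * (\<phi> (t0, y0 + z) - \<phi> (t0, y0) - gradient (\<lambda>x. \<phi> (t0, x)) y0 \<bullet> z)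
           \<le> indicator (cball 0 r) z * ?a z + E * M / R\<^sup>2 * (indicator (cball 0 r) z * (norm z)\<^sup>2)"
          by (simp add: indicator_def)
      qed
      also have "\<dots> = (\<integral>z. indicator (cball 0 r) z * ?a z \<partial>\<mu>) + E * M / R\<^sup>2 * small_moment r"
        by (subst Bochner_Integration.integral_add[OF split(2) i2]) (simp add: small_moment_def)
      finally show ?thesis by simp
    qed
    have outer: "levy_outer g s r (\<lambda>x. v (t0, x)) y0 \<le> (\<integral>z. \<Phi> (t0, y0 + z) - \<Phi> (t0, y0) \<partial>tail r) + E * M * (\<integral>z. min 1 (2 / R * norm z + (norm z)\<^sup>2 / R\<^sup>2) \<partial>tail r)"
    proof -
      have bb: "\<bar>barrier R (y0 + z) - barrier R y0\<bar> \<le> 1" for z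
        using barrier_bounds(1,2)[of R "y0 + z"] barrier_bounds(1,2)[of R y0] by linarith
      have ib: "integrable (tail r) (\<lambda>z. barrier R (y0 + z) - barrier R y0)"
        by (rule integrable_tail_bounded[OF r _ bb]) measurable
      have bv: "\<bar>v (t0, y0 + z) - v (t0, y0)\<bar> \<le> 2 * V" for z
        using V(2)[of t0 "y0 + z"] V(2)[of t0 y0] t0pos t0T by linarith
      have iv: "integrable (tail r) (\<lambda>z. v (t0, y0 + z) - v (t0, y0))"
        by (rule integrable_tail_bounded[OF r _ bv]) measurable
      have "levy_outer g s r (\<lambda>x. v (t0, x)) y0 = (\<integral>z. v (t0, y0 + z) - v (t0, y0) \<partial>tail r)"
        by (rule levy_outer_tail) measurable
      also have "\<dots> \<le> (\<integral>z. (\<Phi> (t0, y0 + z) - \<Phi> (t0, y0)) + E * M * (barrier R (y0 + z) - barrier R y0) \<partial>tail r)"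
      proof (rule integral_mono[OF iv Bochner_Integration.integrable_add[OF split(3) integrable_mult_right[OF ib]]])
        fix z
        have "v (t0, y0 + z) - v (t0, y0) \<le> \<phi> (t0, y0 + z) - \<phi> (t0, y0)" using above[OF t0, of "y0 + z"] touch by linarith
        also have "\<dots> = (\<Phi> (t0, y0 + z) - \<Phi> (t0, y0)) + E * M * (barrier R (y0 + z) - barrier R y0)"
          unfolding \<phi>_eq E_def[symmetric] by (simp add: algebra_simps)
        finally show "v (t0, y0 + z) - v (t0, y0) \<le> (\<Phi> (t0, y0 + z) - \<Phi> (t0, y0)) + E * M * (barrier R (y0 + z) - barrier R y0)" .
      qed
      also have "\<dots> = (\<integral>z. \<Phi> (t0, y0 + z) - \<Phi> (t0, y0) \<partial>tail r) + E * M * (\<integral>z. barrier R (y0 + z) - barrier R y0 \<partial>tail r)"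
        by (subst Bochner_Integration.integral_add[OF split(3) integrable_mult_right[OF ib]]) simp
      also have "\<dots> \<le> (\<integral>z. \<Phi> (t0, y0 + z) - \<Phi> (t0, y0) \<partial>tail r) + E * M * (\<integral>z. min 1 (2 / R * norm z + (norm z)\<^sup>2 / R\<^sup>2) \<partial>tail r)"
        using E M by (intro add_left_mono mult_left_mono barrier_tail_le[OF R r]) auto
      finally show ?thesis .
    qed
    have sum: "levy_inner g s r (\<lambda>x. \<phi> (t0, x)) y0 + levy_outer g s r (\<lambda>x. v (t0, x)) y0 \<le> levy_op (\<lambda>x. \<Phi> (t0, x)) y0 + E * M * \<beta> R"
    proof -
      have "E * M * \<beta> R = E * M * (small_moment r / R\<^sup>2) + E * M * (\<integral>z. min 1 (2 / R * norm z + (norm z)\<^sup>2 / R\<^sup>2) \<partial>tail r)"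
        by (simp only: \<beta>_def distrib_left)
      then show ?thesis using inner outer split(1) by linarith
    qed
    have fv: "f t0 y0 (v (t0, y0)) \<le> f t0 y0 (\<Phi> (t0, y0)) + K * (E * Q)"
    proof -
      have "v (t0, y0) - \<Phi> (t0, y0) = E * Q" using touch by (simp add: \<phi>_eq E_def Q_def)
      moreover have "0 \<le> E * Q" using E Q m0 by simp
      ultimately show ?thesis using f[OF t0(1), of y0 "v (t0, y0)" "\<Phi> (t0, y0)"] by simp
    qed
    have pen: "0 \<le> E * (M * (3 * (max 0 (t0 - T))\<^sup>2))" using E M by simp
    have "\<gamma> * E * Q \<le> E * M * \<beta> R + K * (E * Q) + \<eta>"
    proof -
      have "levy_op (\<lambda>x. \<Phi> (t0, x)) y0 + f t0 y0 (\<Phi> (t0, y0)) \<le> \<Phi>' (t0, y0) (1, 0) + \<eta>"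
        using P(6)[OF t0, of y0] by linarith
      then show ?thesis using visc sum fv pen unfolding DERIV_imp_deriv[OF D\<phi>] by linarith
    qed
    then have "E * Q \<le> E * (M * \<beta> R) + \<eta>" by (simp add: \<gamma>_def algebra_simps)
    also have "\<eta> \<le> E * \<eta>"
    proof -
      have "1 \<le> E" using t0 K by (simp add: E_def \<gamma>_def)
      then show ?thesis using \<eta> mult_right_mono[of 1 E \<eta>] by simp
    qed
    finally have "E * Q \<le> E * (M * \<beta> R + \<eta>)" by (simp add: algebra_simps)
    then have "Q \<le> M * \<beta> R + \<eta>" using E by simp
    then show False using m Q by linarith
  qed
  \<comment> \<open>Widening the barrier removes its cost.\<close>
  have "exp (- \<gamma> * t1) * (v (t1, y1) - \<Phi> (t1, y1)) \<le> \<eta> + M * 0 + M * 0"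
  proof (rule LIMSEQ_le_const)
    show "(\<lambda>n. \<eta> + M * \<beta> (real (Suc n)) + M * barrier (real (Suc n)) y1) \<longlonglongrightarrow> \<eta> + M * 0 + M * 0"
      unfolding \<beta>_def by (intro tendsto_intros barrier_total_tendsto_0[OF r] barrier_tendsto_0)
    show "\<exists>N. \<forall>n\<ge>N. exp (- \<gamma> * t1) * (v (t1, y1) - \<Phi> (t1, y1)) \<le> \<eta> + M * \<beta> (real (Suc n)) + M * barrier (real (Suc n)) y1"
      using key by (intro exI[of _ 0]) simp
  qed
  then have "exp (\<gamma> * t1) * (exp (- \<gamma> * t1) * (v (t1, y1) - \<Phi> (t1, y1))) \<le> exp (\<gamma> * t1) * \<eta>"
    by (intro mult_left_mono) auto
  also have "exp (\<gamma> * t1) * (exp (- \<gamma> * t1) * (v (t1, y1) - \<Phi> (t1, y1))) = v (t1, y1) - \<Phi> (t1, y1)"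
    by (simp add: mult.assoc[symmetric] exp_add[symmetric])
  finally show ?thesis by (simp add: \<gamma>_def)
qed

end

section \<open>The limit of the scheme is a viscosity solution\<close>

context levy_equation
begin

text \<open>
  The term \<open>\<kappa> * |z - (t0, x0)|\<^sup>2\<close> makes a maximum of \<open>u - \<phi>\<close> strict. For approximate solutions \<open>\<Phi>\<close>
  close to \<open>u\<close>, the maxima of \<open>\<Phi>\<close> minus the perturbed test function then converge to \<open>(t0, x0)\<close>. At
  these points the equation holds classically for \<open>\<Phi>\<close>, and its derivatives are those of the test
  function.
\<close>
lemma limit_subsolution_perturbed:
  fixes u \<phi> :: "real \<times> (real ^ 'n) \<Rightarrow> real"
  assumes u: "u \<in> C_b"
    and approx: "\<And>T e. 0 < T \<Longrightarrow> 0 < e \<Longrightarrow> \<exists>\<Phi>. approx_solution f T e \<Phi> \<and> (\<forall>t\<in>{0..T}. \<forall>y. \<bar>u (t, y) - \<Phi> (t, y)\<bar> \<le> e)"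
    and \<tau>: "0 < \<tau>" "\<tau> < t0" and \<phi>: "C2_on spacetime \<phi>"
    and max: "\<And>z. z \<in> {t0 - \<tau><..<t0 + \<tau>} \<times> ball x0 1 \<Longrightarrow> u z - \<phi> z \<le> u (t0, x0) - \<phi> (t0, x0)" and \<kappa>: "0 < \<kappa>"
  shows "deriv (\<lambda>t. \<phi> (t, x0)) t0 \<le> (\<integral>z. indicator (cball 0 (1/4)) z * (\<phi> (t0, x0 + z) - \<phi> (t0, x0) - gradient (\<lambda>x. \<phi> (t0, x)) x0 \<bullet> z) \<partial>\<mu>)
     + \<kappa> * small_moment (1/4) + (\<integral>z. u (t0, x0 + z) - u (t0, x0) \<partial>tail (1/4)) + f t0 x0 (u (t0, x0))"
proof -
  let ?z0 = "(t0, x0)"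
  define \<psi> where "\<psi> z = \<phi> z + \<kappa> * (norm (z - ?z0))\<^sup>2" for z
  have t0: "0 < t0" using \<tau> by linarith
  have C2\<psi>: "C2_on spacetime \<psi>" unfolding \<psi>_def
    by (intro C2_on_add \<phi> C2_on_cmult C2_on_norm_square bounded_linear_ident)
  obtain \<phi>' where \<phi>': "\<And>t x. 0 < t \<Longrightarrow> (\<phi> has_derivative blinfun_apply (\<phi>' (t, x))) (at (t, x))"
    by (rule C2_spacetimeE[OF \<phi>]) blast
  obtain \<psi>' where \<psi>': "\<And>t x. 0 < t \<Longrightarrow> (\<psi> has_derivative blinfun_apply (\<psi>' (t, x))) (at (t, x))"
    "continuous_on spacetime \<psi>" "continuous_on spacetime \<psi>'"
    "\<And>S. compact S \<Longrightarrow> convex S \<Longrightarrow> S \<subseteq> spacetime \<Longrightarrow> \<exists>B\<ge>0. \<forall>x v. x \<in> S \<longrightarrow> x + v \<in> S \<longrightarrow> \<bar>\<psi> (x + v) - \<psi> x - \<psi>' x v\<bar> \<le> B * (norm v)\<^sup>2"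
    by (rule C2_spacetimeE[OF C2\<psi>]) blast
  have same: "\<psi>' ?z0 = \<phi>' ?z0"
  proof -
    have "((\<lambda>z. (norm (z - ?z0))\<^sup>2) has_derivative (\<lambda>v. 0)) (at ?z0)"
    proof -
      have "((\<lambda>z. (z - ?z0) \<bullet> (z - ?z0)) has_derivative (\<lambda>v. (?z0 - ?z0) \<bullet> v + v \<bullet> (?z0 - ?z0))) (at ?z0)"
        by (intro has_derivative_inner) (auto intro!: derivative_eq_intros)
      then show ?thesis by (simp add: power2_norm_eq_inner)
    qed
    then have "(\<psi> has_derivative (\<lambda>v. \<phi>' ?z0 v + \<kappa> * 0)) (at ?z0)"
      unfolding \<psi>_def[abs_def] by (intro has_derivative_add \<phi>'[OF t0] has_derivative_mult_right)
    then have "blinfun_apply (\<phi>' ?z0) = blinfun_apply (\<psi>' ?z0)"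
      using has_derivative_unique[OF _ \<psi>'(1)[OF t0, of x0]] by simp
    then show ?thesis by (simp add: blinfun_apply_inject)
  qed
  define d where "d = min (1/4) (\<tau> / 2)"
  have d: "0 < d" "d \<le> 1/4" "d \<le> \<tau> / 2" using \<tau> by (auto simp: d_def)
  \<comment> \<open>Maxima are taken over \<open>N\<close>. They lie within \<open>1/4\<close> of \<open>x0\<close>, so jumps up to length \<open>1/4\<close> from them stay in \<open>N\<close>.\<close>
  define N where "N = {t0 - \<tau> / 2..t0 + \<tau> / 2} \<times> cball x0 (1/2)"
  have N: "compact N" "convex N" "N \<subseteq> spacetime" "N \<subseteq> {t0 - \<tau><..<t0 + \<tau>} \<times> ball x0 1" "?z0 \<in> N"
    using \<tau> unfolding N_def by (auto intro!: compact_Times convex_Times simp: spacetime_def)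
  obtain B where B: "B \<ge> 0" "\<And>x v. x \<in> N \<Longrightarrow> x + v \<in> N \<Longrightarrow> \<bar>\<psi> (x + v) - \<psi> x - \<psi>' x v\<bar> \<le> B * (norm v)\<^sup>2"
    using \<psi>'(4)[OF N(1-3)] by blast
  define T where "T = t0 + \<tau>"
  have T: "0 < T" using \<tau> by (simp add: T_def)
  have NT: "0 < fst z \<and> fst z \<le> T" if "z \<in> N" for z using that \<tau> by (auto simp: N_def T_def)
  obtain V where V: "0 \<le> V" "\<And>t x. 0 < t \<Longrightarrow> t < T + 1 \<Longrightarrow> \<bar>u (t, x)\<bar> \<le> V"
    using C_b_bound[OF u, of "T + 1"] T by auto
  define e where "e n = min 1 (\<kappa> * d\<^sup>2 / 4) * inverse (real (Suc n))" for n
  have e_pos: "0 < e n" for n using \<kappa> d by (simp add: e_def)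
  have e_le: "e n \<le> 1" "e n \<le> \<kappa> * d\<^sup>2 / 4" for n
  proof -
    have i: "inverse (real (Suc n)) \<le> 1" by (simp add: field_simps)
    have "e n \<le> min 1 (\<kappa> * d\<^sup>2 / 4) * 1" unfolding e_def using \<kappa> i by (intro mult_left_mono) auto
    then show "e n \<le> 1" "e n \<le> \<kappa> * d\<^sup>2 / 4" by auto
  qed
  have e_lim: "e \<longlonglongrightarrow> 0"
  proof -
    have "e \<longlonglongrightarrow> min 1 (\<kappa> * d\<^sup>2 / 4) * 0" unfolding e_def by (intro tendsto_intros LIMSEQ_inverse_real_of_nat)
    then show ?thesis by simp
  qed
  have "\<forall>n. \<exists>\<Phi>. approx_solution f T (e n) \<Phi> \<and> (\<forall>t\<in>{0..T}. \<forall>y. \<bar>u (t, y) - \<Phi> (t, y)\<bar> \<le> e n)"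
    using approx[OF T e_pos] by blast
  then obtain \<Phi> where \<Phi>: "\<And>n. approx_solution f T (e n) (\<Phi> n)" "\<And>n t y. 0 \<le> t \<Longrightarrow> t \<le> T \<Longrightarrow> \<bar>u (t, y) - \<Phi> n (t, y)\<bar> \<le> e n"
    by (metis atLeastAtMost_iff)
  have \<Phi>N: "\<bar>u z - \<Phi> n z\<bar> \<le> e n" if "z \<in> N" for n z
    using \<Phi>(2)[of "fst z" "snd z" n] NT[OF that] by simp
  have c\<Phi>: "continuous_on UNIV (\<Phi> n)" for n
    by (rule approx_solutionE[OF \<Phi>(1)[of n] levy_kernel_axioms]) (auto elim: C2_onE)
  have "\<exists>z\<in>N. \<forall>z'\<in>N. \<Phi> n z' - \<psi> z' \<le> \<Phi> n z - \<psi> z" for n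
    by (rule continuous_attains_sup[OF N(1)])
       (use N(5) in \<open>auto intro!: continuous_intros continuous_on_subset[OF c\<Phi>] continuous_on_subset[OF \<psi>'(2) N(3)]\<close>)
  then obtain Z where Z: "\<And>n. Z n \<in> N" "\<And>n z'. z' \<in> N \<Longrightarrow> \<Phi> n z' - \<psi> z' \<le> \<Phi> n (Z n) - \<psi> (Z n)" by metis
  have dist2: "\<kappa> * (norm (Z n - ?z0))\<^sup>2 \<le> 2 * e n" for n
  proof -
    have "u (Z n) - \<phi> (Z n) \<le> u ?z0 - \<phi> ?z0" using max N(4) Z(1) by blast
    moreover have "\<Phi> n ?z0 - \<psi> ?z0 \<le> \<Phi> n (Z n) - \<psi> (Z n)" by (rule Z(2)[OF N(5)])
    moreover have "\<psi> ?z0 = \<phi> ?z0" "\<psi> (Z n) = \<phi> (Z n) + \<kappa> * (norm (Z n - ?z0))\<^sup>2" by (simp_all add: \<psi>_def)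
    ultimately show ?thesis using \<Phi>N[OF Z(1)[of n], of n] \<Phi>N[OF N(5), of n] by linarith
  qed
  have near: "norm (Z n - ?z0) < d" for n
  proof -
    have "\<kappa> * (norm (Z n - ?z0))\<^sup>2 \<le> \<kappa> * (d\<^sup>2 / 2)" using dist2[of n] e_le(2)[of n] by (simp add: mult.commute)
    then have "(norm (Z n - ?z0))\<^sup>2 \<le> d\<^sup>2 / 2" using \<kappa> by simp
    also have "\<dots> < d\<^sup>2" using d by simp
    finally show ?thesis using d by (simp add: power2_less_imp_less)
  qed
  have "(\<lambda>n. norm (Z n - ?z0)) \<longlonglongrightarrow> 0"
  proof -
    have "(\<lambda>n. (norm (Z n - ?z0))\<^sup>2) \<longlonglongrightarrow> 0"
    proof (rule Lim_null_comparison)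
      show "\<forall>\<^sub>F n in sequentially. norm ((norm (Z n - ?z0))\<^sup>2) \<le> 2 / \<kappa> * e n"
        using dist2 \<kappa> by (intro always_eventually allI) (simp add: field_simps)
      have "(\<lambda>n. 2 / \<kappa> * e n) \<longlonglongrightarrow> 2 / \<kappa> * 0" by (intro tendsto_intros e_lim)
      then show "(\<lambda>n. 2 / \<kappa> * e n) \<longlonglongrightarrow> 0" by simp
    qed
    then have "(\<lambda>n. sqrt ((norm (Z n - ?z0))\<^sup>2)) \<longlonglongrightarrow> sqrt 0" by (rule tendsto_real_sqrt)
    then show ?thesis by simp
  qed
  then have Zlim: "Z \<longlonglongrightarrow> ?z0" by (simp add: LIM_zero_iff tendsto_norm_zero_iff)
  define tn where "tn n = fst (Z n)" for n
  define yn where "yn n = snd (Z n)" for n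
  have Zn: "Z n = (tn n, yn n)" for n by (simp add: tn_def yn_def)
  have tlim: "tn \<longlonglongrightarrow> t0" and ylim: "yn \<longlonglongrightarrow> x0"
    using tendsto_fst[OF Zlim] tendsto_snd[OF Zlim] by (simp_all add: tn_def[abs_def] yn_def[abs_def])
  have tn: "0 < tn n" "tn n \<le> T" for n using NT[OF Z(1)[of n]] by (auto simp: tn_def)
  have tnear: "\<bar>tn n - t0\<bar> < \<tau> / 2" and ynear: "norm (yn n - x0) < 1/4" for n
    using near[of n] norm_fst_le[of "tn n - t0" "yn n - x0"] norm_snd_le[of "yn n - x0" "tn n - t0"] d(2,3)
    by (auto simp: Zn)
  have shift: "Z n + (0, z) \<in> N" if "norm z \<le> 1/4" for n z
  proof -
    have "norm (x0 - (yn n + z)) \<le> norm (yn n - x0) + norm z"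
      using norm_triangle_ineq[of "yn n - x0" z] by (simp add: norm_minus_commute[of x0] algebra_simps)
    moreover have "t0 - \<tau> / 2 \<le> tn n" "tn n \<le> t0 + \<tau> / 2" using tnear[of n] by linarith+
    ultimately show ?thesis using ynear[of n] that by (auto simp: N_def Zn dist_norm)
  qed
  have ineq: "\<psi>' (Z n) (1, 0) \<le> (\<integral>z. indicator (cball 0 (1/4)) z * (\<psi> (Z n + (0, z)) - \<psi> (Z n) - \<psi>' (Z n) (0, z)) \<partial>\<mu>)
      + (\<integral>z. \<Phi> n (Z n + (0, z)) - \<Phi> n (Z n) \<partial>tail (1/4)) + f (tn n) (yn n) (\<Phi> n (Z n)) + e n" for n
  proof -
    obtain \<Phi>' A where P: "C2_on UNIV (\<Phi> n)" "\<And>z. (\<Phi> n has_derivative blinfun_apply (\<Phi>' z)) (at z)" "\<And>z. \<bar>\<Phi> n z\<bar> \<le> A"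
      "\<And>z v. \<bar>\<Phi> n (z + v) - \<Phi> n z - \<Phi>' z v\<bar> \<le> A * (norm v)\<^sup>2" "0 \<le> A"
      "\<And>t y. 0 \<le> t \<Longrightarrow> t \<le> T \<Longrightarrow> \<bar>\<Phi>' (t, y) (1, 0) - levy_op (\<lambda>x. \<Phi> n (t, x)) y - f t y (\<Phi> n (t, y))\<bar> \<le> e n"
      by (rule approx_solutionE[OF \<Phi>(1)[of n] levy_kernel_axioms]) blast
    \<comment> \<open>\<open>Z n\<close> is an interior maximum.\<close>
    have eq: "\<Phi>' (Z n) = \<psi>' (Z n)"
    proof -
      let ?O = "{t0 - \<tau> / 2<..<t0 + \<tau> / 2} \<times> ball x0 (1/2)"
      have D: "((\<lambda>z. \<Phi> n z - \<psi> z) has_derivative (\<lambda>v. \<Phi>' (Z n) v - \<psi>' (Z n) v)) (at (Z n))"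
        unfolding Zn by (intro has_derivative_diff P(2) \<psi>'(1) tn)
      have "(\<lambda>v. \<Phi>' (Z n) v - \<psi>' (Z n) v) = (\<lambda>v. 0)"
      proof (rule differential_zero_maxmin[of "Z n" ?O, OF _ _ D])
        have "t0 - \<tau> / 2 < tn n" "tn n < t0 + \<tau> / 2" using tnear[of n] by linarith+
        then show "Z n \<in> ?O" using ynear[of n] unfolding Zn
          by (simp add: dist_norm norm_minus_commute[of x0])
        show "open ?O" by (intro open_Times) auto
        have "?O \<subseteq> N" unfolding N_def by (intro Sigma_mono) auto
        then show "(\<forall>y\<in>?O. \<Phi> n y - \<psi> y \<le> \<Phi> n (Z n) - \<psi> (Z n)) \<or> (\<forall>y\<in>?O. \<Phi> n (Z n) - \<psi> (Z n) \<le> \<Phi> n y - \<psi> y)"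
          using Z(2) by blast
      qed
      then have "blinfun_apply (\<Phi>' (Z n)) v = blinfun_apply (\<psi>' (Z n)) v" for v by (metis eq_iff_diff_eq_0)
      then show ?thesis by (intro blinfun_eqI)
    qed
    have m\<Phi>: "(\<lambda>x. \<Phi> n (tn n, x)) \<in> borel_measurable borel"
    proof (rule borel_measurable_continuous_onI)
      show "continuous_on UNIV (\<lambda>x. \<Phi> n (tn n, x))"
        by (rule continuous_on_compose2[OF c\<Phi>]) (auto intro: continuous_intros)
    qed
    have T\<Phi>: "\<bar>\<Phi> n (tn n, yn n + z) - \<Phi> n (tn n, yn n) - space_gradient (\<Phi>' (Z n)) \<bullet> z\<bar> \<le> A * (norm z)\<^sup>2" for z
      using P(4)[of "Z n" "(0, z)"] by (simp add: space_gradient_inner norm_Pair Zn)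
    note split = levy_op_split[OF _ m\<Phi> P(3) T\<Phi>, of "1/4"]
    have m\<psi>: "(\<lambda>z. \<psi> (Z n + (0, z)) - \<psi> (Z n) - \<psi>' (Z n) (0, z)) \<in> borel_measurable borel"
    proof (rule borel_measurable_continuous_onI)
      have "continuous_on UNIV (\<lambda>z. \<psi> (Z n + (0, z)))"
        by (rule continuous_on_compose2[OF \<psi>'(2)]) (use tn[of n] in \<open>auto intro!: continuous_intros simp: spacetime_def Zn less_imp_le\<close>)
      then show "continuous_on UNIV (\<lambda>z. \<psi> (Z n + (0, z)) - \<psi> (Z n) - \<psi>' (Z n) (0, z))"
        by (intro continuous_intros)
    qed
    have "\<psi>' (Z n) (1, 0) \<le> levy_op (\<lambda>x. \<Phi> n (tn n, x)) (yn n) + f (tn n) (yn n) (\<Phi> n (Z n)) + e n"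
      using P(6)[of "tn n" "yn n"] tn[of n] eq by (simp add: Zn)
    also have "levy_op (\<lambda>x. \<Phi> n (tn n, x)) (yn n) = (\<integral>z. indicator (cball 0 (1/4)) z * (\<Phi> n (tn n, yn n + z) - \<Phi> n (tn n, yn n) - space_gradient (\<Phi>' (Z n)) \<bullet> z) \<partial>\<mu>)
        + (\<integral>z. \<Phi> n (Z n + (0, z)) - \<Phi> n (Z n) \<partial>tail (1/4))"
      using split(1) by (simp add: Zn)
    also have "(\<integral>z. indicator (cball 0 (1/4)) z * (\<Phi> n (tn n, yn n + z) - \<Phi> n (tn n, yn n) - space_gradient (\<Phi>' (Z n)) \<bullet> z) \<partial>\<mu>)
       \<le> (\<integral>z. indicator (cball 0 (1/4)) z * (\<psi> (Z n + (0, z)) - \<psi> (Z n) - \<psi>' (Z n) (0, z)) \<partial>\<mu>)"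
    proof (rule integral_mono)
      show "integrable \<mu> (\<lambda>z. indicator (cball 0 (1/4)) z * (\<Phi> n (tn n, yn n + z) - \<Phi> n (tn n, yn n) - space_gradient (\<Phi>' (Z n)) \<bullet> z))"
        by (rule split(2)) simp
      show "integrable \<mu> (\<lambda>z. indicator (cball 0 (1/4)) z * (\<psi> (Z n + (0, z)) - \<psi> (Z n) - \<psi>' (Z n) (0, z)))"
      proof (rule levy_dominated_small(1)[OF _ m\<psi>])
        show "\<bar>\<psi> (Z n + (0, z)) - \<psi> (Z n) - \<psi>' (Z n) (0, z)\<bar> \<le> B * (norm z)\<^sup>2" if "norm z \<le> 1/4" for z
          using B(2)[OF Z(1) shift[OF that]] by (simp add: norm_Pair)
      qed simp
      show "indicator (cball 0 (1/4)) z * (\<Phi> n (tn n, yn n + z) - \<Phi> n (tn n, yn n) - space_gradient (\<Phi>' (Z n)) \<bullet> z)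
         \<le> indicator (cball 0 (1/4)) z * (\<psi> (Z n + (0, z)) - \<psi> (Z n) - \<psi>' (Z n) (0, z))" for z
      proof (cases "norm z \<le> 1/4")
        case True
        have "\<Phi> n (tn n, yn n + z) - \<Phi> n (tn n, yn n) \<le> \<psi> (Z n + (0, z)) - \<psi> (Z n)"
          using Z(2)[OF shift[OF True, of n], of n] by (simp add: Zn)
        then show ?thesis using True by (simp add: space_gradient_inner eq)
      qed simp
    qed
    finally show ?thesis by simp
  qed
  have cu: "continuous_on spacetime u" by (rule C_b_continuous[OF u])
  have in_st: "Z n + (0, z) \<in> spacetime" "?z0 + (0, z) \<in> spacetime" for n z
    using tn[of n] t0 by (simp_all add: spacetime_def Zn)
  have Zs: "(\<lambda>n. Z n + (0, z)) \<longlonglongrightarrow> ?z0 + (0, z)" for z by (intro tendsto_intros Zlim)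
  have along: "(\<lambda>n. F (Z n + (0, z))) \<longlonglongrightarrow> F (?z0 + (0, z))" if "continuous_on spacetime F" for F :: "real \<times> (real ^ 'n) \<Rightarrow> 'b::real_normed_vector" and z
    by (rule continuous_on_tendsto_compose[OF that Zs]) (use in_st in auto)
  have zz: "Z n + (0, 0) = Z n" "?z0 + (0, 0) = ?z0" for n by (simp_all add: Zn)
  have l\<psi>: "(\<lambda>n. \<psi> (Z n)) \<longlonglongrightarrow> \<psi> ?z0" using along[OF \<psi>'(2), of 0] unfolding zz .
  have l\<psi>': "(\<lambda>n. \<psi>' (Z n)) \<longlonglongrightarrow> \<psi>' ?z0" using along[OF \<psi>'(3), of 0] unfolding zz .
  have l\<Phi>: "(\<lambda>n. \<Phi> n (Z n + (0, z))) \<longlonglongrightarrow> u (?z0 + (0, z))" for z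
  proof -
    have "(\<lambda>n. \<Phi> n (Z n + (0, z)) - u (Z n + (0, z))) \<longlonglongrightarrow> 0"
    proof (rule Lim_null_comparison[OF always_eventually e_lim], rule allI)
      show "norm (\<Phi> n (Z n + (0, z)) - u (Z n + (0, z))) \<le> e n" for n
        using \<Phi>(2)[of "tn n" "yn n + z" n] tn[of n] by (simp add: Zn abs_minus_commute)
    qed
    from tendsto_add[OF this along[OF cu, of z]] show ?thesis by simp
  qed
  have J: "(\<lambda>n. \<integral>z. indicator (cball 0 (1/4)) z * (\<psi> (Z n + (0, z)) - \<psi> (Z n) - \<psi>' (Z n) (0, z)) \<partial>\<mu>)
      \<longlonglongrightarrow> (\<integral>z. indicator (cball 0 (1/4)) z * (\<psi> (?z0 + (0, z)) - \<psi> ?z0 - \<psi>' ?z0 (0, z)) \<partial>\<mu>)"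
  proof (rule integral_dominated_convergence[where w = "\<lambda>z. B * (indicator (cball 0 (1/4)) z * (norm z)\<^sup>2)"])
    have meas: "(\<lambda>z. indicator (cball 0 (1/4)) z * (\<psi> (x + (0, z)) - \<psi> x - \<psi>' x (0, z))) \<in> borel_measurable \<mu>" if "0 \<le> fst x" for x
    proof -
      have xe: "x + (0, z) = (fst x, snd x + z)" for z by (simp add: prod_eq_iff)
      have "continuous_on UNIV (\<lambda>z. \<psi> (x + (0, z)))"
        unfolding xe by (rule continuous_on_compose2[OF \<psi>'(2)]) (use that in \<open>auto intro!: continuous_intros simp: spacetime_def\<close>)
      then have "continuous_on UNIV (\<lambda>z. \<psi> (x + (0, z)) - \<psi> x - \<psi>' x (0, z))"
        by (intro continuous_intros)
      then have [measurable]: "(\<lambda>z. \<psi> (x + (0, z)) - \<psi> x - \<psi>' x (0, z)) \<in> borel_measurable borel" by (rule borel_measurable_continuous_onI)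
      show ?thesis unfolding measurable_levy by measurable
    qed
    show "(\<lambda>z. indicator (cball 0 (1/4)) z * (\<psi> (?z0 + (0, z)) - \<psi> ?z0 - \<psi>' ?z0 (0, z))) \<in> borel_measurable \<mu>"
      by (rule meas) (use t0 in simp)
    show "(\<lambda>z. indicator (cball 0 (1/4)) z * (\<psi> (Z n + (0, z)) - \<psi> (Z n) - \<psi>' (Z n) (0, z))) \<in> borel_measurable \<mu>" for n
      by (rule meas) (use tn[of n] in \<open>simp add: tn_def\<close>)
    show "integrable \<mu> (\<lambda>z. B * (indicator (cball 0 (1/4)) z * (norm z)\<^sup>2))"
      by (intro integrable_mult_right second_moment_finite) simp
    show "AE z in \<mu>. (\<lambda>n. indicator (cball 0 (1/4)) z * (\<psi> (Z n + (0, z)) - \<psi> (Z n) - \<psi>' (Z n) (0, z))) \<longlonglongrightarrow>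
        indicator (cball 0 (1/4)) z * (\<psi> (?z0 + (0, z)) - \<psi> ?z0 - \<psi>' ?z0 (0, z))"
      by (intro AE_I2 tendsto_intros along[OF \<psi>'(2)] l\<psi> l\<psi>' blinfun.tendsto)
    show "AE z in \<mu>. norm (indicator (cball 0 (1/4)) z * (\<psi> (Z n + (0, z)) - \<psi> (Z n) - \<psi>' (Z n) (0, z))) \<le> B * (indicator (cball 0 (1/4)) z * (norm z)\<^sup>2)" for n
    proof (rule AE_I2)
      fix z show "norm (indicator (cball 0 (1/4)) z * (\<psi> (Z n + (0, z)) - \<psi> (Z n) - \<psi>' (Z n) (0, z))) \<le> B * (indicator (cball 0 (1/4)) z * (norm z)\<^sup>2)"
        using B(2)[OF Z(1) shift[of z n]] by (cases "norm z \<le> 1/4") (simp_all add: norm_Pair)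
    qed
  qed
  have O: "(\<lambda>n. \<integral>z. \<Phi> n (Z n + (0, z)) - \<Phi> n (Z n) \<partial>tail (1/4)) \<longlonglongrightarrow> (\<integral>z. u (?z0 + (0, z)) - u ?z0 \<partial>tail (1/4))"
  proof -
    interpret finite_measure "tail (1/4)" by (rule finite_tail) simp
    show ?thesis
    proof (rule integral_dominated_convergence[where w = "\<lambda>_. 2 * (V + 1)"])
      have "(\<lambda>x. u (t0, x)) \<in> borel_measurable borel" using C_b_slice_measurable[OF u, of t0] t0 by simp
      then have "(\<lambda>z. (\<lambda>x. u (t0, x)) (x0 + z)) \<in> borel_measurable borel" by measurable
      then show "(\<lambda>z. u (?z0 + (0, z)) - u ?z0) \<in> borel_measurable (tail (1/4))" by simp
      show "(\<lambda>z. \<Phi> n (Z n + (0, z)) - \<Phi> n (Z n)) \<in> borel_measurable (tail (1/4))" for n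
      proof -
        have "continuous_on UNIV (\<lambda>z. \<Phi> n (Z n + (0, z)))"
          by (rule continuous_on_compose2[OF c\<Phi>]) (auto intro!: continuous_intros)
        then have "(\<lambda>z. \<Phi> n (Z n + (0, z))) \<in> borel_measurable borel" by (rule borel_measurable_continuous_onI)
        then show ?thesis by simp
      qed
      have l0: "(\<lambda>n. \<Phi> n (Z n)) \<longlonglongrightarrow> u ?z0" using l\<Phi>[of 0] unfolding zz .
      show "AE z in tail (1/4). (\<lambda>n. \<Phi> n (Z n + (0, z)) - \<Phi> n (Z n)) \<longlonglongrightarrow> u (?z0 + (0, z)) - u ?z0"
        by (intro AE_I2 tendsto_diff l\<Phi> l0)
      have b: "\<bar>\<Phi> n (tn n, y)\<bar> \<le> V + 1" for n y
        using \<Phi>(2)[of "tn n" y n] V(2)[of "tn n" y] tn[of n] e_le(1)[of n] by linarith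
      have "norm (\<Phi> n (Z n + (0, z)) - \<Phi> n (Z n)) \<le> 2 * (V + 1)" for n z
        using b[of n "yn n + z"] b[of n "yn n"] by (simp add: Zn)
      then show "AE z in tail (1/4). norm (\<Phi> n (Z n + (0, z)) - \<Phi> n (Z n)) \<le> 2 * (V + 1)" for n
        by (intro AE_I2)
    qed simp
  qed
  have F: "(\<lambda>n. f (tn n) (yn n) (\<Phi> n (Z n))) \<longlonglongrightarrow> f t0 x0 (u ?z0)"
  proof (rule LIM_zero_cancel, rule Lim_null_comparison)
    show "\<forall>\<^sub>F n in sequentially. norm (f (tn n) (yn n) (\<Phi> n (Z n)) - f t0 x0 (u ?z0)) \<le> K' * (\<bar>tn n - t0\<bar> + norm (yn n - x0)) + K * \<bar>\<Phi> n (Z n) - u ?z0\<bar>"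
      using f_lip_both tn t0 by (intro always_eventually allI) (simp add: less_imp_le)
    have l0: "(\<lambda>n. \<Phi> n (Z n)) \<longlonglongrightarrow> u ?z0" using l\<Phi>[of 0] unfolding zz .
    have "(\<lambda>n. K' * (\<bar>tn n - t0\<bar> + norm (yn n - x0)) + K * \<bar>\<Phi> n (Z n) - u ?z0\<bar>) \<longlonglongrightarrow> K' * (\<bar>t0 - t0\<bar> + norm (x0 - x0)) + K * \<bar>u ?z0 - u ?z0\<bar>"
      by (intro tendsto_intros tlim ylim l0)
    then show "(\<lambda>n. K' * (\<bar>tn n - t0\<bar> + norm (yn n - x0)) + K * \<bar>\<Phi> n (Z n) - u ?z0\<bar>) \<longlonglongrightarrow> 0" by simp
  qed
  have "\<psi>' ?z0 (1, 0) \<le> (\<integral>z. indicator (cball 0 (1/4)) z * (\<psi> (?z0 + (0, z)) - \<psi> ?z0 - \<psi>' ?z0 (0, z)) \<partial>\<mu>)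
      + (\<integral>z. u (?z0 + (0, z)) - u ?z0 \<partial>tail (1/4)) + f t0 x0 (u ?z0) + 0"
  proof (rule LIMSEQ_le)
    show "(\<lambda>n. \<psi>' (Z n) (1, 0)) \<longlonglongrightarrow> \<psi>' ?z0 (1, 0)" by (intro blinfun.tendsto l\<psi>' tendsto_const)
    show "(\<lambda>n. (\<integral>z. indicator (cball 0 (1/4)) z * (\<psi> (Z n + (0, z)) - \<psi> (Z n) - \<psi>' (Z n) (0, z)) \<partial>\<mu>)
      + (\<integral>z. \<Phi> n (Z n + (0, z)) - \<Phi> n (Z n) \<partial>tail (1/4)) + f (tn n) (yn n) (\<Phi> n (Z n)) + e n) \<longlonglongrightarrow>
       (\<integral>z. indicator (cball 0 (1/4)) z * (\<psi> (?z0 + (0, z)) - \<psi> ?z0 - \<psi>' ?z0 (0, z)) \<partial>\<mu>)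
      + (\<integral>z. u (?z0 + (0, z)) - u ?z0 \<partial>tail (1/4)) + f t0 x0 (u ?z0) + 0"
      by (intro tendsto_add J O F e_lim)
  qed (use ineq in blast)
  moreover have "deriv (\<lambda>t. \<phi> (t, x0)) t0 = \<psi>' ?z0 (1, 0)" and grad: "gradient (\<lambda>x. \<phi> (t0, x)) x0 = space_gradient (\<psi>' ?z0)"
    using has_derivative_slices(1,2)[OF \<phi>'[OF t0, of x0]] by (simp_all add: same)
  moreover have "(\<integral>z. indicator (cball 0 (1/4)) z * (\<psi> (?z0 + (0, z)) - \<psi> ?z0 - \<psi>' ?z0 (0, z)) \<partial>\<mu>)
      = (\<integral>z. indicator (cball 0 (1/4)) z * (\<phi> (t0, x0 + z) - \<phi> (t0, x0) - gradient (\<lambda>x. \<phi> (t0, x)) x0 \<bullet> z) \<partial>\<mu>) + \<kappa> * small_moment (1/4)"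
  proof -
    obtain B' where B': "0 \<le> B'" "\<And>z. norm z \<le> 1/4 \<Longrightarrow> \<bar>\<phi> (t0, x0 + z) - \<phi> (t0, x0) - gradient (\<lambda>x. \<phi> (t0, x)) x0 \<bullet> z\<bar> \<le> B' * (norm z)\<^sup>2"
      using slice_taylor[OF \<phi> t0] by blast
    have "continuous_on spacetime \<phi>" by (rule C2_onE[OF \<phi>])
    then have "continuous_on UNIV (\<lambda>x. \<phi> (t0, x))"
      by (rule continuous_on_compose2) (use t0 in \<open>auto intro!: continuous_intros simp: spacetime_def\<close>)
    then have [measurable]: "(\<lambda>x. \<phi> (t0, x)) \<in> borel_measurable borel" by (rule borel_measurable_continuous_onI)
    have i1: "integrable \<mu> (\<lambda>z. indicator (cball 0 (1/4)) z * (\<phi> (t0, x0 + z) - \<phi> (t0, x0) - gradient (\<lambda>x. \<phi> (t0, x)) x0 \<bullet> z))"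
      by (rule levy_dominated_small(1)[OF _ _ B'(2)]) (simp, measurable)
    have i2: "integrable \<mu> (\<lambda>z. \<kappa> * (indicator (cball 0 (1/4)) z * (norm z)\<^sup>2))"
      by (intro integrable_mult_right second_moment_finite) simp
    have "(\<integral>z. indicator (cball 0 (1/4)) z * (\<psi> (?z0 + (0, z)) - \<psi> ?z0 - \<psi>' ?z0 (0, z)) \<partial>\<mu>)
      = (\<integral>z. indicator (cball 0 (1/4)) z * (\<phi> (t0, x0 + z) - \<phi> (t0, x0) - gradient (\<lambda>x. \<phi> (t0, x)) x0 \<bullet> z) + \<kappa> * (indicator (cball 0 (1/4)) z * (norm z)\<^sup>2) \<partial>\<mu>)"
      by (rule Bochner_Integration.integral_cong[OF refl]) (simp add: \<psi>_def grad space_gradient_inner norm_Pair algebra_simps)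
    then show ?thesis using Bochner_Integration.integral_add[OF i1 i2] by (simp add: small_moment_def)
  qed
  ultimately show ?thesis by simp
qed

end

lemma C_b_uminus:
  assumes "v \<in> C_b"
  shows "(\<lambda>z. - v z) \<in> C_b"
proof -
  have u: "usc_on S (\<lambda>z. - v z)" if "lsc_on S v" for S
    unfolding usc_on_def
  proof (intro ballI allI impI)
    fix x a assume "x \<in> S" "- v x < a"
    then have "\<forall>\<^sub>F y in at x within S. - a < v y" using that unfolding lsc_on_def by (meson minus_less_iff)
    then show "\<forall>\<^sub>F y in at x within S. - v y < a" by eventually_elim simp
  qed
  have l: "lsc_on S (\<lambda>z. - v z)" if "usc_on S v" for S
    unfolding lsc_on_def
  proof (intro ballI allI impI)
    fix x a assume "x \<in> S" "a < - v x"
    then have "\<forall>\<^sub>F y in at x within S. v y < - a" using that unfolding usc_on_def by (meson less_minus_iff)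
    then show "\<forall>\<^sub>F y in at x within S. a < - v y" by eventually_elim simp
  qed
  have b: "bounded_in_finite_time (\<lambda>z. - v z)" if "bounded_in_finite_time v"
    using that unfolding bounded_in_finite_time_def by (metis bounded_uminus image_image)
  show ?thesis using assms u l b by (auto simp: C_b_def USC_b_def LSC_b_def)
qed

context levy_kernel
begin

lemma levy_outer_uminus:
  "levy_outer g s r (\<lambda>x. - u x) x = - levy_outer g s r u x"
proof -
  have "(\<lambda>z. indicat_real {z. r < norm z} z *\<^sub>R (- u (x + z) - - u x)) = (\<lambda>z. - (indicat_real {z. r < norm z} z *\<^sub>R (u (x + z) - u x)))"
    by (auto simp: algebra_simps)
  then show ?thesis unfolding levy_outer_def set_lebesgue_integral_def by (simp only: Bochner_Integration.integral_minus)
qed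

lemma test_function_uminus:
  assumes "C2_on spacetime \<phi>" "0 < t0"
  shows "deriv (\<lambda>t. - \<phi> (t, x0)) t0 = - deriv (\<lambda>t. \<phi> (t, x0)) t0"
    "levy_inner g s r (\<lambda>x. - \<phi> (t0, x)) x0 = - levy_inner g s r (\<lambda>x. \<phi> (t0, x)) x0"
proof -
  obtain \<phi>' where \<phi>': "\<And>t x. 0 < t \<Longrightarrow> (\<phi> has_derivative blinfun_apply (\<phi>' (t, x))) (at (t, x))"
    by (rule C2_spacetimeE[OF assms(1)]) blast
  have "((\<lambda>z. - \<phi> z) has_derivative blinfun_apply (- \<phi>' (t0, x0))) (at (t0, x0))"
    by (rule has_derivative_eq_rhs[OF has_derivative_minus[OF \<phi>'[OF assms(2)]]]) (simp add: uminus_blinfun.rep_eq)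
  note n = has_derivative_slices(1,2)[OF this] and p = has_derivative_slices(1,2)[OF \<phi>'[OF assms(2), of x0]]
  show "deriv (\<lambda>t. - \<phi> (t, x0)) t0 = - deriv (\<lambda>t. \<phi> (t, x0)) t0"
    using n(2) p(2) by (simp add: uminus_blinfun.rep_eq)
  have g: "gradient (\<lambda>x. - \<phi> (t0, x)) x0 = - gradient (\<lambda>x. \<phi> (t0, x)) x0"
    using n(1) p(1) by (simp add: space_gradient_def uminus_blinfun.rep_eq sum_negf)
  show "levy_inner g s r (\<lambda>x. - \<phi> (t0, x)) x0 = - levy_inner g s r (\<lambda>x. \<phi> (t0, x)) x0"
    unfolding levy_inner_eq g
    by (subst Bochner_Integration.integral_minus[symmetric])
       (rule arg_cong[where f = "integral\<^sup>L \<mu>"], auto simp: algebra_simps)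
qed

text \<open>
  Negation turns every statement about supersolutions into one about subsolutions of an equation of
  the same class.
\<close>
lemma viscosity_supersolution_uminus:
  assumes v: "v \<in> C_b"
  shows "viscosity_supersolution g s (\<lambda>t y a q l. l + f t y a) (\<lambda>_. 0) v \<longleftrightarrow>
    viscosity_subsolution g s (\<lambda>t y a q l. l + - f t y (- a)) (\<lambda>_. 0) (\<lambda>z. - v z)"
proof -
  have env: "upper_envelope (\<lambda>_. 0) x = 0" "lower_envelope (\<lambda>_. 0) x = 0" for x :: "real ^ 'n"
    by (simp_all add: upper_envelope_def lower_envelope_def Limsup_const Liminf_const)
  let ?sup = "\<lambda>r t0 x0 \<tau> \<phi>. (t0, x0) \<in> spacetime \<and> \<tau> \<in> {0<..<t0} \<and> C2_on spacetime \<phi> \<and>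
        (\<forall>z \<in> {t0 - \<tau><..<t0 + \<tau>} \<times> ball x0 r. v z - \<phi> z \<ge> v (t0, x0) - \<phi> (t0, x0)) \<longrightarrow>
        deriv (\<lambda>t. \<phi> (t, x0)) t0
          - (levy_inner g s r (\<lambda>x. \<phi> (t0, x)) x0 + levy_outer g s r (\<lambda>x. v (t0, x)) x0 + f t0 x0 (v (t0, x0))) \<ge> 0"
  let ?sub = "\<lambda>r t0 x0 \<tau> \<phi>. (t0, x0) \<in> spacetime \<and> \<tau> \<in> {0<..<t0} \<and> C2_on spacetime \<phi> \<and>
        (\<forall>z \<in> {t0 - \<tau><..<t0 + \<tau>} \<times> ball x0 r. - v z - \<phi> z \<le> - v (t0, x0) - \<phi> (t0, x0)) \<longrightarrow>
        deriv (\<lambda>t. \<phi> (t, x0)) t0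
          - (levy_inner g s r (\<lambda>x. \<phi> (t0, x)) x0 + levy_outer g s r (\<lambda>x. - v (t0, x)) x0 + - f t0 x0 (- (- v (t0, x0)))) \<le> 0"
  have 1: "?sub r t0 x0 \<tau> \<phi>" if S: "\<And>\<phi>. ?sup r t0 x0 \<tau> \<phi>" for r t0 x0 \<tau> \<phi>
  proof (intro impI, elim conjE)
    assume a: "(t0, x0) \<in> spacetime" "\<tau> \<in> {0<..<t0}" "C2_on spacetime \<phi>"
      "\<forall>z \<in> {t0 - \<tau><..<t0 + \<tau>} \<times> ball x0 r. - v z - \<phi> z \<le> - v (t0, x0) - \<phi> (t0, x0)"
    have t0: "0 < t0" using a(2) by auto
    have m: "\<forall>z \<in> {t0 - \<tau><..<t0 + \<tau>} \<times> ball x0 r. v z - (- \<phi> z) \<ge> v (t0, x0) - (- \<phi> (t0, x0))"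
    proof
      fix z assume "z \<in> {t0 - \<tau><..<t0 + \<tau>} \<times> ball x0 r"
      then have "- v z - \<phi> z \<le> - v (t0, x0) - \<phi> (t0, x0)" using a(4) by blast
      then show "v z - (- \<phi> z) \<ge> v (t0, x0) - (- \<phi> (t0, x0))" by linarith
    qed
    from S[of "\<lambda>z. - \<phi> z"] a(1,2) C2_on_uminus[OF a(3)] m
    show "deriv (\<lambda>t. \<phi> (t, x0)) t0
          - (levy_inner g s r (\<lambda>x. \<phi> (t0, x)) x0 + levy_outer g s r (\<lambda>x. - v (t0, x)) x0 + - f t0 x0 (- (- v (t0, x0)))) \<le> 0"
      unfolding test_function_uminus[OF a(3) t0] levy_outer_uminus by simp
  qed
  have 2: "?sup r t0 x0 \<tau> \<phi>" if S: "\<And>\<phi>. ?sub r t0 x0 \<tau> \<phi>" for r t0 x0 \<tau> \<phi>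
  proof (intro impI, elim conjE)
    assume a: "(t0, x0) \<in> spacetime" "\<tau> \<in> {0<..<t0}" "C2_on spacetime \<phi>"
      "\<forall>z \<in> {t0 - \<tau><..<t0 + \<tau>} \<times> ball x0 r. v z - \<phi> z \<ge> v (t0, x0) - \<phi> (t0, x0)"
    have t0: "0 < t0" using a(2) by auto
    have m: "\<forall>z \<in> {t0 - \<tau><..<t0 + \<tau>} \<times> ball x0 r. - v z - (- \<phi> z) \<le> - v (t0, x0) - (- \<phi> (t0, x0))"
    proof
      fix z assume "z \<in> {t0 - \<tau><..<t0 + \<tau>} \<times> ball x0 r"
      then have "v z - \<phi> z \<ge> v (t0, x0) - \<phi> (t0, x0)" using a(4) by blast
      then show "- v z - (- \<phi> z) \<le> - v (t0, x0) - (- \<phi> (t0, x0))" by linarith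
    qed
    from S[of "\<lambda>z. - \<phi> z"] a(1,2) C2_on_uminus[OF a(3)] m
    show "deriv (\<lambda>t. \<phi> (t, x0)) t0
          - (levy_inner g s r (\<lambda>x. \<phi> (t0, x)) x0 + levy_outer g s r (\<lambda>x. v (t0, x)) x0 + f t0 x0 (v (t0, x0))) \<ge> 0"
      unfolding test_function_uminus[OF a(3) t0] levy_outer_uminus by simp
  qed
  have "(\<exists>r>0. \<forall>t0 x0 \<tau> \<phi>. ?sup r t0 x0 \<tau> \<phi>) \<longleftrightarrow> (\<exists>r>0. \<forall>t0 x0 \<tau> \<phi>. ?sub r t0 x0 \<tau> \<phi>)"
  proof
    assume "\<exists>r>0. \<forall>t0 x0 \<tau> \<phi>. ?sup r t0 x0 \<tau> \<phi>"
    then show "\<exists>r>0. \<forall>t0 x0 \<tau> \<phi>. ?sub r t0 x0 \<tau> \<phi>"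
    proof (elim exE conjE)
      fix r :: real assume r: "0 < r" and S: "\<forall>t0 x0 \<tau> \<phi>. ?sup r t0 x0 \<tau> \<phi>"
      have "\<forall>t0 x0 \<tau> \<phi>. ?sub r t0 x0 \<tau> \<phi>"
        by (intro allI, rule 1, rule S[THEN spec, THEN spec, THEN spec, THEN spec])
      with r show "\<exists>r>0. \<forall>t0 x0 \<tau> \<phi>. ?sub r t0 x0 \<tau> \<phi>" by (intro exI[of _ r] conjI)
    qed
  next
    assume "\<exists>r>0. \<forall>t0 x0 \<tau> \<phi>. ?sub r t0 x0 \<tau> \<phi>"
    then show "\<exists>r>0. \<forall>t0 x0 \<tau> \<phi>. ?sup r t0 x0 \<tau> \<phi>"
    proof (elim exE conjE)
      fix r :: real assume r: "0 < r" and S: "\<forall>t0 x0 \<tau> \<phi>. ?sub r t0 x0 \<tau> \<phi>"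
      have "\<forall>t0 x0 \<tau> \<phi>. ?sup r t0 x0 \<tau> \<phi>"
        by (intro allI, rule 2, rule S[THEN spec, THEN spec, THEN spec, THEN spec])
      with r show "\<exists>r>0. \<forall>t0 x0 \<tau> \<phi>. ?sup r t0 x0 \<tau> \<phi>" by (intro exI[of _ r] conjI)
    qed
  qed
  moreover have "v \<in> LSC_b" "(\<lambda>z. - v z) \<in> USC_b" using v C_b_uminus[OF v] by (auto simp: C_b_def)
  ultimately show ?thesis
    unfolding viscosity_subsolution_def viscosity_supersolution_def env by simp
qed

lemma approx_solution_uminus:
  assumes "approx_solution f T \<eta> \<Phi>"
  shows "approx_solution (\<lambda>t y a. - f t y (- a)) T \<eta> (\<lambda>z. - \<Phi> z)"
proof -
  obtain \<Phi>' B where P: "C2_on UNIV \<Phi>" "\<And>z. (\<Phi> has_derivative blinfun_apply (\<Phi>' z)) (at z)" "\<And>z. \<bar>\<Phi> z\<bar> \<le> B"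
    "\<And>z v. \<bar>\<Phi> (z + v) - \<Phi> z - \<Phi>' z v\<bar> \<le> B * (norm v)\<^sup>2" "0 \<le> B"
    "\<And>t y. 0 \<le> t \<Longrightarrow> t \<le> T \<Longrightarrow> \<bar>\<Phi>' (t, y) (1, 0) - levy_op (\<lambda>x. \<Phi> (t, x)) y - f t y (\<Phi> (t, y))\<bar> \<le> \<eta>"
    "\<And>y. \<bar>\<Phi> (0, y)\<bar> \<le> \<eta>"
    by (rule approx_solutionE[OF assms levy_kernel_axioms]) blast
  show ?thesis unfolding approx_solution_def
  proof (intro conjI exI[of _ "\<lambda>z. - \<Phi>' z"] exI[of _ B] allI ballI)
    show "C2_on UNIV (\<lambda>z. - \<Phi> z)" by (rule C2_on_uminus[OF P(1)])
    show "((\<lambda>z. - \<Phi> z) has_derivative blinfun_apply (- \<Phi>' z)) (at z)" for z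
      by (rule has_derivative_eq_rhs[OF has_derivative_minus[OF P(2)]]) (simp add: uminus_blinfun.rep_eq)
    show "\<bar>- \<Phi> (z + v) - - \<Phi> z - blinfun_apply (- \<Phi>' z) v\<bar> \<le> B * (norm v)\<^sup>2" for z v
      using P(4)[of z v] by (simp add: uminus_blinfun.rep_eq abs_le_iff)
    show "\<bar>blinfun_apply (- \<Phi>' (t, y)) (1, 0) - levy_op (\<lambda>x. - \<Phi> (t, x)) y - (- f t y (- (- \<Phi> (t, y))))\<bar> \<le> \<eta>" if "t \<in> {0..T}" for t y
      using P(6)[of t y] that unfolding levy_op_uminus by (simp add: uminus_blinfun.rep_eq abs_le_iff)
  qed (use P in auto)
qed

end

context levy_equation
begin

lemma uminus_equation: "levy_equation g s (\<lambda>t y a. - f t y (- a)) K K' C"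
proof (unfold_locales)
  show "\<bar>- f t y (- a) - - f t y (- a')\<bar> \<le> K * \<bar>a - a'\<bar>" if "0 \<le> t" for t y a a'
    using f_lip[OF that, of y "- a" "- a'"] by (simp add: abs_minus_commute)
  show "\<bar>- f t y (- a) - - f t' y' (- a)\<bar> \<le> K' * (\<bar>t - t'\<bar> + norm (y - y'))" if "0 \<le> t" "0 \<le> t'" for t t' y y' a
    using f_lip'[OF that, of y "- a" y'] by (simp add: abs_minus_commute)
qed (use f_bound K_nonneg K'_nonneg in auto)

text \<open>
  The perturbed inequality is available with the test function on jumps up to \<open>1/4\<close> and \<open>u\<close> on longer
  ones. Between \<open>1/4\<close> and 1 the increments of \<open>u\<close> are dominated by those of the test function, as
  \<open>u - \<phi>\<close> has a maximum over the unit ball, and the gradient term integrates to zero.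
\<close>
lemma limit_subsolution:
  assumes u: "u \<in> C_b" and u0: "\<And>y. u (0, y) \<le> 0"
    and approx: "\<And>T e. 0 < T \<Longrightarrow> 0 < e \<Longrightarrow> \<exists>\<Phi>. approx_solution f T e \<Phi> \<and> (\<forall>t\<in>{0..T}. \<forall>y. \<bar>u (t, y) - \<Phi> (t, y)\<bar> \<le> e)"
  shows "viscosity_subsolution g s (\<lambda>t y a q l. l + f t y a) (\<lambda>_. 0) u"
proof -
  have env: "upper_envelope (\<lambda>_. 0) x = 0" for x :: "real ^ 'n"
    by (simp add: upper_envelope_def Limsup_const)
  have main: "deriv (\<lambda>t. \<phi> (t, x0)) t0 - (levy_inner g s 1 (\<lambda>x. \<phi> (t0, x)) x0 + levy_outer g s 1 (\<lambda>x. u (t0, x)) x0 + f t0 x0 (u (t0, x0))) \<le> 0"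
    if a: "\<tau> \<in> {0<..<t0}" "C2_on spacetime \<phi>" and max: "\<And>z. z \<in> {t0 - \<tau><..<t0 + \<tau>} \<times> ball x0 1 \<Longrightarrow> u z - \<phi> z \<le> u (t0, x0) - \<phi> (t0, x0)"
    for t0 x0 \<tau> \<phi>
  proof -
    have \<tau>: "0 < \<tau>" "\<tau> < t0" using a by auto
    have t0: "0 < t0" using \<tau> by linarith
    let ?A = "\<lambda>z. \<phi> (t0, x0 + z) - \<phi> (t0, x0) - gradient (\<lambda>x. \<phi> (t0, x)) x0 \<bullet> z"
    let ?U = "\<lambda>z. u (t0, x0 + z) - u (t0, x0)"
    let ?G = "gradient (\<lambda>x. \<phi> (t0, x)) x0"
    let ?S = "{z. 1/4 < norm z \<and> norm z \<le> 1}"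
    have D: "deriv (\<lambda>t. \<phi> (t, x0)) t0 \<le> (\<integral>z. indicator (cball 0 (1/4)) z * ?A z \<partial>\<mu>) + (\<integral>z. ?U z \<partial>tail (1/4)) + f t0 x0 (u (t0, x0))"
    proof (rule field_le_epsilon)
      fix e :: real assume e: "0 < e"
      define \<kappa> where "\<kappa> = e / (small_moment (1/4) + 1)"
      have \<kappa>: "0 < \<kappa>" "\<kappa> * small_moment (1/4) \<le> e"
        using e small_moment_nonneg[of "1/4"] by (auto simp: \<kappa>_def field_simps add_nonneg_pos)
      show "deriv (\<lambda>t. \<phi> (t, x0)) t0 \<le> (\<integral>z. indicator (cball 0 (1/4)) z * ?A z \<partial>\<mu>) + (\<integral>z. ?U z \<partial>tail (1/4)) + f t0 x0 (u (t0, x0)) + e"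
        using limit_subsolution_perturbed[OF u approx \<tau> a(2) max \<kappa>(1)] \<kappa>(2) by linarith
    qed
    have c\<phi>: "continuous_on UNIV (\<lambda>x. \<phi> (t0, x))"
      by (rule C2_onE[OF a(2)], rule continuous_on_compose2, assumption) (use t0 in \<open>auto intro!: continuous_intros simp: spacetime_def\<close>)
    have cu: "continuous_on UNIV (\<lambda>x. u (t0, x))"
      by (rule continuous_on_compose2[OF C_b_continuous[OF u]]) (use t0 in \<open>auto intro!: continuous_intros simp: spacetime_def\<close>)
    have [measurable]: "(\<lambda>x. \<phi> (t0, x)) \<in> borel_measurable borel" "(\<lambda>x. u (t0, x)) \<in> borel_measurable borel"
      by (rule borel_measurable_continuous_onI[OF c\<phi>], rule borel_measurable_continuous_onI[OF cu])
    obtain V where V: "0 \<le> V" "\<And>t x. 0 < t \<Longrightarrow> t < t0 + 1 \<Longrightarrow> \<bar>u (t, x)\<bar> \<le> V"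
      using C_b_bound[OF u, of "t0 + 1"] t0 by auto
    have Ub: "\<bar>?U z\<bar> \<le> 2 * V" for z using V(2)[of t0 "x0 + z"] V(2)[of t0 x0] t0 by linarith
    have iU: "integrable (tail r) ?U" if "0 < r" for r
      by (rule integrable_tail_bounded[OF that _ Ub]) measurable
    have iU': "integrable \<mu> (\<lambda>z. indicator {z. r < norm z} z * ?U z)" if "0 < r" for r
      using iU[OF that] by (subst (asm) tail_integral_eq(2)) auto
    obtain B where B: "0 \<le> B" "\<And>z. norm z \<le> 1 \<Longrightarrow> \<bar>?A z\<bar> \<le> B * (norm z)\<^sup>2"
      using slice_taylor[OF a(2) t0] by blast
    have iA: "integrable \<mu> (\<lambda>z. indicator (cball 0 r) z * ?A z)" if "0 < r" "r \<le> 1" for r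
      by (rule levy_dominated_small(1)[OF that(1) _ B(2)]) (use that in auto)
    have split_ind: "indicator (cball 0 1) z = indicator (cball 0 (1/4)) z + (indicator ?S z :: real)"
      "indicator {z. 1/4 < norm z} z = indicator {z. 1 < norm z} z + (indicator ?S z :: real)" for z :: "real ^ 'n"
      by (auto simp: indicator_def)
    have iSA: "integrable \<mu> (\<lambda>z. indicator ?S z * ?A z)"
      using Bochner_Integration.integrable_diff[OF iA[of 1] iA[of "1/4"]] unfolding split_ind by (simp add: algebra_simps)
    have iSU: "integrable \<mu> (\<lambda>z. indicator ?S z * ?U z)"
      using Bochner_Integration.integrable_diff[OF iU'[of "1/4"] iU'[of 1]] unfolding split_ind by (simp add: algebra_simps)
    have iSG: "integrable \<mu> (\<lambda>z. indicator ?S z * (?G \<bullet> z))" and zSG: "(\<integral>z. indicator ?S z * (?G \<bullet> z) \<partial>\<mu>) = 0"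
      by (rule annulus_linear_integral; simp)+
    \<comment> \<open>The maximum is over an open ball; points at distance 1 are reached by continuity.\<close>
    have le1: "?U z \<le> ?A z + ?G \<bullet> z" if "norm z \<le> 1" for z
    proof -
      have "(\<lambda>n. u (t0, x0 + (1 - inverse (real (Suc n))) *\<^sub>R z) - \<phi> (t0, x0 + (1 - inverse (real (Suc n))) *\<^sub>R z)) \<longlonglongrightarrow> u (t0, x0 + (1 - 0) *\<^sub>R z) - \<phi> (t0, x0 + (1 - 0) *\<^sub>R z)"
      proof -
        have "(\<lambda>n. x0 + (1 - inverse (real (Suc n))) *\<^sub>R z) \<longlonglongrightarrow> x0 + (1 - 0) *\<^sub>R z"
          by (intro tendsto_intros LIMSEQ_inverse_real_of_nat)
        from continuous_on_tendsto_compose[OF cu this] continuous_on_tendsto_compose[OF c\<phi> this]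
        show ?thesis by (intro tendsto_diff) auto
      qed
      moreover have "u (t0, x0 + (1 - inverse (real (Suc n))) *\<^sub>R z) - \<phi> (t0, x0 + (1 - inverse (real (Suc n))) *\<^sub>R z) \<le> u (t0, x0) - \<phi> (t0, x0)" for n
      proof (rule max)
        have i: "0 < inverse (real (Suc n))" "inverse (real (Suc n)) \<le> 1" by (auto simp: field_simps)
        have "norm ((1 - inverse (real (Suc n))) *\<^sub>R z) = (1 - inverse (real (Suc n))) * norm z" using i by simp
        also have "\<dots> \<le> (1 - inverse (real (Suc n))) * 1" using i that by (intro mult_left_mono) auto
        also have "\<dots> < 1" using i by simp
        finally show "(t0, x0 + (1 - inverse (real (Suc n))) *\<^sub>R z) \<in> {t0 - \<tau><..<t0 + \<tau>} \<times> ball x0 1"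
          using \<tau> by (simp add: dist_norm)
      qed
      ultimately have "u (t0, x0 + (1 - 0) *\<^sub>R z) - \<phi> (t0, x0 + (1 - 0) *\<^sub>R z) \<le> u (t0, x0) - \<phi> (t0, x0)"
        by (intro LIMSEQ_le_const2) blast+
      then show ?thesis by simp
    qed
    have "(\<integral>z. ?U z \<partial>tail (1/4)) = (\<integral>z. indicator {z. 1/4 < norm z} z * ?U z \<partial>\<mu>)" by (subst tail_integral_eq(1)) auto
    also have "\<dots> = (\<integral>z. indicator {z. 1 < norm z} z * ?U z + indicator ?S z * ?U z \<partial>\<mu>)"
      unfolding split_ind(2) by (simp add: distrib_right)
    also have "\<dots> = (\<integral>z. indicator {z. 1 < norm z} z * ?U z \<partial>\<mu>) + (\<integral>z. indicator ?S z * ?U z \<partial>\<mu>)"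
      by (rule Bochner_Integration.integral_add[OF iU' iSU]) simp
    finally have split_outer: "(\<integral>z. ?U z \<partial>tail (1/4)) = (\<integral>z. indicator {z. 1 < norm z} z * ?U z \<partial>\<mu>) + (\<integral>z. indicator ?S z * ?U z \<partial>\<mu>)" .
    have far: "(\<integral>z. indicator {z. 1 < norm z} z * ?U z \<partial>\<mu>) = (\<integral>z. ?U z \<partial>tail 1)" by (subst tail_integral_eq(1)) auto
    have near: "(\<integral>z. indicator ?S z * ?U z \<partial>\<mu>) \<le> (\<integral>z. indicator ?S z * ?A z + indicator ?S z * (?G \<bullet> z) \<partial>\<mu>)"
    proof (rule integral_mono[OF iSU Bochner_Integration.integrable_add[OF iSA iSG]])
      show "indicator ?S z * ?U z \<le> indicator ?S z * ?A z + indicator ?S z * (?G \<bullet> z)" for z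
        using le1[of z] by (simp add: indicator_def)
    qed
    have annulus: "(\<integral>z. indicator ?S z * ?A z + indicator ?S z * (?G \<bullet> z) \<partial>\<mu>) = (\<integral>z. indicator ?S z * ?A z \<partial>\<mu>)"
      using Bochner_Integration.integral_add[OF iSA iSG] zSG by simp
    have O: "(\<integral>z. ?U z \<partial>tail (1/4)) \<le> (\<integral>z. ?U z \<partial>tail 1) + (\<integral>z. indicator ?S z * ?A z \<partial>\<mu>)" using split_outer near unfolding far annulus by linarith
    have "(\<integral>z. indicator (cball 0 1) z * ?A z \<partial>\<mu>) = (\<integral>z. indicator (cball 0 (1/4)) z * ?A z + indicator ?S z * ?A z \<partial>\<mu>)"
      unfolding split_ind(1) by (simp add: distrib_right)
    also have "\<dots> = (\<integral>z. indicator (cball 0 (1/4)) z * ?A z \<partial>\<mu>) + (\<integral>z. indicator ?S z * ?A z \<partial>\<mu>)"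
      by (rule Bochner_Integration.integral_add[OF iA iSA]) auto
    finally have I: "levy_inner g s 1 (\<lambda>x. \<phi> (t0, x)) x0 = (\<integral>z. indicator (cball 0 (1/4)) z * ?A z \<partial>\<mu>) + (\<integral>z. indicator ?S z * ?A z \<partial>\<mu>)"
      by (simp add: levy_inner_eq)
    have "levy_outer g s 1 (\<lambda>x. u (t0, x)) x0 = (\<integral>z. ?U z \<partial>tail 1)" by (rule levy_outer_tail) measurable
    then show ?thesis using D O I by linarith
  qed
  show ?thesis
    unfolding viscosity_subsolution_def env
  proof (intro conjI exI[of _ 1] allI impI)
    show "u \<in> USC_b" using u by (simp add: C_b_def)
    show "ereal (u (0, x)) \<le> 0" for x using u0[of x] by simp
  qed (use main in auto)
qed

lemma sol_0: "sol (0, y) = 0"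
  using sol_bound[of 0 y] by simp

lemma continuous_on_imp_C_b:
  fixes u :: "real \<times> (real ^ 'n) \<Rightarrow> real"
  assumes "continuous_on spacetime u" "bounded_in_finite_time u"
  shows "u \<in> C_b"
proof -
  have lim: "(u \<longlongrightarrow> u x) (at x within spacetime)" if "x \<in> spacetime" for x
    using assms(1) that unfolding continuous_on_def by blast
  have "usc_on spacetime u" "lsc_on spacetime u"
    using order_tendstoD[OF lim] by (auto simp only: usc_on_def lsc_on_def)
  then show ?thesis using assms(2) by (simp add: C_b_def USC_b_def LSC_b_def)
qed

lemma sol_C_b: "sol \<in> C_b"
proof (rule continuous_on_imp_C_b[OF sol_continuous])
  show "bounded_in_finite_time sol"
    unfolding bounded_in_finite_time_def
  proof (intro allI impI)
    fix T :: real assume T: "0 < T"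
    show "bounded (sol ` ({0<..<T} \<times> UNIV))"
    proof (rule boundedI[of _ "T * C"])
      fix x assume "x \<in> sol ` ({0<..<T} \<times> UNIV)"
      then obtain t y where ty: "0 < t" "t < T" "x = sol (t, y)" by auto
      have "\<bar>sol (t, y)\<bar> \<le> t * C" using sol_bound[of t y] ty by simp
      also have "\<dots> \<le> T * C" using ty C_nonneg by (intro mult_right_mono) auto
      finally show "norm x \<le> T * C" by (simp add: ty)
    qed
  qed
qed

lemma sol_approx:
  assumes "0 < T" "0 < e"
  shows "\<exists>\<Phi>. approx_solution f T e \<Phi> \<and> (\<forall>t\<in>{0..T}. \<forall>y. \<bar>sol (t, y) - \<Phi> (t, y)\<bar> \<le> e)"
proof -
  define \<eta> where "\<eta> = min e (e / stability_constant T)"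
  have c: "0 < stability_constant T" using assms by (intro stability_constant_pos) simp
  have \<eta>: "0 < \<eta>" "\<eta> \<le> e" "stability_constant T * \<eta> \<le> e"
  proof -
    show "0 < \<eta>" "\<eta> \<le> e" using c assms by (auto simp: \<eta>_def)
    have "stability_constant T * \<eta> \<le> stability_constant T * (e / stability_constant T)"
      using c by (intro mult_left_mono) (auto simp: \<eta>_def)
    then show "stability_constant T * \<eta> \<le> e" using c by simp
  qed
  obtain \<Phi> where \<Phi>: "approx_solution f T \<eta> \<Phi>" using approx_solution_exists[of T \<eta>] assms \<eta> by auto
  have "approx_solution f T e \<Phi>" using \<Phi> \<eta>(2) unfolding approx_solution_def by (meson order_trans)
  moreover have "\<bar>sol (t, y) - \<Phi> (t, y)\<bar> \<le> e" if "t \<in> {0..T}" for t y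
    using sol_near_approx_solution[OF \<Phi> \<eta>(1), of t y] that \<eta>(3) by auto
  ultimately show ?thesis by blast
qed

theorem sol_viscosity_solution: "viscosity_solution g s (\<lambda>t y a q l. l + f t y a) (\<lambda>_. 0) sol"
proof -
  interpret neg: levy_equation g s "\<lambda>t y a. - f t y (- a)" K K' C by (rule uminus_equation)
  have "viscosity_subsolution g s (\<lambda>t y a q l. l + f t y a) (\<lambda>_. 0) sol"
    by (rule limit_subsolution[OF sol_C_b _ sol_approx]) (auto simp: sol_0)
  moreover have "viscosity_subsolution g s (\<lambda>t y a q l. l + - f t y (- a)) (\<lambda>_. 0) (\<lambda>z. - sol z)"
  proof (rule neg.limit_subsolution[OF C_b_uminus[OF sol_C_b]])
    fix T e :: real assume "0 < T" "0 < e"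
    from sol_approx[OF this] obtain \<Phi> where \<Phi>: "approx_solution f T e \<Phi>" "\<And>t y. t \<in> {0..T} \<Longrightarrow> \<bar>sol (t, y) - \<Phi> (t, y)\<bar> \<le> e" by blast
    have "\<bar>- sol (t, y) - - \<Phi> (t, y)\<bar> \<le> e" if "t \<in> {0..T}" for t y using \<Phi>(2)[OF that, of y] by (simp add: abs_le_iff)
    then show "\<exists>\<Phi>. approx_solution (\<lambda>t y a. - f t y (- a)) T e \<Phi> \<and> (\<forall>t\<in>{0..T}. \<forall>y. \<bar>- sol (t, y) - \<Phi> (t, y)\<bar> \<le> e)"
      using approx_solution_uminus[OF \<Phi>(1)] by blast
  qed (simp add: sol_0)
  ultimately show ?thesis
    unfolding viscosity_solution_def using sol_C_b viscosity_supersolution_uminus[OF sol_C_b, of f] by blast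
qed

text \<open>
  The approximate solutions bound \<open>v\<close> from above and, through negation, from below, and they
  converge to \<open>sol\<close>.
\<close>
theorem viscosity_solution_unique:
  assumes v: "viscosity_solution g s (\<lambda>t y a q l. l + f t y a) (\<lambda>_. 0) v" and z: "z \<in> spacetime"
  shows "v z = sol z"
proof -
  obtain t y where ty: "z = (t, y)" by (cases z)
  have t: "0 \<le> t" using z by (simp add: ty spacetime_def)
  have vC: "v \<in> C_b" and sub: "viscosity_subsolution g s (\<lambda>t y a q l. l + f t y a) (\<lambda>_. 0) v"
    and sup: "viscosity_subsolution g s (\<lambda>t y a q l. l + - f t y (- a)) (\<lambda>_. 0) (\<lambda>z. - v z)"
    using v viscosity_supersolution_uminus[of v f] by (auto simp: viscosity_solution_def)
  interpret neg: levy_equation g s "\<lambda>t y a. - f t y (- a)" K K' C by (rule uminus_equation)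
  have "\<bar>v (t, y) - sol (t, y)\<bar> \<le> 0 + e" if e: "0 < e" for e
  proof -
    define E where "E = exp ((K + 1) * t)"
    have E: "0 < E" by (simp add: E_def)
    define \<eta> where "\<eta> = e / (E + 1)"
    have \<eta>: "0 < \<eta>" "E * \<eta> + \<eta> = e" using e E by (auto simp: \<eta>_def add_pos_pos add_divide_distrib[symmetric] distrib_right[symmetric] field_simps)
    have t1: "0 < t + 1" using t by linarith
    obtain \<Phi> where \<Phi>: "approx_solution f (t + 1) \<eta> \<Phi>" "\<And>t' y. t' \<in> {0..t + 1} \<Longrightarrow> \<bar>sol (t', y) - \<Phi> (t', y)\<bar> \<le> \<eta>"
      using sol_approx[OF t1 \<eta>(1)] by blast
    have "v (t, y) \<le> \<Phi> (t, y) + E * \<eta>"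
      unfolding E_def by (rule subsolution_le_approx_solution[OF vC sub K_nonneg f_lip \<Phi>(1) less_imp_le[OF \<eta>(1)] t order_refl])
    moreover have "- v (t, y) \<le> - \<Phi> (t, y) + E * \<eta>"
      unfolding E_def by (rule subsolution_le_approx_solution[OF C_b_uminus[OF vC] sup K_nonneg neg.f_lip approx_solution_uminus[OF \<Phi>(1)] less_imp_le[OF \<eta>(1)] t order_refl])
    moreover have "\<bar>sol (t, y) - \<Phi> (t, y)\<bar> \<le> \<eta>" using \<Phi>(2)[of t y] t by simp
    ultimately show ?thesis using \<eta>(2) by linarith
  qed
  then have "\<bar>v (t, y) - sol (t, y)\<bar> \<le> 0" by (rule field_le_epsilon)
  then show ?thesis by (simp add: ty)
qed

end

section \<open>Bounded oscillation and almost additivity in time\<close>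

text \<open>
  Almost additivity gives \<open>(a m - E) / m \<le> (a j + E) / j\<close> for all \<open>m\<close> and \<open>j\<close>, so a real number separates
  the left-hand sides from the right-hand sides.
\<close>
lemma almost_additive_linear:
  fixes a :: "nat \<Rightarrow> real"
  assumes E: "\<And>m j. \<bar>a (m + j) - a m - a j\<bar> \<le> E"
  obtains c where "\<And>m. \<bar>a m - c * real m\<bar> \<le> E"
proof -
  have E0: "0 \<le> E" using E[of 0 0] by linarith
  have mult: "\<bar>a (Suc k * m) - real (Suc k) * a m\<bar> \<le> real k * E" for k m
  proof (induction k)
    case (Suc k)
    have "\<bar>a (m + Suc k * m) - a m - a (Suc k * m)\<bar> \<le> E" by (rule E)
    then have "\<bar>a (Suc (Suc k) * m) - real (Suc (Suc k)) * a m\<bar> \<le> E + \<bar>a (Suc k * m) - real (Suc k) * a m\<bar>"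
      by (simp add: algebra_simps)
    also have "\<dots> \<le> real (Suc k) * E" using Suc by (simp add: algebra_simps)
    finally show ?case .
  qed simp
  have cross: "(a m - E) / real m \<le> (a j + E) / real j" if "0 < m" "0 < j" for m j
  proof -
    have mult': "\<bar>a (k * l) - real k * a l\<bar> \<le> real k * E" if k: "0 < k" for k l
    proof -
      have "real (k - 1) * E \<le> real k * E" using E0 by (intro mult_right_mono) auto
      then show ?thesis using mult[of "k - 1" l] k by simp
    qed
    have "\<bar>a (m * j) - real m * a j\<bar> \<le> real m * E" by (rule mult'[OF that(1)])
    moreover have "\<bar>a (m * j) - real j * a m\<bar> \<le> real j * E" using mult'[OF that(2), of m] by (simp only: mult.commute[of j m])
    ultimately have "real j * a m - real j * E \<le> real m * a j + real m * E" by linarith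
    then show ?thesis using that by (simp add: divide_simps algebra_simps)
  qed
  define S where "S = (\<lambda>m. (a m - E) / real m) ` {0<..}"
  have ne: "S \<noteq> {}" by (auto simp: S_def)
  have bdd: "bdd_above S" using cross[of _ 1] unfolding S_def by (intro bdd_aboveI[of _ "(a 1 + E) / real 1"]) auto
  have "\<bar>a m - Sup S * real m\<bar> \<le> E" for m
  proof (cases "m = 0")
    case True then show ?thesis using E[of 0 0] by simp
  next
    case False
    then have m: "0 < m" by simp
    have "(a m - E) / real m \<le> Sup S" by (rule cSup_upper[OF _ bdd]) (use m in \<open>auto simp: S_def\<close>)
    moreover have "Sup S \<le> (a m + E) / real m" by (rule cSup_least[OF ne]) (use cross m in \<open>auto simp: S_def\<close>)
    ultimately show ?thesis using m by (simp add: abs_le_iff field_simps)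
  qed
  then show thesis by (rule that)
qed

lemma periodic_of_int:
  fixes G :: "real \<Rightarrow> real"
  assumes G_per: "\<And>a. G (a + 1) = G a"
  shows "G (a + of_int k) = G a"
proof -
  have nat: "G (a + of_nat m) = G a" for a m
  proof (induction m)
    case (Suc m) then show ?case using G_per[of "a + of_nat m"] by (simp add: add_ac)
  qed simp
  show ?thesis
  proof (cases k)
    case (nonneg m) then show ?thesis using nat[of a m] by simp
  next
    case (neg m) then show ?thesis using nat[of "a + of_int k" "Suc m"] by simp
  qed
qed

lemma integer_translate_near:
  fixes y y' :: "real ^ 'n"
  shows "\<exists>j :: real ^ 'n. (\<forall>i. j $ i \<in> \<int>) \<and> norm (y - (y' + j)) \<le> real CARD('n)"
proof (intro exI conjI allI)
  let ?j = "\<chi> i. of_int \<lfloor>(y - y') $ i\<rfloor> :: real ^ 'n"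
  show "?j $ i \<in> \<int>" for i by simp
  have "norm (y - (y' + ?j)) \<le> (\<Sum>i\<in>UNIV. \<bar>(y - (y' + ?j)) $ i\<bar>)" by (rule norm_le_l1_cart)
  also have "\<dots> \<le> (\<Sum>i\<in>(UNIV :: 'n set). 1)"
  proof (rule sum_mono)
    fix i
    have "(y - (y' + ?j)) $ i = (y - y') $ i - of_int \<lfloor>(y - y') $ i\<rfloor>" by simp
    then show "\<bar>(y - (y' + ?j)) $ i\<bar> \<le> 1" by linarith
  qed
  finally show "norm (y - (y' + ?j)) \<le> real CARD('n)" by simp
qed

context levy_equation
begin

lemma scheme_order:
  fixes u v :: "nat \<Rightarrow> real ^ 'n \<Rightarrow> real"
  assumes m: "\<And>k. u k \<in> borel_measurable borel" "\<And>k. v k \<in> borel_measurable borel"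
    and bd: "\<And>k x. \<bar>u k x\<bar> \<le> A k" "\<And>k x. \<bar>v k x\<bar> \<le> A' k"
    and u: "\<And>k y. u (Suc k) y \<le> step (cutoff n) (hs n) (f (real k * hs n)) (u k) y"
    and v: "\<And>k y. step (cutoff n) (hs n) (f (real k * hs n)) (v k) y \<le> v (Suc k) y"
    and init: "\<And>y. u 0 y \<le> v 0 y"
  shows "u k y \<le> v k y"
proof -
  have "u k y \<le> v k y + exp (K * (real k * hs n)) * (0 + real k * hs n * 0)"
    by (rule step_mono_sequence[OF cutoff_pos(1) less_imp_le[OF mesh_pos] K_nonneg mesh_cfl[OF K_nonneg] m bd f_lip[OF time_nonneg] _ _ _ order_refl order_refl order_refl])
       (use u v init in auto)
  then show ?thesis by simp
qed

lemma step_shift: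
  assumes "\<And>y a. F y (a + c) = F' y a"
  shows "step \<epsilon> h F (\<lambda>y. u y + c) y = step \<epsilon> h F' u y + c"
  using assms by (simp add: step_def)

end

context levy_kernel
begin

lemma tail_integral_antimono:
  fixes k :: "real ^ 'n \<Rightarrow> real"
  assumes "0 < \<epsilon>" "\<epsilon> \<le> r" "k \<in> borel_measurable borel" "\<And>z. 0 \<le> k z" "\<And>z. k z \<le> B"
  shows "(\<integral>z. k z \<partial>tail r) \<le> (\<integral>z. k z \<partial>tail \<epsilon>)"
proof -
  have b: "\<bar>k z\<bar> \<le> B" for z using assms(4,5)[of z] by simp
  have "integrable (tail \<epsilon>) k" "integrable (tail r) k"
    using assms by (auto intro!: integrable_tail_bounded[OF _ assms(3) b])
  then have "integrable \<mu> (\<lambda>z. indicator {z. \<epsilon> < norm z} z * k z)" "integrable \<mu> (\<lambda>z. indicator {z. r < norm z} z * k z)"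
    using tail_integral_eq(2)[OF assms(3)] by auto
  then have "(\<integral>z. indicator {z. r < norm z} z * k z \<partial>\<mu>) \<le> (\<integral>z. indicator {z. \<epsilon> < norm z} z * k z \<partial>\<mu>)"
    by (intro integral_mono) (use assms in \<open>auto simp: indicator_def\<close>)
  then show ?thesis using tail_integral_eq(1)[OF assms(3)] by simp
qed

end

locale cell_data = levy_kernel g s for g :: "real ^ 'n \<Rightarrow> real" and s +
  fixes G :: "real \<Rightarrow> real" and \<sigma> :: "real \<times> (real ^ 'n) \<Rightarrow> real" and K S Gb Sb :: real
  assumes G_lip: "\<And>a b. \<bar>G a - G b\<bar> \<le> K * \<bar>a - b\<bar>" and G_per: "\<And>a. G (a + 1) = G a" and G_bound: "\<And>a. \<bar>G a\<bar> \<le> Gb"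
    and \<sigma>_lip: "\<And>t t' y y'. 0 \<le> t \<Longrightarrow> 0 \<le> t' \<Longrightarrow> \<bar>\<sigma> (t, y) - \<sigma> (t', y')\<bar> \<le> S * (\<bar>t - t'\<bar> + norm (y - y'))"
    and \<sigma>_time: "\<And>t y. 0 \<le> t \<Longrightarrow> \<sigma> (t + 1, y) = \<sigma> (t, y)"
    and \<sigma>_space: "\<And>t y j. 0 \<le> t \<Longrightarrow> (\<And>i. j $ i \<in> \<int>) \<Longrightarrow> \<sigma> (t, y + j) = \<sigma> (t, y)"
    and \<sigma>_bound: "\<And>t y. 0 \<le> t \<Longrightarrow> \<bar>\<sigma> (t, y)\<bar> \<le> Sb"
    and KS: "0 \<le> K" "0 \<le> S"
begin

definition rhs :: "real ^ 'n \<Rightarrow> real \<Rightarrow> real \<Rightarrow> real ^ 'n \<Rightarrow> real \<Rightarrow> real" where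
  "rhs p L t y a = L - G (a + p \<bullet> y) + \<sigma> (t, y)"

lemma equation: "levy_equation g s (rhs p L) K (K * norm p + S) (\<bar>L\<bar> + Gb + Sb)"
proof
  fix t t' :: real and y y' :: "real ^ 'n" and a a' :: real
  show "\<bar>rhs p L t y a - rhs p L t y a'\<bar> \<le> K * \<bar>a - a'\<bar>" if "0 \<le> t"
    using G_lip[of "a + p \<bullet> y" "a' + p \<bullet> y"] by (simp add: rhs_def abs_minus_commute)
  show "\<bar>rhs p L t y a - rhs p L t' y' a\<bar> \<le> (K * norm p + S) * (\<bar>t - t'\<bar> + norm (y - y'))" if t: "0 \<le> t" "0 \<le> t'"
  proof -
    have "\<bar>p \<bullet> (y - y')\<bar> \<le> norm p * norm (y - y')" by (rule Cauchy_Schwarz_ineq2)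
    also have "\<dots> \<le> norm p * (\<bar>t - t'\<bar> + norm (y - y'))" by (intro mult_left_mono) auto
    finally have "K * \<bar>p \<bullet> (y - y')\<bar> \<le> K * (norm p * (\<bar>t - t'\<bar> + norm (y - y')))" using KS by (intro mult_left_mono)
    then have "\<bar>G (a + p \<bullet> y) - G (a + p \<bullet> y')\<bar> \<le> K * (norm p * (\<bar>t - t'\<bar> + norm (y - y')))"
      using G_lip[of "a + p \<bullet> y" "a + p \<bullet> y'"] by (simp add: inner_diff_right)
    then show ?thesis using \<sigma>_lip[OF t, of y y'] by (simp add: rhs_def distrib_right mult.assoc)
  qed
  show "\<bar>rhs p L t y a\<bar> \<le> \<bar>L\<bar> + Gb + Sb" if "0 \<le> t"
    using G_bound[of "a + p \<bullet> y"] \<sigma>_bound[OF that, of y] by (simp add: rhs_def)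
qed (use KS in auto)

sublocale eq: levy_equation g s "rhs p L" K "K * norm p + S" "\<bar>L\<bar> + Gb + Sb" for p L
  by (rule equation)

lemma G_per_int: "G (a + of_int k) = G a"
  by (rule periodic_of_int) (rule G_per)

lemma rhs_per_value: "rhs p L t y (a + of_int k) = rhs p L t y a"
  using G_per_int[of "a + p \<bullet> y" k] by (simp add: rhs_def add_ac)

lemma rhs_per_time: "0 \<le> t \<Longrightarrow> rhs p L (real m + t) y a = rhs p L t y a"
proof (induction m)
  case (Suc m)
  then show ?case using \<sigma>_time[of "real m + t" y] by (simp add: rhs_def add_ac)
qed simp

abbreviation "cell_scheme p L \<equiv> scheme K (rhs p L)"

text \<open>
  Translation by \<open>j\<close> changes \<open>p \<bullet> y\<close> by \<open>p \<bullet> j\<close>, and the integral part of that number is invisible to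
  a periodic nonlinearity. What remains is a constant \<open>c\<close> between 0 and 1 added to the unknown, and
  solutions starting from 0, \<open>c\<close> and 1 are ordered.
\<close>
lemma scheme_integer_translate:
  assumes j: "\<And>i. j $ i \<in> \<int>"
  shows "\<bar>cell_scheme p L n k (y + j) - cell_scheme p L n k y\<bar> \<le> 1"
proof -
  define c where "c = p \<bullet> j - of_int \<lfloor>p \<bullet> j\<rfloor>"
  have c: "0 \<le> c" "c \<le> 1" unfolding c_def by linarith+
  define v where "v k y = cell_scheme p L n k (y + j) + c" for k and y :: "real ^ 'n"
  define u where "u k y = cell_scheme p L n k y + of_int 1" for k and y :: "real ^ 'n"
  have rec: "v (Suc k) y = step (cutoff n) (mesh K n) (rhs p L (real k * mesh K n)) (v k) y" for k y
  proof -
    have t: "0 \<le> real k * mesh K n" by (rule eq.time_nonneg)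
    have "rhs p L (real k * mesh K n) y (a + c) = rhs p L (real k * mesh K n) (y + j) a" for y a
      using \<sigma>_space[OF t j, of y] G_per_int[of "a + c + p \<bullet> y" "\<lfloor>p \<bullet> j\<rfloor>"]
      by (simp add: rhs_def c_def inner_add_right algebra_simps)
    from eq.step_shift[where F = "rhs p L (real k * mesh K n)" and F' = "\<lambda>y. rhs p L (real k * mesh K n) (y + j)" and c = c, OF this]
    show ?thesis unfolding v_def scheme.simps eq.step_translate by simp
  qed
  have rec1: "u (Suc k) y = step (cutoff n) (mesh K n) (rhs p L (real k * mesh K n)) (u k) y" for k y
    unfolding u_def scheme.simps by (rule eq.step_shift[symmetric]) (rule rhs_per_value)
  let ?A = "\<lambda>k. real k * mesh K n * (\<bar>L\<bar> + Gb + Sb)"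
  have mw: "cell_scheme p L n k \<in> borel_measurable borel" for k by (rule eq.scheme_measurable)
  note mw[measurable]
  have mv: "v k \<in> borel_measurable borel" for k unfolding v_def[abs_def] by measurable
  have mu: "u k \<in> borel_measurable borel" for k unfolding u_def[abs_def] by measurable
  have bv: "\<bar>v k y\<bar> \<le> ?A k + 1" for k y using eq.scheme_bound[of p L n k "y + j"] c by (simp add: v_def)
  have bu: "\<bar>u k y\<bar> \<le> ?A k + 1" for k y using eq.scheme_bound[of p L n k y] by (simp add: u_def)
  have init: "v 0 y = c" "u 0 y = 1" for y by (simp_all add: v_def u_def)
  have "v k y \<le> u k y"
    by (rule eq.scheme_order[where p = p and L = L and n = n, OF mv mu bv bu]) (use rec rec1 init c in \<open>auto simp del: scheme.simps\<close>)
  moreover have "cell_scheme p L n k y \<le> v k y"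
    by (rule eq.scheme_order[where p = p and L = L and n = n, OF mw mv eq.scheme_bound bv]) (use rec init c in auto)
  ultimately show ?thesis using c by (simp add: v_def u_def)
qed

text \<open>
  Let \<open>D\<close> bound the oscillation between points at distance at most \<open>R\<close>, where \<open>R\<close> is such that every
  point has an integer translate within \<open>R\<close> of any other; then \<open>D + 1\<close> bounds the total oscillation.
  In one step, jumps longer than 1 reduce the contribution of the tail from \<open>tail_mass 1 * (D + 1)\<close> to
  \<open>(tail_mass 1 - c) * (D + 1)\<close>, while the zeroth-order terms add at most \<open>A\<close>. The gain beats the loss as soon
  as \<open>c * D = tail_mass 1 + A\<close>, so this \<open>D\<close> is preserved. The constants are independent of \<open>p\<close>, \<open>L\<close> and the mesh.
\<close>
lemma oscillation_bound:
  obtains D where "0 \<le> D" "\<And>p L n k y y'. \<bar>cell_scheme p L n k y - cell_scheme p L n k y'\<bar> \<le> D"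
proof -
  define R where "R = real CARD('n)"
  have R: "0 \<le> R" by (simp add: R_def)
  obtain c where c: "0 < c" "\<And>d (u :: real ^ 'n \<Rightarrow> real). norm d \<le> R \<Longrightarrow> u \<in> borel_measurable borel \<Longrightarrow> (\<And>x. 0 \<le> u x) \<Longrightarrow> (\<And>x. u x \<le> 1) \<Longrightarrow>
     c \<le> (\<integral>z. 1 - u z \<partial>tail 1) + (\<integral>z. u (d + z) \<partial>tail 1)"
    by (rule tail_overlap[OF R]) (rule that, assumption, blast)
  define A where "A = 2 * (Gb + Sb)"
  have A0: "0 \<le> A" using G_bound[of 0] \<sigma>_bound[of 0 0] by (simp add: A_def)
  define D where "D = (tail_mass 1 + A) / c"
  have D: "0 \<le> D" "c * D = tail_mass 1 + A" using c(1) A0 tail_mass_nonneg[of 1] by (auto simp: D_def)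
  have full: "cell_scheme p L n k y - cell_scheme p L n k y' \<le> D + 1"
    if loc: "\<And>y y'. norm (y - y') \<le> R \<Longrightarrow> cell_scheme p L n k y - cell_scheme p L n k y' \<le> D" for p L n k y y'
  proof -
    obtain j :: "real ^ 'n" where j: "\<And>i. j $ i \<in> \<int>" "norm (y - (y' + j)) \<le> R"
      using integer_translate_near[of y y'] unfolding R_def by blast
    have "\<bar>cell_scheme p L n k (y' + j) - cell_scheme p L n k y'\<bar> \<le> 1" by (rule scheme_integer_translate) (rule j)
    then show ?thesis using loc[OF j(2)] by linarith
  qed
  have loc: "cell_scheme p L n k y - cell_scheme p L n k y' \<le> D" if "norm (y - y') \<le> R" for p L n k y y'
    using that
  proof (induction k arbitrary: y y')
    case 0 then show ?case using D by simp
  next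
    case (Suc k)
    let ?u = "cell_scheme p L n k"
    define h where "h = mesh K n"
    define \<epsilon> where "\<epsilon> = cutoff n"
    have h: "0 < h" unfolding h_def by (rule mesh_pos)
    have \<epsilon>: "0 < \<epsilon>" "\<epsilon> \<le> 1" using cutoff_pos by (auto simp: \<epsilon>_def)
    have [measurable]: "?u \<in> borel_measurable borel" by (rule eq.scheme_measurable)
    define U where "U = real k * mesh K n * (\<bar>L\<bar> + Gb + Sb)"
    have ub: "\<bar>?u x\<bar> \<le> U" for x unfolding U_def by (rule eq.scheme_bound)
    have osc: "?u x - ?u x' \<le> D + 1" for x x' by (rule full) (rule Suc.IH)
    define b where "b = Inf (range ?u)"
    have bdd: "bdd_below (range ?u)" by (rule bdd_belowI[of _ "- U"]) (use ub in \<open>auto simp: abs_le_iff minus_le_iff\<close>)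
    have b1: "b \<le> ?u x" for x unfolding b_def by (rule cInf_lower[OF _ bdd]) simp
    have b2: "?u x - b \<le> D + 1" for x
    proof -
      have "?u x - (D + 1) \<le> b" unfolding b_def by (rule cInf_greatest) (use osc[of x] in \<open>auto simp: algebra_simps\<close>)
      then show ?thesis by simp
    qed
    \<comment> \<open>Normalised to values between 0 and 1, as the overlap of long jumps requires.\<close>
    define V where "V x = (?u (y + x) - b) / (D + 1)" for x
    have [measurable]: "V \<in> borel_measurable borel" unfolding V_def[abs_def] by measurable
    have V01: "0 \<le> V x" "V x \<le> 1" for x using b1[of "y + x"] b2[of "y + x"] D(1) by (auto simp: V_def divide_simps)
    have nd: "norm (y' - y) \<le> R" using Suc.prems by (simp add: norm_minus_commute)
    have ov: "c \<le> (\<integral>z. 1 - V z \<partial>tail 1) + (\<integral>z. V ((y' - y) + z) \<partial>tail 1)"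
      by (rule c(2)[OF nd _ V01]) measurable
    define d where "d z = ?u (y + z) - ?u (y' + z)" for z
    have [measurable]: "d \<in> borel_measurable borel" unfolding d_def[abs_def] by measurable
    have dD: "d z \<le> D" for z unfolding d_def by (rule Suc.IH) (use Suc.prems in simp)
    have db: "\<bar>d z\<bar> \<le> 2 * U" for z using ub[of "y + z"] ub[of "y' + z"] unfolding d_def by linarith
    have far: "(\<integral>z. d z \<partial>tail 1) \<le> (tail_mass 1 - c) * (D + 1)"
    proof -
      have Vb: "\<bar>V x\<bar> \<le> 1" for x using V01[of x] by simp
      have iV: "integrable (tail 1) V" "integrable (tail 1) (\<lambda>z. V ((y' - y) + z))"
        by (rule integrable_tail_bounded[OF _ _ Vb], simp, measurable)+
      interpret t1: finite_measure "tail 1" by (rule finite_tail) simp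
      have "(\<integral>z. 1 - V z \<partial>tail 1) = tail_mass 1 - (\<integral>z. V z \<partial>tail 1)"
        by (subst Bochner_Integration.integral_diff[OF _ iV(1)]) (auto simp: tail_mass_def)
      then have le: "(\<integral>z. V z \<partial>tail 1) - (\<integral>z. V ((y' - y) + z) \<partial>tail 1) \<le> tail_mass 1 - c" using ov by linarith
      have "d z = (D + 1) * (V z - V ((y' - y) + z))" for z
        using D(1) by (simp add: d_def V_def diff_divide_distrib[symmetric])
      then have "(\<integral>z. d z \<partial>tail 1) = (D + 1) * ((\<integral>z. V z \<partial>tail 1) - (\<integral>z. V ((y' - y) + z) \<partial>tail 1))"
        using Bochner_Integration.integral_diff[OF iV] by simp
      also have "\<dots> \<le> (D + 1) * (tail_mass 1 - c)" using le D(1) by (intro mult_left_mono) auto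
      finally show ?thesis by (simp add: mult.commute)
    qed
    have tot: "(\<integral>z. d z \<partial>tail \<epsilon>) \<le> D * (tail_mass \<epsilon> - tail_mass 1) + (\<integral>z. d z \<partial>tail 1)"
    proof -
      have "(\<integral>z. D - d z \<partial>tail 1) \<le> (\<integral>z. D - d z \<partial>tail \<epsilon>)"
      proof (rule tail_integral_antimono[OF \<epsilon>])
        show "D - d z \<le> D + 2 * U" for z using db[of z] by linarith
      qed (use dD in auto)
      moreover have "(\<integral>z. D - d z \<partial>tail r) = D * tail_mass r - (\<integral>z. d z \<partial>tail r)" if "0 < r" for r
      proof -
        interpret finite_measure "tail r" by (rule finite_tail[OF that])
        have "integrable (tail r) d" by (rule integrable_tail_bounded[OF that _ db]) measurable
        then show ?thesis by (subst Bochner_Integration.integral_diff) (auto simp: tail_mass_def)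
      qed
      ultimately show ?thesis using \<epsilon> by (simp add: right_diff_distrib)
    qed
    have fA: "rhs p L t y a - rhs p L t y' a' \<le> A" if "0 \<le> t" for t a a'
      using G_bound[of "a + p \<bullet> y"] G_bound[of "a' + p \<bullet> y'"] \<sigma>_bound[OF that, of y] \<sigma>_bound[OF that, of y']
      by (simp add: rhs_def A_def)
    let ?t = "real k * mesh K n"
    have tt: "0 \<le> ?t" by (rule eq.time_nonneg)
    have eqn: "cell_scheme p L n (Suc k) x = (1 - h * tail_mass \<epsilon>) * ?u x + h * (\<integral>z. ?u (x + z) \<partial>tail \<epsilon>) + h * rhs p L ?t x (?u x)" for x
      unfolding scheme.simps step_def tail_integral_shift(1)[OF \<epsilon>(1)[unfolded \<epsilon>_def] eq.scheme_measurable eq.scheme_bound] h_def \<epsilon>_def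
      by (simp add: algebra_simps)
    have Id: "(\<integral>z. d z \<partial>tail \<epsilon>) = (\<integral>z. ?u (y + z) \<partial>tail \<epsilon>) - (\<integral>z. ?u (y' + z) \<partial>tail \<epsilon>)"
      unfolding d_def by (rule Bochner_Integration.integral_diff; rule tail_integral_shift(2)[OF \<epsilon>(1) eq.scheme_measurable eq.scheme_bound])
    have cfl: "h * tail_mass \<epsilon> \<le> 1"
    proof -
      have "h * tail_mass \<epsilon> \<le> h * (tail_mass \<epsilon> + K)" using h KS by (intro mult_left_mono) auto
      then show ?thesis using mesh_cfl[OF KS(1), of n] unfolding h_def \<epsilon>_def by linarith
    qed
    have s1: "(1 - h * tail_mass \<epsilon>) * (?u y - ?u y') \<le> (1 - h * tail_mass \<epsilon>) * D"
      using Suc.IH[OF Suc.prems] cfl by (intro mult_left_mono) auto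
    have s2: "h * (\<integral>z. d z \<partial>tail \<epsilon>) \<le> h * (D * (tail_mass \<epsilon> - tail_mass 1) + (tail_mass 1 - c) * (D + 1))"
      using tot far h by (intro mult_left_mono) auto
    have s3: "h * (rhs p L ?t y (?u y) - rhs p L ?t y' (?u y')) \<le> h * A"
      using fA[OF tt] h by (intro mult_left_mono) auto
    have "cell_scheme p L n (Suc k) y - cell_scheme p L n (Suc k) y' = (1 - h * tail_mass \<epsilon>) * (?u y - ?u y') + h * (\<integral>z. d z \<partial>tail \<epsilon>) + h * (rhs p L ?t y (?u y) - rhs p L ?t y' (?u y'))"
      unfolding eqn Id by (simp add: algebra_simps)
    also have "\<dots> \<le> (1 - h * tail_mass \<epsilon>) * D + h * (D * (tail_mass \<epsilon> - tail_mass 1) + (tail_mass 1 - c) * (D + 1)) + h * A"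
      using s1 s2 s3 by linarith
    also have "\<dots> = D + h * ((tail_mass 1 + A) - c * D) - h * c" by (simp add: algebra_simps)
    also have "\<dots> \<le> D" using D(2) h c(1) by simp
    finally show ?case .
  qed
  show thesis
  proof (rule that[of "D + 1"])
    fix p L n k y y'
    show "\<bar>cell_scheme p L n k y - cell_scheme p L n k y'\<bar> \<le> D + 1"
      using full[OF loc, of p L n k y y'] full[OF loc, of p L n k y' y] by (simp add: abs_le_iff)
  qed (use D in simp)
qed

abbreviation "cell_sol p L \<equiv> levy_equation.sol g s (rhs p L) K"

text \<open>
  Restarting at an integer time gives the same equation with an initial value that is constant up
  to the oscillation bound, and shifting the value by an integer changes nothing.
\<close>
lemma almost_additive:
  obtains E where "0 \<le> E" "\<And>p L m t y. 0 \<le> t \<Longrightarrow> \<bar>cell_sol p L (real m + t, y) - cell_sol p L (t, y) - cell_sol p L (real m, 0)\<bar> \<le> E"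
proof -
  obtain D where D: "0 \<le> D" "\<And>p L n k y y'. \<bar>cell_scheme p L n k y - cell_scheme p L n k y'\<bar> \<le> D"
    by (rule oscillation_bound) (rule that)
  have disc: "\<bar>cell_scheme p L n (m * steps_per_unit K n + k) y - cell_scheme p L n k y - cell_scheme p L n (m * steps_per_unit K n) 0\<bar> \<le> D + 1" for p L n m k y
  proof -
    let ?q = "m * steps_per_unit K n"
    define u where "u k = cell_scheme p L n (?q + k)" for k
    have ru: "u (Suc k) y = step (cutoff n) (mesh K n) (rhs p L (real k * mesh K n)) (u k) y" for k y
    proof -
      have "real (?q + k) * mesh K n = real m + real k * mesh K n"
        using mesh_steps[of m K n] by (simp only: of_nat_add distrib_right)
      then have "rhs p L (real (?q + k) * mesh K n) = rhs p L (real k * mesh K n)"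
        using rhs_per_time[OF eq.time_nonneg] by (intro ext) simp
      then show ?thesis unfolding u_def add_Suc_right scheme.simps by simp
    qed
    have shift: "cell_scheme p L n (Suc k) y + of_int i = step (cutoff n) (mesh K n) (rhs p L (real k * mesh K n)) (\<lambda>y. cell_scheme p L n k y + of_int i) y" for k y i
      unfolding scheme.simps by (rule eq.step_shift[symmetric]) (rule rhs_per_value)
    have mw: "cell_scheme p L n k \<in> borel_measurable borel" for k by (rule eq.scheme_measurable)
    note mw[measurable]
    let ?A = "\<lambda>k. real k * mesh K n * (\<bar>L\<bar> + Gb + Sb)"
    have mu: "u k \<in> borel_measurable borel" for k unfolding u_def by measurable
    have bu: "\<bar>u k y\<bar> \<le> ?A (?q + k)" for k y unfolding u_def by (rule eq.scheme_bound)
    have ms: "(\<lambda>y. cell_scheme p L n k y + of_int i) \<in> borel_measurable borel" for k i by measurable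
    have bs: "\<bar>cell_scheme p L n k y + of_int i\<bar> \<le> ?A k + \<bar>of_int i\<bar>" for k y i using eq.scheme_bound[of p L n k y] by linarith
    define i1 where "i1 = \<lceil>u 0 0 + D\<rceil>"
    define i2 where "i2 = \<lfloor>u 0 0 - D\<rfloor>"
    have i: "u 0 0 + D \<le> of_int i1" "of_int i1 \<le> u 0 0 + D + 1" "of_int i2 \<le> u 0 0 - D" "u 0 0 - D - 1 \<le> of_int i2"
      unfolding i1_def i2_def by linarith+
    have u0: "u 0 y \<le> of_int i1" "of_int i2 \<le> u 0 y" for y
      using D(2)[of p L n ?q y 0] i unfolding u_def by (simp_all add: abs_le_iff)
    have "u k y \<le> cell_scheme p L n k y + of_int i1"
      by (rule eq.scheme_order[where p = p and L = L and n = n and v = "\<lambda>k y. cell_scheme p L n k y + of_int i1", OF mu ms bu bs])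
         (simp_all add: ru shift[symmetric] u0 del: scheme.simps(2))
    moreover have "cell_scheme p L n k y + of_int i2 \<le> u k y"
      by (rule eq.scheme_order[where p = p and L = L and n = n and u = "\<lambda>k y. cell_scheme p L n k y + of_int i2", OF ms mu bs bu])
         (simp_all add: ru shift[symmetric] u0 del: scheme.simps(2))
    ultimately show ?thesis using i by (simp add: u_def)
  qed
  show thesis
  proof (rule that[of "D + 1"])
    fix p L m and t :: real and y assume t: "0 \<le> t"
    have i0: "eq.step_index n (real m) = m * steps_per_unit K n" for n
      using eq.step_index_add_period[of 0 n m] by (simp add: eq.step_index_def)
    show "\<bar>cell_sol p L (real m + t, y) - cell_sol p L (t, y) - cell_sol p L (real m, 0)\<bar> \<le> D + 1"
    proof (rule LIMSEQ_le_const2)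
      show "(\<lambda>n. \<bar>cell_scheme p L n (eq.step_index n (real m + t)) y - cell_scheme p L n (eq.step_index n t) y - cell_scheme p L n (eq.step_index n (real m)) 0\<bar>)
         \<longlonglongrightarrow> \<bar>cell_sol p L (real m + t, y) - cell_sol p L (t, y) - cell_sol p L (real m, 0)\<bar>"
        using t by (intro tendsto_intros eq.sol_LIMSEQ) auto
      show "\<exists>N. \<forall>n\<ge>N. \<bar>cell_scheme p L n (eq.step_index n (real m + t)) y - cell_scheme p L n (eq.step_index n t) y - cell_scheme p L n (eq.step_index n (real m)) 0\<bar> \<le> D + 1"
        unfolding i0 eq.step_index_add_period[OF t] using disc by blast
    qed
  qed (use D in simp)
qed

end

section \<open>The growth rate\<close>

lemma growth_rate_unique:
  fixes w :: "real \<times> (real ^ 'n) \<Rightarrow> real"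
  assumes "has_growth_rate w c" "has_growth_rate w c'"
  shows "c = c'"
proof -
  have "((\<lambda>\<tau>. w (\<tau>, 0) / \<tau>) \<longlongrightarrow> b) at_top" if "has_growth_rate w b" for b
  proof -
    have "uniform_limit {0} (\<lambda>\<tau> y. w (\<tau>, y) / \<tau>) (\<lambda>y. b) at_top" using that finite_imp_compact[of "{0}"] unfolding has_growth_rate_def by blast
    then show ?thesis by (rule tendsto_uniform_limitI) simp
  qed
  from tendsto_unique[OF trivial_limit_at_top_linorder this[OF assms(1)] this[OF assms(2)]] show ?thesis .
qed

lemma has_growth_rate_cong:
  fixes v w :: "real \<times> (real ^ 'n) \<Rightarrow> real"
  assumes w: "has_growth_rate w c" and eq: "\<And>z. z \<in> spacetime \<Longrightarrow> v z = w z"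
  shows "has_growth_rate v c"
  unfolding has_growth_rate_def
proof (intro allI impI)
  fix K :: "(real ^ 'n) set" assume "compact K"
  then have "uniform_limit K (\<lambda>\<tau> y. w (\<tau>, y) / \<tau>) (\<lambda>y. c) at_top" using w by (simp add: has_growth_rate_def)
  moreover have "\<forall>\<^sub>F \<tau> in at_top. \<forall>y\<in>K. v (\<tau>, y) / \<tau> = w (\<tau>, y) / \<tau>"
    using eventually_ge_at_top[of 0] by eventually_elim (simp add: eq spacetime_def)
  ultimately show "uniform_limit K (\<lambda>\<tau> y. v (\<tau>, y) / \<tau>) (\<lambda>y. c) at_top"
    by (subst uniform_limit_cong[where g = "\<lambda>\<tau> y. w (\<tau>, y) / \<tau>" and i = "\<lambda>y. c"]) auto
qed

lemma has_growth_rateI: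
  fixes w :: "real \<times> (real ^ 'n) \<Rightarrow> real"
  assumes M: "\<And>t y. 0 \<le> t \<Longrightarrow> \<bar>w (t, y) - c * t\<bar> \<le> M"
  shows "has_growth_rate w c"
  unfolding has_growth_rate_def uniform_limit_iff
proof (intro allI impI)
  fix K :: "(real ^ 'n) set" and e :: real assume e: "0 < e"
  show "\<forall>\<^sub>F t in at_top. \<forall>y\<in>K. dist (w (t, y) / t) c < e"
    using eventually_gt_at_top[of "\<bar>M\<bar> / e"]
  proof eventually_elim
    case (elim t)
    have t: "0 < t" using elim e by (meson abs_ge_zero divide_nonneg_pos le_less_trans)
    have "\<bar>w (t, y) - c * t\<bar> < e * t" for y
      using M[of t y] t elim e by (simp add: field_simps)
    moreover have "dist (w (t, y) / t) c = \<bar>w (t, y) - c * t\<bar> / t" for y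
    proof -
      have "w (t, y) / t - c = (w (t, y) - c * t) / t" using t by (simp add: field_simps)
      then show ?thesis using t by (simp add: dist_real_def)
    qed
    ultimately show ?case using t by (simp add: divide_less_eq)
  qed
qed

context cell_data
begin

lemma growth_rates_exist:
  obtains E c where "0 \<le> E" "\<And>p L. has_growth_rate (cell_sol p L) (c p L)"
    "\<And>p L m. \<bar>cell_sol p L (real m, 0) - c p L * real m\<bar> \<le> E"
proof -
  obtain E where E: "0 \<le> E" "\<And>p L m t y. 0 \<le> t \<Longrightarrow> \<bar>cell_sol p L (real m + t, y) - cell_sol p L (t, y) - cell_sol p L (real m, 0)\<bar> \<le> E"
    by (rule almost_additive) (rule that, assumption, blast)
  have "\<exists>b. \<forall>m. \<bar>cell_sol p L (real m, 0) - b * real m\<bar> \<le> E" for p L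
  proof -
    have "\<bar>cell_sol p L (real (m + j), 0) - cell_sol p L (real m, 0) - cell_sol p L (real j, 0)\<bar> \<le> E" for m j
      using E(2)[of "real j" p L m 0] by (simp add: algebra_simps)
    from almost_additive_linear[of "\<lambda>m. cell_sol p L (real m, 0)", OF this] show ?thesis by blast
  qed
  then obtain c where c: "\<And>p L m. \<bar>cell_sol p L (real m, 0) - c p L * real m\<bar> \<le> E" by metis
  show thesis
  proof (rule that[OF E(1) _ c])
    fix p L
    show "has_growth_rate (cell_sol p L) (c p L)"
    proof (rule has_growth_rateI)
      fix t :: real and y assume t: "0 \<le> t"
      define m where "m = nat \<lfloor>t\<rfloor>"
      define r where "r = t - real m"
      have r: "0 \<le> r" "r \<le> 1" "t = real m + r" using t by (auto simp: r_def m_def) linarith+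
      let ?C = "\<bar>L\<bar> + Gb + Sb"
      have "\<bar>cell_sol p L (r, y)\<bar> \<le> r * ?C" by (rule eq.sol_bound[OF r(1)])
      also have "\<dots> \<le> 1 * ?C" using r eq.C_nonneg[of L] by (intro mult_right_mono) auto
      finally have 1: "\<bar>cell_sol p L (r, y)\<bar> \<le> ?C" by simp
      have "\<bar>c p L * r\<bar> \<le> \<bar>c p L\<bar> * 1" unfolding abs_mult using r by (intro mult_left_mono) auto
      moreover have "c p L * t = c p L * real m + c p L * r" by (simp add: r(3) distrib_left)
      ultimately show "\<bar>cell_sol p L (t, y) - c p L * t\<bar> \<le> 2 * E + ?C + \<bar>c p L\<bar>"
        using E(2)[OF r(1), of p L m y] c[of p L m] 1 unfolding r(3)[symmetric] by linarith
    qed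
  qed
qed

lemma sol_mono_constant:
  assumes L: "L \<le> L'" and t: "0 \<le> t"
  shows "cell_sol p L (t, y) \<le> cell_sol p L' (t, y)"
proof (rule LIMSEQ_le[OF eq.sol_LIMSEQ[OF t] eq.sol_LIMSEQ[OF t]])
  have "cell_scheme p L n k y \<le> cell_scheme p L' n k y" for n k y
  proof (rule eq.scheme_order[where p = p and L = L' and n = n, OF eq.scheme_measurable eq.scheme_measurable eq.scheme_bound eq.scheme_bound])
    fix k y
    show "cell_scheme p L n (Suc k) y \<le> step (cutoff n) (mesh K n) (rhs p L' (real k * mesh K n)) (cell_scheme p L n k) y"
      using mult_nonneg_nonneg[OF less_imp_le[OF mesh_pos[of K n]], of "L' - L"] L
      by (subst step_change[of _ _ _ _ _ "rhs p L (real k * mesh K n)"]) (simp add: rhs_def)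
  qed auto
  then show "\<exists>N. \<forall>n\<ge>N. cell_scheme p L n (eq.step_index n t) y \<le> cell_scheme p L' n (eq.step_index n t) y" by blast
qed

text \<open>
  A change of \<open>p\<close> perturbs the equation by an amount that is small near the origin and bounded
  everywhere. Dominated by a small constant plus a wide barrier, it costs little, because the
  nonlocal operator of a wide barrier is small.
\<close>
lemma sol_continuous_dependence:
  assumes "0 < e" "0 \<le> t"
  obtains \<delta> where "0 < \<delta>" "\<And>p p' L L'. norm (p - p') < \<delta> \<Longrightarrow> \<bar>L - L'\<bar> < \<delta> \<Longrightarrow> cell_sol p L (t, 0) \<le> cell_sol p' L' (t, 0) + e"
proof -
  define M where "M = 4 * Gb + 1"
  have Gb: "0 \<le> Gb" using G_bound[of 0] by linarith
  have M: "0 < M" using Gb by (simp add: M_def)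
  define \<eta> where "\<eta> = e / (exp ((K + 1) * t) * (t + 1))"
  have et: "0 < exp ((K + 1) * t) * (t + 1)" using assms by simp
  have \<eta>: "0 < \<eta>" "exp ((K + 1) * t) * (t + 1) * \<eta> = e" using assms et by (auto simp: \<eta>_def)
  let ?B = "\<lambda>R. small_moment 1 / R\<^sup>2 + (\<integral>z. min 1 (2 / R * norm z + (norm z)\<^sup>2 / R\<^sup>2) \<partial>tail 1)"
  have "(\<lambda>n. ?B (real (Suc n))) \<longlonglongrightarrow> 0" by (rule barrier_total_tendsto_0) simp
  then have "\<forall>\<^sub>F n in sequentially. ?B (real (Suc n)) < \<eta> / M" by (rule order_tendstoD) (use \<eta> M in simp)
  then obtain n0 where n0: "?B (real (Suc n0)) < \<eta> / M" unfolding eventually_sequentially by blast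
  obtain R where R: "0 < R" "?B R < \<eta> / M" using n0 that[of "real (Suc n0)"] by (metis of_nat_0_less_iff zero_less_Suc)
  \<comment> \<open>Within radius \<open>R\<close> the perturbation is at most \<open>\<eta>\<close>; beyond it, \<open>2 * Gb\<close> is absorbed by the barrier, which is at least \<open>1/2\<close> there.\<close>
  define \<delta> where "\<delta> = min (\<eta> / 2) (\<eta> / (2 * (K * R + 1)))"
  have KR: "0 \<le> K * R" using KS R by simp
  have \<delta>: "0 < \<delta>" "\<delta> \<le> \<eta> / 2" "K * R * \<delta> \<le> \<eta> / 2"
  proof -
    show "0 < \<delta>" using \<eta> KR by (simp add: \<delta>_def)
    show "\<delta> \<le> \<eta> / 2" unfolding \<delta>_def by (rule min.cobounded1)
    have "K * R * \<delta> \<le> K * R * (\<eta> / (2 * (K * R + 1)))" unfolding \<delta>_def using KR by (intro mult_left_mono min.cobounded2)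
    also have "\<dots> \<le> \<eta> / 2" using KR \<eta> by (simp add: field_simps)
    finally show "K * R * \<delta> \<le> \<eta> / 2" .
  qed
  define P where "P y = \<eta> + M * barrier R y" for y :: "real ^ 'n"
  have [measurable]: "barrier R \<in> borel_measurable borel"
    by (rule borel_measurable_continuous_onI[OF barrier_continuous])
  have P0: "\<eta> \<le> P y" "P y \<le> \<eta> + M" for y
    using barrier_bounds(1,2)[of R y] M by (auto simp: P_def mult_left_le)
  have far: "2 * Gb \<le> M * barrier R y" if "R \<le> norm y" for y
  proof -
    have "1 \<le> (norm y)\<^sup>2 / R\<^sup>2" using that R by (simp add: power_mono)
    then have "exp (- ((norm y)\<^sup>2 / R\<^sup>2)) \<le> exp (- 1)" by simp
    moreover have "exp (- 1 :: real) \<le> 1 / 2"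
      using exp_ge_add_one_self[of "1::real"] by (simp add: exp_minus inverse_eq_divide divide_le_eq)
    ultimately have "1 / 2 \<le> barrier R y" unfolding barrier_def by linarith
    then have "M * (1 / 2) \<le> M * barrier R y" using M by (intro mult_left_mono) auto
    then show ?thesis by (simp add: M_def)
  qed
  have le: "cell_scheme p L n k 0 \<le> cell_scheme p' L' n k 0 + exp ((K + 1) * t) * t * \<eta>"
    if pL: "norm (p - p') < \<delta>" "\<bar>L - L'\<bar> < \<delta>" and kt: "real k * mesh K n \<le> t" for p p' L L' n k
  proof -
    let ?h = "mesh K n"
    have h: "0 < ?h" by (rule mesh_pos)
    define B where "B k = exp ((K + 1) * (real k * ?h)) * (0 + real k * ?h * 1)" for k
    have B0: "0 \<le> B k" for k using eq.time_nonneg[of k n] by (simp add: B_def)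
    have BS: "(1 + ?h * (K + 1)) * B k + ?h \<le> B (Suc k)" for k
      using discrete_gronwall_step[of ?h "K + 1" 0 1 k] h KS by (simp add: B_def del: of_nat_Suc)
    have FE: "rhs p L s' y a \<le> rhs p' L' s' y a + P y" for s' y a
    proof -
      have "\<bar>G (a + p' \<bullet> y) - G (a + p \<bullet> y)\<bar> \<le> \<eta> / 2 + M * barrier R y"
      proof (cases "R \<le> norm y")
        case True
        then show ?thesis using far[OF True] G_bound[of "a + p \<bullet> y"] G_bound[of "a + p' \<bullet> y"] \<eta> by linarith
      next
        case False
        have "\<bar>(p' - p) \<bullet> y\<bar> \<le> norm (p' - p) * norm y" by (rule Cauchy_Schwarz_ineq2)
        also have "\<dots> \<le> \<delta> * R" using False pL(1) \<delta> by (intro mult_mono) (auto simp: norm_minus_commute)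
        finally have "K * \<bar>(p' - p) \<bullet> y\<bar> \<le> K * (\<delta> * R)" using KS by (intro mult_left_mono)
        moreover have "K * (\<delta> * R) = K * R * \<delta>" by simp
        moreover have "\<bar>G (a + p' \<bullet> y) - G (a + p \<bullet> y)\<bar> \<le> K * \<bar>(p' - p) \<bullet> y\<bar>"
          using G_lip[of "a + p' \<bullet> y" "a + p \<bullet> y"] by (simp add: inner_diff_left)
        moreover have "0 \<le> M * barrier R y" using M barrier_bounds(1)[of R y] by simp
        ultimately show ?thesis using \<delta>(3) by linarith
      qed
      then show ?thesis using pL(2) \<delta>(2) by (simp add: rhs_def P_def)
    qed
    have "cell_scheme p L n k y \<le> cell_scheme p' L' n k y + B k * P y" for k y
    proof (induction k arbitrary: y)
      case 0 show ?case by (simp add: B_def)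
    next
      case (Suc k)
      let ?t = "real k * ?h"
      let ?b = "\<lambda>y. B k * P y"
      have mb: "?b \<in> borel_measurable borel" unfolding P_def by measurable
      have bb: "\<bar>?b y\<bar> \<le> B k * (\<eta> + M)" for y
        using P0[of y] \<eta> B0[of k] by (simp add: abs_mult mult_left_mono)
      have b0: "0 \<le> ?b y" for y using P0[of y] \<eta> B0[of k] by simp
      have "step (cutoff n) ?h (rhs p L ?t) (cell_scheme p L n k) y
        \<le> step (cutoff n) ?h (rhs p' L' ?t) (cell_scheme p' L' n k) y + ?b y + ?h * ((\<integral>z. ?b (y + z) - ?b y \<partial>tail (cutoff n)) + K * ?b y + P y)"
        by (rule step_mono[where u = "cell_scheme p L n k" and v = "cell_scheme p' L' n k" and b = ?b and y = y and E = "P y",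
              OF cutoff_pos(1) less_imp_le[OF h] KS(1) mesh_cfl[OF KS(1)] eq.scheme_measurable eq.scheme_measurable mb
              eq.scheme_bound eq.scheme_bound bb b0 Suc.IH])
           (rule eq.f_lip[OF eq.time_nonneg] FE)+
      moreover have "(\<integral>z. ?b (y + z) - ?b y \<partial>tail (cutoff n)) \<le> B k * \<eta>"
      proof -
        have "(\<integral>z. ?b (y + z) - ?b y \<partial>tail (cutoff n)) = (\<integral>z. B k * M * (barrier R (y + z) - barrier R y) \<partial>tail (cutoff n))"
          by (simp add: P_def algebra_simps)
        also have "\<dots> = B k * (M * (\<integral>z. barrier R (y + z) - barrier R y \<partial>tail (cutoff n)))" by simp
        also have "\<dots> \<le> B k * \<eta>"
        proof (rule mult_left_mono[OF _ B0])
          have "(\<integral>z. barrier R (y + z) - barrier R y \<partial>tail (cutoff n)) \<le> ?B R"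
            by (rule barrier_truncated_le[OF R(1) cutoff_pos])
          then have "(\<integral>z. barrier R (y + z) - barrier R y \<partial>tail (cutoff n)) \<le> \<eta> / M" using R(2) by linarith
          then show "M * (\<integral>z. barrier R (y + z) - barrier R y \<partial>tail (cutoff n)) \<le> \<eta>" using M by (simp add: pos_le_divide_eq mult.commute)
        qed
        finally show ?thesis .
      qed
      ultimately have "cell_scheme p L n (Suc k) y \<le> cell_scheme p' L' n (Suc k) y + B k * P y + ?h * (B k * \<eta> + K * (B k * P y) + P y)"
        using mult_left_mono[of "(\<integral>z. ?b (y + z) - ?b y \<partial>tail (cutoff n)) + K * ?b y + P y" "B k * \<eta> + K * ?b y + P y" ?h] h
        unfolding scheme.simps by linarith
      moreover have "?h * (B k * \<eta>) \<le> ?h * (B k * P y)"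
        using mult_left_mono[OF P0(1)[of y] B0[of k]] h by simp
      ultimately have "cell_scheme p L n (Suc k) y \<le> cell_scheme p' L' n (Suc k) y + ((1 + ?h * (K + 1)) * B k + ?h) * P y"
        by (simp add: algebra_simps del: scheme.simps)
      also have "\<dots> \<le> cell_scheme p' L' n (Suc k) y + B (Suc k) * P y"
        using mult_right_mono[OF BS[of k], of "P y"] P0[of y] \<eta> by simp
      finally show ?case .
    qed
    from this[of k 0] have "cell_scheme p L n k 0 \<le> cell_scheme p' L' n k 0 + B k * \<eta>" by (simp add: P_def barrier_bounds)
    moreover have "B k \<le> exp ((K + 1) * t) * t"
      unfolding B_def using kt assms KS eq.time_nonneg[of k n] by (intro mult_mono) auto
    ultimately show ?thesis using mult_right_mono[of "B k" "exp ((K + 1) * t) * t" \<eta>] \<eta> by linarith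
  qed
  show thesis
  proof (rule that[OF \<delta>(1)])
    fix p p' :: "real ^ 'n" and L L' :: real assume pL: "norm (p - p') < \<delta>" "\<bar>L - L'\<bar> < \<delta>"
    have "cell_sol p L (t, 0) \<le> cell_sol p' L' (t, 0) + exp ((K + 1) * t) * t * \<eta>"
    proof (rule LIMSEQ_le[OF eq.sol_LIMSEQ[OF assms(2)] tendsto_add[OF eq.sol_LIMSEQ[OF assms(2)] tendsto_const]])
      show "\<exists>N. \<forall>n\<ge>N. cell_scheme p L n (eq.step_index n t) 0 \<le> cell_scheme p' L' n (eq.step_index n t) 0 + exp ((K + 1) * t) * t * \<eta>"
        using le[OF pL] eq.step_index_bounds(1)[OF assms(2)] by blast
    qed
    moreover have "exp ((K + 1) * t) * t * \<eta> \<le> e"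
    proof -
      have "exp ((K + 1) * t) * (t + 1) * \<eta> = exp ((K + 1) * t) * t * \<eta> + exp ((K + 1) * t) * \<eta>"
        by (simp only: distrib_left distrib_right mult_1_right)
      moreover have "0 \<le> exp ((K + 1) * t) * \<eta>" using \<eta> by simp
      ultimately show ?thesis using \<eta>(2) by linarith
    qed
    ultimately show "cell_sol p L (t, 0) \<le> cell_sol p' L' (t, 0) + e" by linarith
  qed
qed

text \<open>
  The growth rate is the limit of \<open>cell_sol p L (real m, 0) / m\<close> at a rate that does not depend on
  \<open>p\<close> and \<open>L\<close>, so it inherits monotonicity and continuity from a fixed large time.
\<close>
theorem growth_rate_function:
  obtains c where "\<And>p L. has_growth_rate (cell_sol p L) (c p L)"
    "continuous_on UNIV (\<lambda>(p, L). c p L)" "\<And>p. mono (c p)"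
proof -
  obtain E c where E: "0 \<le> E" and gr: "\<And>p L. has_growth_rate (cell_sol p L) (c p L)"
    and c: "\<And>p L m. \<bar>cell_sol p L (real m, 0) - c p L * real m\<bar> \<le> E"
    by (rule growth_rates_exist) (rule that, assumption, blast, blast)
  have big: "\<exists>m. 0 < real m \<and> 2 * E < d * real m" if d: "0 < d" for d
  proof -
    obtain m where "2 * E / d < real m" using reals_Archimedean2 by blast
    moreover have "0 \<le> 2 * E / d" using E d by simp
    moreover from calculation have "0 < real m" by linarith
    ultimately show ?thesis using d by (intro exI[of _ m]) (auto simp: pos_divide_less_eq mult.commute)
  qed
  have close: "\<exists>\<delta>>0. \<forall>p p' L L'. norm (p - p') < \<delta> \<longrightarrow> \<bar>L - L'\<bar> < \<delta> \<longrightarrow> c p L < c p' L' + d" if d: "0 < d" for d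
  proof -
    obtain m where m: "0 < real m" "2 * E < d / 2 * real m" using big[of "d / 2"] d by auto
    have dm: "0 < d / 2 * real m" using d m by simp
    obtain \<delta> where \<delta>: "0 < \<delta>" "\<And>p p' L L'. norm (p - p') < \<delta> \<Longrightarrow> \<bar>L - L'\<bar> < \<delta> \<Longrightarrow> cell_sol p L (real m, 0) \<le> cell_sol p' L' (real m, 0) + d / 2 * real m"
      by (rule sol_continuous_dependence[OF dm of_nat_0_le_iff]) (rule that, assumption, blast)
    have "c p L < c p' L' + d" if pL: "norm (p - p') < \<delta>" "\<bar>L - L'\<bar> < \<delta>" for p p' L L'
    proof -
      have "c p L * real m < (c p' L' + d) * real m"
        using \<delta>(2)[OF pL] c[of p L m] c[of p' L' m] m(2) by (simp add: distrib_right abs_le_iff)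
      then show ?thesis using m(1) by simp
    qed
    then show ?thesis using \<delta>(1) by blast
  qed
  have "continuous_on UNIV (\<lambda>(p, L). c p L)"
    unfolding continuous_on_iff
  proof (intro ballI allI impI, clarify)
    fix p :: "real ^ 'n" and L d :: real assume d: "0 < d"
    obtain \<delta> where \<delta>: "0 < \<delta>" "\<And>p p' L L'. norm (p - p') < \<delta> \<Longrightarrow> \<bar>L - L'\<bar> < \<delta> \<Longrightarrow> c p L < c p' L' + d"
      using close[OF d] by blast
    show "\<exists>\<delta>>0. \<forall>z\<in>UNIV. dist z (p, L) < \<delta> \<longrightarrow> dist (case z of (p, L) \<Rightarrow> c p L) (c p L) < d"
    proof (rule exI[of _ \<delta>], intro conjI \<delta>(1) ballI impI)
      fix z assume z: "dist z (p, L) < \<delta>"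
      obtain p' L' where pL: "z = (p', L')" by (cases z)
      have "norm (p' - p) < \<delta>" "\<bar>L' - L\<bar> < \<delta>"
        using z dist_fst_le[of z "(p, L)"] dist_snd_le[of z "(p, L)"] by (auto simp: pL dist_norm)
      then have "c p' L' < c p L + d" "c p L < c p' L' + d"
        by (auto intro!: \<delta>(2) simp: norm_minus_commute abs_minus_commute)
      then show "dist (case z of (p, L) \<Rightarrow> c p L) (c p L) < d" by (simp add: pL dist_real_def abs_less_iff)
    qed
  qed
  moreover have "mono (c p)" for p
  proof (rule monoI, rule field_le_epsilon)
    fix L L' d :: real assume L: "L \<le> L'" and d: "0 < d"
    obtain m where m: "0 < real m" "2 * E < d * real m" using big[OF d] by blast
    have "c p L * real m \<le> (c p L' + d) * real m"
      using sol_mono_constant[OF L, of "real m" p 0] c[of p L m] c[of p L' m] m(2) by (simp add: distrib_right abs_le_iff)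
    then show "c p L \<le> c p L' + d" using m(1) by simp
  qed
  ultimately show thesis by (rule that[OF gr])
qed

end

section \<open>Existence, uniqueness and the effective Hamiltonian\<close>

lemma periodic_deriv:
  fixes W :: "real \<Rightarrow> real"
  assumes "W differentiable_on UNIV" and "\<And>v. W (v + 1) = W v"
  shows "deriv W (v + 1) = deriv W v"
proof -
  have "(W has_real_derivative deriv W (v + 1)) (at (v + 1))"
    using assms(1) by (auto simp: differentiable_on_def DERIV_deriv_iff_real_differentiable)
  then have "((\<lambda>x. W (x + 1)) has_real_derivative deriv W (v + 1)) (at v)" by (simp add: DERIV_shift)
  then have "(W has_real_derivative deriv W (v + 1)) (at v)" using assms(2) by simp
  then show ?thesis by (rule DERIV_imp_deriv[symmetric])
qed

lemma periodic_lipschitz_bounded: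
  fixes G :: "real \<Rightarrow> real"
  assumes per: "\<And>a. G (a + 1) = G a" and lip: "\<And>a b. \<bar>G a - G b\<bar> \<le> K * \<bar>a - b\<bar>" and K: "0 \<le> K"
  shows "\<bar>G a\<bar> \<le> \<bar>G 0\<bar> + K"
proof -
  have "G (frac a) = G a" using periodic_of_int[of G "frac a" "\<lfloor>a\<rfloor>", OF per] by (simp add: frac_def)
  moreover have "K * \<bar>frac a\<bar> \<le> K * 1" using K frac_lt_1[of a] by (intro mult_left_mono) auto
  ultimately show ?thesis using lip[of "frac a" 0] by simp
qed

text \<open>
  Every point of space-time is equivalent, modulo the periods, to one in a bounded set.
\<close>
lemma periodic_spacetime_bounded:
  fixes \<sigma> :: "real \<times> (real ^ 'n) \<Rightarrow> real"
  assumes lip: "\<And>t t' y y'. 0 \<le> t \<Longrightarrow> 0 \<le> t' \<Longrightarrow> \<bar>\<sigma> (t, y) - \<sigma> (t', y')\<bar> \<le> S * (\<bar>t - t'\<bar> + norm (y - y'))"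
    and time: "\<And>t y. 0 \<le> t \<Longrightarrow> \<sigma> (t + 1, y) = \<sigma> (t, y)"
    and space: "\<And>t y j. 0 \<le> t \<Longrightarrow> (\<And>i. j $ i \<in> \<int>) \<Longrightarrow> \<sigma> (t, y + j) = \<sigma> (t, y)"
    and S: "0 \<le> S" and t: "0 \<le> t"
  shows "\<bar>\<sigma> (t, y)\<bar> \<le> \<bar>\<sigma> (0, 0)\<bar> + S * (1 + real CARD('n))"
proof -
  have per: "\<sigma> (r + of_nat m, y) = \<sigma> (r, y)" if "0 \<le> r" for r y and m :: nat
  proof (induction m)
    case (Suc m) then show ?case using time[of "r + of_nat m" y] that by (simp add: add_ac)
  qed simp
  have f: "0 \<le> frac t" "frac t \<le> 1" using frac_lt_1[of t] by auto
  have "t = frac t + of_nat (nat \<lfloor>t\<rfloor>)" using t by (simp add: frac_def)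
  then have 1: "\<sigma> (t, y) = \<sigma> (frac t, y)" using per[OF f(1), of "nat \<lfloor>t\<rfloor>" y] by simp
  obtain j :: "real ^ 'n" where j: "\<And>i. j $ i \<in> \<int>" "norm (y - (0 + j)) \<le> real CARD('n)"
    using integer_translate_near[of y 0] by blast
  have 2: "\<sigma> (frac t, y - j) = \<sigma> (frac t, y)" using space[OF f(1) j(1), of "y - j"] by simp
  have "\<bar>\<sigma> (frac t, y - j) - \<sigma> (0, 0)\<bar> \<le> S * (\<bar>frac t - 0\<bar> + norm (y - j - 0))" using lip[OF f(1), of 0] by blast
  also have "\<dots> \<le> S * (1 + real CARD('n))" using f j(2) S by (intro mult_left_mono) auto
  finally show ?thesis using 1 2 by linarith
qed

theorem theorem1p1:
  fixes s :: real
    and g :: "real ^ 'n \<Rightarrow> real"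
    and W :: "real \<Rightarrow> real"
    and \<sigma> :: "real \<times> (real ^ 'n) \<Rightarrow> real"
  assumes "0 < s" and "s < 1"
    and "continuous_on (sphere 0 1) g"
    and "\<And>z. z \<in> sphere 0 1 \<Longrightarrow> g z > 0"
    and "\<And>z. z \<in> sphere 0 1 \<Longrightarrow> g (- z) = g z"
    and "W differentiable_on UNIV" and "\<exists>C. C-lipschitz_on UNIV (deriv W)"
    and "\<And>v. W (v + 1) = W v"
    and "\<exists>C. C-lipschitz_on spacetime \<sigma>"
    and "\<And>t x. (t, x) \<in> spacetime \<Longrightarrow> \<sigma> (t + 1, x) = \<sigma> (t, x)"
    and "\<And>t x k. (t, x) \<in> spacetime \<Longrightarrow> (\<forall>i. k $ i \<in> \<int>) \<Longrightarrow> \<sigma> (t, x + k) = \<sigma> (t, x)"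
  shows "(\<forall>L p. \<exists>w. cell_solution g s W \<sigma> p L w \<and>
              (\<forall>v. cell_solution g s W \<sigma> p L v \<longrightarrow> (\<forall>z\<in>spacetime. v z = w z)) \<and>
              (\<exists>!c. has_growth_rate w c)) \<and>
         continuous_on UNIV (\<lambda>(p, L). effective_hamiltonian g s W \<sigma> p L) \<and>
         (\<forall>p. mono (effective_hamiltonian g s W \<sigma> p))"
proof -
  obtain K where K: "K-lipschitz_on UNIV (deriv W)" using assms(7) by blast
  obtain S where S: "S-lipschitz_on spacetime \<sigma>" using assms(9) by blast
  note KS = lipschitz_on_nonneg[OF K] lipschitz_on_nonneg[OF S]
  have G_lip: "\<bar>deriv W a - deriv W b\<bar> \<le> K * \<bar>a - b\<bar>" for a b
    using lipschitz_onD[OF K, of a b] by (simp add: dist_real_def)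
  have G_per: "deriv W (a + 1) = deriv W a" for a by (rule periodic_deriv[OF assms(6,8)])
  have \<sigma>_lip: "\<bar>\<sigma> (t, y) - \<sigma> (t', y')\<bar> \<le> S * (\<bar>t - t'\<bar> + norm (y - y'))" if "0 \<le> t" "0 \<le> t'" for t t' y y'
  proof -
    have "\<bar>\<sigma> (t, y) - \<sigma> (t', y')\<bar> \<le> S * dist (t, y) (t', y')"
      using lipschitz_onD[OF S, of "(t, y)" "(t', y')"] that by (simp add: spacetime_def dist_real_def)
    also have "\<dots> \<le> S * (\<bar>t - t'\<bar> + norm (y - y'))"
      using KS sqrt_sum_squares_le_sum_abs[of "t - t'" "norm (y - y')"]
      by (intro mult_left_mono) (auto simp: dist_norm norm_Pair)
    finally show ?thesis .
  qed
  have \<sigma>_time: "\<sigma> (t + 1, y) = \<sigma> (t, y)" if "0 \<le> t" for t y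
    using assms(10) that by (simp add: spacetime_def)
  have \<sigma>_space: "\<sigma> (t, y + j) = \<sigma> (t, y)" if "0 \<le> t" "\<And>i. j $ i \<in> \<int>" for t y j
    using assms(11) that by (simp add: spacetime_def)
  interpret cell_data g s "deriv W" \<sigma> K S "\<bar>deriv W 0\<bar> + K" "\<bar>\<sigma> (0, 0)\<bar> + S * (1 + real CARD('n))"
  proof unfold_locales
    fix t :: real and y :: "real ^ 'n" assume "0 \<le> t"
    then show "\<bar>\<sigma> (t, y)\<bar> \<le> \<bar>\<sigma> (0, 0)\<bar> + S * (1 + real CARD('n))"
      by (intro periodic_spacetime_bounded[OF \<sigma>_lip \<sigma>_time \<sigma>_space KS(2)])
  qed (use assms(1-5) KS in \<open>auto intro!: G_lip G_per \<sigma>_lip \<sigma>_time \<sigma>_space periodic_lipschitz_bounded[OF G_per G_lip]\<close>)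
  obtain c where c: "\<And>p L. has_growth_rate (cell_sol p L) (c p L)"
    "continuous_on UNIV (\<lambda>(p, L). c p L)" "\<And>p. mono (c p)"
    by (rule growth_rate_function) (rule that, assumption, assumption, assumption)
  have cell: "cell_solution g s W \<sigma> p L v = viscosity_solution g s (\<lambda>t y a q l. l + rhs p L t y a) (\<lambda>_. 0) v" for p L v
  proof -
    have "(\<lambda>t y a q l. l + L - deriv W (a + p \<bullet> y) + \<sigma> (t, y)) = (\<lambda>t y a (q :: real ^ 'n) l. l + rhs p L t y a)"
      by (intro ext) (simp add: rhs_def)
    then show ?thesis by (simp add: cell_solution_def)
  qed
  have sol: "cell_solution g s W \<sigma> p L (cell_sol p L)" for p L
    unfolding cell by (rule eq.sol_viscosity_solution)
  have uniq: "v z = cell_sol p L z" if "cell_solution g s W \<sigma> p L v" "z \<in> spacetime" for p L v z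
    using that unfolding cell by (rule eq.viscosity_solution_unique)
  have H: "effective_hamiltonian g s W \<sigma> p L = c p L" for p L
    unfolding effective_hamiltonian_def
  proof (rule the_equality)
    show "\<exists>w. cell_solution g s W \<sigma> p L w \<and> has_growth_rate w (c p L)" using sol c(1) by blast
    fix b assume "\<exists>w. cell_solution g s W \<sigma> p L w \<and> has_growth_rate w b"
    then show "b = c p L"
    proof (elim exE conjE)
      fix w assume w: "cell_solution g s W \<sigma> p L w" "has_growth_rate w b"
      have "has_growth_rate (cell_sol p L) b"
        by (rule has_growth_rate_cong[OF w(2)]) (simp add: uniq[OF w(1)])
      then show ?thesis using c(1) by (rule growth_rate_unique)
    qed
  qed
  have "\<exists>!b. has_growth_rate (cell_sol p L) b" for p L using c(1) growth_rate_unique by blast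
  then have "\<forall>L p. \<exists>w. cell_solution g s W \<sigma> p L w \<and>
              (\<forall>v. cell_solution g s W \<sigma> p L v \<longrightarrow> (\<forall>z\<in>spacetime. v z = w z)) \<and>
              (\<exists>!c. has_growth_rate w c)"
    using sol uniq by (intro allI exI[where x = "cell_sol _ _"] conjI impI ballI) auto
  moreover have "effective_hamiltonian g s W \<sigma> = c" by (intro ext) (rule H)
  ultimately show ?thesis using c(2,3) by simp
qed

end
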